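(* Let $k$ be a field and let $\Delta$ be a Dynkin quiver of type $\mathbb{D}_n$ ($n\ge4$) or $\mathbb{E}_m$ ($m=6,7,8$) with exceptional vertex $y$ and special antichain triple $A(1),A(2),A(3)$. Then the $\mathrm{Ext}$-quiver of $$\mathcal C(\Delta)=\mathcal E(A(1),A(2),A(3),S(y))$$ has the four vertices $A(1),A(2),A(3),S(y)$, with exactly one arrow (in one of the two directions) between $S(y)$ and each of $A(1),A(2),A(3)$, and no other arrows; thus it is of type $\mathbb{D}_4$. Moreover, $\mathcal C(\Delta)$ contains the maximal indecomposable representation $M$ of $\Delta$.
   Context: $\mathrm{rep}\,\Delta$ is the category of finite-dimensional representations of $\Delta$ over $k$ (arbitrary orientation). The exceptional vertex $y$ is: for $\mathbb{D}_n$, with vertices $1,\dots,n$ and edges $1-3$, $2-3$, $i-(i+1)$ for $3\le i\le n-1$, the vertex $y=n-1$. For $\mathbb{E}_6,\mathbb{E}_7,\mathbb{E}_8$, the graph is a star consisting of a center $c$ with three branches having, not counting $c$, $(1,2,2)$, $(1,2,3)$, $(1,2,4)$ vertices respectively; $y$ is the end vertex of the branch with $1$ vertex for $\mathbb E_6$, of the branch with $2$ vertices for $\mathbb E_7$, and of the branch with $4$ vertices for $\mathbb E_8$. $\Delta'$ is the full subquiver obtained by deleting $y$; $\Delta''$ is obtained by deleting $y$ and all neighbors of $y$. An antichain in $\mathrm{rep}\,\Delta$ is a set of pairwise $\mathrm{Hom}$-orthogonal objects whose endomorphism rings are division rings. The special antichain triple of $\Delta$ is the unique (up to isomorphism and ordering)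 antichain $A(1),A(2),A(3)$ of cardinality $3$ in $\mathrm{rep}\,\Delta$ such that the support of each $A(i)$ is contained in $\Delta'$ but not in $\Delta''$ (it is known to exist and to be unique). $S(y)$ is the simple representation with $S(y)_y=k$ and $S(y)_x=0$ for $x\ne y$. For an antichain $A$, $\mathcal E(A)$ is the full subcategory of all objects having a finite filtration with factors in $A$; its simple objects are the elements of $A$. The $\mathrm{Ext}$-quiver of an antichain $\{A_1,\dots,A_t\}$ with endomorphism rings $k$ (or of $\mathcal E(A_1,\dots,A_t)$) has vertices $A_1,\dots,A_t$ and $\dim_k\mathrm{Ext}^1(A_j,A_i)$ arrows $A_j\to A_i$. The maximal indecomposable representation is the indecomposable representation whose dimension vector is the maximal positive root. *)

theory Defs
  imports "Jordan_Normal_Form.VS_Connect" "Graph_Theory.Digraph"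
begin

section \<open>Dynkin quivers\<close>

text \<open>
  A quiver is a \<open>pre_digraph\<close>; its full subquivers are given by sets of vertices.
  The star \<open>TypeE m\<close> has centre \<open>1\<close> and branches \<open>2\<close>, \<open>3 - 4\<close>, \<open>5 - 6 - ... - m\<close>,
  of \<open>1\<close>, \<open>2\<close> and \<open>m - 4\<close> vertices.
\<close>

datatype dynkin = TypeD nat | TypeE nat

fun diagram_verts :: "dynkin \<Rightarrow> nat set" where
  "diagram_verts (TypeD n) = {1..n}"
| "diagram_verts (TypeE m) = {1..m}"

fun diagram_edges :: "dynkin \<Rightarrow> nat set set" where
  "diagram_edges (TypeD n) = {{1, 3}, {2, 3}} \<union> {{i, i + 1} | i. 3 \<le> i \<and> i + 1 \<le> n}"
| "diagram_edges (TypeE m) = {{1, 2}, {1, 3}, {3, 4}, {1, 5}} \<union> {{i, i + 1} | i. 5 \<le> i \<and> i + 1 \<le> m}"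

fun exceptional_vertex :: "dynkin \<Rightarrow> nat" where
  "exceptional_vertex (TypeD n) = n - 1"
| "exceptional_vertex (TypeE m) = (if m = 6 then 2 else if m = 7 then 4 else 8)"

text \<open>
  \<open>dynkin_labelling T Q f\<close>: forgetting the orientation, \<open>f\<close> is an isomorphism from the diagram
  \<open>T\<close> to \<open>Q\<close>. Taking \<open>u = v\<close> excludes loops.
\<close>

definition dynkin_labelling ::
    "dynkin \<Rightarrow> ('v, 'a) pre_digraph \<Rightarrow> (nat \<Rightarrow> 'v) \<Rightarrow> bool" where
  "dynkin_labelling T Q f \<longleftrightarrow>
     wf_digraph Q \<and> bij_betw f (diagram_verts T) (verts Q) \<and>
     (\<forall>u \<in> diagram_verts T. \<forall>v \<in> diagram_verts T.
        let B = {a \<in> arcs Q. {tail Q a, head Q a} = {f u, f v}}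
        in if {u, v} \<in> diagram_edges T then card B = 1 else B = {})"

definition neighbours :: "('v, 'a) pre_digraph \<Rightarrow> 'v \<Rightarrow> 'v set" where
  "neighbours Q y = {x. \<exists>a \<in> arcs Q. {tail Q a, head Q a} = {x, y}}"

definition tits_form :: "('v, 'a) pre_digraph \<Rightarrow> ('v \<Rightarrow> nat) \<Rightarrow> int" where
  "tits_form Q d =
     (\<Sum>x \<in> verts Q. (int (d x))\<^sup>2) - (\<Sum>a \<in> arcs Q. int (d (tail Q a)) * int (d (head Q a)))"

text \<open>For a Dynkin quiver, the roots are the integral vectors on which the Tits form is \<open>1\<close>.\<close>

definition positive_root :: "('v, 'a) pre_digraph \<Rightarrow> ('v \<Rightarrow> nat) \<Rightarrow> bool" where
  "positive_root Q d \<longleftrightarrow> tits_form Q d = 1"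

definition maximal_positive_root :: "('v, 'a) pre_digraph \<Rightarrow> ('v \<Rightarrow> nat) \<Rightarrow> bool" where
  "maximal_positive_root Q d \<longleftrightarrow>
     positive_root Q d \<and> (\<forall>e. positive_root Q e \<longrightarrow> (\<forall>x \<in> verts Q. e x \<le> d x))"


section \<open>Finite-dimensional representations\<close>

text \<open>
  The space at a vertex \<open>x\<close> is the coordinate space of column vectors of length \<open>dimv X x\<close>, and
  linear maps are matrices. Values of \<open>dimv X\<close>, \<open>lin X\<close> and of morphisms outside the vertices
  and arrows of the quiver are irrelevant.
\<close>

record ('v, 'a, 'k) rep =
  dimv :: "'v \<Rightarrow> nat"
  lin :: "'a \<Rightarrow> 'k mat"

type_synonym ('v, 'k) mor = "'v \<Rightarrow> 'k mat"

definition is_rep :: "('v, 'a) pre_digraph \<Rightarrow> ('v, 'a, 'k) rep \<Rightarrow> bool" where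
  "is_rep Q X \<longleftrightarrow>
     (\<forall>a \<in> arcs Q. lin X a \<in> carrier_mat (dimv X (head Q a)) (dimv X (tail Q a)))"

definition zero_rep :: "('v, 'a) pre_digraph \<Rightarrow> ('v, 'a, 'k) rep \<Rightarrow> bool" where
  "zero_rep Q X \<longleftrightarrow> (\<forall>x \<in> verts Q. dimv X x = 0)"

definition rep_support :: "('v, 'a) pre_digraph \<Rightarrow> ('v, 'a, 'k) rep \<Rightarrow> 'v set" where
  "rep_support Q X = {x \<in> verts Q. dimv X x \<noteq> 0}"

definition is_mor :: "('v, 'a) pre_digraph \<Rightarrow> ('v, 'a, 'k::field) rep \<Rightarrow> ('v, 'a, 'k) rep \<Rightarrow>
    ('v, 'k) mor \<Rightarrow> bool" where
  "is_mor Q X Y \<phi> \<longleftrightarrow>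
     (\<forall>x \<in> verts Q. \<phi> x \<in> carrier_mat (dimv Y x) (dimv X x)) \<and>
     (\<forall>a \<in> arcs Q. \<phi> (head Q a) * lin X a = lin Y a * \<phi> (tail Q a))"

definition zero_mor :: "('v, 'a) pre_digraph \<Rightarrow> ('v, 'k::zero) mor \<Rightarrow> bool" where
  "zero_mor Q \<phi> \<longleftrightarrow> (\<forall>x \<in> verts Q. \<phi> x = 0\<^sub>m (dim_row (\<phi> x)) (dim_col (\<phi> x)))"

definition mor_eq :: "('v, 'a) pre_digraph \<Rightarrow> ('v, 'k) mor \<Rightarrow> ('v, 'k) mor \<Rightarrow> bool" where
  "mor_eq Q \<phi> \<psi> \<longleftrightarrow> (\<forall>x \<in> verts Q. \<phi> x = \<psi> x)"

definition mor_comp :: "('v, 'k::semiring_0) mor \<Rightarrow> ('v, 'k) mor \<Rightarrow> ('v, 'k) mor" where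
  "mor_comp \<psi> \<phi> = (\<lambda>x. \<psi> x * \<phi> x)"

definition scalar_mor :: "'k::field \<Rightarrow> ('v, 'a, 'k) rep \<Rightarrow> ('v, 'k) mor" where
  "scalar_mor c X = (\<lambda>x. c \<cdot>\<^sub>m 1\<^sub>m (dimv X x))"

abbreviation id_mor :: "('v, 'a, 'k::field) rep \<Rightarrow> ('v, 'k) mor" where
  "id_mor X \<equiv> (\<lambda>x. 1\<^sub>m (dimv X x))"

definition rep_iso :: "('v, 'a) pre_digraph \<Rightarrow> ('v, 'a, 'k::field) rep \<Rightarrow> ('v, 'a, 'k) rep \<Rightarrow> bool"
  where
  "rep_iso Q X Y \<longleftrightarrow> (\<exists>\<phi> \<psi>. is_mor Q X Y \<phi> \<and> is_mor Q Y X \<psi> \<and>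
     mor_eq Q (mor_comp \<psi> \<phi>) (id_mor X) \<and> mor_eq Q (mor_comp \<phi> \<psi>) (id_mor Y))"

definition mat_dsum :: "'k::zero mat \<Rightarrow> 'k mat \<Rightarrow> 'k mat" where
  "mat_dsum A B = four_block_mat A (0\<^sub>m (dim_row A) (dim_col B)) (0\<^sub>m (dim_row B) (dim_col A)) B"

definition rep_dsum :: "('v, 'a, 'k::field) rep \<Rightarrow> ('v, 'a, 'k) rep \<Rightarrow> ('v, 'a, 'k) rep" where
  "rep_dsum X Y = \<lparr> dimv = (\<lambda>x. dimv X x + dimv Y x), lin = (\<lambda>a. mat_dsum (lin X a) (lin Y a)) \<rparr>"

definition mor_dsum :: "('v, 'k::field) mor \<Rightarrow> ('v, 'k) mor \<Rightarrow> ('v, 'k) mor" where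
  "mor_dsum \<phi> \<psi> = (\<lambda>x. mat_dsum (\<phi> x) (\<psi> x))"

definition diag_mor :: "('v, 'a, 'k::field) rep \<Rightarrow> ('v, 'k) mor" where
  "diag_mor X = (\<lambda>x. append_rows (1\<^sub>m (dimv X x)) (1\<^sub>m (dimv X x)))"

definition codiag_mor :: "('v, 'a, 'k::field) rep \<Rightarrow> ('v, 'k) mor" where
  "codiag_mor X = (\<lambda>x. transpose_mat (diag_mor X x))"

definition indecomposable_rep ::
    "('v, 'a) pre_digraph \<Rightarrow> ('v, 'a, 'k::field) rep \<Rightarrow> bool" where
  "indecomposable_rep Q M \<longleftrightarrow> is_rep Q M \<and> \<not> zero_rep Q M \<and>
     (\<forall>X Y. is_rep Q X \<and> is_rep Q Y \<and> rep_iso Q M (rep_dsum X Y) \<longrightarrow> zero_rep Q X \<or> zero_rep Q Y)"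

definition maximal_indecomposable ::
    "('v, 'a) pre_digraph \<Rightarrow> ('v, 'a, 'k::field) rep \<Rightarrow> bool" where
  "maximal_indecomposable Q M \<longleftrightarrow> indecomposable_rep Q M \<and> maximal_positive_root Q (dimv M)"

definition simple_rep :: "('v, 'a) pre_digraph \<Rightarrow> 'v \<Rightarrow> ('v, 'a, 'k::field) rep" where
  "simple_rep Q y = (let d = (\<lambda>x. if x = y then 1 else 0)
     in \<lparr> dimv = d, lin = (\<lambda>a. 0\<^sub>m (d (head Q a)) (d (tail Q a))) \<rparr>)"


section \<open>Antichains and their filtered objects\<close>

definition end_division_ring ::
    "('v, 'a) pre_digraph \<Rightarrow> ('v, 'a, 'k::field) rep \<Rightarrow> bool" where
  "end_division_ring Q X \<longleftrightarrow> \<not> zero_mor Q (id_mor X) \<and>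
     (\<forall>\<phi>. is_mor Q X X \<phi> \<and> \<not> zero_mor Q \<phi> \<longrightarrow> (\<exists>\<psi>. is_mor Q X X \<psi> \<and>
        mor_eq Q (mor_comp \<psi> \<phi>) (id_mor X) \<and> mor_eq Q (mor_comp \<phi> \<psi>) (id_mor X)))"

definition end_is_base_field ::
    "('v, 'a) pre_digraph \<Rightarrow> ('v, 'a, 'k::field) rep \<Rightarrow> bool" where
  "end_is_base_field Q X \<longleftrightarrow> \<not> zero_mor Q (id_mor X) \<and>
     (\<forall>\<phi>. is_mor Q X X \<phi> \<longrightarrow> (\<exists>c. mor_eq Q \<phi> (scalar_mor c X)))"

definition antichain :: "('v, 'a) pre_digraph \<Rightarrow> ('v, 'a, 'k::field) rep set \<Rightarrow> bool" where
  "antichain Q A \<longleftrightarrow>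
     (\<forall>X \<in> A. is_rep Q X \<and> end_division_ring Q X) \<and>
     (\<forall>X \<in> A. \<forall>Y \<in> A. X \<noteq> Y \<longrightarrow> (\<forall>\<phi>. is_mor Q X Y \<phi> \<longrightarrow> zero_mor Q \<phi>))"

definition special_antichain_triple :: "('v, 'a) pre_digraph \<Rightarrow> 'v \<Rightarrow>
    ('v, 'a, 'k::field) rep \<Rightarrow> ('v, 'a, 'k) rep \<Rightarrow> ('v, 'a, 'k) rep \<Rightarrow> bool" where
  "special_antichain_triple Q y A1 A2 A3 \<longleftrightarrow>
     distinct [A1, A2, A3] \<and> antichain Q {A1, A2, A3} \<and>
     (\<forall>X \<in> {A1, A2, A3}.
        rep_support Q X \<subseteq> verts Q - {y} \<and>
        \<not> rep_support Q X \<subseteq> verts Q - ({y} \<union> neighbours Q y))"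

text \<open>Exactness of \<open>0 \<rightarrow> X \<rightarrow> Y \<rightarrow> Z \<rightarrow> 0\<close>; kernels and cokernels are computed pointwise.\<close>

definition short_exact :: "('v, 'a) pre_digraph \<Rightarrow> ('v, 'a, 'k::field) rep \<Rightarrow> ('v, 'k) mor \<Rightarrow>
    ('v, 'a, 'k) rep \<Rightarrow> ('v, 'k) mor \<Rightarrow> ('v, 'a, 'k) rep \<Rightarrow> bool" where
  "short_exact Q X i Y p Z \<longleftrightarrow> is_mor Q X Y i \<and> is_mor Q Y Z p \<and>
     (\<forall>x \<in> verts Q.
        inj_on ((*\<^sub>v) (i x)) (carrier_vec (dimv X x)) \<and>
        (*\<^sub>v) (i x) ` carrier_vec (dimv X x)
          = {v \<in> carrier_vec (dimv Y x). p x *\<^sub>v v = 0\<^sub>v (dimv Z x)} \<and>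
        (*\<^sub>v) (p x) ` carrier_vec (dimv Y x) = carrier_vec (dimv Z x))"

text \<open>
  The objects of \<open>\<E>(A)\<close>: those with a filtration \<open>0 = M\<^sub>0 \<subseteq> \<dots> \<subseteq> M\<^sub>r = M\<close> whose factors are
  isomorphic to elements of \<open>A\<close>.
\<close>

inductive_set filtered_objects ::
    "('v, 'a) pre_digraph \<Rightarrow> ('v, 'a, 'k::field) rep set \<Rightarrow> ('v, 'a, 'k) rep set"
  for Q :: "('v, 'a) pre_digraph" and A :: "('v, 'a, 'k::field) rep set" where
  filtered_zero: "\<lbrakk> is_rep Q M; zero_rep Q M \<rbrakk> \<Longrightarrow> M \<in> filtered_objects Q A"
| filtered_step: "\<lbrakk> L \<in> filtered_objects Q A; B \<in> A; is_rep Q M; short_exact Q L i M p B \<rbrakk>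
    \<Longrightarrow> M \<in> filtered_objects Q A"


section \<open>The space of Yoneda extensions\<close>

text \<open>
  An extension of \<open>X\<close> by \<open>Y\<close> is a short exact sequence \<open>0 \<rightarrow> Y \<rightarrow> E \<rightarrow> X \<rightarrow> 0\<close>, recorded as the
  middle term with the two maps.
\<close>

type_synonym ('v, 'a, 'k) ext = "('v, 'a, 'k) rep \<times> ('v, 'k) mor \<times> ('v, 'k) mor"

definition extensions :: "('v, 'a) pre_digraph \<Rightarrow> ('v, 'a, 'k::field) rep \<Rightarrow> ('v, 'a, 'k) rep \<Rightarrow>
    ('v, 'a, 'k) ext set" where
  "extensions Q X Y = {(E, i, p). is_rep Q E \<and> short_exact Q Y i E p X}"

text \<open>
  \<open>ext_mor Q \<alpha> \<gamma> \<xi> \<zeta>\<close>: there is a morphism of extensions \<open>\<xi> \<rightarrow> \<zeta>\<close> with components \<open>\<alpha>\<close> on the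
  subobjects and \<open>\<gamma>\<close> on the quotients. For \<open>\<gamma> = id\<close> it says that \<open>\<zeta>\<close> is the pushout of
  \<open>\<xi>\<close> along \<open>\<alpha>\<close>, for \<open>\<alpha> = id\<close> that \<open>\<xi>\<close> is the pullback of \<open>\<zeta>\<close> along \<open>\<gamma>\<close>, and when both
  are identities that \<open>\<xi>\<close> and \<open>\<zeta>\<close> are equivalent.
\<close>

fun ext_mor :: "('v, 'a) pre_digraph \<Rightarrow> ('v, 'k::field) mor \<Rightarrow> ('v, 'k) mor \<Rightarrow>
    ('v, 'a, 'k) ext \<Rightarrow> ('v, 'a, 'k) ext \<Rightarrow> bool" where
  "ext_mor Q \<alpha> \<gamma> (E, i, p) (F, j, q) \<longleftrightarrow> (\<exists>\<beta>. is_mor Q E F \<beta> \<and>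
     mor_eq Q (mor_comp \<beta> i) (mor_comp j \<alpha>) \<and> mor_eq Q (mor_comp q \<beta>) (mor_comp \<gamma> p))"

definition ext_equiv :: "('v, 'a) pre_digraph \<Rightarrow> ('v, 'a, 'k::field) rep \<Rightarrow> ('v, 'a, 'k) rep \<Rightarrow>
    (('v, 'a, 'k) ext \<times> ('v, 'a, 'k) ext) set" where
  "ext_equiv Q X Y = {(\<xi>, \<zeta>). \<xi> \<in> extensions Q X Y \<and> \<zeta> \<in> extensions Q X Y \<and>
     ext_mor Q (id_mor Y) (id_mor X) \<xi> \<zeta>}"

fun ext_dsum :: "('v, 'a, 'k::field) ext \<Rightarrow> ('v, 'a, 'k) ext \<Rightarrow> ('v, 'a, 'k) ext" where
  "ext_dsum (E, i, p) (F, j, q) = (rep_dsum E F, mor_dsum i j, mor_dsum p q)"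

text \<open>
  \<open>\<zeta>\<close> is a Baer sum of \<open>\<xi>\<^sub>1\<close> and \<open>\<xi>\<^sub>2\<close>: pull \<open>\<xi>\<^sub>1 \<oplus> \<xi>\<^sub>2\<close> back along the diagonal of \<open>X\<close> and push
  the result \<open>\<eta>\<close> out along the codiagonal of \<open>Y\<close>.
\<close>

definition baer_sum :: "('v, 'a) pre_digraph \<Rightarrow> ('v, 'a, 'k::field) rep \<Rightarrow> ('v, 'a, 'k) rep \<Rightarrow>
    ('v, 'a, 'k) ext \<Rightarrow> ('v, 'a, 'k) ext \<Rightarrow> ('v, 'a, 'k) ext \<Rightarrow> bool" where
  "baer_sum Q X Y \<xi>\<^sub>1 \<xi>\<^sub>2 \<zeta> \<longleftrightarrow> (\<exists>\<eta> \<in> extensions Q X (rep_dsum Y Y).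
     ext_mor Q (id_mor (rep_dsum Y Y)) (diag_mor X) \<eta> (ext_dsum \<xi>\<^sub>1 \<xi>\<^sub>2) \<and>
     ext_mor Q (codiag_mor Y) (id_mor X) \<eta> \<zeta>)"

definition split_extensions :: "('v, 'a) pre_digraph \<Rightarrow> ('v, 'a, 'k::field) rep \<Rightarrow>
    ('v, 'a, 'k) rep \<Rightarrow> ('v, 'a, 'k) ext set" where
  "split_extensions Q X Y = {(E, i, p). (E, i, p) \<in> extensions Q X Y \<and>
     (\<exists>\<sigma>. is_mor Q X E \<sigma> \<and> mor_eq Q (mor_comp p \<sigma>) (id_mor X))}"

text \<open>
  \<open>Ext\<^sup>1(X, Y)\<close> as a vector space over \<open>k\<close>: Baer sum, and multiplication by \<open>c\<close> as pushout along
  \<open>c \<cdot> id\<^sub>Y\<close>. The ring-only fields \<open>mult\<close> and \<open>one\<close> of the record are irrelevant.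
\<close>

definition Ext1 :: "('v, 'a) pre_digraph \<Rightarrow> ('v, 'a, 'k::field) rep \<Rightarrow> ('v, 'a, 'k) rep \<Rightarrow>
    ('k, ('v, 'a, 'k) ext set) module" where
  "Ext1 Q X Y = \<lparr>
     carrier = extensions Q X Y // ext_equiv Q X Y,
     mult = undefined, one = undefined,
     zero = split_extensions Q X Y,
     add = (\<lambda>C D. {\<zeta> \<in> extensions Q X Y. \<exists>\<xi>\<^sub>1 \<in> C. \<exists>\<xi>\<^sub>2 \<in> D. baer_sum Q X Y \<xi>\<^sub>1 \<xi>\<^sub>2 \<zeta>}),
     smult = (\<lambda>c C. {\<zeta> \<in> extensions Q X Y. \<exists>\<xi> \<in> C. ext_mor Q (scalar_mor c Y) (id_mor X) \<xi> \<zeta>}) \<rparr>"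

definition dim_Ext1 ::
    "('v, 'a) pre_digraph \<Rightarrow> ('v, 'a, 'k::field) rep \<Rightarrow> ('v, 'a, 'k) rep \<Rightarrow> nat" where
  "dim_Ext1 Q X Y = vectorspace.dim (class_ring :: 'k ring) (Ext1 Q X Y)"

text \<open>The arrows from \<open>X\<close> to \<open>Y\<close> are the triples \<open>(X, Y, l)\<close> with \<open>l < dim Ext\<^sup>1(X, Y)\<close>.\<close>

definition ext_quiver :: "('v, 'a) pre_digraph \<Rightarrow> ('v, 'a, 'k::field) rep set \<Rightarrow>
    (('v, 'a, 'k) rep, ('v, 'a, 'k) rep \<times> ('v, 'a, 'k) rep \<times> nat) pre_digraph" where
  "ext_quiver Q A = \<lparr>
     verts = A,
     arcs = {(X, Y, l). X \<in> A \<and> Y \<in> A \<and> l < dim_Ext1 Q X Y},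
     tail = fst,
     head = (\<lambda>(X, Y, l). Y) \<rparr>"

end

theory Submission
  imports Defs "HOL-Library.Function_Algebras"
begin

text \<open>
  Write \<open>\<langle>m, n\<rangle>\<close> for the Euler form of the quiver and \<open>q m = \<langle>m, m\<rangle>\<close> for the Tits form, so that
  \<open>\<langle>dim V, dim W\<rangle> = dim Hom(V, W) - dim Ext(V, W)\<close>. Everything rests on one computation with \<open>q\<close>.

  The maximal root \<open>\<theta>\<close> of a diagram of type D or E has \<open>\<theta>(y) = 2\<close> at the exceptional vertex, and it is
  the positive function for which \<open>2 \<theta>(x)\<close> exceeds the sum of \<open>\<theta>\<close> over the neighbours of \<open>x\<close> by \<open>1\<close>
  if \<open>x = y\<close> and by \<open>0\<close> otherwise. These few properties (locale \<open>marked_quiver\<close>) imply that \<open>q\<close> is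
  positive definite, that \<open>\<theta>\<close> bounds all positive roots, and that \<open>\<theta>\<close> is the only root with value \<open>2\<close>
  at \<open>y\<close>; the diagrams enter only through the values of \<open>\<theta>\<close> and through
  connectedness.

  Let \<open>A\<^sub>0, A\<^sub>1, A\<^sub>2\<close> be the triple, \<open>n\<^sub>i \<ge> 1\<close> the total dimension of \<open>A\<^sub>i\<close> at the neighbours of \<open>y\<close>, and
  \<open>s\<close> the sum of the three dimension vectors, which vanishes at \<open>y\<close>. Positivity at \<open>s + 2 e\<^sub>y\<close> says
  \<open>1 \<le> q(s) + 4 - 2 (n\<^sub>0 + n\<^sub>1 + n\<^sub>2)\<close>. Orthogonality gives \<open>\<langle>A\<^sub>i, A\<^sub>j\<rangle> \<le> 0\<close> for \<open>i \<noteq> j\<close>, and evaluating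
  endomorphisms at a vector over a neighbour of \<open>y\<close> gives \<open>\<langle>A\<^sub>i, A\<^sub>i\<rangle> \<le> n\<^sub>i\<close>. So the right hand side is at
  most \<open>4 - (n\<^sub>0 + n\<^sub>1 + n\<^sub>2) \<le> 1\<close>, and all the estimates are equalities: \<open>n\<^sub>i = 1\<close>, there are no extensions
  among the \<open>A\<^sub>i\<close>, their endomorphism rings are the base field, and \<open>s + 2 e\<^sub>y\<close> is a root, hence \<open>\<theta>\<close>.
  Since \<open>n\<^sub>i = 1\<close>, a single arrow joins \<open>y\<close> to the support of \<open>A\<^sub>i\<close>, and it meets a one-dimensional space;
  its direction decides which of \<open>Ext(S(y), A\<^sub>i)\<close> and \<open>Ext(A\<^sub>i, S(y))\<close> is one-dimensional while the other
  one vanishes. This is the extension quiver.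

  For the maximal indecomposable, the sum of the \<open>A\<^sub>i\<close> and two copies of \<open>S(y)\<close> is glued along these
  arrows by three pairwise independent vectors of \<open>k\<^sup>2\<close>, as for the maximal root of D4. The result has
  dimension vector \<open>\<theta>\<close> and is filtered by construction (\<open>filt_MV\<close>); three lines in general position
  make its endomorphisms scalar (\<open>MV_brick\<close>). It remains to see that every indecomposable of dimension vector
  \<open>\<theta>\<close> is isomorphic to it. When \<open>q\<close> is positive, a brick has no self-extension and an indecomposable is a
  brick (\<open>findec_rigid\<close>, Ringel's argument), and two representations without self-extensions that have
  the same real root as dimension vector are isomorphic (\<open>rigid_unique\<close>).

  Kernels, images and subrepresentations are awkward for representations by matrices. The
  arguments above are carried out for operators on finite-dimensional subspaces of function spaces,
  and matrices are translated into such operators. Extensions are treated there as cocycles modulo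
  coboundaries; the passage from Yoneda classes with the Baer sum to cocycles is \<open>presented_Ext1\<close>.
\<close>

section \<open>Linear maps between function spaces\<close>

definition fscale :: "'k::field \<Rightarrow> ('i \<Rightarrow> 'k) \<Rightarrow> 'i \<Rightarrow> 'k" where
  "fscale c v = (\<lambda>i. c * v i)"

lemma fscale_apply: "fscale c v i = c * v i"
  by (simp add: fscale_def)

lemmas pointwise = plus_fun_apply zero_fun_apply minus_apply uminus_apply fscale_apply

\<comment> \<open>Vectors are functions, and simplification should treat them as vectors; it evaluates them at a
  point only when \<open>pointwise\<close> is given.\<close>
declare plus_fun_apply [simp del] zero_fun_apply [simp del] minus_apply [simp del] uminus_apply [simp del]

interpretation fs: vector_space fscale
  by unfold_locales (auto simp: fun_eq_iff pointwise algebra_simps)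

interpretation fp: vector_space_pair fscale fscale ..

abbreviation flinear :: "(('i \<Rightarrow> 'k::field) \<Rightarrow> 'j \<Rightarrow> 'k) \<Rightarrow> bool" where
  "flinear \<equiv> Vector_Spaces.linear fscale fscale"

lemma flinearI:
  assumes "\<And>u v. f (u + v) = f u + f v" "\<And>c v. f (fscale c v) = fscale c (f v)"
  shows "flinear f"
  using assms by (simp add: Vector_Spaces.linear_iff fs.vector_space_axioms)

lemma flinear_simps:
  assumes "flinear f"
  shows "f (u + v) = f u + f v" "f (u - v) = f u - f v" "f (- v) = - f v"
    "f 0 = 0" "f (fscale c v) = fscale c (f v)" "f (sum g A) = (\<Sum>a\<in>A. f (g a))"
  using fp.linear_add[OF assms] fp.linear_diff[OF assms] fp.linear_neg[OF assms]
    fp.linear_0[OF assms] fp.linear_scale[OF assms] fp.linear_sum[OF assms] by auto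

lemma flinear_ops:
  "flinear (\<lambda>v. v)" "flinear (\<lambda>v. 0)"
  "flinear f \<Longrightarrow> flinear g \<Longrightarrow> flinear (\<lambda>v. f v + g v)"
  "flinear f \<Longrightarrow> flinear g \<Longrightarrow> flinear (\<lambda>v. f v - g v)"
  "flinear f \<Longrightarrow> flinear (\<lambda>v. - f v)"
  "flinear f \<Longrightarrow> flinear (\<lambda>v. fscale c (f v))"
  by (auto intro!: flinearI simp: flinear_simps fun_eq_iff pointwise algebra_simps)

lemma flinear_compose: "flinear f \<Longrightarrow> flinear h \<Longrightarrow> flinear (\<lambda>v. h (f v))"
  by (intro flinearI) (simp_all add: flinear_simps)

section \<open>Finite-dimensional subspaces\<close>

text \<open>
  Spaces are subspaces of function spaces, so that kernels and images are again of this kind.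
\<close>

definition fds :: "('i \<Rightarrow> 'k::field) set \<Rightarrow> bool" where
  "fds U \<longleftrightarrow> fs.subspace U \<and> (\<exists>B. finite B \<and> U \<subseteq> fs.span B)"

lemma fds_subspace: "fds U \<Longrightarrow> fs.subspace U"
  by (simp add: fds_def)

lemma fds_closed:
  assumes "fds U"
  shows "0 \<in> U" "u \<in> U \<Longrightarrow> v \<in> U \<Longrightarrow> u + v \<in> U" "u \<in> U \<Longrightarrow> v \<in> U \<Longrightarrow> u - v \<in> U"
    "u \<in> U \<Longrightarrow> - u \<in> U" "u \<in> U \<Longrightarrow> fscale c u \<in> U" "(\<And>a. a \<in> A \<Longrightarrow> g a \<in> U) \<Longrightarrow> sum g A \<in> U"
proof -
  note U = fds_subspace[OF assms]
  show "0 \<in> U" by (rule fs.subspace_0[OF U])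
  show "u \<in> U \<Longrightarrow> v \<in> U \<Longrightarrow> u + v \<in> U" by (rule fs.subspace_add[OF U])
  show "u \<in> U \<Longrightarrow> v \<in> U \<Longrightarrow> u - v \<in> U" by (rule fs.subspace_diff[OF U])
  show "u \<in> U \<Longrightarrow> - u \<in> U" by (rule fs.subspace_neg[OF U])
  show "u \<in> U \<Longrightarrow> fscale c u \<in> U" by (rule fs.subspace_scale[OF U])
  show "(\<And>a. a \<in> A \<Longrightarrow> g a \<in> U) \<Longrightarrow> sum g A \<in> U" by (rule fs.subspace_sum[OF U])
qed

lemma fds_basis:
  assumes "fds U"
  obtains B where "finite B" "B \<subseteq> U" "fs.independent B" "fs.span B = U" "card B = fs.dim U"
proof -
  obtain B where B: "B \<subseteq> U" "fs.independent B" "U \<subseteq> fs.span B" "card B = fs.dim U"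
    using fs.basis_exists by blast
  obtain C where "finite C" "U \<subseteq> fs.span C" using assms unfolding fds_def by blast
  then have "finite B" using fs.independent_span_bound[of C B] B by auto
  moreover have "fs.span B = U"
    using B fs.span_minimal[OF B(1) fds_subspace[OF assms]] by blast
  ultimately show ?thesis using that B by blast
qed

lemma fds_subset: "fds U \<Longrightarrow> fs.subspace W \<Longrightarrow> W \<subseteq> U \<Longrightarrow> fds W"
  unfolding fds_def by (meson order_trans)

lemma dim_mono_fds:
  assumes "fds U" "W \<subseteq> U" shows "fs.dim W \<le> fs.dim U"
  by (metis assms fds_basis fs.dim_le_card)

text \<open>
  The dimension function returns a default value on infinite-dimensional sets, hence the finiteness of the larger space.
\<close>

lemma fds_eqI:
  assumes U: "fds U" and W: "fs.subspace W" "W \<subseteq> U" and d: "fs.dim U \<le> fs.dim W"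
  shows "W = U"
proof (rule ccontr)
  assume "W \<noteq> U"
  then obtain u where u: "u \<in> U" "u \<notin> W" using W by blast
  obtain B where B: "finite B" "B \<subseteq> U" "fs.independent B" "fs.span B = U" "card B = fs.dim U"
    using fds_basis[OF U] .
  obtain C where C: "finite C" "C \<subseteq> W" "fs.independent C" "fs.span C = W" "card C = fs.dim W"
    using fds_basis[OF fds_subset[OF U W]] .
  have "fs.independent (insert u C)" using u C fs.independent_insertI by blast
  moreover have "insert u C \<subseteq> fs.span B" using u C B W by auto
  ultimately have "card (insert u C) \<le> card B" using fs.independent_span_bound[OF B(1)] by blast
  moreover have "u \<notin> C" using u C by auto
  ultimately show False using C B d by auto
qed

lemma fds_kernel:
  assumes "fds U" "flinear f" shows "fds {u \<in> U. f u = 0}"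
  by (rule fds_subset[OF assms(1)], rule fs.subspaceI)
    (auto simp: fds_closed[OF assms(1)] flinear_simps[OF assms(2)])

lemma fds_image:
  assumes "fds U" "flinear f" shows "fds (f ` U)"
proof -
  obtain B where B: "finite B" "fs.span B = U" using fds_basis[OF assms(1)] by metis
  have "f ` U = fs.span (f ` B)" using fp.linear_span_image[OF assms(2)] B by simp
  then show ?thesis unfolding fds_def using B(1) by (auto intro: fs.subspace_span)
qed

lemma rank_nullity:
  assumes U: "fds U" and f: "flinear f"
  shows "fs.dim U = fs.dim {u \<in> U. f u = 0} + fs.dim (f ` U)"
proof -
  let ?K = "{u \<in> U. f u = 0}"
  obtain C where C: "finite C" "C \<subseteq> ?K" "fs.independent C" "fs.span C = ?K" "card C = fs.dim ?K"
    using fds_basis[OF fds_kernel[OF U f]] .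
  obtain B where B: "C \<subseteq> B" "B \<subseteq> U" "fs.independent B" "U \<subseteq> fs.span B"
    using fs.maximal_independent_subset_extend[of C U] C by blast
  obtain D where D: "finite D" "fs.span D = U" using fds_basis[OF U] by metis
  have fB: "finite B" using fs.independent_span_bound[OF D(1) B(3)] B D by auto
  have cB: "card B = fs.dim U" using fs.basis_card_eq_dim B by blast
  let ?R = "B - C"
  have indR: "fs.independent ?R" using B(3) fs.independent_mono by blast
  have spR: "fs.span ?R \<subseteq> U" using B(2) fs.span_minimal[OF _ fds_subspace[OF U]] by blast
  have inj: "inj_on f (fs.span ?R)"
  proof (rule fp.linear_inj_on_iff_eq_0[OF f fs.subspace_span, THEN iffD2])
    show "\<forall>x\<in>fs.span ?R. f x = 0 \<longrightarrow> x = 0"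
    proof (intro ballI impI)
      fix x assume x: "x \<in> fs.span ?R" "f x = 0"
      then have xC: "x \<in> fs.span C" using C(4) spR by blast
      have "fs.representation B x = fs.representation ?R x"
        by (rule fs.representation_extend[OF B(3) x(1)]) auto
      moreover have "fs.representation B x = fs.representation C x"
        by (rule fs.representation_extend[OF B(3) xC B(1)])
      ultimately have "fs.representation B x b = 0" for b
        using fs.representation_ne_zero[of ?R x b] fs.representation_ne_zero[of C x b] by force
      moreover have "x \<in> fs.span B" using x(1) fs.span_mono[of ?R B] by auto
      ultimately show "x = 0"
        using fs.sum_nonzero_representation_eq[OF B(3), of x] by simp
    qed
  qed
  have "fs.independent (f ` ?R)" by (rule fp.linear_independent_injective_image[OF f indR inj])
  moreover have "f ` U \<subseteq> fs.span (f ` ?R)"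
  proof -
    have "f ` U \<subseteq> fs.span (f ` B)" using B(4) fp.linear_span_image[OF f] by blast
    also have "\<dots> \<subseteq> fs.span (f ` ?R)"
    proof (rule fs.span_minimal[OF _ fs.subspace_span], rule image_subsetI)
      fix b assume "b \<in> B"
      show "f b \<in> fs.span (f ` ?R)"
      proof (cases "b \<in> C")
        case True
        then have "f b = 0" using C by blast
        then show ?thesis by (simp add: fs.span_zero)
      next
        case False
        then show ?thesis using \<open>b \<in> B\<close> by (auto intro: fs.span_base)
      qed
    qed
    finally show ?thesis .
  qed
  moreover have "f ` ?R \<subseteq> f ` U" using B by auto
  ultimately have "card (f ` ?R) = fs.dim (f ` U)" using fs.basis_card_eq_dim by blast
  moreover have "card (f ` ?R) = card ?R"
    using inj_on_subset[OF inj fs.span_superset] card_image by blast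
  moreover have "card ?R = card B - card C" using C B by (simp add: card_Diff_subset)
  moreover have "card C \<le> card B" using B fB card_mono by blast
  ultimately show ?thesis using cB C by simp
qed

lemma dim_image_inj:
  assumes U: "fds U" and f: "flinear f" and i: "\<And>u. u \<in> U \<Longrightarrow> f u = 0 \<Longrightarrow> u = 0"
  shows "fs.dim (f ` U) = fs.dim U"
proof -
  have "{u \<in> U. f u = 0} = {0}" using i fds_closed(1)[OF U] flinear_simps[OF f] by auto
  moreover have "fs.dim {0::'a \<Rightarrow> 'b} = 0" using fs.dim_le_card[of "{0}" "{}"] by simp
  ultimately show ?thesis using rank_nullity[OF U f] by simp
qed

lemma fds_dim_0:
  assumes "fds U" shows "fs.dim U = 0 \<longleftrightarrow> U = {0}"
proof
  assume "fs.dim U = 0"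
  then obtain B where "finite B" "fs.span B = U" "card B = 0" using fds_basis[OF assms] by metis
  then show "U = {0}" by auto
next
  assume "U = {0}" then show "fs.dim U = 0" using fs.dim_le_card[of "{0}" "{}"] by simp
qed

text \<open>
  The map is defined on the whole function space, with values in the subspace everywhere. Maps made
  total in this way compose without side conditions.
\<close>

lemma projection_exists:
  assumes "fs.subspace S"
  obtains g where "flinear g" "\<And>v. g v \<in> S" "\<And>v. v \<in> S \<Longrightarrow> g v = v"
proof -
  have "\<exists>g. g ` UNIV \<subseteq> S \<and> flinear g \<and> (\<forall>v\<in>S. g ((\<lambda>v. v) v) = v)"
    by (rule fp.linear_exists_left_inverse_on[OF flinear_ops(1) assms]) (simp add: inj_on_def)
  then obtain g where "range g \<subseteq> S" "flinear g" "\<forall>v\<in>S. g v = v" by auto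
  then show ?thesis by (intro that[of g]) auto
qed

lemma retraction_exists:
  assumes "flinear f" "fds V" "\<And>v. v \<in> V \<Longrightarrow> f v = 0 \<Longrightarrow> v = 0"
  obtains g where "flinear g" "\<And>v. g v \<in> V" "\<And>v. v \<in> V \<Longrightarrow> g (f v) = v"
proof -
  have V: "fs.subspace V" by (rule fds_subspace[OF assms(2)])
  have "inj_on f V" by (simp add: fp.linear_inj_on_iff_eq_0[OF assms(1) V] assms(3))
  then obtain g where "range g \<subseteq> V" "flinear g" "\<forall>v\<in>V. g (f v) = v"
    using fp.linear_exists_left_inverse_on[OF assms(1) V] by auto
  then show ?thesis by (intro that[of g]) auto
qed

lemma section_exists:
  assumes "flinear f" "fds V"
  obtains g where "flinear g" "\<And>w. g w \<in> V" "\<And>v. v \<in> V \<Longrightarrow> f (g (f v)) = f v"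
proof -
  have V: "fs.subspace V" by (rule fds_subspace[OF assms(2)])
  obtain g where "range g \<subseteq> V" "flinear g" "\<forall>w\<in>f ` V. f (g w) = w"
    using fp.linear_exists_right_inverse_on[OF assms(1) V] by auto
  then show ?thesis by (intro that[of g]) auto
qed

lemma dim_direct_sum_le:
  assumes U: "fds U" and S: "fs.subspace S" "S \<subseteq> U" and T: "fs.subspace T" "T \<subseteq> U"
    and ST: "S \<inter> T \<subseteq> {0}"
  shows "fs.dim S + fs.dim T \<le> fs.dim U"
proof -
  obtain g where g: "flinear g" "\<And>v. g v \<in> S" "\<And>v. v \<in> S \<Longrightarrow> g v = v"
    using projection_exists[OF S(1)] by blast
  let ?f = "\<lambda>v. v - g v"
  have f: "flinear ?f" by (intro flinear_ops g)
  have "S \<subseteq> {u \<in> U. ?f u = 0}" using g S by auto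
  then have "fs.dim S \<le> fs.dim {u \<in> U. ?f u = 0}" by (rule dim_mono_fds[OF fds_kernel[OF U f]])
  moreover have "fs.dim (?f ` T) = fs.dim T"
  proof (rule dim_image_inj[OF fds_subset[OF U T] f])
    fix u assume "u \<in> T" "u - g u = 0"
    then show "u = 0" using g(2)[of u] ST by auto
  qed
  moreover have "fs.dim (?f ` T) \<le> fs.dim (?f ` U)"
    by (rule dim_mono_fds[OF fds_image[OF U f]]) (use T in auto)
  ultimately show ?thesis using rank_nullity[OF U f] by simp
qed

text \<open>
  A basis \<open>bs\<close> with its coordinate functionals \<open>co\<close>. The functionals are additive on the whole function
  space, because they are composed with a projection to \<open>U\<close>.
\<close>

lemma chart_exists:
  fixes U :: "('i \<Rightarrow> 'k::field) set"
  assumes U: "fds U"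
  obtains bs :: "nat \<Rightarrow> 'i \<Rightarrow> 'k" and co :: "nat \<Rightarrow> ('i \<Rightarrow> 'k) \<Rightarrow> 'k"
  where "\<And>j. j < fs.dim U \<Longrightarrow> bs j \<in> U"
    "\<And>j u v. co j (u + v) = co j u + co j v" "\<And>j c v. co j (fscale c v) = c * co j v"
    "\<And>u. u \<in> U \<Longrightarrow> u = (\<Sum>j<fs.dim U. fscale (co j u) (bs j))"
    "\<And>i j. i < fs.dim U \<Longrightarrow> j < fs.dim U \<Longrightarrow> co i (bs j) = (if i = j then 1 else 0)"
proof -
  obtain B where B: "finite B" "B \<subseteq> U" "fs.independent B" "fs.span B = U" "card B = fs.dim U"
    using fds_basis[OF U] .
  obtain bs where bs: "bij_betw bs {..<fs.dim U} B"
    using ex_bij_betw_nat_finite[OF B(1)] B(5) by (metis atLeast0LessThan)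
  obtain g where g: "flinear g" "\<And>v. g v \<in> U" "\<And>v. v \<in> U \<Longrightarrow> g v = v"
    using projection_exists[OF fds_subspace[OF U]] by blast
  let ?co = "\<lambda>j v. fs.representation B (g v) (bs j)"
  have bsB: "j < fs.dim U \<Longrightarrow> bs j \<in> B" for j using bs by (auto dest: bij_betwE)
  have gs: "g v \<in> fs.span B" for v using g(2) B(4) by simp
  show ?thesis
  proof (rule that[of bs ?co])
    show "bs j \<in> U" if "j < fs.dim U" for j using bsB[OF that] B by auto
    show "?co j (u + v) = ?co j u + ?co j v" for j u v
      by (simp add: flinear_simps[OF g(1)] fs.representation_add[OF B(3) gs gs])
    show "?co j (fscale c v) = c * ?co j v" for j c v
      by (simp add: flinear_simps[OF g(1)] fs.representation_scale[OF B(3) gs])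
    show "u = (\<Sum>j<fs.dim U. fscale (?co j u) (bs j))" if "u \<in> U" for u
    proof -
      have "(\<Sum>j<fs.dim U. fscale (?co j u) (bs j)) = (\<Sum>b\<in>B. fscale (fs.representation B u b) b)"
        using sum.reindex_bij_betw[OF bs, of "\<lambda>b. fscale (fs.representation B u b) b"] g(3)[OF that]
        by simp
      also have "\<dots> = u"
        by (rule fs.sum_representation_eq[OF B(3) _ B(1)]) (use that B in auto)
      finally show ?thesis by simp
    qed
    show "?co i (bs j) = (if i = j then 1 else 0)" if "i < fs.dim U" "j < fs.dim U" for i j
    proof -
      have "g (bs j) = bs j" using g(3) bsB[OF that(2)] B by auto
      then have "?co i (bs j) = (if bs i = bs j then 1 else 0)"
        using fs.representation_basis[OF B(3) bsB[OF that(2)]] by auto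
      moreover have "bs i = bs j \<longleftrightarrow> i = j"
        using bs that unfolding bij_betw_def by (auto dest: inj_onD)
      ultimately show ?thesis by simp
    qed
  qed
qed

definition fsupp :: "'i set \<Rightarrow> ('i \<Rightarrow> 'k::field) set" where
  "fsupp P = {c. \<forall>p. p \<notin> P \<longrightarrow> c p = 0}"

definition unitf :: "'i \<Rightarrow> 'i \<Rightarrow> 'k::field" where
  "unitf p = (\<lambda>q. if q = p then 1 else 0)"

lemma sum_apply: "(\<Sum>a\<in>A. f a) x = (\<Sum>a\<in>A. f a x)"
  by (induction A rule: infinite_finite_induct) (auto simp: pointwise)

lemma fsupp_expand:
  assumes "finite P" "c \<in> fsupp P" shows "c = (\<Sum>p\<in>P. fscale (c p) (unitf p))"
proof
  fix q
  have "(\<Sum>p\<in>P. fscale (c p) (unitf p)) q = (\<Sum>p\<in>P. if q = p then c q else 0)"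
    by (auto simp: sum_apply unitf_def pointwise intro!: sum.cong)
  also have "\<dots> = c q" using assms by (auto simp: fsupp_def)
  finally show "c q = (\<Sum>p\<in>P. fscale (c p) (unitf p)) q" ..
qed

lemma fsupp_fds_dim:
  assumes P: "finite P"
  shows "fds (fsupp P :: ('i \<Rightarrow> 'k::field) set)" "fs.dim (fsupp P :: ('i \<Rightarrow> 'k) set) = card P"
proof -
  let ?U = "unitf ` P :: ('i \<Rightarrow> 'k) set"
  have sub: "fs.subspace (fsupp P :: ('i \<Rightarrow> 'k) set)"
    by (rule fs.subspaceI) (auto simp: fsupp_def pointwise)
  have mem: "?U \<subseteq> fsupp P" by (auto simp: fsupp_def unitf_def)
  have inj: "inj_on (unitf :: 'i \<Rightarrow> 'i \<Rightarrow> 'k) P"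
  proof (rule inj_onI)
    fix p q assume "(unitf p :: 'i \<Rightarrow> 'k) = unitf q"
    then have "(unitf p :: 'i \<Rightarrow> 'k) p = unitf q p" by simp
    then show "p = q" by (simp add: unitf_def split: if_splits)
  qed
  have sp: "fsupp P \<subseteq> fs.span ?U"
  proof
    fix c :: "'i \<Rightarrow> 'k" assume "c \<in> fsupp P"
    then have "c = (\<Sum>p\<in>P. fscale (c p) (unitf p))" by (rule fsupp_expand[OF P])
    also have "\<dots> \<in> fs.span ?U"
      by (intro fs.span_sum fs.span_scale fs.span_base) auto
    finally show "c \<in> fs.span ?U" .
  qed
  have ind: "fs.independent ?U"
  proof (rule fs.independent_if_scalars_zero)
    show "finite ?U" using P by simp
    fix f :: "('i \<Rightarrow> 'k) \<Rightarrow> 'k" and x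
    assume s: "(\<Sum>x\<in>?U. fscale (f x) x) = 0" and "x \<in> ?U"
    then obtain p where p: "p \<in> P" "x = unitf p" by auto
    have "(\<Sum>x\<in>?U. fscale (f x) x) = (\<Sum>p\<in>P. fscale (f (unitf p)) (unitf p))"
      by (simp add: sum.reindex[OF inj])
    then have "0 = (\<Sum>q\<in>P. fscale (f (unitf q)) (unitf q)) p" using s by (simp add: pointwise)
    also have "\<dots> = (\<Sum>q\<in>P. if p = q then f (unitf p) else 0)"
      by (auto simp: sum_apply unitf_def pointwise intro!: sum.cong)
    also have "\<dots> = f x" using p P by simp
    finally show "f x = 0" by simp
  qed
  show "fds (fsupp P :: ('i \<Rightarrow> 'k) set)"
    unfolding fds_def using sub sp P by (intro conjI exI[of _ ?U]) simp_all
  show "fs.dim (fsupp P :: ('i \<Rightarrow> 'k) set) = card P"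
    using fs.basis_card_eq_dim[OF mem sp ind] card_image[OF inj] by simp
qed

section \<open>Representations as operators on subspaces\<close>

text \<open>
  A representation is given by a subspace \<open>V x\<close> at every vertex and an operator \<open>T a\<close> for every arrow,
  defined on the whole function space and respecting the subspaces. A subrepresentation keeps the
  operators and shrinks the spaces. The complex
  \<open>\<Prod>\<^sub>x Hom(V x, W x) \<rightarrow> \<Prod>\<^sub>a Hom(V (tail a), W (head a))\<close> has \<open>Hom(V, W)\<close> as kernel and \<open>Ext(V, W)\<close> as
  cokernel. Its terms are \<open>ffam\<close> and \<open>cochain\<close>, and \<open>coboundary\<close> is the graph of its differential.
\<close>

locale quiver = fin_digraph Q for Q :: "('v, 'a) pre_digraph"
begin

definition frep :: "('v \<Rightarrow> ('i \<Rightarrow> 'k::field) set) \<Rightarrow> ('a \<Rightarrow> ('i \<Rightarrow> 'k) \<Rightarrow> 'i \<Rightarrow> 'k) \<Rightarrow> bool" where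
  "frep V T \<longleftrightarrow> (\<forall>x \<in> verts Q. fds (V x)) \<and>
     (\<forall>a \<in> arcs Q. flinear (T a) \<and> (\<forall>v \<in> V (tail Q a). T a v \<in> V (head Q a)))"

definition ffam :: "('v \<Rightarrow> ('i \<Rightarrow> 'k::field) set) \<Rightarrow> ('v \<Rightarrow> ('j \<Rightarrow> 'k) set) \<Rightarrow>
    ('v \<Rightarrow> ('i \<Rightarrow> 'k) \<Rightarrow> 'j \<Rightarrow> 'k) \<Rightarrow> bool" where
  "ffam V W \<phi> \<longleftrightarrow> (\<forall>x \<in> verts Q. flinear (\<phi> x) \<and> (\<forall>v \<in> V x. \<phi> x v \<in> W x))"

definition cochain :: "('v \<Rightarrow> ('i \<Rightarrow> 'k::field) set) \<Rightarrow> ('v \<Rightarrow> ('j \<Rightarrow> 'k) set) \<Rightarrow>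
    ('a \<Rightarrow> ('i \<Rightarrow> 'k) \<Rightarrow> 'j \<Rightarrow> 'k) \<Rightarrow> bool" where
  "cochain V W c \<longleftrightarrow> (\<forall>a \<in> arcs Q. flinear (c a) \<and> (\<forall>v \<in> V (tail Q a). c a v \<in> W (head Q a)))"

definition coboundary :: "('v \<Rightarrow> ('i \<Rightarrow> 'k::field) set) \<Rightarrow> ('a \<Rightarrow> ('i \<Rightarrow> 'k) \<Rightarrow> 'i \<Rightarrow> 'k) \<Rightarrow>
    ('a \<Rightarrow> ('j \<Rightarrow> 'k) \<Rightarrow> 'j \<Rightarrow> 'k) \<Rightarrow> ('v \<Rightarrow> ('i \<Rightarrow> 'k) \<Rightarrow> 'j \<Rightarrow> 'k) \<Rightarrow>
    ('a \<Rightarrow> ('i \<Rightarrow> 'k) \<Rightarrow> 'j \<Rightarrow> 'k) \<Rightarrow> bool" where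
  "coboundary V T T' \<psi> c \<longleftrightarrow> (\<forall>a \<in> arcs Q. \<forall>v \<in> V (tail Q a).
     \<psi> (head Q a) (T a v) - T' a (\<psi> (tail Q a) v) = c a v)"

definition fhom :: "('v \<Rightarrow> ('i \<Rightarrow> 'k::field) set) \<Rightarrow> ('a \<Rightarrow> ('i \<Rightarrow> 'k) \<Rightarrow> 'i \<Rightarrow> 'k) \<Rightarrow>
    ('v \<Rightarrow> ('j \<Rightarrow> 'k) set) \<Rightarrow> ('a \<Rightarrow> ('j \<Rightarrow> 'k) \<Rightarrow> 'j \<Rightarrow> 'k) \<Rightarrow>
    ('v \<Rightarrow> ('i \<Rightarrow> 'k) \<Rightarrow> 'j \<Rightarrow> 'k) \<Rightarrow> bool" where
  "fhom V T W T' \<phi> \<longleftrightarrow> ffam V W \<phi> \<and>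
     (\<forall>a \<in> arcs Q. \<forall>v \<in> V (tail Q a). \<phi> (head Q a) (T a v) = T' a (\<phi> (tail Q a) v))"

definition fzero :: "('v \<Rightarrow> ('i \<Rightarrow> 'k::field) set) \<Rightarrow> ('v \<Rightarrow> ('i \<Rightarrow> 'k) \<Rightarrow> 'j \<Rightarrow> 'k) \<Rightarrow> bool" where
  "fzero V \<phi> \<longleftrightarrow> (\<forall>x \<in> verts Q. \<forall>v \<in> V x. \<phi> x v = 0)"

definition finj :: "('v \<Rightarrow> ('i \<Rightarrow> 'k::field) set) \<Rightarrow> ('v \<Rightarrow> ('i \<Rightarrow> 'k) \<Rightarrow> 'j \<Rightarrow> 'k) \<Rightarrow> bool" where
  "finj V \<phi> \<longleftrightarrow> (\<forall>x \<in> verts Q. \<forall>v \<in> V x. \<phi> x v = 0 \<longrightarrow> v = 0)"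

definition ext_vanishes :: "('v \<Rightarrow> ('i \<Rightarrow> 'k::field) set) \<Rightarrow> ('a \<Rightarrow> ('i \<Rightarrow> 'k) \<Rightarrow> 'i \<Rightarrow> 'k) \<Rightarrow>
    ('v \<Rightarrow> ('j \<Rightarrow> 'k) set) \<Rightarrow> ('a \<Rightarrow> ('j \<Rightarrow> 'k) \<Rightarrow> 'j \<Rightarrow> 'k) \<Rightarrow> bool" where
  "ext_vanishes V T W T' \<longleftrightarrow> (\<forall>c. cochain V W c \<longrightarrow> (\<exists>\<psi>. ffam V W \<psi> \<and> coboundary V T T' \<psi> c))"

text \<open>
  Injectivity rather than invertibility: for finite-dimensional spaces they agree, and this form
  needs no inverse family. The zero representation counts as a brick.
\<close>

definition brick :: "('v \<Rightarrow> ('i \<Rightarrow> 'k::field) set) \<Rightarrow> ('a \<Rightarrow> ('i \<Rightarrow> 'k) \<Rightarrow> 'i \<Rightarrow> 'k) \<Rightarrow> bool" where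
  "brick V T \<longleftrightarrow> (\<forall>\<phi>. fhom V T V T \<phi> \<longrightarrow> fzero V \<phi> \<or> finj V \<phi>)"

definition euler :: "('v \<Rightarrow> nat) \<Rightarrow> ('v \<Rightarrow> nat) \<Rightarrow> int" where
  "euler m n = (\<Sum>x\<in>verts Q. int (m x) * int (n x)) - (\<Sum>a\<in>arcs Q. int (m (tail Q a)) * int (n (head Q a)))"

abbreviation fdimv :: "('v \<Rightarrow> ('i \<Rightarrow> 'k::field) set) \<Rightarrow> 'v \<Rightarrow> nat" where
  "fdimv V \<equiv> \<lambda>x. fs.dim (V x)"

lemma frepD:
  assumes "frep V T"
  shows "x \<in> verts Q \<Longrightarrow> fds (V x)" "a \<in> arcs Q \<Longrightarrow> flinear (T a)"
    "a \<in> arcs Q \<Longrightarrow> v \<in> V (tail Q a) \<Longrightarrow> T a v \<in> V (head Q a)"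
  using assms by (auto simp: frep_def)

lemma ffamD:
  assumes "ffam V W \<phi>"
  shows "x \<in> verts Q \<Longrightarrow> flinear (\<phi> x)" "x \<in> verts Q \<Longrightarrow> v \<in> V x \<Longrightarrow> \<phi> x v \<in> W x"
  using assms by (auto simp: ffam_def)

lemma fhomD:
  assumes "fhom V T W T' \<phi>"
  shows "ffam V W \<phi>" "x \<in> verts Q \<Longrightarrow> flinear (\<phi> x)" "x \<in> verts Q \<Longrightarrow> v \<in> V x \<Longrightarrow> \<phi> x v \<in> W x"
    "a \<in> arcs Q \<Longrightarrow> v \<in> V (tail Q a) \<Longrightarrow> \<phi> (head Q a) (T a v) = T' a (\<phi> (tail Q a) v)"
  using assms by (auto simp: fhom_def ffam_def)

end

definition is_chart :: "('i \<Rightarrow> 'k::field) set \<Rightarrow> (nat \<Rightarrow> 'i \<Rightarrow> 'k) \<Rightarrow> (nat \<Rightarrow> ('i \<Rightarrow> 'k) \<Rightarrow> 'k) \<Rightarrow> bool" where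
  "is_chart U bs co \<longleftrightarrow> (\<forall>j < fs.dim U. bs j \<in> U) \<and>
    (\<forall>j u v. co j (u + v) = co j u + co j v) \<and> (\<forall>j c v. co j (fscale c v) = c * co j v) \<and>
    (\<forall>u \<in> U. u = (\<Sum>j<fs.dim U. fscale (co j u) (bs j))) \<and>
    (\<forall>i < fs.dim U. \<forall>j < fs.dim U. co i (bs j) = (if i = j then 1 else 0))"

lemma is_chart_exists: "fds U \<Longrightarrow> \<exists>bs co. is_chart U bs co"
  by (erule chart_exists) (unfold is_chart_def, blast)

lemma is_chartD:
  assumes "is_chart U bs co"
  shows "j < fs.dim U \<Longrightarrow> bs j \<in> U" "co j (u + v) = co j u + co j v" "co j (fscale c v) = c * co j v"
    "u \<in> U \<Longrightarrow> u = (\<Sum>j<fs.dim U. fscale (co j u) (bs j))"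
    "i < fs.dim U \<Longrightarrow> j < fs.dim U \<Longrightarrow> co i (bs j) = (if i = j then 1 else 0)"
  using assms unfolding is_chart_def by blast+

lemma is_chart_0: assumes "is_chart U bs co" shows "co j 0 = 0"
  using is_chartD(3)[OF assms, of j 0 0] by simp

lemma is_chart_diff: assumes "is_chart U bs co" shows "co j (u - v) = co j u - co j v"
proof -
  have "co j ((u - v) + v) = co j (u - v) + co j v" by (rule is_chartD(2)[OF assms])
  then show ?thesis by simp
qed

lemma is_chart_sum: assumes "is_chart U bs co" shows "co j (sum g A) = (\<Sum>a\<in>A. co j (g a))"
  by (induction A rule: infinite_finite_induct) (simp_all add: is_chart_0[OF assms] is_chartD(2)[OF assms])

definition matmap :: "nat \<Rightarrow> nat \<Rightarrow> (nat \<Rightarrow> ('i \<Rightarrow> 'k) \<Rightarrow> 'k) \<Rightarrow> (nat \<Rightarrow> 'j \<Rightarrow> 'k) \<Rightarrow>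
    (nat \<Rightarrow> nat \<Rightarrow> 'k::field) \<Rightarrow> ('i \<Rightarrow> 'k) \<Rightarrow> 'j \<Rightarrow> 'k" where
  "matmap M N co bs f v = (\<Sum>j<N. \<Sum>i<M. fscale (f i j * co j v) (bs i))"

lemma matmap_linear:
  assumes "is_chart U bU cU"
  shows "flinear (matmap M N cU bW f)"
  by (rule flinearI)
    (simp_all add: matmap_def is_chartD(2,3)[OF assms] algebra_simps fs.scale_left_distrib
      sum.distrib fs.scale_sum_right)

lemma matmap_add: "matmap M N co bs (\<lambda>i j. f i j + g i j) v = matmap M N co bs f v + matmap M N co bs g v"
  by (simp add: matmap_def algebra_simps fs.scale_left_distrib sum.distrib)

lemma matmap_scale: "matmap M N co bs (\<lambda>i j. r * f i j) v = fscale r (matmap M N co bs f v)"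
  by (simp add: matmap_def fs.scale_sum_right algebra_simps)

lemma matmap_in:
  assumes "fds W" "is_chart W bW cW" shows "matmap (fs.dim W) N co bW f v \<in> W"
  unfolding matmap_def
  by (intro fds_closed(6)[OF assms(1)] fds_closed(5)[OF assms(1)] is_chartD(1)[OF assms(2)]) auto

lemma matmap_entry:
  assumes "is_chart U bU cU" "is_chart W bW cW" "i < fs.dim W" "j < fs.dim U"
  shows "cW i (matmap (fs.dim W) (fs.dim U) cU bW f (bU j)) = f i j"
proof -
  have "cW i (matmap (fs.dim W) (fs.dim U) cU bW f (bU j)) =
      (\<Sum>j'<fs.dim U. \<Sum>i'<fs.dim W. f i' j' * cU j' (bU j) * cW i (bW i'))"
    by (simp add: matmap_def is_chart_sum[OF assms(2)] is_chartD(3)[OF assms(2)])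
  also have "\<dots> = (\<Sum>j'<fs.dim U. \<Sum>i'<fs.dim W. if i = i' then (if j' = j then f i j else 0) else 0)"
    using assms by (intro sum.cong refl) (auto simp: is_chartD(5)[OF assms(1)] is_chartD(5)[OF assms(2)])
  also have "\<dots> = f i j" using assms(3,4) by (simp add: sum.delta)
  finally show ?thesis .
qed

lemma linear_eq_on_chart:
  assumes U: "is_chart U bU cU" and f: "flinear f" and g: "flinear g"
    and eq: "\<And>j. j < fs.dim U \<Longrightarrow> f (bU j) = g (bU j)" and u: "u \<in> U"
  shows "f u = g u"
proof -
  have "f (\<Sum>j<fs.dim U. fscale (cU j u) (bU j)) = g (\<Sum>j<fs.dim U. fscale (cU j u) (bU j))"
    by (simp only: flinear_simps[OF f] flinear_simps[OF g]) (simp add: eq)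
  then show ?thesis using is_chartD(4)[OF U u] by simp
qed

lemma chart_eqI:
  assumes W: "is_chart W bW cW" and "u \<in> W" "v \<in> W" "\<And>i. i < fs.dim W \<Longrightarrow> cW i u = cW i v"
  shows "u = v"
proof -
  have "(\<Sum>j<fs.dim W. fscale (cW j u) (bW j)) = (\<Sum>j<fs.dim W. fscale (cW j v) (bW j))"
    using assms(4) by simp
  then show ?thesis using is_chartD(4)[OF W] assms(2,3) by metis
qed

lemma linear_eq_on_charts:
  assumes U: "is_chart U bU cU" and W: "is_chart W bW cW" and f: "flinear f" and g: "flinear g"
    and fW: "\<And>u. u \<in> U \<Longrightarrow> f u \<in> W" and gW: "\<And>u. u \<in> U \<Longrightarrow> g u \<in> W"
    and eq: "\<And>i j. i < fs.dim W \<Longrightarrow> j < fs.dim U \<Longrightarrow> cW i (f (bU j)) = cW i (g (bU j))" and u: "u \<in> U"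
  shows "f u = g u"
proof (rule linear_eq_on_chart[OF U f g _ u])
  fix j assume j: "j < fs.dim U"
  show "f (bU j) = g (bU j)"
    by (rule chart_eqI[OF W]) (use j fW gW eq is_chartD(1)[OF U] in auto)
qed

section \<open>The Euler form\<close>

text \<open>
  Bases of all the spaces turn the two terms of the complex into the coordinate spaces on the finite
  index sets \<open>P\<close> and \<open>R\<close>, and its differential into the linear map \<open>df\<close>. The Euler form is then
  the difference of the two dimensions, and rank and nullity give \<open>dim Hom - dim Ext\<close>. The maps \<open>ev\<close>
  and \<open>evR\<close> recover families and cochains from their matrix entries.
\<close>

locale rep_pair = quiver Q for Q :: "('v, 'a) pre_digraph" +
  fixes V :: "'v \<Rightarrow> ('i \<Rightarrow> 'k::field) set" and T :: "'a \<Rightarrow> ('i \<Rightarrow> 'k) \<Rightarrow> 'i \<Rightarrow> 'k"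
    and W :: "'v \<Rightarrow> ('j \<Rightarrow> 'k) set" and T' :: "'a \<Rightarrow> ('j \<Rightarrow> 'k) \<Rightarrow> 'j \<Rightarrow> 'k"
    and bV cV bW cW
  assumes V: "frep V T" and W: "frep W T'"
    and chV: "x \<in> verts Q \<Longrightarrow> is_chart (V x) (bV x) (cV x)"
    and chW: "x \<in> verts Q \<Longrightarrow> is_chart (W x) (bW x) (cW x)"
begin

definition P :: "('v \<times> nat \<times> nat) set" where
  "P = (SIGMA x:verts Q. {..<fs.dim (W x)} \<times> {..<fs.dim (V x)})"

definition R :: "('a \<times> nat \<times> nat) set" where
  "R = (SIGMA a:arcs Q. {..<fs.dim (W (head Q a))} \<times> {..<fs.dim (V (tail Q a))})"

definition ev :: "('v \<times> nat \<times> nat \<Rightarrow> 'k) \<Rightarrow> 'v \<Rightarrow> ('i \<Rightarrow> 'k) \<Rightarrow> 'j \<Rightarrow> 'k" where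
  "ev c x = matmap (fs.dim (W x)) (fs.dim (V x)) (cV x) (bW x) (\<lambda>i j. c (x, i, j))"

definition evR :: "('a \<times> nat \<times> nat \<Rightarrow> 'k) \<Rightarrow> 'a \<Rightarrow> ('i \<Rightarrow> 'k) \<Rightarrow> 'j \<Rightarrow> 'k" where
  "evR d a = matmap (fs.dim (W (head Q a))) (fs.dim (V (tail Q a))) (cV (tail Q a)) (bW (head Q a))
     (\<lambda>i j. d (a, i, j))"

definition df :: "('v \<times> nat \<times> nat \<Rightarrow> 'k) \<Rightarrow> 'a \<times> nat \<times> nat \<Rightarrow> 'k" where
  "df c = (\<lambda>(a, i, j). if (a, i, j) \<in> R then cW (head Q a) i
     (ev c (head Q a) (T a (bV (tail Q a) j)) - T' a (ev c (tail Q a) (bV (tail Q a) j))) else 0)"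

lemma ev_ffam: "ffam V W (ev c)"
  unfolding ffam_def ev_def
  by (auto intro: matmap_linear[OF chV] matmap_in[OF frepD(1)[OF W] chW])

lemma evR_cochain: "cochain V W (evR d)"
  unfolding cochain_def evR_def
  by (auto intro: matmap_linear[OF chV[OF tail_in_verts]]
      matmap_in[OF frepD(1)[OF W head_in_verts] chW[OF head_in_verts]])

lemma ev_add: "ev (c + d) x v = ev c x v + ev d x v"
  by (simp add: ev_def matmap_add pointwise(1))

lemma ev_scale: "ev (fscale r c) x v = fscale r (ev c x v)"
  by (simp add: ev_def matmap_scale fscale_apply[of r c])

lemma evR_scale: "evR (fscale r c) x v = fscale r (evR c x v)"
  by (simp add: evR_def matmap_scale fscale_apply[of r c])

lemma evR_0: "evR 0 a v = 0"
  using evR_scale[of 0 0 a v] by simp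

lemma df_linear: "flinear df"
proof (rule flinearI)
  fix c d
  show "df (c + d) = df c + df d"
  proof
    fix p show "df (c + d) p = (df c + df d) p"
      by (cases p) (auto simp: df_def pointwise(1) R_def ev_add flinear_simps[OF frepD(2)[OF W]]
          is_chart_diff[OF chW[OF head_in_verts]] is_chartD(2)[OF chW[OF head_in_verts]])
  qed
next
  fix r c
  show "df (fscale r c) = fscale r (df c)"
  proof
    fix p show "df (fscale r c) p = fscale r (df c) p"
      by (cases p) (auto simp: df_def fscale_apply[of r "\<lambda>(a, i, j). _ a i j"] R_def ev_scale
          flinear_simps[OF frepD(2)[OF W]] is_chart_diff[OF chW[OF head_in_verts]]
          is_chartD(3)[OF chW[OF head_in_verts]] algebra_simps)
  qed
qed

lemma df_supp: "df c \<in> fsupp R"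
  by (auto simp: fsupp_def df_def)

lemma df_iff:
  assumes d: "d \<in> fsupp R"
  shows "df c = d \<longleftrightarrow> coboundary V T T' (ev c) (evR d)"
proof
  assume eq: "df c = d"
  show "coboundary V T T' (ev c) (evR d)"
    unfolding coboundary_def
  proof (intro ballI)
    fix a v assume a: "a \<in> arcs Q" and v: "v \<in> V (tail Q a)"
    note h = head_in_verts[OF a] and t = tail_in_verts[OF a]
    let ?f = "\<lambda>v. ev c (head Q a) (T a v) - T' a (ev c (tail Q a) v)"
    show "?f v = evR d a v"
    proof (rule linear_eq_on_charts[OF chV[OF t] chW[OF h] _ _ _ _ _ v])
      show "flinear ?f"
        by (intro flinear_ops(4) flinear_compose[OF frepD(2)[OF V a]] flinear_compose[OF _ frepD(2)[OF W a]]
            ffamD(1)[OF ev_ffam] h t)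
      show "flinear (evR d a)" using evR_cochain a by (simp add: cochain_def)
      show "?f u \<in> W (head Q a)" if "u \<in> V (tail Q a)" for u
        by (intro fds_closed(3)[OF frepD(1)[OF W h]] ffamD(2)[OF ev_ffam] frepD(3)[OF V]
            frepD(3)[OF W] a h t that)
      show "evR d a u \<in> W (head Q a)" if "u \<in> V (tail Q a)" for u
        using evR_cochain a that by (simp add: cochain_def)
      show "cW (head Q a) i (?f (bV (tail Q a) j)) = cW (head Q a) i (evR d a (bV (tail Q a) j))"
        if "i < fs.dim (W (head Q a))" "j < fs.dim (V (tail Q a))" for i j
      proof -
        have "cW (head Q a) i (?f (bV (tail Q a) j)) = df c (a, i, j)"
          using that a by (simp add: df_def R_def)
        then show ?thesis
          unfolding evR_def by (simp add: eq matmap_entry[OF chV[OF t] chW[OF h] that])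
      qed
    qed
  qed
next
  assume cb: "coboundary V T T' (ev c) (evR d)"
  show "df c = d"
  proof
    fix p :: "'a \<times> nat \<times> nat"
    obtain a i j where p: "p = (a, i, j)" by (cases p)
    show "df c p = d p"
    proof (cases "p \<in> R")
      case False
      then show ?thesis using d p by (simp add: df_def fsupp_def)
    next
      case True
      then have a: "a \<in> arcs Q" and ij: "i < fs.dim (W (head Q a))" "j < fs.dim (V (tail Q a))"
        using p by (auto simp: R_def)
      note h = head_in_verts[OF a] and t = tail_in_verts[OF a]
      have "df c p = cW (head Q a) i (evR d a (bV (tail Q a) j))"
        using cb a is_chartD(1)[OF chV[OF t] ij(2)] True p by (simp add: df_def coboundary_def)
      then show ?thesis
        unfolding evR_def p by (simp add: matmap_entry[OF chV[OF t] chW[OF h] ij])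
    qed
  qed
qed

lemma ev_repr:
  assumes "ffam V W \<phi>"
  obtains c where "c \<in> fsupp P" "\<And>x v. x \<in> verts Q \<Longrightarrow> v \<in> V x \<Longrightarrow> ev c x v = \<phi> x v"
proof
  let ?c = "\<lambda>(x, i, j). if (x, i, j) \<in> P then cW x i (\<phi> x (bV x j)) else 0"
  show "?c \<in> fsupp P" by (auto simp: fsupp_def)
  fix x v assume x: "x \<in> verts Q" and v: "v \<in> V x"
  show "ev ?c x v = \<phi> x v"
    by (rule linear_eq_on_charts[OF chV[OF x] chW[OF x] _ _ _ _ _ v])
      (use x in \<open>auto simp: ffamD[OF ev_ffam] ffamD[OF assms] ev_def matmap_entry[OF chV[OF x] chW[OF x]] P_def
        intro: matmap_linear[OF chV[OF x]] matmap_in[OF frepD(1)[OF W x] chW[OF x]]\<close>)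
qed

lemma evR_repr:
  assumes "cochain V W c"
  obtains d where "d \<in> fsupp R" "\<And>a v. a \<in> arcs Q \<Longrightarrow> v \<in> V (tail Q a) \<Longrightarrow> evR d a v = c a v"
proof
  let ?d = "\<lambda>(a, i, j). if (a, i, j) \<in> R then cW (head Q a) i (c a (bV (tail Q a) j)) else 0"
  show "?d \<in> fsupp R" by (auto simp: fsupp_def)
  fix a v assume a: "a \<in> arcs Q" and v: "v \<in> V (tail Q a)"
  note h = head_in_verts[OF a] and t = tail_in_verts[OF a]
  show "evR ?d a v = c a v"
    by (rule linear_eq_on_charts[OF chV[OF t] chW[OF h] _ _ _ _ _ v])
      (use a assms in \<open>auto simp: cochain_def evR_def matmap_entry[OF chV[OF t] chW[OF h]] R_def
        intro: matmap_linear[OF chV[OF t]] matmap_in[OF frepD(1)[OF W h] chW[OF h]]\<close>)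
qed

lemma ev_inj:
  assumes c: "c \<in> fsupp P" and z: "fzero V (ev c)"
  shows "c = 0"
proof
  fix p :: "'v \<times> nat \<times> nat"
  obtain x i j where p: "p = (x, i, j)" by (cases p)
  show "c p = 0 p"
  proof (cases "p \<in> P")
    case True
    then have x: "x \<in> verts Q" and ij: "i < fs.dim (W x)" "j < fs.dim (V x)" by (auto simp: P_def p)
    have "c p = cW x i (ev c x (bV x j))"
      unfolding ev_def p by (simp add: matmap_entry[OF chV[OF x] chW[OF x] ij])
    also have "\<dots> = 0"
      using z x is_chartD(1)[OF chV[OF x] ij(2)] by (simp add: fzero_def is_chart_0[OF chW[OF x]])
    finally show ?thesis by (simp add: pointwise)
  next
    case False
    then have "c p = 0" using c unfolding fsupp_def by blast
    then show ?thesis by (simp add: pointwise)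
  qed
qed

lemma finite_P: "finite P" and finite_R: "finite R"
  by (simp_all add: P_def R_def)

lemma card_P_R: "int (card P) - int (card R) = euler (fdimv V) (fdimv W)"
  unfolding P_def R_def euler_def by (simp add: card_SigmaI mult.commute)

definition H :: "('v \<times> nat \<times> nat \<Rightarrow> 'k) set" where
  "H = {c \<in> fsupp P. df c = 0}"

lemma H_iff: "c \<in> H \<longleftrightarrow> c \<in> fsupp P \<and> fhom V T W T' (ev c)"
proof -
  have "0 \<in> fsupp R" by (simp add: fsupp_def pointwise)
  then have "df c = 0 \<longleftrightarrow> coboundary V T T' (ev c) (evR 0)" by (rule df_iff)
  also have "\<dots> \<longleftrightarrow> fhom V T W T' (ev c)"
    using ev_ffam by (auto simp: coboundary_def fhom_def evR_0)
  finally show ?thesis by (auto simp: H_def)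
qed

lemma fds_H: "fds H"
  unfolding H_def by (rule fds_kernel[OF fsupp_fds_dim(1)[OF finite_P] df_linear])

lemma hom_repr:
  assumes "fhom V T W T' \<phi>"
  obtains c where "c \<in> H" "\<And>x v. x \<in> verts Q \<Longrightarrow> v \<in> V x \<Longrightarrow> ev c x v = \<phi> x v"
proof -
  obtain c where c: "c \<in> fsupp P" "\<And>x v. x \<in> verts Q \<Longrightarrow> v \<in> V x \<Longrightarrow> ev c x v = \<phi> x v"
    using ev_repr[OF fhomD(1)[OF assms]] by blast
  have "fhom V T W T' (ev c)"
    unfolding fhom_def
  proof (intro conjI ballI)
    show "ffam V W (ev c)" by (rule ev_ffam)
    fix a v assume "a \<in> arcs Q" "v \<in> V (tail Q a)"
    then show "ev c (head Q a) (T a v) = T' a (ev c (tail Q a) v)"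
      using c(2) fhomD(4)[OF assms] frepD(3)[OF V] by simp
  qed
  then show ?thesis using c that by (simp add: H_iff)
qed

definition im :: "('a \<times> nat \<times> nat \<Rightarrow> 'k) set" where
  "im = df ` fsupp P"

lemma im_sub: "im \<subseteq> fsupp R" "fs.subspace im"
  using df_supp fds_image[OF fsupp_fds_dim(1)[OF finite_P] df_linear] by (auto simp: im_def fds_def)

lemma dim_im_le: "fs.dim im \<le> card R"
  using dim_mono_fds[OF fsupp_fds_dim(1)[OF finite_R] im_sub(1)]
    fsupp_fds_dim(2)[OF finite_R, where 'k = 'k] by simp

lemma dim_sum: "card P = fs.dim H + fs.dim im"
  using rank_nullity[OF fsupp_fds_dim(1)[OF finite_P] df_linear] fsupp_fds_dim(2)[OF finite_P, where 'k = 'k]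
  by (simp add: H_def im_def)

text \<open>
  The term subtracted is the codimension of the coboundaries, the dimension of \<open>Ext(V, W)\<close>.
\<close>

lemma euler_eq: "int (fs.dim H) - int (card R - fs.dim im) = euler (fdimv V) (fdimv W)"
  using card_P_R dim_sum dim_im_le by simp

lemma mem_im_iff:
  assumes d: "d \<in> fsupp R"
  shows "d \<in> im \<longleftrightarrow> (\<exists>\<psi>. ffam V W \<psi> \<and> coboundary V T T' \<psi> (evR d))"
proof
  assume "d \<in> im"
  then obtain c where "d = df c" by (auto simp: im_def)
  then show "\<exists>\<psi>. ffam V W \<psi> \<and> coboundary V T T' \<psi> (evR d)" using df_iff[OF d] ev_ffam by blast
next
  assume "\<exists>\<psi>. ffam V W \<psi> \<and> coboundary V T T' \<psi> (evR d)"
  then obtain \<psi> where psi: "ffam V W \<psi>" "coboundary V T T' \<psi> (evR d)" by blast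
  obtain c where c: "c \<in> fsupp P" "\<And>x v. x \<in> verts Q \<Longrightarrow> v \<in> V x \<Longrightarrow> ev c x v = \<psi> x v"
    using ev_repr[OF psi(1)] by blast
  have "coboundary V T T' (ev c) (evR d)"
    using psi(2) c(2) frepD(3)[OF V] by (simp add: coboundary_def)
  then have "df c = d" using df_iff[OF d] by simp
  then show "d \<in> im" using c(1) by (auto simp: im_def)
qed

lemma im_full_iff: "im = fsupp R \<longleftrightarrow> ext_vanishes V T W T'"
proof
  assume full: "im = fsupp R"
  show "ext_vanishes V T W T'"
    unfolding ext_vanishes_def
  proof (intro allI impI)
    fix c assume "cochain V W c"
    then obtain d where d: "d \<in> fsupp R" "\<And>a v. a \<in> arcs Q \<Longrightarrow> v \<in> V (tail Q a) \<Longrightarrow> evR d a v = c a v"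
      using evR_repr by blast
    then obtain \<psi> where "ffam V W \<psi>" "coboundary V T T' \<psi> (evR d)" using full mem_im_iff by blast
    then show "\<exists>\<psi>. ffam V W \<psi> \<and> coboundary V T T' \<psi> c"
      using d(2) by (intro exI[of _ \<psi>]) (simp add: coboundary_def)
  qed
next
  assume ev: "ext_vanishes V T W T'"
  show "im = fsupp R"
  proof
    show "fsupp R \<subseteq> im"
    proof
      fix d :: "'a \<times> nat \<times> nat \<Rightarrow> 'k" assume d: "d \<in> fsupp R"
      then show "d \<in> im" using ev evR_cochain by (simp add: mem_im_iff ext_vanishes_def)
    qed
  qed (rule im_sub)
qed

lemma codim_0_iff: "card R - fs.dim im = 0 \<longleftrightarrow> ext_vanishes V T W T'"
proof -
  note fR = fsupp_fds_dim[OF finite_R, where 'k = 'k]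
  have "card R - fs.dim im = 0 \<longleftrightarrow> im = fsupp R"
    using fds_eqI[OF fR(1) im_sub(2,1)] fR(2) by auto
  then show ?thesis by (simp add: im_full_iff)
qed

lemma hom_0_iff: "fs.dim H = 0 \<longleftrightarrow> (\<forall>\<phi>. fhom V T W T' \<phi> \<longrightarrow> fzero V \<phi>)"
proof
  assume "fs.dim H = 0"
  then have H0: "H = {0}" using fds_dim_0[OF fds_H] by simp
  show "\<forall>\<phi>. fhom V T W T' \<phi> \<longrightarrow> fzero V \<phi>"
  proof (intro allI impI)
    fix \<phi> assume "fhom V T W T' \<phi>"
    then obtain c where c: "c \<in> H" "\<And>x v. x \<in> verts Q \<Longrightarrow> v \<in> V x \<Longrightarrow> ev c x v = \<phi> x v"
      using hom_repr by blast
    have "ev 0 x v = 0" for x v using ev_scale[of 0 0 x v] by simp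
    then show "fzero V \<phi>" using c H0 by (simp add: fzero_def)
  qed
next
  assume z: "\<forall>\<phi>. fhom V T W T' \<phi> \<longrightarrow> fzero V \<phi>"
  have "H \<subseteq> {0}" using z ev_inj by (auto simp: H_iff)
  then have "H = {0}" using fds_closed(1)[OF fds_H] by auto
  then show "fs.dim H = 0" using fds_dim_0[OF fds_H] by simp
qed

text \<open>
  The evaluation at \<open>v\<close> embeds \<open>Hom(V, W)\<close> in \<open>W x\<close>.
\<close>

lemma hom_le_eval:
  assumes x: "x \<in> verts Q" and v: "v \<in> V x"
    and inj: "\<And>\<phi>. fhom V T W T' \<phi> \<Longrightarrow> \<phi> x v = 0 \<Longrightarrow> fzero V \<phi>"
  shows "fs.dim H \<le> fs.dim (W x)"
proof -
  have l: "flinear (\<lambda>c. ev c x v)" by (rule flinearI) (simp_all add: ev_add ev_scale)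
  have "fs.dim ((\<lambda>c. ev c x v) ` H) = fs.dim H"
    by (rule dim_image_inj[OF fds_H l]) (auto simp: H_iff dest: inj intro!: ev_inj)
  moreover have "(\<lambda>c. ev c x v) ` H \<subseteq> W x" using ffamD(2)[OF ev_ffam x v] by auto
  ultimately show ?thesis using dim_mono_fds[OF frepD(1)[OF W x]] by metis
qed

lemma hom_1_scalar:
  assumes "fs.dim H \<le> 1" and p0: "fhom V T W T' \<phi>\<^sub>0" "\<not> fzero V \<phi>\<^sub>0" and p: "fhom V T W T' \<phi>"
  shows "\<exists>r. \<forall>x\<in>verts Q. \<forall>v\<in>V x. \<phi> x v = fscale r (\<phi>\<^sub>0 x v)"
proof -
  obtain c0 where c0: "c0 \<in> H" "\<And>x v. x \<in> verts Q \<Longrightarrow> v \<in> V x \<Longrightarrow> ev c0 x v = \<phi>\<^sub>0 x v"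
    using hom_repr[OF p0(1)] by blast
  obtain c where c: "c \<in> H" "\<And>x v. x \<in> verts Q \<Longrightarrow> v \<in> V x \<Longrightarrow> ev c x v = \<phi> x v"
    using hom_repr[OF p] by blast
  have "ev 0 x v = 0" for x v using ev_scale[of 0 0 x v] by simp
  then have "c0 \<noteq> 0" using p0(2) c0(2) by (force simp: fzero_def)
  then have "fs.independent {c0}" by (simp add: fs.dependent_single)
  then have "fs.dim (fs.span {c0}) = 1" using fs.dim_span_eq_card_independent[of "{c0}"] by (simp del: fs.dim_span)
  moreover have "fs.span {c0} \<subseteq> H" using c0(1) fs.span_minimal[OF _ fds_subspace[OF fds_H]] by auto
  ultimately have "fs.span {c0} = H" using fds_eqI[OF fds_H fs.subspace_span] assms(1) by simp
  then obtain r where "c = fscale r c0" using c(1) by (auto simp: fs.span_singleton)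
  then show ?thesis using c c0 by (intro exI[of _ r]) (metis ev_scale)
qed

end

context quiver
begin

lemma rep_pair_exists:
  assumes "frep V T" "frep W T'"
  obtains bV cV bW cW where "rep_pair Q V T W T' bV cV bW cW"
proof -
  have "\<forall>x\<in>verts Q. \<exists>b. \<exists>c. is_chart (V x) b c"
    using is_chart_exists[OF frepD(1)[OF assms(1)]] by blast
  moreover have "\<forall>x\<in>verts Q. \<exists>b. \<exists>c. is_chart (W x) b c"
    using is_chart_exists[OF frepD(1)[OF assms(2)]] by blast
  ultimately obtain bV cV bW cW where "\<forall>x\<in>verts Q. is_chart (V x) (bV x) (cV x)"
    "\<forall>x\<in>verts Q. is_chart (W x) (bW x) (cW x)" by metis
  then have "rep_pair Q V T W T' bV cV bW cW"
    using assms by unfold_locales auto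
  then show ?thesis by (rule that)
qed

lemma euler_le_0:
  assumes "frep V T" "frep W T'" "\<And>\<phi>. fhom V T W T' \<phi> \<Longrightarrow> fzero V \<phi>"
  shows "euler (fdimv V) (fdimv W) \<le> 0"
    "euler (fdimv V) (fdimv W) \<ge> 0 \<Longrightarrow> ext_vanishes V T W T'"
proof -
  obtain bV cV bW cW where "rep_pair Q V T W T' bV cV bW cW" using rep_pair_exists[OF assms(1,2)] .
  then interpret rep_pair Q V T W T' bV cV bW cW .
  have "fs.dim H = 0" using hom_0_iff assms(3) by blast
  then show "euler (fdimv V) (fdimv W) \<le> 0"
    "euler (fdimv V) (fdimv W) \<ge> 0 \<Longrightarrow> ext_vanishes V T W T'"
    using euler_eq codim_0_iff by auto
qed

text \<open>
  If a homomorphism is determined by its value at \<open>v\<close>, then \<open>dim Hom(V, W) \<le> dim (W x)\<close>. For bricks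
  any nonzero \<open>v\<close> will do.
\<close>

lemma euler_le_eval:
  assumes "frep V T" "frep W T'" "x \<in> verts Q" "v \<in> V x"
    and "\<And>\<phi>. fhom V T W T' \<phi> \<Longrightarrow> \<phi> x v = 0 \<Longrightarrow> fzero V \<phi>"
  shows "euler (fdimv V) (fdimv W) \<le> fs.dim (W x)"
    "euler (fdimv V) (fdimv W) \<ge> fs.dim (W x) \<Longrightarrow> ext_vanishes V T W T'"
    "fs.dim (W x) \<le> 1 \<Longrightarrow> fhom V T W T' \<phi>\<^sub>0 \<Longrightarrow> \<not> fzero V \<phi>\<^sub>0 \<Longrightarrow> fhom V T W T' \<phi> \<Longrightarrow>
      \<exists>r. \<forall>x\<in>verts Q. \<forall>v\<in>V x. \<phi> x v = fscale r (\<phi>\<^sub>0 x v)"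
proof -
  obtain bV cV bW cW where "rep_pair Q V T W T' bV cV bW cW" using rep_pair_exists[OF assms(1,2)] .
  then interpret rep_pair Q V T W T' bV cV bW cW .
  have le: "fs.dim H \<le> fs.dim (W x)" by (rule hom_le_eval[OF assms(3-5)])
  then show "euler (fdimv V) (fdimv W) \<le> fs.dim (W x)"
    "euler (fdimv V) (fdimv W) \<ge> fs.dim (W x) \<Longrightarrow> ext_vanishes V T W T'"
    using euler_eq codim_0_iff by auto
  show "fs.dim (W x) \<le> 1 \<Longrightarrow> fhom V T W T' \<phi>\<^sub>0 \<Longrightarrow> \<not> fzero V \<phi>\<^sub>0 \<Longrightarrow> fhom V T W T' \<phi> \<Longrightarrow>
      \<exists>r. \<forall>x\<in>verts Q. \<forall>v\<in>V x. \<phi> x v = fscale r (\<phi>\<^sub>0 x v)"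
    by (rule hom_1_scalar) (use le in auto)
qed

lemma euler_ge_1:
  assumes "frep V T" "frep W T'" "ext_vanishes V T W T'" "fhom V T W T' \<phi>" "\<not> fzero V \<phi>"
  shows "euler (fdimv V) (fdimv W) \<ge> 1"
proof -
  obtain bV cV bW cW where "rep_pair Q V T W T' bV cV bW cW" using rep_pair_exists[OF assms(1,2)] .
  then interpret rep_pair Q V T W T' bV cV bW cW .
  have "fs.dim H \<noteq> 0" using hom_0_iff assms(4,5) by blast
  then show ?thesis using euler_eq codim_0_iff assms(3) by auto
qed

lemma hom_exists:
  assumes "frep V T" "frep W T'" "euler (fdimv V) (fdimv W) \<ge> 1"
  obtains \<phi> where "fhom V T W T' \<phi>" "\<not> fzero V \<phi>"
proof -
  obtain bV cV bW cW where "rep_pair Q V T W T' bV cV bW cW" using rep_pair_exists[OF assms(1,2)] .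
  then interpret rep_pair Q V T W T' bV cV bW cW .
  have "fs.dim H \<noteq> 0" using euler_eq assms(3) by auto
  then have "\<exists>\<phi>. fhom V T W T' \<phi> \<and> \<not> fzero V \<phi>" by (simp add: hom_0_iff)
  then show ?thesis using that by blast
qed

lemma finj_surj:
  assumes "frep V T" "fhom V T V T \<phi>" "finj V \<phi>" "x \<in> verts Q"
  shows "\<phi> x ` V x = V x"
proof (rule fds_eqI[OF frepD(1)[OF assms(1,4)]])
  note V = frepD(1)[OF assms(1,4)] and l = fhomD(2)[OF assms(2,4)]
  show "fs.subspace (\<phi> x ` V x)" using fds_image[OF V l] by (rule fds_subspace)
  show "\<phi> x ` V x \<subseteq> V x" using fhomD(3)[OF assms(2,4)] by auto
  show "fs.dim (V x) \<le> fs.dim (\<phi> x ` V x)"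
    using dim_image_inj[OF V l] assms(3,4) by (simp add: finj_def)
qed

lemma fam_retraction_exists:
  assumes "frep V T" "ffam V W \<phi>" "finj V \<phi>"
  obtains g where "\<And>x. x \<in> verts Q \<Longrightarrow> flinear (g x)" "\<And>x w. x \<in> verts Q \<Longrightarrow> g x w \<in> V x"
    "\<And>x v. x \<in> verts Q \<Longrightarrow> v \<in> V x \<Longrightarrow> g x (\<phi> x v) = v"
proof -
  have "\<forall>x\<in>verts Q. \<exists>g. flinear g \<and> (\<forall>w. g w \<in> V x) \<and> (\<forall>v\<in>V x. g (\<phi> x v) = v)"
  proof
    fix x assume x: "x \<in> verts Q"
    show "\<exists>g. flinear g \<and> (\<forall>w. g w \<in> V x) \<and> (\<forall>v\<in>V x. g (\<phi> x v) = v)"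
      using retraction_exists[OF ffamD(1)[OF assms(2) x] frepD(1)[OF assms(1) x]] assms(3) x
      unfolding finj_def by metis
  qed
  then show ?thesis using that by metis
qed

lemma fam_section_exists:
  assumes "frep V T" "ffam V W \<phi>"
  obtains g where "\<And>x. x \<in> verts Q \<Longrightarrow> flinear (g x)" "\<And>x w. x \<in> verts Q \<Longrightarrow> g x w \<in> V x"
    "\<And>x v. x \<in> verts Q \<Longrightarrow> v \<in> V x \<Longrightarrow> \<phi> x (g x (\<phi> x v)) = \<phi> x v"
proof -
  have "\<forall>x\<in>verts Q. \<exists>g. flinear g \<and> (\<forall>w. g w \<in> V x) \<and> (\<forall>v\<in>V x. \<phi> x (g (\<phi> x v)) = \<phi> x v)"
    using section_exists ffamD(1)[OF assms(2)] frepD(1)[OF assms(1)] by metis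
  then show ?thesis using that by metis
qed

lemma fam_projection_exists:
  assumes "frep V T"
  obtains g where "\<And>x. x \<in> verts Q \<Longrightarrow> flinear (g x)" "\<And>x w. x \<in> verts Q \<Longrightarrow> g x w \<in> V x"
    "\<And>x v. x \<in> verts Q \<Longrightarrow> v \<in> V x \<Longrightarrow> g x v = v"
proof -
  have "\<forall>x\<in>verts Q. \<exists>g. flinear g \<and> (\<forall>w. g w \<in> V x) \<and> (\<forall>v\<in>V x. g v = v)"
    using projection_exists[OF fds_subspace[OF frepD(1)[OF assms]]] by metis
  then show ?thesis using that by metis
qed

text \<open>
  Suppose that \<open>d\<^sub>0\<close> is a class outside the coboundaries. The endomorphisms act on the extension
  classes, and \<open>c \<mapsto> c \<cdot> d\<^sub>0\<close> is injective modulo coboundaries, because a nonzero endomorphism of a brick is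
  invertible. Hence \<open>dim Hom(V, V) \<le> dim Ext(V, V)\<close>, contrary to the positivity of the Euler form.
\<close>

lemma brick_ext_vanishes:
  assumes V: "frep V T" and br: "brick V T" and pos: "euler (fdimv V) (fdimv V) \<ge> 1"
  shows "ext_vanishes V T V T"
proof (rule ccontr)
  assume nonext: "\<not> ext_vanishes V T V T"
  have "\<forall>x\<in>verts Q. \<exists>b. \<exists>c. is_chart (V x) b c" using is_chart_exists frepD(1)[OF V] by auto
  then obtain bV cV where ch: "\<And>x. x \<in> verts Q \<Longrightarrow> is_chart (V x) (bV x) (cV x)" by metis
  interpret rep_pair Q V T V T bV cV bV cV by unfold_locales (use V ch in auto)
  obtain d0 where d0: "d0 \<in> fsupp R" "d0 \<notin> im"
    using nonext im_full_iff im_sub(1) by blast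
  let ?act = "\<lambda>c a v. ev c (head Q a) (evR d0 a v)"
  define \<mu> where "\<mu> c = (\<lambda>(a, i, j). if (a, i, j) \<in> R
      then cV (head Q a) i (?act c a (bV (tail Q a) j)) else 0)" for c
  have lin: "flinear \<mu>"
  proof (rule flinearI)
    fix c d show "\<mu> (c + d) = \<mu> c + \<mu> d"
    proof
      fix p show "\<mu> (c + d) p = (\<mu> c + \<mu> d) p"
        by (cases p) (auto simp: \<mu>_def pointwise(1) R_def ev_add is_chartD(2)[OF ch[OF head_in_verts]])
    qed
  next
    fix r c show "\<mu> (fscale r c) = fscale r (\<mu> c)"
    proof
      fix p show "\<mu> (fscale r c) p = fscale r (\<mu> c) p"
        by (cases p) (auto simp: \<mu>_def fscale_apply[of r "\<lambda>(a, i, j). _ a i j"] R_def ev_scale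
          is_chartD(3)[OF ch[OF head_in_verts]])
    qed
  qed
  have supp: "\<mu> c \<in> fsupp R" for c by (auto simp: \<mu>_def fsupp_def)
  have act: "evR (\<mu> c) a v = ?act c a v" if a: "a \<in> arcs Q" and v: "v \<in> V (tail Q a)" for c a v
  proof -
    note h = head_in_verts[OF a] and t = tail_in_verts[OF a]
    have e1: "flinear (evR d a)" "u \<in> V (tail Q a) \<Longrightarrow> evR d a u \<in> V (head Q a)" for d u
      using evR_cochain[of d] a by (auto simp: cochain_def)
    show ?thesis
    proof (rule linear_eq_on_charts[OF ch[OF t] ch[OF h] _ _ _ _ _ v])
      show "flinear (?act c a)" by (rule flinear_compose[OF e1(1) ffamD(1)[OF ev_ffam h]])
      show "?act c a u \<in> V (head Q a)" if "u \<in> V (tail Q a)" for u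
        by (rule ffamD(2)[OF ev_ffam h e1(2)[OF that]])
      show "cV (head Q a) i (evR (\<mu> c) a (bV (tail Q a) j)) = cV (head Q a) i (?act c a (bV (tail Q a) j))"
        if "i < fs.dim (V (head Q a))" "j < fs.dim (V (tail Q a))" for i j
        using that a by (simp add: evR_def[of "\<mu> c"] matmap_entry[OF ch[OF t] ch[OF h]]) (simp add: \<mu>_def R_def)
    qed (rule e1; assumption)+
  qed
  \<comment> \<open>if \<open>c \<cdot> d\<^sub>0\<close> is a coboundary, apply the inverse of a nonzero \<open>c\<close> to it\<close>
  have key: "c = 0" if c: "c \<in> H" and mu: "\<mu> c \<in> im" for c
  proof -
    obtain \<psi> where psi: "ffam V V \<psi>" "coboundary V T T \<psi> (evR (\<mu> c))"
      using mu mem_im_iff[OF supp] by blast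
    have hom: "fhom V T V T (ev c)" using c H_iff by blast
    then consider "fzero V (ev c)" | "finj V (ev c)" using br unfolding brick_def by blast
    then show ?thesis
    proof cases
      case 1 then show ?thesis using ev_inj c H_iff by blast
    next
      case 2
      obtain g where g: "\<And>x. x \<in> verts Q \<Longrightarrow> flinear (g x)" "\<And>x w. x \<in> verts Q \<Longrightarrow> g x w \<in> V x"
        "\<And>x v. x \<in> verts Q \<Longrightarrow> v \<in> V x \<Longrightarrow> g x (ev c x v) = v"
        using fam_retraction_exists[OF V ev_ffam 2] by blast
      have ghom: "g (head Q a) (T a w) = T a (g (tail Q a) w)" if a: "a \<in> arcs Q" and w: "w \<in> V (tail Q a)" for a w
      proof -
        note h = head_in_verts[OF a] and t = tail_in_verts[OF a]
        obtain u where u: "u \<in> V (tail Q a)" "w = ev c (tail Q a) u"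
          using finj_surj[OF V hom 2 t] w by blast
        then have "T a w = ev c (head Q a) (T a u)" using fhomD(4)[OF hom a u(1)] by simp
        then show ?thesis using u g(3)[OF h frepD(3)[OF V a u(1)]] g(3)[OF t u(1)] by simp
      qed
      have "ffam V V (\<lambda>x v. g x (\<psi> x v))"
        unfolding ffam_def using g(1,2) ffamD(1)[OF psi(1)] by (auto intro: flinear_compose)
      moreover have "coboundary V T T (\<lambda>x v. g x (\<psi> x v)) (evR d0)"
        unfolding coboundary_def
      proof (intro ballI)
        fix a v assume a: "a \<in> arcs Q" and v: "v \<in> V (tail Q a)"
        note h = head_in_verts[OF a] and t = tail_in_verts[OF a]
        have "g (head Q a) (\<psi> (head Q a) (T a v)) - T a (g (tail Q a) (\<psi> (tail Q a) v)) =
            g (head Q a) (\<psi> (head Q a) (T a v) - T a (\<psi> (tail Q a) v))"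
          using ghom[OF a ffamD(2)[OF psi(1) t v]] by (simp add: flinear_simps[OF g(1)[OF h]])
        also have "\<dots> = g (head Q a) (ev c (head Q a) (evR d0 a v))"
          using psi(2) a v act[OF a v] by (simp add: coboundary_def)
        also have "\<dots> = evR d0 a v"
          by (rule g(3)[OF h]) (use evR_cochain a v in \<open>auto simp: cochain_def\<close>)
        finally show "g (head Q a) (\<psi> (head Q a) (T a v)) - T a (g (tail Q a) (\<psi> (tail Q a) v)) = evR d0 a v" .
      qed
      ultimately have "d0 \<in> im" using mem_im_iff[OF d0(1)] by blast
      then show ?thesis using d0(2) by simp
    qed
  qed
  have mu0: "\<mu> 0 = 0" using flinear_simps(4)[OF lin] .
  have im0: "0 \<in> im" using fs.subspace_0[OF im_sub(2)] .
  have "fs.dim (\<mu> ` H) = fs.dim H"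
    by (rule dim_image_inj[OF fds_H lin]) (use key im0 in auto)
  moreover have "fs.dim (\<mu> ` H) + fs.dim im \<le> fs.dim (fsupp R :: ('a \<times> nat \<times> nat \<Rightarrow> 'c) set)"
  proof (rule dim_direct_sum_le[OF fsupp_fds_dim(1)[OF finite_R] _ _ im_sub(2,1)])
    show "fs.subspace (\<mu> ` H)" by (rule fds_subspace[OF fds_image[OF fds_H lin]])
    show "\<mu> ` H \<subseteq> fsupp R" using supp by auto
    show "\<mu> ` H \<inter> im \<subseteq> {0}" using key mu0 by blast
  qed
  ultimately have "fs.dim H \<le> card R - fs.dim im"
    using fsupp_fds_dim(2)[OF finite_R, where 'k = 'c] by simp
  then show False using euler_eq pos by simp
qed

text \<open>
  There is no second extension group, so \<open>Ext(V, -)\<close> is right exact: lift the cochain along linear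
  sections.
\<close>

lemma ext_vanishes_quotient:
  assumes W: "frep W T'" and ext: "ext_vanishes V T W T'" and p: "fhom W T' Z T'' p"
    and surj: "\<And>x. x \<in> verts Q \<Longrightarrow> Z x \<subseteq> p x ` W x" and V: "frep V T"
  shows "ext_vanishes V T Z T''"
  unfolding ext_vanishes_def
proof (intro allI impI)
  fix c assume c: "cochain V Z c"
  obtain s where s: "\<And>x. x \<in> verts Q \<Longrightarrow> flinear (s x)" "\<And>x w. x \<in> verts Q \<Longrightarrow> s x w \<in> W x"
    "\<And>x v. x \<in> verts Q \<Longrightarrow> v \<in> W x \<Longrightarrow> p x (s x (p x v)) = p x v"
    using fam_section_exists[OF W fhomD(1)[OF p]] by blast
  have ps: "p x (s x z) = z" if "x \<in> verts Q" "z \<in> Z x" for x z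
    using surj[OF that(1)] s(3)[OF that(1)] that(2) by blast
  have "cochain V W (\<lambda>a v. s (head Q a) (c a v))"
    unfolding cochain_def using c s(1,2)[OF head_in_verts]
    by (auto simp: cochain_def intro: flinear_compose)
  then obtain \<psi> where psi: "ffam V W \<psi>" "coboundary V T T' \<psi> (\<lambda>a v. s (head Q a) (c a v))"
    using ext unfolding ext_vanishes_def by blast
  have "ffam V Z (\<lambda>x v. p x (\<psi> x v))"
    unfolding ffam_def using ffamD[OF psi(1)] fhomD(2,3)[OF p] by (auto intro: flinear_compose)
  moreover have "coboundary V T T'' (\<lambda>x v. p x (\<psi> x v)) c"
    unfolding coboundary_def
  proof (intro ballI)
    fix a v assume a: "a \<in> arcs Q" and v: "v \<in> V (tail Q a)"
    note h = head_in_verts[OF a] and t = tail_in_verts[OF a]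
    have "p (head Q a) (\<psi> (head Q a) (T a v)) - T'' a (p (tail Q a) (\<psi> (tail Q a) v)) =
        p (head Q a) (\<psi> (head Q a) (T a v) - T' a (\<psi> (tail Q a) v))"
      using fhomD(4)[OF p a ffamD(2)[OF psi(1) t v]] by (simp add: flinear_simps[OF fhomD(2)[OF p h]])
    also have "\<dots> = c a v"
      using psi(2) a v ps[OF h] c by (simp add: coboundary_def cochain_def)
    finally show "p (head Q a) (\<psi> (head Q a) (T a v)) - T'' a (p (tail Q a) (\<psi> (tail Q a) v)) = c a v" .
  qed
  ultimately show "\<exists>\<psi>. ffam V Z \<psi> \<and> coboundary V T T'' \<psi> c" by blast
qed

text \<open>
  Dually, \<open>Ext(-, W)\<close> turns inclusions into surjections: extend the cochain along linear retractions.
\<close>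

lemma ext_vanishes_sub:
  assumes U: "frep U S" and ext: "ext_vanishes V T W T'" and j: "fhom U S V T j" and inj: "finj U j"
  shows "ext_vanishes U S W T'"
  unfolding ext_vanishes_def
proof (intro allI impI)
  fix c assume c: "cochain U W c"
  obtain r where r: "\<And>x. x \<in> verts Q \<Longrightarrow> flinear (r x)" "\<And>x w. x \<in> verts Q \<Longrightarrow> r x w \<in> U x"
    "\<And>x v. x \<in> verts Q \<Longrightarrow> v \<in> U x \<Longrightarrow> r x (j x v) = v"
    using fam_retraction_exists[OF U fhomD(1)[OF j] inj] by blast
  have "cochain V W (\<lambda>a v. c a (r (tail Q a) v))"
    unfolding cochain_def using c r(1,2)[OF tail_in_verts]
    by (auto simp: cochain_def intro: flinear_compose)
  then obtain \<psi> where psi: "ffam V W \<psi>" "coboundary V T T' \<psi> (\<lambda>a v. c a (r (tail Q a) v))"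
    using ext unfolding ext_vanishes_def by blast
  have "ffam U W (\<lambda>x v. \<psi> x (j x v))"
    unfolding ffam_def using ffamD[OF psi(1)] fhomD(2,3)[OF j] by (auto intro: flinear_compose)
  moreover have "coboundary U S T' (\<lambda>x v. \<psi> x (j x v)) c"
    using psi(2) fhomD(3,4)[OF j] r(3) by (simp add: coboundary_def)
  ultimately show "\<exists>\<psi>. ffam U W \<psi> \<and> coboundary U S T' \<psi> c" by blast
qed

end

section \<open>Indecomposable representations are rigid bricks\<close>

context quiver
begin

definition tdim :: "('v \<Rightarrow> ('i \<Rightarrow> 'k::field) set) \<Rightarrow> nat" where
  "tdim V = (\<Sum>x\<in>verts Q. fs.dim (V x))"

definition nonzero :: "('v \<Rightarrow> ('i \<Rightarrow> 'k::field) set) \<Rightarrow> bool" where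
  "nonzero V \<longleftrightarrow> (\<exists>x\<in>verts Q. \<exists>v\<in>V x. v \<noteq> 0)"

text \<open>
  Direct summands are encoded by idempotents.
\<close>

definition findec :: "('v \<Rightarrow> ('i \<Rightarrow> 'k::field) set) \<Rightarrow> ('a \<Rightarrow> ('i \<Rightarrow> 'k) \<Rightarrow> 'i \<Rightarrow> 'k) \<Rightarrow> bool" where
  "findec V T \<longleftrightarrow> nonzero V \<and> (\<forall>e. fhom V T V T e \<and> (\<forall>x\<in>verts Q. \<forall>v\<in>V x. e x (e x v) = e x v) \<longrightarrow>
     fzero V e \<or> finj V e)"

lemma fhom_id: "fhom V T V T (\<lambda>x v. v)"
  by (simp add: fhom_def ffam_def flinear_ops)

lemma fhom_comp:
  assumes "fhom V T W T' \<phi>" "fhom W T' Z T'' \<psi>" shows "fhom V T Z T'' (\<lambda>x v. \<psi> x (\<phi> x v))"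
  using assms tail_in_verts unfolding fhom_def ffam_def by (auto intro: flinear_compose)

lemma frep_kernel:
  assumes V: "frep V T" and W: "frep W T'" and p: "fhom V T W T' \<phi>"
  shows "frep (\<lambda>x. {v \<in> V x. \<phi> x v = 0}) T"
  unfolding frep_def
proof (intro conjI ballI)
  show "fds {v \<in> V x. \<phi> x v = 0}" if "x \<in> verts Q" for x
    by (rule fds_kernel[OF frepD(1)[OF V that] fhomD(2)[OF p that]])
  fix a assume a: "a \<in> arcs Q"
  show "flinear (T a)" by (rule frepD(2)[OF V a])
  show "T a v \<in> {v \<in> V (head Q a). \<phi> (head Q a) v = 0}" if "v \<in> {v \<in> V (tail Q a). \<phi> (tail Q a) v = 0}" for v
    using that fhomD(4)[OF p a, of v] frepD(3)[OF V a, of v] by (simp add: flinear_simps(4)[OF frepD(2)[OF W a]])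
qed

lemma frep_image:
  assumes V: "frep V T" and W: "frep W T'" and p: "fhom V T W T' \<phi>"
  shows "frep (\<lambda>x. \<phi> x ` V x) T'"
  unfolding frep_def
proof (intro conjI ballI)
  show "fds (\<phi> x ` V x)" if "x \<in> verts Q" for x
    by (rule fds_image[OF frepD(1)[OF V that] fhomD(2)[OF p that]])
  fix a assume a: "a \<in> arcs Q"
  show "flinear (T' a)" by (rule frepD(2)[OF W a])
  show "T' a v \<in> \<phi> (head Q a) ` V (head Q a)" if "v \<in> \<phi> (tail Q a) ` V (tail Q a)" for v
    using that fhomD(4)[OF p a] frepD(3)[OF V a] by (auto intro!: image_eqI[OF sym])
qed

lemma tdim_mono:
  assumes "frep W T" "\<And>x. x \<in> verts Q \<Longrightarrow> V x \<subseteq> W x"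
  shows "tdim V \<le> tdim W"
  unfolding tdim_def by (intro sum_mono dim_mono_fds assms(2) frepD(1)[OF assms(1)])

lemma tdim_rank_nullity:
  assumes "frep V T" "ffam V W \<phi>"
  shows "tdim V = tdim (\<lambda>x. {v \<in> V x. \<phi> x v = 0}) + tdim (\<lambda>x. \<phi> x ` V x)"
  unfolding tdim_def sum.distrib[symmetric]
  by (intro sum.cong refl rank_nullity frepD(1)[OF assms(1)] ffamD(1)[OF assms(2)])

lemma tdim_0: assumes "frep V T" shows "tdim V = 0 \<longleftrightarrow> \<not> nonzero V"
proof -
  have "fs.dim (V x) = 0 \<longleftrightarrow> (\<forall>v\<in>V x. v = 0)" if "x \<in> verts Q" for x
    using fds_dim_0[OF frepD(1)[OF assms that]] fds_closed(1)[OF frepD(1)[OF assms that]] by auto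
  then show ?thesis unfolding tdim_def nonzero_def by simp
qed

lemma tdim_image_less:
  assumes "frep V T" "ffam V W \<phi>" "\<not> finj V \<phi>"
  shows "tdim (\<lambda>x. \<phi> x ` V x) < tdim V"
proof -
  have "frep (\<lambda>x. {v \<in> V x. \<phi> x v = 0}) (\<lambda>a v. 0)"
    unfolding frep_def using fds_kernel[OF frepD(1)[OF assms(1)] ffamD(1)[OF assms(2)]]
      flinear_simps(4)[OF ffamD(1)[OF assms(2) head_in_verts]]
      fds_closed(1)[OF frepD(1)[OF assms(1) head_in_verts]]
    by (auto simp: flinear_ops)
  moreover have "nonzero (\<lambda>x. {v \<in> V x. \<phi> x v = 0})"
    using assms(3) by (auto simp: nonzero_def finj_def)
  ultimately show ?thesis using tdim_0 tdim_rank_nullity[OF assms(1,2)] by fastforce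
qed

text \<open>
  Fitting's lemma in the only case that is needed. If \<open>h\<close> inverts \<open>f\<close> on the image of \<open>f\<close>, then
  \<open>h \<circ> f\<close> is an idempotent with the same kernel as \<open>f\<close>.
\<close>

lemma findec_injective_on_image:
  assumes V: "frep V T" and ind: "findec V T" and f: "fhom V T V T f"
    and inj: "finj (\<lambda>x. f x ` V x) f"
  shows "fzero V f \<or> finj V f"
proof -
  let ?I = "\<lambda>x. f x ` V x"
  have I: "frep ?I T" by (rule frep_image[OF V V f])
  have IV: "?I x \<subseteq> V x" if "x \<in> verts Q" for x using fhomD(3)[OF f that] by auto
  have fI: "fhom ?I T ?I T f"
    unfolding fhom_def ffam_def using fhomD(2,3,4)[OF f] tail_in_verts
    by (auto intro!: imageI)
  obtain h where h: "\<And>x. x \<in> verts Q \<Longrightarrow> flinear (h x)" "\<And>x w. x \<in> verts Q \<Longrightarrow> h x w \<in> ?I x"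
    "\<And>x v. x \<in> verts Q \<Longrightarrow> v \<in> ?I x \<Longrightarrow> h x (f x v) = v"
    using fam_retraction_exists[OF I fhomD(1)[OF fI] inj] by blast
  have fh: "f x (h x w) = w" if "x \<in> verts Q" "w \<in> ?I x" for x w
    using finj_surj[OF I fI inj that(1)] h(3)[OF that(1)] that(2) by (metis (no_types, lifting) imageE)
  let ?e = "\<lambda>x v. h x (f x v)"
  have "fhom V T V T ?e"
    unfolding fhom_def ffam_def
  proof (intro conjI ballI)
    show "flinear (?e x)" if "x \<in> verts Q" for x
      by (rule flinear_compose[OF fhomD(2)[OF f that] h(1)[OF that]])
    show "?e x v \<in> V x" if "x \<in> verts Q" for x v by (rule subsetD[OF IV[OF that] h(2)[OF that]])
    fix a v assume a: "a \<in> arcs Q" and v: "v \<in> V (tail Q a)"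
    note hd = head_in_verts[OF a] and t = tail_in_verts[OF a]
    have "f (head Q a) (T a v) = T a (f (tail Q a) (?e (tail Q a) v))"
      using fhomD(4)[OF f a v] fh[OF t, of "f (tail Q a) v"] v by simp
    also have "\<dots> = f (head Q a) (T a (?e (tail Q a) v))"
      using fhomD(4)[OF fI a h(2)[OF t]] by simp
    finally show "?e (head Q a) (T a v) = T a (?e (tail Q a) v)"
      using h(3)[OF hd frepD(3)[OF I a h(2)[OF t]]] by simp
  qed
  moreover have "\<forall>x\<in>verts Q. \<forall>v\<in>V x. ?e x (?e x v) = ?e x v" using h(2,3) by simp
  ultimately have "fzero V ?e \<or> finj V ?e" using ind unfolding findec_def by blast
  then show ?thesis
  proof
    assume z: "fzero V ?e"
    have "f x v = 0" if "x \<in> verts Q" "v \<in> V x" for x v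
      using fh[OF that(1), of "f x v"] z that by (simp add: fzero_def flinear_simps(4)[OF fhomD(2)[OF f that(1)]])
    then show ?thesis by (simp add: fzero_def)
  next
    assume "finj V ?e"
    then have "finj V f" unfolding finj_def
      using flinear_simps(4)[OF h(1)] by simp
    then show ?thesis ..
  qed
qed

text \<open>
  Ringel's argument. Take a nonzero, non-injective endomorphism \<open>f\<close> of minimal rank, with image \<open>I\<close>
  and kernel \<open>K\<close>. Minimality forces \<open>f \<circ> f = 0\<close>, so \<open>I\<close> lies in \<open>K\<close>, and some indecomposable
  direct summand \<open>U\<close> of \<open>K\<close> receives a nonzero map from \<open>I\<close>, which is injective, again by minimality.
  By induction \<open>U\<close> has no self-extensions, hence \<open>Ext(I, U) = 0\<close>. Pushing out
  \<open>0 \<rightarrow> K \<rightarrow> V \<rightarrow> I \<rightarrow> 0\<close> along the projection \<open>K \<rightarrow> U\<close> therefore gives a split sequence, so \<open>U\<close> is a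
  proper direct summand of \<open>V\<close>.
\<close>

lemma findec_brick:
  fixes V :: "'v \<Rightarrow> ('i \<Rightarrow> 'k::field) set"
  assumes V: "frep V T" and ind: "findec V T"
    and IH: "\<And>U :: 'v \<Rightarrow> ('i \<Rightarrow> 'k) set. frep U T \<Longrightarrow> findec U T \<Longrightarrow> tdim U < tdim V \<Longrightarrow> ext_vanishes U T U T"
  shows "brick V T"
proof (rule ccontr)
  assume "\<not> brick V T"
  then obtain f0 where f0: "fhom V T V T f0 \<and> \<not> fzero V f0 \<and> \<not> finj V f0"
    unfolding brick_def by blast
  define rk where "rk f = tdim (\<lambda>x. f x ` V x)" for f :: "'v \<Rightarrow> ('i \<Rightarrow> 'k) \<Rightarrow> 'i \<Rightarrow> 'k"
  obtain f where f: "fhom V T V T f" "\<not> fzero V f" "\<not> finj V f"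
    and min: "\<And>g. fhom V T V T g \<Longrightarrow> \<not> fzero V g \<Longrightarrow> \<not> finj V g \<Longrightarrow> rk f \<le> rk g"
    using ex_has_least_nat[of "\<lambda>f. fhom V T V T f \<and> \<not> fzero V f \<and> \<not> finj V f" f0 rk] f0 by blast
  let ?I = "\<lambda>x. f x ` V x" and ?K = "\<lambda>x. {v \<in> V x. f x v = 0}"
  have I: "frep ?I T" by (rule frep_image[OF V V f(1)])
  have K: "frep ?K T" by (rule frep_kernel[OF V V f(1)])
  have IV: "?I x \<subseteq> V x" if "x \<in> verts Q" for x using fhomD(3)[OF f(1) that] by auto
  \<comment> \<open>a map that does not vanish on the image is injective there\<close>
  have inj_on_I: "finj ?I g"
    if g: "fhom V T V T (\<lambda>x v. g x (f x v))" "\<not> fzero V (\<lambda>x v. g x (f x v))"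
      and gl: "ffam ?I Z g" for g and Z :: "'v \<Rightarrow> ('i \<Rightarrow> 'k) set"
  proof (rule ccontr)
    assume "\<not> finj ?I g"
    then have "tdim (\<lambda>x. g x ` ?I x) < tdim ?I" by (rule tdim_image_less[OF I gl])
    moreover have "rk (\<lambda>x v. g x (f x v)) = tdim (\<lambda>x. g x ` ?I x)" by (simp add: rk_def image_image)
    moreover have "\<not> finj V (\<lambda>x v. g x (f x v))"
      using f(3) flinear_simps(4)[OF ffamD(1)[OF gl]] unfolding finj_def by metis
    ultimately show False using min[OF g] by (simp add: rk_def)
  qed
  have ff: "fzero V (\<lambda>x v. f x (f x v))"
  proof (rule ccontr)
    assume nz: "\<not> fzero V (\<lambda>x v. f x (f x v))"
    have "ffam ?I V f" using fhomD(2,3)[OF f(1)] by (auto simp: ffam_def)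
    from inj_on_I[OF fhom_comp[OF f(1) f(1)] nz this] show False
      using findec_injective_on_image[OF V ind f(1)] f(2,3) by blast
  qed
  have IK: "?I x \<subseteq> ?K x" if "x \<in> verts Q" for x
    using ff IV[OF that] that by (auto simp: fzero_def)
  \<comment> \<open>a direct summand \<open>U\<close> of \<open>K\<close> with its projection \<open>p\<close>, such that the image of \<open>f\<close> is not killed by \<open>p\<close>\<close>
  define ok where "ok = (\<lambda>(U, p). frep U T \<and> (\<forall>x\<in>verts Q. U x \<subseteq> ?K x) \<and> fhom ?K T U T p \<and>
    (\<forall>x\<in>verts Q. \<forall>u\<in>U x. p x u = u) \<and> \<not> fzero V (\<lambda>x v. p x (f x v)))"
  have "ok (?K, \<lambda>x v. v)" unfolding ok_def using K f(2) by (simp add: fhom_id)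
  then obtain Up where up: "ok Up" and minU: "\<And>Wp. ok Wp \<Longrightarrow> tdim (fst Up) \<le> tdim (fst Wp)"
    using ex_has_least_nat[of ok _ "\<lambda>Up. tdim (fst Up)"] by blast
  obtain U p where Up: "Up = (U, p)" by (cases Up)
  have U: "frep U T" and UK: "\<And>x. x \<in> verts Q \<Longrightarrow> U x \<subseteq> ?K x" and p: "fhom ?K T U T p"
    and pU: "\<And>x u. x \<in> verts Q \<Longrightarrow> u \<in> U x \<Longrightarrow> p x u = u" and pf: "\<not> fzero V (\<lambda>x v. p x (f x v))"
    using up by (auto simp: Up ok_def)
  have UV: "U x \<subseteq> V x" if "x \<in> verts Q" for x using UK[OF that] by auto
  have nzU: "nonzero U"
    using pf IK fhomD(3)[OF p] unfolding fzero_def nonzero_def by (metis (no_types, lifting) image_subset_iff)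
  \<comment> \<open>minimality makes \<open>U\<close> indecomposable\<close>
  have indU: "findec U T"
    unfolding findec_def
  proof (intro conjI allI impI nzU)
    fix e assume e: "fhom U T U T e \<and> (\<forall>x\<in>verts Q. \<forall>v\<in>U x. e x (e x v) = e x v)"
    show "fzero U e \<or> finj U e"
    proof (rule ccontr)
      assume neg: "\<not> (fzero U e \<or> finj U e)"
      have small: "fzero V (\<lambda>x v. g x (p x (f x v)))"
        if g: "fhom U T U T g" "\<And>x v. x \<in> verts Q \<Longrightarrow> v \<in> U x \<Longrightarrow> g x (g x v) = g x v" "\<not> finj U g" for g
      proof (rule ccontr)
        assume nz: "\<not> fzero V (\<lambda>x v. g x (p x (f x v)))"
        let ?W = "\<lambda>x. g x ` U x"
        have "fhom U T ?W T g" using g(1) by (auto simp: fhom_def ffam_def)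
        from fhom_comp[OF p this] have "fhom ?K T ?W T (\<lambda>x v. g x (p x v))" .
        moreover have "\<forall>x\<in>verts Q. ?W x \<subseteq> ?K x"
          using fhomD(3)[OF g(1)] UK by (metis (no_types, lifting) image_subset_iff subset_iff)
        moreover have "\<forall>x\<in>verts Q. \<forall>u\<in>?W x. g x (p x u) = u"
          using fhomD(3)[OF g(1)] pU g(2) by auto
        ultimately have "ok (?W, \<lambda>x v. g x (p x v))"
          unfolding ok_def using frep_image[OF U U g(1)] nz by simp
        then have "tdim U \<le> tdim ?W" using minU[of "(?W, \<lambda>x v. g x (p x v))"] by (simp add: Up)
        then show False using tdim_image_less[OF U fhomD(1)[OF g(1)] g(3)] by simp
      qed
      let ?e' = "\<lambda>x v. v - e x v"
      have e1: "fhom U T U T e" "\<And>x v. x \<in> verts Q \<Longrightarrow> v \<in> U x \<Longrightarrow> e x (e x v) = e x v" using e by auto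
      have e'1: "fhom U T U T ?e'"
        unfolding fhom_def ffam_def
        using fhomD(2-4)[OF e1(1)] fds_closed(3)[OF frepD(1)[OF U]]
        by (auto intro!: flinear_ops simp: flinear_simps(2)[OF frepD(2)[OF U]])
      have e'2: "?e' x (?e' x v) = ?e' x v" if "x \<in> verts Q" "v \<in> U x" for x v
        using e1(2)[OF that] by (simp add: flinear_simps(2)[OF fhomD(2)[OF e1(1) that(1)]])
      have e'3: "\<not> finj U ?e'"
        using neg e1(2) fhomD(3)[OF e1(1)] by (auto simp: fzero_def finj_def)
      have "p x (f x v) = 0" if x: "x \<in> verts Q" and v: "v \<in> V x" for x v
      proof -
        have "e x (p x (f x v)) = 0" using small[OF e1] neg x v by (auto simp: fzero_def)
        moreover have "?e' x (p x (f x v)) = 0" using small[OF e'1 e'2 e'3] x v by (auto simp: fzero_def)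
        ultimately show ?thesis by simp
      qed
      then show False using pf by (simp add: fzero_def)
    qed
  qed
  have "\<not> fzero V f \<longrightarrow> tdim ?K < tdim V"
  proof
    assume "\<not> fzero V f"
    then have "nonzero ?I" by (auto simp: fzero_def nonzero_def)
    then have "tdim ?I \<noteq> 0" using tdim_0[OF I] by simp
    then show "tdim ?K < tdim V" using tdim_rank_nullity[OF V fhomD(1)[OF f(1)]] by simp
  qed
  then have small: "tdim U < tdim V" using f(2) tdim_mono[OF K UK] by simp
  have extU: "ext_vanishes U T U T" by (rule IH[OF U indU small])
  \<comment> \<open>the image embeds into \<open>U\<close>, hence has no extensions by \<open>U\<close>\<close>
  have pI: "fhom ?I T U T p"
    unfolding fhom_def ffam_def
  proof (intro conjI ballI)
    show "flinear (p x)" if "x \<in> verts Q" for x by (rule fhomD(2)[OF p that])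
    show "p x v \<in> U x" if "x \<in> verts Q" "v \<in> ?I x" for x v using fhomD(3)[OF p that(1)] IK that by blast
    show "p (head Q a) (T a v) = T a (p (tail Q a) v)" if "a \<in> arcs Q" "v \<in> ?I (tail Q a)" for a v
      using fhomD(4)[OF p that(1)] IK[OF tail_in_verts[OF that(1)]] that(2) by blast
  qed
  have fI: "fhom V T ?I T f" using f(1) by (auto simp: fhom_def ffam_def)
  have pfV: "fhom V T V T (\<lambda>x v. p x (f x v))"
    using fhom_comp[OF fI pI] UV unfolding fhom_def ffam_def by blast
  have pinj: "finj ?I p" by (rule inj_on_I[OF pfV pf fhomD(1)[OF pI]])
  have extI: "ext_vanishes ?I T U T" by (rule ext_vanishes_sub[OF I extU pI pinj])
  \<comment> \<open>therefore \<open>p\<close> extends from the kernel to the whole representation\<close>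
  obtain g where g: "\<And>x. x \<in> verts Q \<Longrightarrow> flinear (g x)" "\<And>x w. x \<in> verts Q \<Longrightarrow> g x w \<in> ?K x"
    "\<And>x v. x \<in> verts Q \<Longrightarrow> v \<in> ?K x \<Longrightarrow> g x v = v"
    using fam_projection_exists[OF K] by blast
  obtain s where s: "\<And>x. x \<in> verts Q \<Longrightarrow> flinear (s x)" "\<And>x w. x \<in> verts Q \<Longrightarrow> s x w \<in> V x"
    "\<And>x v. x \<in> verts Q \<Longrightarrow> v \<in> V x \<Longrightarrow> f x (s x (f x v)) = f x v"
    using fam_section_exists[OF V fhomD(1)[OF f(1)]] by blast
  let ?r = "\<lambda>x v. p x (g x v)"
  have rl: "flinear (?r x)" if "x \<in> verts Q" for x
    by (rule flinear_compose[OF g(1)[OF that] fhomD(2)[OF p that]])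
  have rU: "?r x v \<in> U x" if "x \<in> verts Q" for x v
    by (rule fhomD(3)[OF p that g(2)[OF that]])
  \<comment> \<open>the linear extension \<open>?r\<close> of \<open>p\<close> fails to commute with the arrows by a cochain that factors through \<open>I\<close>\<close>
  let ?d = "\<lambda>a v. ?r (head Q a) (T a v) - T a (?r (tail Q a) v)"
  have dl: "flinear (?d a)" if "a \<in> arcs Q" for a
    using rl[OF head_in_verts[OF that]] rl[OF tail_in_verts[OF that]] frepD(2)[OF V that]
    by (intro flinear_ops(4)) (auto intro: flinear_compose[of "T a" "?r (head Q a)"] flinear_compose[of "?r (tail Q a)" "T a"])
  have dK: "?d a v = 0" if a: "a \<in> arcs Q" and v: "v \<in> ?K (tail Q a)" for a v
    using fhomD(4)[OF p a v] g(3)[OF tail_in_verts[OF a] v]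
      g(3)[OF head_in_verts[OF a] frepD(3)[OF K a v]] by simp
  have df: "?d a (s (tail Q a) (f (tail Q a) v)) = ?d a v" if a: "a \<in> arcs Q" and v: "v \<in> V (tail Q a)" for a v
  proof -
    note t = tail_in_verts[OF a]
    have "v - s (tail Q a) (f (tail Q a) v) \<in> ?K (tail Q a)"
      using s(3)[OF t v] v s(2)[OF t] fds_closed(3)[OF frepD(1)[OF V t]]
      by (simp add: flinear_simps(2)[OF fhomD(2)[OF f(1) t]])
    from dK[OF a this] show ?thesis unfolding flinear_simps(2)[OF dl[OF a]] by simp
  qed
  have "cochain ?I U (\<lambda>a v. ?d a (s (tail Q a) v))"
    unfolding cochain_def
  proof (intro ballI conjI)
    fix a assume a: "a \<in> arcs Q"
    note h = head_in_verts[OF a] and t = tail_in_verts[OF a]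
    show "flinear (\<lambda>v. ?d a (s (tail Q a) v))" by (rule flinear_compose[OF s(1)[OF t] dl[OF a]])
    show "?d a (s (tail Q a) v) \<in> U (head Q a)" for v
      by (intro fds_closed(3)[OF frepD(1)[OF U h]] rU h frepD(3)[OF U a] t)
  qed
  then obtain \<psi> where psi: "ffam ?I U \<psi>" "coboundary ?I T T \<psi> (\<lambda>a v. ?d a (s (tail Q a) v))"
    using extI unfolding ext_vanishes_def by blast
  \<comment> \<open>the corrected extension is an idempotent endomorphism of \<open>V\<close> with image \<open>U\<close>\<close>
  let ?\<rho> = "\<lambda>x v. ?r x v - \<psi> x (f x v)"
  have rho: "fhom V T V T ?\<rho>"
    unfolding fhom_def ffam_def
  proof (intro conjI ballI)
    show "flinear (?\<rho> x)" if "x \<in> verts Q" for x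
      using rl[OF that] by (intro flinear_ops(4) flinear_compose[OF fhomD(2)[OF f(1)] ffamD(1)[OF psi(1)]] that)
    show "?\<rho> x v \<in> V x" if x: "x \<in> verts Q" and v: "v \<in> V x" for x v
      using fds_closed(3)[OF frepD(1)[OF V x]] rU[OF x] ffamD(2)[OF psi(1) x imageI[OF v]] UV[OF x] by blast
    fix a v assume a: "a \<in> arcs Q" and v: "v \<in> V (tail Q a)"
    note h = head_in_verts[OF a] and t = tail_in_verts[OF a]
    have "\<psi> (head Q a) (T a (f (tail Q a) v)) - T a (\<psi> (tail Q a) (f (tail Q a) v)) = ?d a v"
      using psi(2) a imageI[OF v, of "f (tail Q a)"] df[OF a v] unfolding coboundary_def by metis
    then show "?\<rho> (head Q a) (T a v) = T a (?\<rho> (tail Q a) v)"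
      unfolding flinear_simps(2)[OF frepD(2)[OF V a]] fhomD(4)[OF f(1) a v] by (simp add: algebra_simps)
  qed
  have rhoU: "?\<rho> x u = u" if x: "x \<in> verts Q" and u: "u \<in> U x" for x u
    using UK[OF x] u g(3)[OF x] pU[OF x u] by (auto simp: flinear_simps(4)[OF ffamD(1)[OF psi(1) x]])
  have rho_in: "?\<rho> x v \<in> U x" if x: "x \<in> verts Q" and v: "v \<in> V x" for x v
    by (rule fds_closed(3)[OF frepD(1)[OF U x] rU[OF x] ffamD(2)[OF psi(1) x imageI[OF v]]])
  have "\<forall>x\<in>verts Q. \<forall>v\<in>V x. ?\<rho> x (?\<rho> x v) = ?\<rho> x v" using rhoU rho_in by blast
  then have "fzero V ?\<rho> \<or> finj V ?\<rho>" using ind rho unfolding findec_def by blast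
  then show False
  proof
    assume "fzero V ?\<rho>"
    then show False using nzU UV rhoU unfolding fzero_def nonzero_def by (metis subset_iff)
  next
    assume inj: "finj V ?\<rho>"
    have "V x \<subseteq> U x" if "x \<in> verts Q" for x
      by (subst finj_surj[OF V rho inj that, symmetric], rule image_subsetI, rule rho_in[OF that])
    then have "tdim V \<le> tdim U" by (rule tdim_mono[OF U])
    then show False using small by simp
  qed
qed

text \<open>
  The induction on the dimension supplies the hypothesis of \<open>findec_brick\<close> for proper
  subrepresentations, which carry the same operators; this is why positivity is quantified over \<open>U\<close>
  with \<open>T\<close> fixed.
\<close>

theorem findec_rigid:
  assumes pos: "\<And>U :: 'v \<Rightarrow> ('i \<Rightarrow> 'k::field) set. frep U T \<Longrightarrow> nonzero U \<Longrightarrow> euler (fdimv U) (fdimv U) \<ge> 1"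
    and V: "frep V T" and ind: "findec V T"
  shows "ext_vanishes V T V T"
  using V ind
proof (induction "tdim V" arbitrary: V rule: less_induct)
  case less
  have "brick V T" by (rule findec_brick[OF less.prems]) (use less.hyps in blast)
  moreover have "nonzero V" using less.prems(2) by (simp add: findec_def)
  ultimately show ?case using brick_ext_vanishes less.prems(1) pos by blast
qed

lemma euler_add:
  "euler (\<lambda>x. m x + m' x) n = euler m n + euler m' n"
  "euler n (\<lambda>x. m x + m' x) = euler n m + euler n m'"
  by (simp_all add: euler_def algebra_simps sum.distrib)

lemma euler_cong:
  assumes "\<And>x. x \<in> verts Q \<Longrightarrow> m x = m' x" "\<And>x. x \<in> verts Q \<Longrightarrow> n x = n' x"
  shows "euler m n = euler m' n'"
  unfolding euler_def using assms by (auto intro!: arg_cong2[of _ _ _ _ "(-)"] sum.cong)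

text \<open>
  Since \<open>\<langle>X, Y\<rangle> = 1\<close> there is a nonzero \<open>f : X \<rightarrow> Y\<close>. Let \<open>K\<close>, \<open>I\<close> and \<open>C\<close> be its kernel, image and cokernel,
  and suppose \<open>K \<noteq> 0\<close>; then \<open>C\<close> is nonzero with the same dimension vector as \<open>K\<close>. The quotient \<open>I\<close> of \<open>X\<close>
  has \<open>Ext(X, I) = 0\<close> and \<open>Hom(X, I) \<noteq> 0\<close>, so \<open>\<langle>X, I\<rangle> \<ge> 1\<close>; in the same way \<open>\<langle>Y, C\<rangle> \<ge> 1\<close>. Then
  \<open>1 = \<langle>X, X\<rangle> = \<langle>X, K\<rangle> + \<langle>X, I\<rangle> = \<langle>Y, C\<rangle> + \<langle>X, I\<rangle> \<ge> 2\<close>.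
\<close>

theorem rigid_unique:
  fixes X :: "'v \<Rightarrow> ('i \<Rightarrow> 'k::field) set" and Y :: "'v \<Rightarrow> ('j \<Rightarrow> 'k) set"
  assumes X: "frep X T" and Y: "frep Y T'" and dim: "\<And>x. x \<in> verts Q \<Longrightarrow> fdimv X x = fdimv Y x"
    and extX: "ext_vanishes X T X T" and extY: "ext_vanishes Y T' Y T'"
    and one: "euler (fdimv X) (fdimv X) = 1"
  obtains f where "fhom X T Y T' f" "finj X f"
proof -
  have eXY: "euler (fdimv X) n = euler (fdimv Y) n" "euler n (fdimv X) = euler n (fdimv Y)" for n
    by (rule euler_cong; use dim in simp)+
  have "euler (fdimv X) (fdimv Y) \<ge> 1" using one eXY(2) by simp
  then obtain f where f: "fhom X T Y T' f" "\<not> fzero X f" using hom_exists[OF X Y] by blast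
  show ?thesis
  proof (cases "finj X f")
    case True then show ?thesis using that f by blast
  next
    case False
    let ?I = "\<lambda>x. f x ` X x" and ?K = "\<lambda>x. {v \<in> X x. f x v = 0}"
    have I: "frep ?I T'" by (rule frep_image[OF X Y f(1)])
    have K: "frep ?K T" by (rule frep_kernel[OF X Y f(1)])
    have IY: "?I x \<subseteq> Y x" if "x \<in> verts Q" for x using fhomD(3)[OF f(1) that] by auto
    obtain g where g: "\<And>x. x \<in> verts Q \<Longrightarrow> flinear (g x)" "\<And>x w. x \<in> verts Q \<Longrightarrow> g x w \<in> ?I x"
      "\<And>x v. x \<in> verts Q \<Longrightarrow> v \<in> ?I x \<Longrightarrow> g x v = v"
      using fam_projection_exists[OF I] by blast
    \<comment> \<open>the cokernel, realised on a complement of the image\<close>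
    let ?q = "\<lambda>x v. v - g x v"
    let ?C = "\<lambda>x. ?q x ` Y x" and ?S = "\<lambda>a v. ?q (head Q a) (T' a v)"
    have ql: "flinear (?q x)" if "x \<in> verts Q" for x by (intro flinear_ops g(1) that)
    have qT: "?q (head Q a) (T' a v) = ?S a (?q (tail Q a) v)" if a: "a \<in> arcs Q" for a v
    proof -
      note h = head_in_verts[OF a] and t = tail_in_verts[OF a]
      have "g (head Q a) (T' a (g (tail Q a) v)) = T' a (g (tail Q a) v)"
        by (rule g(3)[OF h frepD(3)[OF I a g(2)[OF t]]])
      then show ?thesis
        by (simp add: flinear_simps(2)[OF frepD(2)[OF Y a]] flinear_simps(2)[OF g(1)[OF h]])
    qed
    have qYC: "?q x v \<in> Y x" if "x \<in> verts Q" "v \<in> Y x" for x v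
      using fds_closed(3)[OF frepD(1)[OF Y that(1)] that(2)] g(2)[OF that(1)] IY[OF that(1)] by blast
    have C: "frep ?C ?S"
      unfolding frep_def
    proof (intro conjI ballI)
      show "fds (?C x)" if "x \<in> verts Q" for x by (rule fds_image[OF frepD(1)[OF Y that] ql[OF that]])
      fix a assume a: "a \<in> arcs Q"
      show "flinear (?S a)" by (rule flinear_compose[OF frepD(2)[OF Y a] ql[OF head_in_verts[OF a]]])
      show "?S a v \<in> ?C (head Q a)" if "v \<in> ?C (tail Q a)" for v
        using that qYC[OF tail_in_verts[OF a]] frepD(3)[OF Y a] by blast
    qed
    have q: "fhom Y T' ?C ?S ?q"
      unfolding fhom_def ffam_def using ql qT by blast
    have ker_q: "{v \<in> Y x. ?q x v = 0} = ?I x" if "x \<in> verts Q" for x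
    proof (rule equalityI; rule subsetI)
      fix v assume "v \<in> {v \<in> Y x. ?q x v = 0}"
      then have "v = g x v" by simp
      then show "v \<in> ?I x" using g(2)[OF that] by metis
    next
      fix v assume v: "v \<in> ?I x"
      then show "v \<in> {v \<in> Y x. ?q x v = 0}" using g(3)[OF that v] IY[OF that] by auto
    qed
    have dX: "fdimv X x = fdimv ?K x + fdimv ?I x" if "x \<in> verts Q" for x
      by (rule rank_nullity[OF frepD(1)[OF X that] fhomD(2)[OF f(1) that]])
    have dY: "fdimv Y x = fdimv ?I x + fdimv ?C x" if "x \<in> verts Q" for x
      using rank_nullity[OF frepD(1)[OF Y that] ql[OF that]] ker_q[OF that] by simp
    have dC: "fdimv ?C x = fdimv ?K x" if "x \<in> verts Q" for x
      using dX[OF that] dY[OF that] dim[OF that] by simp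
    have nzK: "nonzero ?K" using False by (auto simp: finj_def nonzero_def)
    moreover have "tdim ?C = tdim ?K" unfolding tdim_def by (intro sum.cong refl dC)
    ultimately have nzC: "nonzero ?C" using tdim_0[OF K] tdim_0[OF C] by simp
    have fI: "fhom X T ?I T' f" using f(1) by (auto simp: fhom_def ffam_def)
    have inI: "fhom ?I T' Y T' (\<lambda>x v. v)" using IY by (auto simp: fhom_def ffam_def flinear_ops)
    have inK: "fhom ?K T X T (\<lambda>x v. v)" by (auto simp: fhom_def ffam_def flinear_ops)
    have 1: "euler (fdimv X) (fdimv ?I) \<ge> 1"
      by (rule euler_ge_1[OF X I ext_vanishes_quotient[OF X extX fI _ X] fI f(2)]) simp
    have "nonzero ?I" using f(2) by (auto simp: fzero_def nonzero_def)
    then have 2: "euler (fdimv ?I) (fdimv Y) \<ge> 1"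
      by (intro euler_ge_1[OF I Y ext_vanishes_sub[OF I extY inI] inI]) (auto simp: finj_def fzero_def nonzero_def)
    have 3: "euler (fdimv ?K) (fdimv X) \<ge> 1"
      by (rule euler_ge_1[OF K X ext_vanishes_sub[OF K extX inK] inK])
        (use nzK in \<open>auto simp: finj_def fzero_def nonzero_def\<close>)
    have "\<not> fzero Y ?q" using nzC by (auto simp: fzero_def nonzero_def)
    then have 4: "euler (fdimv Y) (fdimv ?C) \<ge> 1"
      by (intro euler_ge_1[OF Y C ext_vanishes_quotient[OF Y extY q _ Y] q]) auto
    have "euler (fdimv X) (fdimv X) = euler (fdimv X) (fdimv ?K) + euler (fdimv X) (fdimv ?I)"
      unfolding euler_add(2)[symmetric] by (rule euler_cong) (simp_all add: dX)
    moreover have "euler (fdimv X) (fdimv ?K) = euler (fdimv Y) (fdimv ?C)"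
      by (rule euler_cong) (simp_all add: dim dC)
    ultimately show ?thesis using 1 4 one by simp
  qed
qed

end

section \<open>The Tits form\<close>

context quiver
begin

text \<open>
  The Tits form on integral vectors, since differences of dimension vectors occur below.
\<close>

definition tits :: "('v \<Rightarrow> int) \<Rightarrow> int" where
  "tits e = (\<Sum>x\<in>verts Q. (e x)\<^sup>2) - (\<Sum>a\<in>arcs Q. e (tail Q a) * e (head Q a))"

definition bil :: "('v \<Rightarrow> int) \<Rightarrow> ('v \<Rightarrow> int) \<Rightarrow> int" where
  "bil u v = (\<Sum>x\<in>verts Q. 2 * u x * v x) -
     (\<Sum>a\<in>arcs Q. u (tail Q a) * v (head Q a) + u (head Q a) * v (tail Q a))"

lemma tits_add: "tits (\<lambda>x. u x + v x) = tits u + tits v + bil u v"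
  unfolding tits_def bil_def by (simp add: power2_eq_square algebra_simps sum.distrib)

lemma tits_form_eq: "tits_form Q d = tits (\<lambda>x. int (d x))"
  by (simp add: tits_form_def tits_def)

lemma euler_tits: "euler m m = tits (\<lambda>x. int (m x))"
  by (simp add: euler_def tits_def power2_eq_square)

lemma tits_cong:
  assumes "\<And>x. x \<in> verts Q \<Longrightarrow> u x = v x" shows "tits u = tits v"
  unfolding tits_def using assms by (auto intro!: arg_cong2[of _ _ _ _ "(-)"] sum.cong)

lemma sum_arcs_by_vertex:
  fixes g u :: "'v \<Rightarrow> 'r::comm_semiring_1"
  shows "(\<Sum>a\<in>arcs Q. g (tail Q a) * u (head Q a) + g (head Q a) * u (tail Q a)) =
    (\<Sum>x\<in>verts Q. g x * ((\<Sum>a\<in>{a\<in>arcs Q. tail Q a = x}. u (head Q a)) +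
      (\<Sum>a\<in>{a\<in>arcs Q. head Q a = x}. u (tail Q a))))"
proof -
  have "(\<Sum>x\<in>verts Q. \<Sum>a\<in>{a\<in>arcs Q. tail Q a = x}. g (tail Q a) * u (head Q a)) =
      (\<Sum>a\<in>arcs Q. g (tail Q a) * u (head Q a))"
    by (rule sum.group) auto
  moreover have "(\<Sum>x\<in>verts Q. \<Sum>a\<in>{a\<in>arcs Q. head Q a = x}. g (head Q a) * u (tail Q a)) =
      (\<Sum>a\<in>arcs Q. g (head Q a) * u (tail Q a))"
    by (rule sum.group) auto
  ultimately show ?thesis
    by (simp add: sum.distrib distrib_left sum_distrib_left)
qed

text \<open>
  The sum of \<open>u\<close> over the neighbours of \<open>x\<close>, counted with multiplicity.
\<close>

definition nb :: "('v \<Rightarrow> nat) \<Rightarrow> 'v \<Rightarrow> nat" where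
  "nb u x = (\<Sum>a\<in>{a\<in>arcs Q. tail Q a = x}. u (head Q a)) + (\<Sum>a\<in>{a\<in>arcs Q. head Q a = x}. u (tail Q a))"

lemma nb_of_nat:
  "(\<Sum>a\<in>{a\<in>arcs Q. tail Q a = x}. of_nat (u (head Q a))) +
   (\<Sum>a\<in>{a\<in>arcs Q. head Q a = x}. of_nat (u (tail Q a))) = of_nat (nb u x)"
  by (simp add: nb_def)

end

text \<open>
  A function \<open>\<theta>\<close> with \<open>bil \<theta> e\<^sub>x = (if x = y then 1 else 0)\<close>, which for a Dynkin quiver with
  exceptional vertex \<open>y\<close> is the maximal root. Connectedness is stated as the absence of a proper set of
  vertices that contains \<open>y\<close> and is closed under arrows in both directions.
\<close>

locale marked_quiver = quiver Q for Q :: "('v, 'a) pre_digraph" +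
  fixes y :: 'v and \<theta> :: "'v \<Rightarrow> nat"
  assumes y: "y \<in> verts Q" and \<theta>y: "\<theta> y = 2"
    and \<theta>_pos: "\<And>x. x \<in> verts Q \<Longrightarrow> 0 < \<theta> x"
    and \<theta>_nb: "\<And>x. x \<in> verts Q \<Longrightarrow> nb \<theta> x + (if x = y then 1 else 0) = 2 * \<theta> x"
    and connected: "\<And>Z. y \<in> Z \<Longrightarrow> (\<And>a. a \<in> arcs Q \<Longrightarrow> tail Q a \<in> Z \<longleftrightarrow> head Q a \<in> Z) \<Longrightarrow> verts Q \<subseteq> Z"
begin

text \<open>
  A loop would contribute \<open>2 \<theta>(y) = 4\<close> to the sum over the neighbours, which is \<open>3\<close>.
\<close>

lemma no_loop_at_y: "a \<in> arcs Q \<Longrightarrow> tail Q a \<noteq> y \<or> head Q a \<noteq> y"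
proof (rule ccontr)
  assume a: "a \<in> arcs Q" and "\<not> (tail Q a \<noteq> y \<or> head Q a \<noteq> y)"
  then have t: "tail Q a = y" "head Q a = y" by auto
  have "\<theta> y \<le> (\<Sum>a\<in>{a\<in>arcs Q. tail Q a = y}. \<theta> (head Q a))"
    using member_le_sum[of a "{a\<in>arcs Q. tail Q a = y}" "\<lambda>a. \<theta> (head Q a)"] a t by simp
  moreover have "\<theta> y \<le> (\<Sum>a\<in>{a\<in>arcs Q. head Q a = y}. \<theta> (tail Q a))"
    using member_le_sum[of a "{a\<in>arcs Q. head Q a = y}" "\<lambda>a. \<theta> (tail Q a)"] a t by simp
  ultimately show False using \<theta>_nb[OF y] unfolding nb_def by simp
qed

lemma bil_\<theta>: "bil (\<lambda>x. int (\<theta> x)) v = v y"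
proof -
  have "(\<Sum>a\<in>arcs Q. int (\<theta> (tail Q a)) * v (head Q a) + int (\<theta> (head Q a)) * v (tail Q a)) =
     (\<Sum>a\<in>arcs Q. v (tail Q a) * int (\<theta> (head Q a)) + v (head Q a) * int (\<theta> (tail Q a)))"
    by (intro sum.cong) (auto simp: algebra_simps)
  also have "\<dots> = (\<Sum>x\<in>verts Q. v x * int (nb \<theta> x))"
    by (simp only: sum_arcs_by_vertex[of v "\<lambda>x. int (\<theta> x)"] nb_of_nat)
  finally have "bil (\<lambda>x. int (\<theta> x)) v = (\<Sum>x\<in>verts Q. v x * (2 * int (\<theta> x) - int (nb \<theta> x)))"
    by (simp add: bil_def algebra_simps sum_subtractf)
  also have "\<dots> = (\<Sum>x\<in>verts Q. if x = y then v y else 0)"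
  proof (intro sum.cong refl)
    fix x assume x: "x \<in> verts Q"
    have "int (nb \<theta> x + (if x = y then 1 else 0)) = int (2 * \<theta> x)" by (simp only: \<theta>_nb[OF x])
    then have "int (nb \<theta> x) + (if x = y then 1 else 0) = 2 * int (\<theta> x)"
      by (simp split: if_splits)
    then have "2 * int (\<theta> x) - int (nb \<theta> x) = (if x = y then 1 else 0)" by simp
    then show "v x * (2 * int (\<theta> x) - int (nb \<theta> x)) = (if x = y then v y else 0)" by simp
  qed
  also have "\<dots> = v y" using y by simp
  finally show ?thesis .
qed

lemma tits_\<theta>: "tits (\<lambda>x. int (\<theta> x)) = 1"
proof -
  have "bil u u = 2 * tits u" for u
    by (simp add: bil_def tits_def power2_eq_square sum_distrib_left right_diff_distrib algebra_simps flip: sum.distrib)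
  then show ?thesis using bil_\<theta>[of "\<lambda>x. int (\<theta> x)"] by (simp add: \<theta>y)
qed

text \<open>
  The usual proof of positivity from a positive function \<open>\<theta>\<close> with \<open>2 \<theta> - nb \<theta> \<ge> 0\<close>; the last term comes
  from the defect at \<open>y\<close>.
\<close>

lemma tits_sum_of_squares:
  "real_of_int (tits e) = (\<Sum>a\<in>arcs Q. \<theta> (tail Q a) * \<theta> (head Q a) / 2 *
     (e (tail Q a) / \<theta> (tail Q a) - e (head Q a) / \<theta> (head Q a))\<^sup>2) + (e y)\<^sup>2 / 4"
proof -
  let ?w = "\<lambda>x. (real_of_int (e x))\<^sup>2 / (2 * real (\<theta> x))"
  have expand: "\<theta> (tail Q a) * \<theta> (head Q a) / 2 * (e (tail Q a) / \<theta> (tail Q a) - e (head Q a) / \<theta> (head Q a))\<^sup>2 =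
      ?w (tail Q a) * real (\<theta> (head Q a)) + ?w (head Q a) * real (\<theta> (tail Q a)) -
      real_of_int (e (tail Q a)) * real_of_int (e (head Q a))" if "a \<in> arcs Q" for a
  proof -
    have "real (\<theta> (tail Q a)) \<noteq> 0" "real (\<theta> (head Q a)) \<noteq> 0"
      using \<theta>_pos[OF tail_in_verts[OF that]] \<theta>_pos[OF head_in_verts[OF that]] by auto
    then show ?thesis by (simp add: field_simps power2_eq_square)
  qed
  have "(\<Sum>x\<in>verts Q. ?w x * real (nb \<theta> x)) = (\<Sum>x\<in>verts Q. (real_of_int (e x))\<^sup>2 - (if x = y then (real_of_int (e y))\<^sup>2 / 4 else 0))"
  proof (intro sum.cong refl)
    fix x assume x: "x \<in> verts Q"
    have "real (nb \<theta> x + (if x = y then 1 else 0)) = real (2 * \<theta> x)" by (simp only: \<theta>_nb[OF x])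
    then have "real (nb \<theta> x) + (if x = y then 1 else 0) = 2 * real (\<theta> x)"
      by (simp split: if_splits)
    then have "real (nb \<theta> x) = 2 * real (\<theta> x) - (if x = y then 1 else 0)" by simp
    then show "?w x * real (nb \<theta> x) = (real_of_int (e x))\<^sup>2 - (if x = y then (real_of_int (e y))\<^sup>2 / 4 else 0)"
      using \<theta>_pos[OF x] \<theta>y by (auto simp: field_simps)
  qed
  also have "\<dots> = (\<Sum>x\<in>verts Q. (real_of_int (e x))\<^sup>2) - (real_of_int (e y))\<^sup>2 / 4" using y by (simp add: sum_subtractf)
  finally have w: "(\<Sum>x\<in>verts Q. ?w x * real (nb \<theta> x)) = (\<Sum>x\<in>verts Q. (real_of_int (e x))\<^sup>2) - (real_of_int (e y))\<^sup>2 / 4" .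
  have "(\<Sum>a\<in>arcs Q. \<theta> (tail Q a) * \<theta> (head Q a) / 2 *
     (e (tail Q a) / \<theta> (tail Q a) - e (head Q a) / \<theta> (head Q a))\<^sup>2) =
    (\<Sum>a\<in>arcs Q. ?w (tail Q a) * real (\<theta> (head Q a)) + ?w (head Q a) * real (\<theta> (tail Q a))) -
    (\<Sum>a\<in>arcs Q. real_of_int (e (tail Q a)) * real_of_int (e (head Q a)))"
    unfolding sum_subtractf[symmetric] by (rule sum.cong[OF refl]) (rule expand)
  also have "\<dots> = (\<Sum>x\<in>verts Q. ?w x * real (nb \<theta> x)) -
    (\<Sum>a\<in>arcs Q. real_of_int (e (tail Q a)) * real_of_int (e (head Q a)))"
    by (simp only: sum_arcs_by_vertex[of ?w "\<lambda>x. real (\<theta> x)"] nb_of_nat)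
  finally show ?thesis using w by (simp add: tits_def)
qed

text \<open>
  All the squares vanish only if \<open>e / \<theta>\<close> is constant along arrows and zero at \<open>y\<close>. As the values of
  the form are integers, positive means at least \<open>1\<close>.
\<close>

lemma tits_pos:
  assumes "x \<in> verts Q" "e x \<noteq> 0" shows "tits e \<ge> 1"
proof (rule ccontr)
  assume "\<not> tits e \<ge> 1"
  then have le: "real_of_int (tits e) \<le> 0" by simp
  let ?s = "\<lambda>a. \<theta> (tail Q a) * \<theta> (head Q a) / 2 *
     (e (tail Q a) / \<theta> (tail Q a) - e (head Q a) / \<theta> (head Q a))\<^sup>2"
  have nn: "0 \<le> ?s a" for a by simp
  have s0: "sum ?s (arcs Q) = 0" and ey: "(real_of_int (e y))\<^sup>2 / 4 = 0"
    using le tits_sum_of_squares[of e] sum_nonneg[of "arcs Q" ?s] nn zero_le_power2[of "real_of_int (e y)"]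
    by (smt (verit) divide_nonneg_pos)+
  have "verts Q \<subseteq> {x. e x = 0}"
  proof (rule connected)
    show "y \<in> {x. e x = 0}" using ey by simp
    fix a assume a: "a \<in> arcs Q"
    then have "?s a = 0" using s0 sum_nonneg_eq_0_iff[of "arcs Q" ?s] nn by simp
    then show "tail Q a \<in> {x. e x = 0} \<longleftrightarrow> head Q a \<in> {x. e x = 0}"
      using \<theta>_pos[OF tail_in_verts[OF a]] \<theta>_pos[OF head_in_verts[OF a]] by (auto simp: field_simps)
  qed
  then show False using assms by auto
qed

lemma tits_zeroD: "tits e \<le> 0 \<Longrightarrow> x \<in> verts Q \<Longrightarrow> e x = 0"
  using tits_pos[of x e] by fastforce

text \<open>
  Let \<open>u\<close> and \<open>w\<close> be the pointwise maximum and minimum of \<open>e\<close> and \<open>\<theta>\<close>. By the rearrangement inequality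
  \<open>q u + q w \<le> q e + q \<theta> = 2\<close>, and \<open>w \<noteq> 0\<close>, so \<open>q u \<le> 1\<close>. With \<open>u = \<theta> + v\<close> and \<open>v \<ge> 0\<close> this reads
  \<open>1 + q v + v(y) \<le> 1\<close>, whence \<open>v = 0\<close>.
\<close>

lemma positive_root_le_\<theta>:
  assumes e: "tits (\<lambda>x. int (e x)) = 1" and x: "x \<in> verts Q"
  shows "e x \<le> \<theta> x"
proof -
  let ?u = "\<lambda>x. int (max (e x) (\<theta> x))" and ?w = "\<lambda>x. int (min (e x) (\<theta> x))"
  have sq: "(?u x)\<^sup>2 + (?w x)\<^sup>2 = (int (e x))\<^sup>2 + (int (\<theta> x))\<^sup>2" for x
    by (cases "e x \<le> \<theta> x") (auto simp: max_def min_def)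
  have rearr: "a * c + b * d \<le> max a b * max c d + min a b * min c d" for a b c d :: int
  proof -
    have "a \<le> b \<Longrightarrow> d \<le> c \<Longrightarrow> 0 \<le> (b - a) * (c - d)" "b \<le> a \<Longrightarrow> c \<le> d \<Longrightarrow> 0 \<le> (a - b) * (d - c)"
      by simp_all
    then show ?thesis by (cases "a \<le> b"; cases "c \<le> d") (auto simp: max_def min_def algebra_simps)
  qed
  have "tits ?u + tits ?w \<le> tits (\<lambda>x. int (e x)) + tits (\<lambda>x. int (\<theta> x))"
  proof -
    have "(\<Sum>x\<in>verts Q. (?u x)\<^sup>2) + (\<Sum>x\<in>verts Q. (?w x)\<^sup>2) =
        (\<Sum>x\<in>verts Q. (int (e x))\<^sup>2) + (\<Sum>x\<in>verts Q. (int (\<theta> x))\<^sup>2)"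
      by (simp only: sum.distrib[symmetric] sq)
    moreover have "(\<Sum>a\<in>arcs Q. int (e (tail Q a)) * int (e (head Q a))) +
        (\<Sum>a\<in>arcs Q. int (\<theta> (tail Q a)) * int (\<theta> (head Q a))) \<le>
        (\<Sum>a\<in>arcs Q. ?u (tail Q a) * ?u (head Q a)) + (\<Sum>a\<in>arcs Q. ?w (tail Q a) * ?w (head Q a))"
      unfolding sum.distrib[symmetric]
      by (intro sum_mono) (use rearr in \<open>simp add: of_nat_max of_nat_min\<close>)
    ultimately show ?thesis by (simp add: tits_def)
  qed
  then have le: "tits ?u + tits ?w \<le> 2" using e tits_\<theta> by simp
  have "\<exists>x\<in>verts Q. e x \<noteq> 0"
  proof (rule ccontr)
    assume "\<not> (\<exists>x\<in>verts Q. e x \<noteq> 0)"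
    then have "tits (\<lambda>x. int (e x)) = tits (\<lambda>x. 0)" by (intro tits_cong) auto
    then show False using e by (simp add: tits_def)
  qed
  then obtain z where z: "z \<in> verts Q" "e z \<noteq> 0" by blast
  then have "tits ?w \<ge> 1" using \<theta>_pos[OF z(1)] by (intro tits_pos[of z]) auto
  then have u1: "tits ?u \<le> 1" using le by simp
  let ?v = "\<lambda>x. int (e x - \<theta> x)"
  have "?u = (\<lambda>x. int (\<theta> x) + ?v x)" by (auto simp: fun_eq_iff max_def)
  then have "tits ?u = tits (\<lambda>x. int (\<theta> x)) + tits ?v + bil (\<lambda>x. int (\<theta> x)) ?v"
    using tits_add[of "\<lambda>x. int (\<theta> x)" ?v] by simp
  then have "tits ?u = 1 + tits ?v + ?v y" by (simp only: tits_\<theta> bil_\<theta>)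
  then have "tits ?v \<le> 0" using u1 by simp
  then show ?thesis using tits_zeroD[OF _ x, of ?v] by simp
qed

lemma maximal_positive_root_\<theta>:
  assumes "\<And>x. x \<in> verts Q \<Longrightarrow> d x = \<theta> x" shows "maximal_positive_root Q d"
proof -
  have "tits (\<lambda>x. int (d x)) = 1" using tits_cong[of "\<lambda>x. int (d x)" "\<lambda>x. int (\<theta> x)"] assms tits_\<theta> by simp
  then show ?thesis
    unfolding maximal_positive_root_def positive_root_def tits_form_eq
    using positive_root_le_\<theta> assms by simp
qed

lemma maximal_positive_root_eq:
  assumes "maximal_positive_root Q d" "x \<in> verts Q" shows "d x = \<theta> x"
proof (rule antisym)
  show "d x \<le> \<theta> x" using assms positive_root_le_\<theta>
    unfolding maximal_positive_root_def positive_root_def tits_form_eq by blast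
  show "\<theta> x \<le> d x" using assms tits_\<theta>
    unfolding maximal_positive_root_def positive_root_def tits_form_eq by blast
qed

lemma tits_add_2y:
  assumes "s y = 0"
  shows "tits (\<lambda>x. int (s x + (if x = y then 2 else 0))) = tits (\<lambda>x. int (s x)) + 4 - 2 * int (nb s y)"
proof -
  let ?d = "\<lambda>x. if x = y then 2 else (0::int)"
  have d: "tits ?d = 4"
  proof -
    have "(\<Sum>x\<in>verts Q. (?d x)\<^sup>2) = (\<Sum>x\<in>verts Q. if x = y then 4 else 0)" by (intro sum.cong) auto
    moreover have "(\<Sum>a\<in>arcs Q. ?d (tail Q a) * ?d (head Q a)) = 0"
      by (intro sum.neutral) (use no_loop_at_y in auto)
    ultimately show ?thesis using y by (simp add: tits_def)
  qed
  have b: "bil (\<lambda>x. int (s x)) ?d = - 2 * int (nb s y)"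
  proof -
    have "(\<Sum>a\<in>arcs Q. int (s (tail Q a)) * ?d (head Q a) + int (s (head Q a)) * ?d (tail Q a)) =
       (\<Sum>a\<in>arcs Q. ?d (tail Q a) * int (s (head Q a)) + ?d (head Q a) * int (s (tail Q a)))"
      by (intro sum.cong) (auto simp: algebra_simps)
    also have "\<dots> = (\<Sum>x\<in>verts Q. ?d x * int (nb s x))" by (simp only: sum_arcs_by_vertex[of ?d "\<lambda>x. int (s x)"] nb_of_nat)
    also have "\<dots> = (\<Sum>x\<in>verts Q. if x = y then 2 * int (nb s y) else 0)" by (intro sum.cong) auto
    also have "\<dots> = 2 * int (nb s y)" using y by simp
    finally have "(\<Sum>a\<in>arcs Q. int (s (tail Q a)) * ?d (head Q a) + int (s (head Q a)) * ?d (tail Q a)) = 2 * int (nb s y)" .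
    moreover have "(\<Sum>x\<in>verts Q. 2 * int (s x) * ?d x) = 0" by (intro sum.neutral) (use assms in auto)
    ultimately show ?thesis by (simp add: bil_def)
  qed
  have "tits (\<lambda>x. int (s x + (if x = y then 2 else 0))) = tits (\<lambda>x. int (s x) + ?d x)"
    by (intro tits_cong) auto
  then show ?thesis using tits_add[of "\<lambda>x. int (s x)" ?d] d b by simp
qed

text \<open>
  For two roots, \<open>q(m - \<theta>) = 2 - bil m \<theta> = 2 - m(y) = 0\<close>.
\<close>

lemma root_with_2y_is_\<theta>:
  assumes "tits (\<lambda>x. int (m x)) = 1" "m y = 2" "x \<in> verts Q"
  shows "m x = \<theta> x"
proof -
  have "tits (\<lambda>x. - int (\<theta> x)) = 1" using tits_\<theta> by (simp add: tits_def)
  moreover have "bil (\<lambda>x. int (m x)) (\<lambda>x. - int (\<theta> x)) = - bil (\<lambda>x. int (\<theta> x)) (\<lambda>x. int (m x))"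
  proof -
    have "(\<Sum>x\<in>verts Q. 2 * int (m x) * - int (\<theta> x)) = - (\<Sum>x\<in>verts Q. 2 * int (\<theta> x) * int (m x))"
      unfolding sum_negf[symmetric] by (intro sum.cong) auto
    moreover have "(\<Sum>a\<in>arcs Q. int (m (tail Q a)) * - int (\<theta> (head Q a)) + int (m (head Q a)) * - int (\<theta> (tail Q a))) =
        - (\<Sum>a\<in>arcs Q. int (\<theta> (tail Q a)) * int (m (head Q a)) + int (\<theta> (head Q a)) * int (m (tail Q a)))"
      unfolding sum_negf[symmetric] by (intro sum.cong) auto
    ultimately show ?thesis by (simp add: bil_def)
  qed
  ultimately have "tits (\<lambda>x. int (m x) + - int (\<theta> x)) = 0"
    using tits_add[of "\<lambda>x. int (m x)" "\<lambda>x. - int (\<theta> x)"] assms bil_\<theta>[of "\<lambda>x. int (m x)"] by simp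
  from tits_zeroD[OF _ assms(3), of "\<lambda>x. int (m x) + - int (\<theta> x)"] this show ?thesis by simp
qed

end

section \<open>The maximal root of each Dynkin diagram\<close>

fun diagram_root :: "dynkin \<Rightarrow> nat \<Rightarrow> nat" where
  "diagram_root (TypeD n) i = (if i = 1 \<or> i = 2 \<or> i = n then 1 else 2)"
| "diagram_root (TypeE m) i =
     (if m = 6 then [0, 3, 2, 2, 1, 2, 1] ! i
      else if m = 7 then [0, 4, 2, 3, 2, 3, 2, 1] ! i
      else [0, 6, 3, 4, 2, 5, 4, 3, 2] ! i)"

lemma edges_D:
  "{u, v} \<in> diagram_edges (TypeD n) \<longleftrightarrow> (u \<in> {1, 2} \<and> v = 3) \<or> (v \<in> {1, 2} \<and> u = 3) \<or>
     (3 \<le> u \<and> v = u + 1 \<and> v \<le> n) \<or> (3 \<le> v \<and> u = v + 1 \<and> u \<le> n)"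
proof -
  have "(\<exists>i. {u, v} = {i, i + 1} \<and> 3 \<le> i \<and> i + 1 \<le> n) \<longleftrightarrow>
      (3 \<le> u \<and> v = u + 1 \<and> v \<le> n) \<or> (3 \<le> v \<and> u = v + 1 \<and> u \<le> n)"
    unfolding doubleton_eq_iff by blast
  moreover have "{u, v} \<in> diagram_edges (TypeD n) \<longleftrightarrow> {u, v} = {1, 3} \<or> {u, v} = {2, 3} \<or>
      (\<exists>i. {u, v} = {i, i + 1} \<and> 3 \<le> i \<and> i + 1 \<le> n)"
    by simp
  ultimately show ?thesis unfolding doubleton_eq_iff insert_iff empty_iff by argo
qed

lemma edges_E:
  "{u, v} \<in> diagram_edges (TypeE m) \<longleftrightarrow>
     (u = 1 \<and> v \<in> {2, 3, 5}) \<or> (v = 1 \<and> u \<in> {2, 3, 5}) \<or> (u = 3 \<and> v = 4) \<or> (u = 4 \<and> v = 3) \<or>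
     (5 \<le> u \<and> v = u + 1 \<and> v \<le> m) \<or> (5 \<le> v \<and> u = v + 1 \<and> u \<le> m)"
proof -
  have "(\<exists>i. {u, v} = {i, i + 1} \<and> 5 \<le> i \<and> i + 1 \<le> m) \<longleftrightarrow>
      (5 \<le> u \<and> v = u + 1 \<and> v \<le> m) \<or> (5 \<le> v \<and> u = v + 1 \<and> u \<le> m)"
    unfolding doubleton_eq_iff by blast
  moreover have "{u, v} \<in> diagram_edges (TypeE m) \<longleftrightarrow> {u, v} = {1, 2} \<or> {u, v} = {1, 3} \<or>
      {u, v} = {3, 4} \<or> {u, v} = {1, 5} \<or> (\<exists>i. {u, v} = {i, i + 1} \<and> 5 \<le> i \<and> i + 1 \<le> m)"
    by simp
  ultimately show ?thesis unfolding doubleton_eq_iff insert_iff empty_iff by argo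
qed

definition is_DE :: "dynkin \<Rightarrow> bool" where
  "is_DE T \<longleftrightarrow> (\<exists>n\<ge>4. T = TypeD n) \<or> (\<exists>m\<in>{6, 7, 8}. T = TypeE m)"

definition diagram_nb :: "dynkin \<Rightarrow> nat \<Rightarrow> nat set" where
  "diagram_nb T u = {v \<in> diagram_verts T. {u, v} \<in> diagram_edges T}"

text \<open>
  An explicit list makes the sums over neighbours computable when the number of vertices is a
  variable.
\<close>

lemma diagram_nb_D:
  assumes "n \<ge> 4" "u \<in> {1..n}"
  shows "diagram_nb (TypeD n) u = (if u = 1 \<or> u = 2 then {3} else if u = 3 then {1, 2, 4}
    else if u < n then {u - 1, u + 1} else {u - 1})"
proof -
  have mem: "v \<in> diagram_nb (TypeD n) u \<longleftrightarrow> 1 \<le> v \<and> v \<le> n \<and> ((u \<in> {1, 2} \<and> v = 3) \<or> (v \<in> {1, 2} \<and> u = 3) \<or>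
     (3 \<le> u \<and> v = u + 1 \<and> v \<le> n) \<or> (3 \<le> v \<and> u = v + 1 \<and> u \<le> n))" for v
    unfolding diagram_nb_def mem_Collect_eq edges_D by simp
  consider "u = 1" | "u = 2" | "u = 3" | "3 < u" "u < n" | "3 < u" "u = n" using assms by fastforce
  then show ?thesis
  proof cases
    case 4
    have "v \<in> diagram_nb (TypeD n) u \<longleftrightarrow> v = u - 1 \<or> v = u + 1" for v
      unfolding mem using 4 by auto
    then show ?thesis using 4 by auto
  next
    case 5
    have "v \<in> diagram_nb (TypeD n) u \<longleftrightarrow> v = u - 1" for v
      unfolding mem using 5 by auto
    then show ?thesis using 5 by auto
  next
    case 3
    have "v \<in> diagram_nb (TypeD n) u \<longleftrightarrow> v = 1 \<or> v = 2 \<or> v = 4" for v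
      unfolding mem using 3 assms(1) by auto
    then show ?thesis using 3 by auto
  next
    case 1
    have "v \<in> diagram_nb (TypeD n) u \<longleftrightarrow> v = 3" for v unfolding mem using 1 assms(1) by auto
    then show ?thesis using 1 by auto
  next
    case 2
    have "v \<in> diagram_nb (TypeD n) u \<longleftrightarrow> v = 3" for v unfolding mem using 2 assms(1) by auto
    then show ?thesis using 2 by auto
  qed
qed

lemma atLeastAtMost_6: "{1..6::nat} = {1,2,3,4,5,6}"
  and atLeastAtMost_7: "{1..7::nat} = {1,2,3,4,5,6,7}"
  and atLeastAtMost_8: "{1..8::nat} = {1,2,3,4,5,6,7,8}"
  unfolding set_eq_iff atLeastAtMost_iff insert_iff empty_iff by presburger+

lemma diagram_root_sum_nb:
  assumes "is_DE T" "u \<in> diagram_verts T"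
  shows "(\<Sum>v\<in>diagram_nb T u. diagram_root T v) + (if u = exceptional_vertex T then 1 else 0) = 2 * diagram_root T u"
proof -
  consider n where "n \<ge> 4" "T = TypeD n" | m where "m \<in> {6, 7, 8}" "T = TypeE m"
    using assms(1) by (auto simp: is_DE_def)
  then show ?thesis
  proof cases
    case D: 1
    have u: "u \<in> {1..n}" using assms(2) D by simp
    consider "u = 1" | "u = 2" | "u = 3" "n = 4" | "u = 3" "4 < n" | "3 < u" "u + 1 < n" | "3 < u" "u + 1 = n" | "3 < u" "u = n"
      using D(1) u by fastforce
    then show ?thesis
    proof cases
      case 1
      then have "diagram_nb T u = {3}" using diagram_nb_D[OF D(1) u] by (simp add: D(2))
      then show ?thesis using 1 D(1) by (simp add: D(2))
    next
      case 2
      then have "diagram_nb T u = {3}" using diagram_nb_D[OF D(1) u] by (simp add: D(2))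
      then show ?thesis using 2 D(1) by (simp add: D(2))
    next
      case 3
      then have "diagram_nb T u = {1, 2, 4}" using diagram_nb_D[OF D(1) u] by (simp add: D(2))
      then show ?thesis using 3 D(1) by (simp add: D(2))
    next
      case 4
      then have "diagram_nb T u = {1, 2, 4}" using diagram_nb_D[OF D(1) u] by (simp add: D(2))
      then show ?thesis using 4 D(1) by (simp add: D(2))
    next
      case 5
      then have "diagram_nb T u = {u - 1, u + 1}" using diagram_nb_D[OF D(1) u] by (simp add: D(2))
      then show ?thesis using 5 D(1) by (auto simp: D(2))
    next
      case 6
      then have "diagram_nb T u = {u - 1, u + 1}" using diagram_nb_D[OF D(1) u] by (simp add: D(2))
      then show ?thesis using 6 D(1) by (auto simp: D(2))
    next
      case 7
      then have "diagram_nb T u = {u - 1}" using diagram_nb_D[OF D(1) u] by (simp add: D(2))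
      then show ?thesis using 7 D(1) by (auto simp: D(2))
    qed
  next
    case E: 2
    have nb: "diagram_nb T u = {v \<in> {1..m}. {u, v} \<in> diagram_edges (TypeE m)}"
      using E by (simp add: diagram_nb_def)
    have sum: "(\<Sum>v\<in>diagram_nb T u. diagram_root (TypeE m) v) =
        (\<Sum>v\<in>{1..m}. if {u, v} \<in> diagram_edges (TypeE m) then diagram_root (TypeE m) v else 0)"
      unfolding nb by (rule sum.inter_filter) simp
    have u: "u \<in> {1..m}" using assms(2) E by simp
    consider "m = 6" | "m = 7" | "m = 8" using E by blast
    then show ?thesis
    proof cases
      case 1
      then have "u = 1 \<or> u = 2 \<or> u = 3 \<or> u = 4 \<or> u = 5 \<or> u = 6" using u atLeastAtMost_6 by blast
      then show ?thesis 
        using sum[unfolded edges_E 1 atLeastAtMost_6]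
        by (elim disjE) (simp_all add: E(2) 1 del: diagram_verts.simps diagram_edges.simps)
    next
      case 2
      then have "u = 1 \<or> u = 2 \<or> u = 3 \<or> u = 4 \<or> u = 5 \<or> u = 6 \<or> u = 7" using u atLeastAtMost_7 by blast
      then show ?thesis 
        using sum[unfolded edges_E 2 atLeastAtMost_7]
        by (elim disjE) (simp_all add: E(2) 2 del: diagram_verts.simps diagram_edges.simps)
    next
      case 3
      then have "u = 1 \<or> u = 2 \<or> u = 3 \<or> u = 4 \<or> u = 5 \<or> u = 6 \<or> u = 7 \<or> u = 8" using u atLeastAtMost_8 by blast
      then show ?thesis 
        using sum[unfolded edges_E 3 atLeastAtMost_8]
        by (elim disjE) (simp_all add: E(2) 3 del: diagram_verts.simps diagram_edges.simps)
    qed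
  qed
qed

lemma diagram_verts_E:
  fixes m u :: nat
  assumes "m \<in> {6, 7, 8}" "u \<in> {1..m}"
  shows "u = 1 \<or> u = 2 \<or> u = 3 \<or> u = 4 \<or> u = 5 \<or> u = 6 \<or> (u = 7 \<and> 7 \<le> m) \<or> (u = 8 \<and> 8 \<le> m)"
  using assms unfolding insert_iff empty_iff atLeastAtMost_iff by presburger

lemma diagram_root_pos:
  assumes "is_DE T" "u \<in> diagram_verts T" shows "0 < diagram_root T u"
proof -
  consider n where "n \<ge> 4" "T = TypeD n" | m where "m \<in> {6, 7, 8}" "T = TypeE m"
    using assms(1) by (auto simp: is_DE_def)
  then show ?thesis
  proof cases
    case 2
    then have "u \<in> {1..m}" using assms(2) by simp
    from diagram_verts_E[OF 2(1) this] show ?thesis using 2 by (elim disjE conjE) auto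
  qed simp
qed

lemma diagram_root_exceptional:
  assumes "is_DE T" shows "diagram_root T (exceptional_vertex T) = 2"
    "exceptional_vertex T \<in> diagram_verts T"
  using assms by (auto simp: is_DE_def)

lemma diagram_connected:
  assumes T: "is_DE T" and e: "P (exceptional_vertex T)"
    and step: "\<And>u v. u \<in> diagram_verts T \<Longrightarrow> v \<in> diagram_verts T \<Longrightarrow> {u, v} \<in> diagram_edges T \<Longrightarrow> P u \<longleftrightarrow> P v"
    and u: "u \<in> diagram_verts T"
  shows "P u"
proof -
  consider n where "n \<ge> 4" "T = TypeD n" | m where "m \<in> {6, 7, 8}" "T = TypeE m"
    using T by (auto simp: is_DE_def)
  then show ?thesis
  proof cases
    case 1
    have s: "P u \<longleftrightarrow> P v" if "u \<in> {1..n}" "v \<in> {1..n}" "{u, v} \<in> diagram_edges (TypeD n)" for u v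
      using step that 1 by simp
    have chain: "P 3 \<longleftrightarrow> P i" if "3 \<le> i" "i \<le> n" for i
      using that
    proof (induction i rule: dec_induct)
      case (step i)
      then show ?case using s[of i "Suc i"] edges_D[of i "Suc i" n] by simp
    qed simp
    have "P (n - 1)" using e 1 by simp
    then have P3: "P 3" using chain[of "n - 1"] 1 by simp
    have "P 1" "P 2" using s[of 1 3] s[of 2 3] edges_D[of 1 3 n] edges_D[of 2 3 n] P3 1 by simp_all
    moreover have "u = 1 \<or> u = 2 \<or> (3 \<le> u \<and> u \<le> n)" using u 1 by auto
    ultimately show ?thesis using chain P3 by blast
  next
    case 2
    have s: "P u \<longleftrightarrow> P v" if "u \<in> {1..m}" "v \<in> {1..m}" "{u, v} \<in> diagram_edges (TypeE m)" for u v
      using step that 2 by simp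
    have "P 1 \<longleftrightarrow> P 2" "P 1 \<longleftrightarrow> P 3" "P 3 \<longleftrightarrow> P 4" "P 1 \<longleftrightarrow> P 5" "P 5 \<longleftrightarrow> P 6"
      using s[of 1 2] s[of 1 3] s[of 3 4] s[of 1 5] s[of 5 6] 2(1) unfolding edges_E by auto
    moreover have "7 \<le> m \<Longrightarrow> P 6 \<longleftrightarrow> P 7" "8 \<le> m \<Longrightarrow> P 7 \<longleftrightarrow> P 8"
      using s[of 6 7] s[of 7 8] unfolding edges_E by auto
    moreover have "P 2 \<or> P 4 \<or> P 8 \<and> m = 8" using e 2 by (auto split: if_splits)
    moreover have "u \<in> {1..m}" using u 2 by simp
    ultimately show ?thesis using diagram_verts_E[OF 2(1), of u] by auto
  qed
qed

lemma diagram_no_loop: "{u, u} \<notin> diagram_edges T"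
proof (cases T)
  case (TypeD n) then show ?thesis unfolding TypeD edges_D by auto
next
  case (TypeE m) then show ?thesis unfolding TypeE edges_E by auto
qed

text \<open>
  In a labelled quiver every edge of the diagram is a single arrow, so the neighbour sum of the
  diagram is that of the quiver, whatever the orientation.
\<close>

lemma dynkin_marked_quiver:
  fixes Q :: "('v, 'a) pre_digraph"
  assumes T: "is_DE T" and lab: "dynkin_labelling T Q f"
  shows "marked_quiver Q (f (exceptional_vertex T)) (\<lambda>x. diagram_root T (inv_into (diagram_verts T) f x))"
proof -
  let ?D = "diagram_verts T" and ?y = "f (exceptional_vertex T)"
  define \<theta> where "\<theta> = (\<lambda>x. diagram_root T (inv_into ?D f x))"
  define B where "B u v = {a \<in> arcs Q. {tail Q a, head Q a} = {f u, f v}}" for u v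
  have wf: "wf_digraph Q" and bij: "bij_betw f ?D (verts Q)"
    using lab by (auto simp: dynkin_labelling_def)
  have B1: "card (B u v) = 1" if "u \<in> ?D" "v \<in> ?D" "{u, v} \<in> diagram_edges T" for u v
    using lab that unfolding dynkin_labelling_def B_def Let_def by meson
  have B0: "B u v = {}" if "u \<in> ?D" "v \<in> ?D" "{u, v} \<notin> diagram_edges T" for u v
    using lab that unfolding dynkin_labelling_def B_def Let_def by meson
  interpret wf_digraph Q by (rule wf)
  have finD: "finite ?D" by (cases T) auto
  have fD: "f u \<in> verts Q" if "u \<in> ?D" for u using bij that by (auto dest: bij_betwE)
  have surj: "\<exists>u\<in>?D. x = f u" if "x \<in> verts Q" for x
    using bij that by (auto simp: bij_betw_def)
  have inj: "f u = f v \<longleftrightarrow> u = v" if "u \<in> ?D" "v \<in> ?D" for u v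
    using bij that by (auto simp: bij_betw_def dest: inj_onD)
  have \<theta>f: "\<theta> (f u) = diagram_root T u" if "u \<in> ?D" for u
    using bij that by (simp add: \<theta>_def bij_betw_def)
  have finB: "finite (B u v)" if "u \<in> ?D" "v \<in> ?D" for u v
    using B1[OF that] B0[OF that] card.infinite by (cases "{u, v} \<in> diagram_edges T") force+
  have "arcs Q \<subseteq> (\<Union>u\<in>?D. \<Union>v\<in>?D. B u v)"
  proof
    fix a assume a: "a \<in> arcs Q"
    obtain u v where "u \<in> ?D" "v \<in> ?D" "tail Q a = f u" "head Q a = f v"
      using surj[OF tail_in_verts[OF a]] surj[OF head_in_verts[OF a]] by metis
    then show "a \<in> (\<Union>u\<in>?D. \<Union>v\<in>?D. B u v)" using a by (auto simp: B_def)
  qed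
  then have "finite (arcs Q)" using finD finB by (meson finite_UN finite_subset)
  moreover have "finite (verts Q)" using bij finD bij_betw_finite by metis
  ultimately interpret quiver Q by unfold_locales
  have nb: "nb \<theta> (f u) = (\<Sum>v\<in>diagram_nb T u. diagram_root T v)" if u: "u \<in> ?D" for u
  proof -
    have g1: "(\<Sum>a\<in>{a\<in>arcs Q. tail Q a = f u}. \<theta> (head Q a)) =
        (\<Sum>x\<in>verts Q. card {a\<in>arcs Q. tail Q a = f u \<and> head Q a = x} * \<theta> x)"
      by (subst sum.group[of "{a\<in>arcs Q. tail Q a = f u}" "verts Q" "head Q", symmetric])
        (auto simp: conj_assoc)
    have g2: "(\<Sum>a\<in>{a\<in>arcs Q. head Q a = f u}. \<theta> (tail Q a)) =
        (\<Sum>x\<in>verts Q. card {a\<in>arcs Q. head Q a = f u \<and> tail Q a = x} * \<theta> x)"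
      by (subst sum.group[of "{a\<in>arcs Q. head Q a = f u}" "verts Q" "tail Q", symmetric])
        (auto simp: conj_assoc)
    have "nb \<theta> (f u) = (\<Sum>x\<in>verts Q. (card {a\<in>arcs Q. tail Q a = f u \<and> head Q a = x} +
        card {a\<in>arcs Q. head Q a = f u \<and> tail Q a = x}) * \<theta> x)"
      unfolding nb_def g1 g2 by (simp add: sum.distrib algebra_simps)
    also have "\<dots> = (\<Sum>v\<in>?D. (card {a\<in>arcs Q. tail Q a = f u \<and> head Q a = f v} +
        card {a\<in>arcs Q. head Q a = f u \<and> tail Q a = f v}) * \<theta> (f v))"
      by (rule sum.reindex_bij_betw[OF bij, symmetric])
    also have "\<dots> = (\<Sum>v\<in>?D. if {u, v} \<in> diagram_edges T then diagram_root T v else 0)"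
    proof (intro sum.cong refl)
      fix v assume v: "v \<in> ?D"
      let ?X = "{a\<in>arcs Q. tail Q a = f u \<and> head Q a = f v}" and ?Y = "{a\<in>arcs Q. head Q a = f u \<and> tail Q a = f v}"
      have XY: "?X \<union> ?Y = B u v" by (auto simp: B_def doubleton_eq_iff)
      show "(card ?X + card ?Y) * \<theta> (f v) = (if {u, v} \<in> diagram_edges T then diagram_root T v else 0)"
      proof (cases "{u, v} \<in> diagram_edges T")
        case True
        then have "u \<noteq> v" using diagram_no_loop by auto
        then have "?X \<inter> ?Y = {}" using inj[OF u v] by auto
        then have "card ?X + card ?Y = card (?X \<union> ?Y)" by (intro card_Un_disjoint[symmetric]) auto
        then show ?thesis using True B1[OF u v] XY \<theta>f[OF v] by simp
      next
        case False
        then have "?X = {}" "?Y = {}" using B0[OF u v] XY by auto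
        then show ?thesis using False by (simp only: card.empty) simp
      qed
    qed
    also have "\<dots> = (\<Sum>v\<in>diagram_nb T u. diagram_root T v)"
      unfolding diagram_nb_def by (rule sum.inter_filter[OF finD, symmetric])
    finally show ?thesis .
  qed
  have "marked_quiver Q ?y \<theta>"
  proof unfold_locales
    show "?y \<in> verts Q" by (rule fD[OF diagram_root_exceptional(2)[OF T]])
    show "\<theta> ?y = 2" using \<theta>f diagram_root_exceptional[OF T] by simp
    show "0 < \<theta> x" if "x \<in> verts Q" for x
      using surj[OF that] \<theta>f diagram_root_pos[OF T] by auto
    show "nb \<theta> x + (if x = ?y then 1 else 0) = 2 * \<theta> x" if x: "x \<in> verts Q" for x
    proof -
      obtain u where u: "u \<in> ?D" "x = f u" using surj[OF x] by blast
      then show ?thesis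
        using diagram_root_sum_nb[OF T u(1)] nb[OF u(1)] \<theta>f[OF u(1)] inj[OF u(1) diagram_root_exceptional(2)[OF T]]
        by simp
    qed
    fix Z assume y: "?y \<in> Z" and Z: "\<And>a. a \<in> arcs Q \<Longrightarrow> (tail Q a \<in> Z) = (head Q a \<in> Z)"
    have "f u \<in> Z" if "u \<in> ?D" for u
    proof (rule diagram_connected[OF T _ _ that, of "\<lambda>u. f u \<in> Z"])
      show "?y \<in> Z" by (rule y)
      fix u v assume uv: "u \<in> ?D" "v \<in> ?D" "{u, v} \<in> diagram_edges T"
      then have "B u v \<noteq> {}" using B1[OF uv] by auto
      then obtain a where "a \<in> arcs Q" "{tail Q a, head Q a} = {f u, f v}" by (auto simp: B_def)
      then show "(f u \<in> Z) = (f v \<in> Z)" using Z[of a] by (auto simp: doubleton_eq_iff)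
    qed
    then show "verts Q \<subseteq> Z" using surj by blast
  qed
  then show ?thesis by (simp add: \<theta>_def)
qed

section \<open>Matrices as operators\<close>

text \<open>
  Column vectors of length \<open>n\<close> are the sequences that vanish from \<open>n\<close> on. All lengths live in one type, which
  makes spaces of different dimension subspaces of one function space.
\<close>

abbreviation cs :: "nat \<Rightarrow> (nat \<Rightarrow> 'k::field) set" where
  "cs n \<equiv> fsupp {..<n}"

lemma cs_iff: "v \<in> cs n \<longleftrightarrow> (\<forall>i\<ge>n. v i = 0)"
  by (auto simp: fsupp_def not_less)

lemma fds_cs: "fds (cs n)" and dim_cs: "fs.dim (cs n :: (nat \<Rightarrow> 'k::field) set) = n"
  using fsupp_fds_dim[of "{..<n}", where 'k = 'k] fsupp_fds_dim(1)[of "{..<n}"] by auto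

lemma cs_0: "v \<in> cs 0 \<longleftrightarrow> v = 0"
  unfolding cs_iff by (auto simp: fun_eq_iff pointwise)

lemma unitf_cs: "j < n \<Longrightarrow> unitf j \<in> cs n"
  by (auto simp: cs_iff unitf_def)

lemma unitf_nz: "unitf j \<noteq> (0 :: 'i \<Rightarrow> 'k::field)"
proof
  assume "unitf j = (0 :: 'i \<Rightarrow> 'k)"
  then have "unitf j j = (0 :: 'i \<Rightarrow> 'k) j" by simp
  then show False by (simp add: unitf_def pointwise)
qed

text \<open>
  The value is a coordinate vector for every argument, so that no carrier condition is needed
  for linearity.
\<close>

definition mact :: "'k::field mat \<Rightarrow> (nat \<Rightarrow> 'k) \<Rightarrow> nat \<Rightarrow> 'k" where
  "mact A v = (\<lambda>i. if i < dim_row A then \<Sum>j<dim_col A. A $$ (i, j) * v j else 0)"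

definition lmat :: "nat \<Rightarrow> nat \<Rightarrow> ((nat \<Rightarrow> 'k::field) \<Rightarrow> nat \<Rightarrow> 'k) \<Rightarrow> 'k mat" where
  "lmat m n g = mat m n (\<lambda>(i, j). g (unitf j) i)"

lemma mact_linear: "flinear (mact A)"
  by (rule flinearI) (auto simp: mact_def fun_eq_iff pointwise algebra_simps sum.distrib sum_distrib_left)

lemma mact_cs: "A \<in> carrier_mat m n \<Longrightarrow> mact A v \<in> cs m"
  by (auto simp: mact_def cs_iff)

lemma mact_mult:
  assumes A: "A \<in> carrier_mat m n" and B: "B \<in> carrier_mat n p"
  shows "mact (A * B) v = mact A (mact B v)"
proof
  fix i
  show "mact (A * B) v i = mact A (mact B v) i"
  proof (cases "i < m")
    case True
    have "mact (A * B) v i = (\<Sum>j<p. (\<Sum>l<n. A $$ (i, l) * B $$ (l, j)) * v j)"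
      using A B True by (simp add: mact_def scalar_prod_def lessThan_atLeast0)
    also have "\<dots> = (\<Sum>j<p. \<Sum>l<n. A $$ (i, l) * (B $$ (l, j) * v j))"
      by (simp add: sum_distrib_right mult.assoc)
    also have "\<dots> = (\<Sum>l<n. \<Sum>j<p. A $$ (i, l) * (B $$ (l, j) * v j))" by (rule sum.swap)
    also have "\<dots> = mact A (mact B v) i"
      using A B True by (simp add: mact_def sum_distrib_left)
    finally show ?thesis .
  next
    case False
    then show ?thesis using A B by (simp add: mact_def)
  qed
qed

lemma mact_one: "v \<in> cs n \<Longrightarrow> mact (1\<^sub>m n) v = v"
proof
  fix i assume v: "v \<in> cs n"
  have "(\<Sum>j<n. (if i = j then 1 else 0) * v j) = (\<Sum>j<n. if i = j then v j else 0)"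
    by (intro sum.cong) auto
  then show "mact (1\<^sub>m n) v i = v i" using v by (simp add: mact_def cs_iff)
qed

lemma mact_zero: "mact (0\<^sub>m m n) v = 0"
  by (auto simp: mact_def fun_eq_iff pointwise)

lemma mact_smult: "mact (c \<cdot>\<^sub>m A) v = fscale c (mact A v)"
  by (auto simp: mact_def fun_eq_iff pointwise sum_distrib_left mult.assoc)

lemma lmat_carrier: "lmat m n g \<in> carrier_mat m n"
  by (simp add: lmat_def)

lemma mact_lmat:
  assumes g: "flinear g" "\<And>v. v \<in> cs n \<Longrightarrow> g v \<in> cs m" and v: "v \<in> cs n"
  shows "mact (lmat m n g) v = g v"
proof
  fix i
  have gv: "g v = (\<Sum>j<n. fscale (v j) (g (unitf j)))"
    using arg_cong[OF fsupp_expand[OF _ v], of g] by (simp add: flinear_simps[OF g(1)])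
  show "mact (lmat m n g) v i = g v i"
  proof (cases "i < m")
    case True
    then show ?thesis unfolding gv by (simp add: mact_def lmat_def sum_apply pointwise mult.commute)
  next
    case False
    then show ?thesis using g(2)[OF v] by (simp add: mact_def lmat_def cs_iff)
  qed
qed

lemma mact_unitf:
  assumes "A \<in> carrier_mat m n" "i < m" "j < n" shows "mact A (unitf j) i = A $$ (i, j)"
proof -
  have "(\<Sum>l<n. A $$ (i, l) * unitf j l) = (\<Sum>l<n. if l = j then A $$ (i, l) else 0)"
    by (intro sum.cong) (auto simp: unitf_def)
  then show ?thesis using assms by (simp add: mact_def)
qed

lemma mact_inject:
  assumes "A \<in> carrier_mat m n" "B \<in> carrier_mat m n" "\<And>v. v \<in> cs n \<Longrightarrow> mact A v = mact B v"
  shows "A = B"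
proof (rule eq_matI)
  fix i j assume "i < dim_row B" "j < dim_col B"
  then have "i < m" "j < n" using assms by auto
  then show "A $$ (i, j) = B $$ (i, j)"
    using mact_unitf[OF assms(1)] mact_unitf[OF assms(2)] assms(3)[OF unitf_cs] by metis
qed (use assms in auto)

text \<open>
  The passage from the vectors of the matrix library to sequences. It is needed only to read the
  definition of exactness.
\<close>

definition vf :: "'k::field vec \<Rightarrow> nat \<Rightarrow> 'k" where
  "vf v = (\<lambda>i. if i < dim_vec v then v $ i else 0)"

lemma vf_cs: "v \<in> carrier_vec n \<Longrightarrow> vf v \<in> cs n"
  by (auto simp: vf_def cs_iff)

lemma vf_vec: "w \<in> cs n \<Longrightarrow> vf (vec n w) = w"
  by (auto simp: vf_def cs_iff fun_eq_iff)

lemma vf_inject: "u \<in> carrier_vec n \<Longrightarrow> v \<in> carrier_vec n \<Longrightarrow> vf u = vf v \<longleftrightarrow> u = v"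
  by (auto simp: vf_def fun_eq_iff intro!: eq_vecI)

lemma vf_image: "vf ` carrier_vec n = (cs n :: (nat \<Rightarrow> 'k::field) set)"
proof
  show "(cs n :: (nat \<Rightarrow> 'k) set) \<subseteq> vf ` carrier_vec n"
  proof
    fix w :: "nat \<Rightarrow> 'k" assume "w \<in> cs n"
    then have "w = vf (vec n w)" by (rule vf_vec[symmetric])
    then show "w \<in> vf ` carrier_vec n" by (rule image_eqI) simp
  qed
qed (auto simp: vf_cs)

lemma vf_mult: "A \<in> carrier_mat m n \<Longrightarrow> v \<in> carrier_vec n \<Longrightarrow> vf (A *\<^sub>v v) = mact A (vf v)"
  by (auto simp: vf_def mact_def fun_eq_iff scalar_prod_def lessThan_atLeast0 intro!: sum.cong)

lemma vf_zero: "vf (0\<^sub>v n) = 0"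
  by (auto simp: vf_def fun_eq_iff pointwise)

text \<open>
  The two halves of a concatenated coordinate vector and the concatenation \<open>vappend\<close>, by which block
  diagonal matrices act.
\<close>

definition vtake :: "nat \<Rightarrow> (nat \<Rightarrow> 'k::field) \<Rightarrow> nat \<Rightarrow> 'k" where
  "vtake n w = (\<lambda>i. if i < n then w i else 0)"
definition vdrop :: "nat \<Rightarrow> (nat \<Rightarrow> 'k::field) \<Rightarrow> nat \<Rightarrow> 'k" where
  "vdrop n w = (\<lambda>i. w (i + n))"
definition vappend :: "nat \<Rightarrow> (nat \<Rightarrow> 'k::field) \<Rightarrow> (nat \<Rightarrow> 'k) \<Rightarrow> nat \<Rightarrow> 'k" where
  "vappend n u v = (\<lambda>i. if i < n then u i else v (i - n))"

lemma vtake_linear: "flinear (vtake n)" and vdrop_linear: "flinear (vdrop n)"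
  by (rule flinearI; auto simp: vtake_def vdrop_def fun_eq_iff pointwise)+

lemma vappend_linear: "flinear f \<Longrightarrow> flinear g \<Longrightarrow> flinear (\<lambda>v. vappend n (f v) (g v))"
  by (rule flinearI) (simp_all add: flinear_simps, simp_all add: vappend_def fun_eq_iff pointwise)

lemma vappend_diff: "vappend n u v - vappend n u' v' = vappend n (u - u') (v - v')"
  and vappend_zero: "vappend n 0 0 = (0 :: nat \<Rightarrow> 'k::field)"
  by (auto simp: vappend_def fun_eq_iff pointwise)

lemma vtake_vappend: "u \<in> cs n \<Longrightarrow> vtake n (vappend n u v) = u" and vdrop_vappend: "vdrop n (vappend n u v) = v"
  and vappend_vtake_vdrop: "vappend n (vtake n w) (vdrop n w) = w"
  by (auto simp: vtake_def vdrop_def vappend_def cs_iff fun_eq_iff)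

lemma vtake_cs: "vtake n w \<in> cs n" and vdrop_cs: "w \<in> cs (n + m) \<Longrightarrow> vdrop n w \<in> cs m"
  and vappend_cs: "v \<in> cs m \<Longrightarrow> vappend n u v \<in> cs (n + m)"
  by (auto simp: vtake_def vdrop_def vappend_def cs_iff)

lemma mact_dsum:
  assumes A: "A \<in> carrier_mat m n" and B: "B \<in> carrier_mat m' n'"
  shows "mact (mat_dsum A B) w = vappend m (mact A (vtake n w)) (mact B (vdrop n w))"
proof
  fix i
  have car: "mat_dsum A B \<in> carrier_mat (m + m') (n + n')"
    using A B unfolding mat_dsum_def by auto
  have ent: "i < m + m' \<Longrightarrow> j < n + n' \<Longrightarrow> mat_dsum A B $$ (i, j) =
      (if i < m then if j < n then A $$ (i, j) else 0 else if j < n then 0 else B $$ (i - m, j - n))" for j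
    using A B unfolding mat_dsum_def by auto
  have split: "(\<Sum>j<n + n'. h j) = (\<Sum>j<n. h j) + (\<Sum>j<n'. h (j + n))" for h :: "nat \<Rightarrow> 'a"
    by (induction n') (auto simp: algebra_simps)
  show "mact (mat_dsum A B) w i = vappend m (mact A (vtake n w)) (mact B (vdrop n w)) i"
  proof (cases "i < m + m'")
    case True
    then have "mact (mat_dsum A B) w i = (\<Sum>j<n + n'. mat_dsum A B $$ (i, j) * w j)"
      using car by (simp add: mact_def)
    also have "\<dots> = (\<Sum>j<n. (if i < m then A $$ (i, j) else 0) * w j) +
        (\<Sum>j<n'. (if i < m then 0 else B $$ (i - m, j)) * w (j + n))"
      unfolding split using True by (intro arg_cong2[of _ _ _ _ "(+)"] sum.cong refl) (auto simp: ent)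
    also have "\<dots> = vappend m (mact A (vtake n w)) (mact B (vdrop n w)) i"
      using A B True by (auto simp: vappend_def mact_def vtake_def vdrop_def)
    finally show ?thesis .
  next
    case False
    then show ?thesis using car A B by (auto simp: mact_def vappend_def)
  qed
qed

section \<open>Matrix representations\<close>

abbreviation rV :: "('v, 'a, 'k::field) rep \<Rightarrow> 'v \<Rightarrow> (nat \<Rightarrow> 'k) set" where
  "rV X \<equiv> \<lambda>x. cs (dimv X x)"

abbreviation rT :: "('v, 'a, 'k::field) rep \<Rightarrow> 'a \<Rightarrow> (nat \<Rightarrow> 'k) \<Rightarrow> nat \<Rightarrow> 'k" where
  "rT X \<equiv> \<lambda>a. mact (lin X a)"

context quiver
begin

lemma frep_rep: "is_rep Q X \<Longrightarrow> frep (rV X) (rT X)"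
  unfolding frep_def is_rep_def by (auto intro: mact_linear mact_cs fds_cs)

lemma fhom_mor:
  assumes X: "is_rep Q X" and Y: "is_rep Q Y" and m: "is_mor Q X Y \<phi>"
  shows "fhom (rV X) (rT X) (rV Y) (rT Y) (\<lambda>x. mact (\<phi> x))"
  unfolding fhom_def ffam_def
proof (intro conjI ballI)
  show "flinear (mact (\<phi> x))" for x by (rule mact_linear)
  show "mact (\<phi> x) v \<in> rV Y x" if "x \<in> verts Q" for x v
    using m that by (auto simp: is_mor_def intro: mact_cs)
  fix a v assume a: "a \<in> arcs Q"
  have "mact (\<phi> (head Q a) * lin X a) v = mact (lin Y a * \<phi> (tail Q a)) v"
    using m a by (simp add: is_mor_def)
  moreover have "mact (\<phi> (head Q a) * lin X a) v = mact (\<phi> (head Q a)) (mact (lin X a) v)"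
    by (rule mact_mult[of _ "dimv Y (head Q a)" "dimv X (head Q a)" _ "dimv X (tail Q a)"])
      (use m X a head_in_verts[OF a] in \<open>auto simp: is_mor_def is_rep_def\<close>)
  moreover have "mact (lin Y a * \<phi> (tail Q a)) v = mact (lin Y a) (mact (\<phi> (tail Q a)) v)"
    by (rule mact_mult[of _ "dimv Y (head Q a)" "dimv Y (tail Q a)" _ "dimv X (tail Q a)"])
      (use m Y a tail_in_verts[OF a] in \<open>auto simp: is_mor_def is_rep_def\<close>)
  ultimately show "mact (\<phi> (head Q a)) (rT X a v) = rT Y a (mact (\<phi> (tail Q a)) v)" by simp
qed

definition mor_of :: "('v, 'a, 'k::field) rep \<Rightarrow> ('v, 'a, 'k) rep \<Rightarrow> ('v \<Rightarrow> (nat \<Rightarrow> 'k) \<Rightarrow> nat \<Rightarrow> 'k) \<Rightarrow> ('v, 'k) mor" where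
  "mor_of X Y g = (\<lambda>x. lmat (dimv Y x) (dimv X x) (g x))"

lemma mact_mor_of:
  assumes "ffam (rV X) (rV Y) g" "x \<in> verts Q" "v \<in> rV X x"
  shows "mact (mor_of X Y g x) v = g x v"
  unfolding mor_of_def by (rule mact_lmat) (use assms in \<open>auto simp: ffam_def\<close>)

lemma mor_of_carrier: "mor_of X Y g x \<in> carrier_mat (dimv Y x) (dimv X x)"
  by (simp add: mor_of_def lmat_carrier)

lemma is_mor_of:
  assumes X: "is_rep Q X" and Y: "is_rep Q Y" and g: "fhom (rV X) (rT X) (rV Y) (rT Y) g"
  shows "is_mor Q X Y (mor_of X Y g)"
  unfolding is_mor_def
proof (intro conjI ballI)
  show "mor_of X Y g x \<in> carrier_mat (dimv Y x) (dimv X x)" for x by (rule mor_of_carrier)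
  fix a assume a: "a \<in> arcs Q"
  have cX: "lin X a \<in> carrier_mat (dimv X (head Q a)) (dimv X (tail Q a))"
    and cY: "lin Y a \<in> carrier_mat (dimv Y (head Q a)) (dimv Y (tail Q a))"
    using X Y a by (auto simp: is_rep_def)
  show "mor_of X Y g (head Q a) * lin X a = lin Y a * mor_of X Y g (tail Q a)"
  proof (rule mact_inject[OF mult_carrier_mat[OF mor_of_carrier cX] mult_carrier_mat[OF cY mor_of_carrier]])
    fix v assume v: "v \<in> rV X (tail Q a)"
    show "mact (mor_of X Y g (head Q a) * lin X a) v = mact (lin Y a * mor_of X Y g (tail Q a)) v"
      unfolding mact_mult[OF mor_of_carrier cX] mact_mult[OF cY mor_of_carrier]
      using mact_mor_of[OF fhomD(1)[OF g]] tail_in_verts[OF a] head_in_verts[OF a] v fhomD(4)[OF g a v]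
        mact_cs[OF cX] by simp
  qed
qed

lemma mor_eq_iff:
  assumes "\<And>x. x \<in> verts Q \<Longrightarrow> \<phi> x \<in> carrier_mat (m x) (n x)" "\<And>x. x \<in> verts Q \<Longrightarrow> \<psi> x \<in> carrier_mat (m x) (n x)"
  shows "mor_eq Q \<phi> \<psi> \<longleftrightarrow> (\<forall>x\<in>verts Q. \<forall>v\<in>cs (n x). mact (\<phi> x) v = mact (\<psi> x) v)"
  unfolding mor_eq_def using mact_inject[OF assms] by metis

lemma mor_comp_carrier:
  assumes "is_mor Q X Y \<phi>" "is_mor Q Y Z \<psi>" "x \<in> verts Q"
  shows "mor_comp \<psi> \<phi> x \<in> carrier_mat (dimv Z x) (dimv X x)"
    "mact (mor_comp \<psi> \<phi> x) v = mact (\<psi> x) (mact (\<phi> x) v)"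
  using assms unfolding mor_comp_def is_mor_def by (auto intro: mact_mult mult_carrier_mat)

lemma zero_mor_iff:
  assumes "\<And>x. x \<in> verts Q \<Longrightarrow> \<phi> x \<in> carrier_mat (m x) (n x)"
  shows "zero_mor Q \<phi> \<longleftrightarrow> fzero (\<lambda>x. cs (n x)) (\<lambda>x. mact (\<phi> x))"
proof -
  have "\<phi> x = 0\<^sub>m (dim_row (\<phi> x)) (dim_col (\<phi> x)) \<longleftrightarrow> (\<forall>v\<in>cs (n x). mact (\<phi> x) v = 0)" if "x \<in> verts Q" for x
    using mact_inject[OF assms[OF that] zero_carrier_mat] assms[OF that] mact_zero by (metis carrier_matD)
  then show ?thesis by (auto simp: zero_mor_def fzero_def)
qed

lemma nonzero_rV:
  fixes X :: "('v, 'a, 'k::field) rep"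
  shows "nonzero (rV X) \<longleftrightarrow> \<not> zero_rep Q X"
proof -
  have "(\<exists>v\<in>cs n. v \<noteq> (0 :: nat \<Rightarrow> 'k)) \<longleftrightarrow> n \<noteq> 0" for n
    using unitf_cs[of 0 n] unitf_nz[of 0] cs_0 by (metis bot_nat_0.not_eq_extremum)
  then show ?thesis by (simp add: nonzero_def zero_rep_def)
qed

lemma rep_iso_iff:
  assumes X: "is_rep Q X" and Y: "is_rep Q Y"
  shows "rep_iso Q X Y \<longleftrightarrow> (\<exists>g h. fhom (rV X) (rT X) (rV Y) (rT Y) g \<and> fhom (rV Y) (rT Y) (rV X) (rT X) h \<and>
     (\<forall>x\<in>verts Q. (\<forall>v\<in>rV X x. h x (g x v) = v) \<and> (\<forall>v\<in>rV Y x. g x (h x v) = v)))" (is "?L \<longleftrightarrow> ?R")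
proof
  assume ?L
  then obtain \<phi> \<psi> where m: "is_mor Q X Y \<phi>" "is_mor Q Y X \<psi>"
    and e: "mor_eq Q (mor_comp \<psi> \<phi>) (id_mor X)" "mor_eq Q (mor_comp \<phi> \<psi>) (id_mor Y)"
    unfolding rep_iso_def by blast
  have "mact (\<psi> x) (mact (\<phi> x) v) = v" if "x \<in> verts Q" "v \<in> rV X x" for x v
    using e(1) mor_comp_carrier(2)[OF m that(1), of v] that mact_one[OF that(2)] unfolding mor_eq_def by metis
  moreover have "mact (\<phi> x) (mact (\<psi> x) v) = v" if "x \<in> verts Q" "v \<in> rV Y x" for x v
    using e(2) mor_comp_carrier(2)[OF m(2,1) that(1), of v] that mact_one[OF that(2)] unfolding mor_eq_def by metis
  ultimately show ?R using fhom_mor[OF X Y m(1)] fhom_mor[OF Y X m(2)]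
    by (intro exI[of _ "\<lambda>x. mact (\<phi> x)"] exI[of _ "\<lambda>x. mact (\<psi> x)"] conjI ballI)
next
  assume ?R
  then obtain g h where gh: "fhom (rV X) (rT X) (rV Y) (rT Y) g" "fhom (rV Y) (rT Y) (rV X) (rT X) h"
    "\<And>x v. x \<in> verts Q \<Longrightarrow> v \<in> rV X x \<Longrightarrow> h x (g x v) = v" "\<And>x v. x \<in> verts Q \<Longrightarrow> v \<in> rV Y x \<Longrightarrow> g x (h x v) = v"
    by blast
  note m = is_mor_of[OF X Y gh(1)] is_mor_of[OF Y X gh(2)]
  note [simp] = mact_mor_of[OF fhomD(1)[OF gh(1)]] mact_mor_of[OF fhomD(1)[OF gh(2)]] fhomD(3)[OF gh(1)] fhomD(3)[OF gh(2)]
  have "mor_eq Q (mor_comp (mor_of Y X h) (mor_of X Y g)) (id_mor X)"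
    by (subst mor_eq_iff[of _ "dimv X" "dimv X"]) (simp_all add: mor_comp_carrier[OF m] mact_one gh)
  moreover have "mor_eq Q (mor_comp (mor_of X Y g) (mor_of Y X h)) (id_mor Y)"
    by (subst mor_eq_iff[of _ "dimv Y" "dimv Y"]) (simp_all add: mor_comp_carrier[OF m(2,1)] mact_one gh)
  ultimately show ?L unfolding rep_iso_def using m by blast
qed

text \<open>
  Bases of the spaces turn the operators into matrices.
\<close>

lemma matrix_model:
  fixes V :: "'v \<Rightarrow> ('i \<Rightarrow> 'k::field) set"
  assumes V: "frep V T"
  obtains X :: "('v, 'a, 'k) rep" and g h where "is_rep Q X" "\<And>x. x \<in> verts Q \<Longrightarrow> dimv X x = fdimv V x"
    "fhom (rV X) (rT X) V T g" "fhom V T (rV X) (rT X) h"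
    "\<And>x v. x \<in> verts Q \<Longrightarrow> v \<in> rV X x \<Longrightarrow> h x (g x v) = v" "\<And>x v. x \<in> verts Q \<Longrightarrow> v \<in> V x \<Longrightarrow> g x (h x v) = v"
proof -
  have "\<forall>x\<in>verts Q. \<exists>b. \<exists>c. is_chart (V x) b c" using is_chart_exists frepD(1)[OF V] by auto
  then obtain bV cV where ch: "\<And>x. x \<in> verts Q \<Longrightarrow> is_chart (V x) (bV x) (cV x)" by metis
  define g where "g x w = (\<Sum>j<fs.dim (V x). fscale (w j) (bV x j))" for x and w :: "nat \<Rightarrow> 'k"
  define h where "h x v = (\<lambda>j. if j < fs.dim (V x) then cV x j v else 0)" for x v
  have g_lin: "flinear (g x)" for x
    by (rule flinearI) (simp_all add: g_def pointwise(1,5) fs.scale_left_distrib sum.distrib fs.scale_sum_right)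
  have h_lin: "flinear (h x)" if "x \<in> verts Q" for x
    by (rule flinearI) (auto simp: h_def fun_eq_iff pointwise is_chartD(2,3)[OF ch[OF that]])
  have gV: "g x w \<in> V x" if "x \<in> verts Q" for x w
    unfolding g_def using is_chartD(1)[OF ch[OF that]]
    by (intro fds_closed(6)[OF frepD(1)[OF V that]] fds_closed(5)[OF frepD(1)[OF V that]]) auto
  have h_cs: "h x v \<in> cs (fdimv V x)" for x v by (simp add: h_def cs_iff)
  have gh: "g x (h x v) = v" if "x \<in> verts Q" "v \<in> V x" for x v
    using is_chartD(4)[OF ch[OF that(1)] that(2)] by (simp add: g_def h_def)
  have hg: "h x (g x w) = w" if x: "x \<in> verts Q" and w: "w \<in> cs (fdimv V x)" for x w
  proof
    fix i
    show "h x (g x w) i = w i"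
    proof (cases "i < fs.dim (V x)")
      case True
      have "cV x i (g x w) = (\<Sum>j<fs.dim (V x). w j * cV x i (bV x j))"
        by (simp add: g_def is_chart_sum[OF ch[OF x]] is_chartD(3)[OF ch[OF x]])
      also have "\<dots> = (\<Sum>j<fs.dim (V x). if i = j then w j else 0)"
        by (intro sum.cong) (auto simp: is_chartD(5)[OF ch[OF x] True])
      finally show ?thesis using True by (simp add: h_def)
    qed (use w in \<open>simp add: h_def cs_iff\<close>)
  qed
  define X :: "('v, 'a, 'k) rep" where "X = \<lparr> dimv = fdimv V,
    lin = (\<lambda>a. lmat (fdimv V (head Q a)) (fdimv V (tail Q a)) (\<lambda>w. h (head Q a) (T a (g (tail Q a) w)))) \<rparr>"
  have X: "is_rep Q X" by (simp add: is_rep_def X_def lmat_carrier)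
  have act: "rT X a w = h (head Q a) (T a (g (tail Q a) w))" if "a \<in> arcs Q" "w \<in> rV X (tail Q a)" for a w
    unfolding X_def rep.simps
    by (rule mact_lmat) (use that h_cs flinear_compose[OF flinear_compose[OF g_lin frepD(2)[OF V that(1)]] h_lin[OF head_in_verts[OF that(1)]]]
      in \<open>auto simp: X_def\<close>)
  show ?thesis
  proof (rule that[of X g h])
    show "fhom (rV X) (rT X) V T g"
      unfolding fhom_def ffam_def using g_lin gV act gh[OF head_in_verts frepD(3)[OF V]] tail_in_verts by simp
    show "fhom V T (rV X) (rT X) h"
      unfolding fhom_def ffam_def using h_lin h_cs act gh[OF tail_in_verts] by (simp add: X_def)
  qed (use X gh hg in \<open>auto simp: X_def\<close>)
qed

lemma is_rep_dsum: "is_rep Q X \<Longrightarrow> is_rep Q Y \<Longrightarrow> is_rep Q (rep_dsum X Y)"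
  by (auto simp: is_rep_def rep_dsum_def mat_dsum_def)

lemma rT_dsum:
  assumes "is_rep Q X" "is_rep Q Y" "a \<in> arcs Q"
  shows "rT (rep_dsum X Y) a w = vappend (dimv X (head Q a)) (rT X a (vtake (dimv X (tail Q a)) w)) (rT Y a (vdrop (dimv X (tail Q a)) w))"
proof -
  have "lin X a \<in> carrier_mat (dimv X (head Q a)) (dimv X (tail Q a))"
    "lin Y a \<in> carrier_mat (dimv Y (head Q a)) (dimv Y (tail Q a))"
    using assms by (auto simp: is_rep_def)
  from mact_dsum[OF this] show ?thesis by (simp add: rep_dsum_def)
qed

text \<open>
  An idempotent endomorphism decomposes the representation into its kernel and image. These are
  subspaces, and the direct sum in question is a direct sum of matrix models for them.
\<close>

lemma indecomposable_findec:
  assumes ind: "indecomposable_rep Q M"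
  shows "findec (rV M) (rT M)"
  unfolding findec_def
proof (intro conjI allI impI)
  have M: "is_rep Q M" using ind by (simp add: indecomposable_rep_def)
  note fM = frep_rep[OF M]
  show "nonzero (rV M)" using ind by (simp add: indecomposable_rep_def nonzero_rV)
  fix e assume e: "fhom (rV M) (rT M) (rV M) (rT M) e \<and> (\<forall>x\<in>verts Q. \<forall>v\<in>rV M x. e x (e x v) = e x v)"
  then have e1: "fhom (rV M) (rT M) (rV M) (rT M) e" and e2: "\<And>x v. x \<in> verts Q \<Longrightarrow> v \<in> rV M x \<Longrightarrow> e x (e x v) = e x v"
    by auto
  let ?I = "\<lambda>x. e x ` rV M x" and ?K = "\<lambda>x. {v \<in> rV M x. e x v = 0}"
  have I: "frep ?I (rT M)" by (rule frep_image[OF fM fM e1])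
  have K: "frep ?K (rT M)" by (rule frep_kernel[OF fM fM e1])
  obtain X :: "('v, 'a, 'b) rep" and gX hX where X: "is_rep Q X" "\<And>x. x \<in> verts Q \<Longrightarrow> dimv X x = fdimv ?I x"
    "fhom (rV X) (rT X) ?I (rT M) gX" "fhom ?I (rT M) (rV X) (rT X) hX"
    "\<And>x v. x \<in> verts Q \<Longrightarrow> v \<in> rV X x \<Longrightarrow> hX x (gX x v) = v" "\<And>x v. x \<in> verts Q \<Longrightarrow> v \<in> ?I x \<Longrightarrow> gX x (hX x v) = v"
    using matrix_model[OF I] by blast
  obtain Y :: "('v, 'a, 'b) rep" and gY hY where Y: "is_rep Q Y" "\<And>x. x \<in> verts Q \<Longrightarrow> dimv Y x = fdimv ?K x"
    "fhom (rV Y) (rT Y) ?K (rT M) gY" "fhom ?K (rT M) (rV Y) (rT Y) hY"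
    "\<And>x v. x \<in> verts Q \<Longrightarrow> v \<in> rV Y x \<Longrightarrow> hY x (gY x v) = v" "\<And>x v. x \<in> verts Q \<Longrightarrow> v \<in> ?K x \<Longrightarrow> gY x (hY x v) = v"
    using matrix_model[OF K] by blast
  let ?d = "dimv X"
  let ?g = "\<lambda>x v. vappend (?d x) (hX x (e x v)) (hY x (v - e x v))"
  let ?h = "\<lambda>x w. gX x (vtake (?d x) w) + gY x (vdrop (?d x) w)"
  have eI: "e x v \<in> ?I x" if "v \<in> rV M x" for x v using that by blast
  have IM: "v \<in> rV M x" "e x v = v" if "x \<in> verts Q" "v \<in> ?I x" for x v
    using that fhomD(3)[OF e1 that(1)] e2[OF that(1)] by auto
  have vK: "v - e x v \<in> ?K x" if "x \<in> verts Q" "v \<in> rV M x" for x v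
    using that fhomD(3)[OF e1 that] e2[OF that] fds_closed(3)[OF fds_cs]
    by (simp add: flinear_simps(2)[OF fhomD(2)[OF e1 that(1)]])
  have tr_in: "vtake (?d x) w \<in> rV X x" for x and w :: "nat \<Rightarrow> 'b" by (rule vtake_cs)
  have sh_in: "vdrop (?d x) w \<in> rV Y x" if "w \<in> rV (rep_dsum X Y) x" for x and w :: "nat \<Rightarrow> 'b"
    using that vdrop_cs by (simp add: rep_dsum_def)
  have "rep_iso Q M (rep_dsum X Y)"
    unfolding rep_iso_iff[OF M is_rep_dsum[OF X(1) Y(1)]]
  proof (rule exI[of _ ?g], rule exI[of _ ?h], intro conjI ballI)
    show "fhom (rV M) (rT M) (rV (rep_dsum X Y)) (rT (rep_dsum X Y)) ?g"
      unfolding fhom_def ffam_def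
    proof (intro conjI ballI)
      fix x assume x: "x \<in> verts Q"
      show "flinear (?g x)"
        by (intro vappend_linear flinear_compose[OF fhomD(2)[OF e1 x] fhomD(2)[OF X(4) x]]
            flinear_compose[OF flinear_ops(4)[OF flinear_ops(1) fhomD(2)[OF e1 x]] fhomD(2)[OF Y(4) x]])
      show "?g x v \<in> rV (rep_dsum X Y) x" if "v \<in> rV M x" for v
        using vappend_cs[OF fhomD(3)[OF Y(4) x vK[OF x that]]] by (simp add: rep_dsum_def)
    next
      fix a v assume a: "a \<in> arcs Q" and v: "v \<in> rV M (tail Q a)"
      note h = head_in_verts[OF a] and t = tail_in_verts[OF a]
      have "e (head Q a) (rT M a v) = rT M a (e (tail Q a) v)" by (rule fhomD(4)[OF e1 a v])
      moreover have "hX (head Q a) (rT M a (e (tail Q a) v)) = rT X a (hX (tail Q a) (e (tail Q a) v))"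
        by (rule fhomD(4)[OF X(4) a eI[OF v]])
      moreover have "hY (head Q a) (rT M a (v - e (tail Q a) v)) = rT Y a (hY (tail Q a) (v - e (tail Q a) v))"
        by (rule fhomD(4)[OF Y(4) a vK[OF t v]])
      moreover have "hX (tail Q a) (e (tail Q a) v) \<in> rV X (tail Q a)" by (rule fhomD(3)[OF X(4) t eI[OF v]])
      ultimately show "?g (head Q a) (rT M a v) = rT (rep_dsum X Y) a (?g (tail Q a) v)"
        by (simp add: rT_dsum[OF X(1) Y(1) a] vtake_vappend vdrop_vappend flinear_simps(2)[OF mact_linear])
    qed
    show "fhom (rV (rep_dsum X Y)) (rT (rep_dsum X Y)) (rV M) (rT M) ?h"
      unfolding fhom_def ffam_def
    proof (intro conjI ballI)
      fix x assume x: "x \<in> verts Q"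
      show "flinear (?h x)"
        by (intro flinear_ops(3) flinear_compose[OF vtake_linear fhomD(2)[OF X(3) x]] flinear_compose[OF vdrop_linear fhomD(2)[OF Y(3) x]])
      show "?h x w \<in> rV M x" if w: "w \<in> rV (rep_dsum X Y) x" for w
        using IM(1)[OF x fhomD(3)[OF X(3) x tr_in]] fhomD(3)[OF Y(3) x sh_in[OF w]] fds_closed(2)[OF fds_cs] by blast
    next
      fix a w assume a: "a \<in> arcs Q" and w: "w \<in> rV (rep_dsum X Y) (tail Q a)"
      note h = head_in_verts[OF a] and t = tail_in_verts[OF a]
      have "rT X a (vtake (?d (tail Q a)) w) \<in> rV X (head Q a)" by (rule frepD(3)[OF frep_rep[OF X(1)] a tr_in])
      then show "?h (head Q a) (rT (rep_dsum X Y) a w) = rT M a (?h (tail Q a) w)"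
        using fhomD(4)[OF X(3) a tr_in] fhomD(4)[OF Y(3) a sh_in[OF w]]
        by (simp add: rT_dsum[OF X(1) Y(1) a] vtake_vappend vdrop_vappend flinear_simps(1)[OF mact_linear])
    qed
    fix x assume x: "x \<in> verts Q"
    show "?h x (?g x v) = v" if v: "v \<in> rV M x" for v
      using X(6)[OF x eI[OF v]] Y(6)[OF x vK[OF x v]] fhomD(3)[OF X(4) x eI[OF v]] by (simp add: vtake_vappend vdrop_vappend)
    show "?g x (?h x w) = w" if w: "w \<in> rV (rep_dsum X Y) x" for w
    proof -
      let ?u = "gX x (vtake (?d x) w)" and ?v = "gY x (vdrop (?d x) w)"
      have u: "?u \<in> ?I x" by (rule fhomD(3)[OF X(3) x tr_in])
      have v: "?v \<in> ?K x" by (rule fhomD(3)[OF Y(3) x sh_in[OF w]])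
      have "e x (?u + ?v) = ?u" using IM(2)[OF x u] v by (simp add: flinear_simps(1)[OF fhomD(2)[OF e1 x]])
      then show ?thesis using X(5)[OF x tr_in] Y(5)[OF x sh_in[OF w]] by (simp add: vappend_vtake_vdrop)
    qed
  qed
  then have "zero_rep Q X \<or> zero_rep Q Y"
    using ind X(1) Y(1) unfolding indecomposable_rep_def by blast
  then show "fzero (rV M) e \<or> finj (rV M) e"
  proof
    assume "zero_rep Q X"
    then have "?I x = {0}" if "x \<in> verts Q" for x
      using X(2)[OF that] fds_dim_0[OF frepD(1)[OF I that]] that by (simp add: zero_rep_def)
    then have "fzero (rV M) e" unfolding fzero_def by blast
    then show ?thesis ..
  next
    assume "zero_rep Q Y"
    then have "?K x = {0}" if "x \<in> verts Q" for x
      using Y(2)[OF that] fds_dim_0[OF frepD(1)[OF K that]] that by (simp add: zero_rep_def)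
    then have "finj (rV M) e" unfolding finj_def by blast
    then show ?thesis ..
  qed
qed

lemma brick_indecomposable:
  assumes M: "is_rep Q M" and nz: "\<not> zero_rep Q M" and br: "brick (rV M) (rT M)"
  shows "indecomposable_rep Q M"
  unfolding indecomposable_rep_def
proof (intro conjI allI impI M nz)
  fix X Y :: "('v, 'a, 'b) rep"
  assume "is_rep Q X \<and> is_rep Q Y \<and> rep_iso Q M (rep_dsum X Y)"
  then have X: "is_rep Q X" and Y: "is_rep Q Y" and iso: "rep_iso Q M (rep_dsum X Y)" by auto
  let ?D = "rep_dsum X Y"
  obtain g h where gh: "fhom (rV M) (rT M) (rV ?D) (rT ?D) g" "fhom (rV ?D) (rT ?D) (rV M) (rT M) h"
    "\<And>x v. x \<in> verts Q \<Longrightarrow> v \<in> rV M x \<Longrightarrow> h x (g x v) = v" "\<And>x v. x \<in> verts Q \<Longrightarrow> v \<in> rV ?D x \<Longrightarrow> g x (h x v) = v"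
    using iso unfolding rep_iso_iff[OF M is_rep_dsum[OF X Y]] by blast
  let ?p = "\<lambda>x w. vappend (dimv X x) (vtake (dimv X x) w) 0"
  have ctD: "v \<in> rV Y x \<Longrightarrow> vappend (dimv X x) u v \<in> rV ?D x" for x u v
    using vappend_cs by (simp add: rep_dsum_def)
  have z: "0 \<in> cs n" for n by (simp add: cs_iff pointwise)
  have p: "fhom (rV ?D) (rT ?D) (rV ?D) (rT ?D) ?p"
    unfolding fhom_def ffam_def
  proof (intro conjI ballI)
    show "flinear (?p x)" for x by (intro vappend_linear vtake_linear flinear_ops(2))
    show "?p x w \<in> rV ?D x" for x w by (rule ctD[OF z])
    fix a w assume a: "a \<in> arcs Q"
    have "rT X a u \<in> rV X (head Q a)" for u using X a by (auto simp: is_rep_def intro: mact_cs)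
    then show "?p (head Q a) (rT ?D a w) = rT ?D a (?p (tail Q a) w)"
      by (simp add: rT_dsum[OF X Y a] vtake_vappend vtake_cs vdrop_vappend flinear_simps(4)[OF mact_linear])
  qed
  let ?e = "\<lambda>x v. h x (?p x (g x v))"
  have "fhom (rV M) (rT M) (rV M) (rT M) ?e" by (rule fhom_comp[OF fhom_comp[OF gh(1) p] gh(2)])
  then have "fzero (rV M) ?e \<or> finj (rV M) ?e" using br unfolding brick_def by blast
  then show "zero_rep Q X \<or> zero_rep Q Y"
  proof
    assume e0: "fzero (rV M) ?e"
    have "\<not> nonzero (rV X)"
    proof
      assume "nonzero (rV X)"
      then obtain x u where x: "x \<in> verts Q" and u: "u \<in> rV X x" "u \<noteq> 0" unfolding nonzero_def by blast
      let ?w = "vappend (dimv X x) u 0"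
      have w: "?w \<in> rV ?D x" by (rule ctD[OF z])
      have "?e x (h x ?w) = h x ?w" using gh(4)[OF x w] u by (simp add: vtake_vappend)
      then have "h x ?w = 0" using e0 x fhomD(3)[OF gh(2) x w] by (simp add: fzero_def)
      then have "?w = 0" using gh(4)[OF x w] by (simp add: flinear_simps(4)[OF fhomD(2)[OF gh(1) x]])
      then have "vtake (dimv X x) ?w = 0" by (simp add: flinear_simps(4)[OF vtake_linear])
      then show False using u by (simp add: vtake_vappend)
    qed
    then show ?thesis by (simp add: nonzero_rV)
  next
    assume ei: "finj (rV M) ?e"
    have "\<not> nonzero (rV Y)"
    proof
      assume "nonzero (rV Y)"
      then obtain x u where x: "x \<in> verts Q" and u: "u \<in> rV Y x" "u \<noteq> 0" unfolding nonzero_def by blast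
      let ?w = "vappend (dimv X x) 0 u"
      have w: "?w \<in> rV ?D x" by (rule ctD[OF u(1)])
      have "?e x (h x ?w) = 0" using gh(4)[OF x w] by (simp add: vtake_vappend z vappend_zero flinear_simps(4)[OF fhomD(2)[OF gh(2) x]])
      then have "h x ?w = 0" using ei x fhomD(3)[OF gh(2) x w] unfolding finj_def by blast
      then have "?w = 0" using gh(4)[OF x w] by (simp add: flinear_simps(4)[OF fhomD(2)[OF gh(1) x]])
      then have "vdrop (dimv X x) ?w = 0" by (simp add: flinear_simps(4)[OF vdrop_linear])
      then show False using u by (simp add: vdrop_vappend)
    qed
    then show ?thesis by (simp add: nonzero_rV)
  qed
qed

end

section \<open>Triples of orthogonal bricks\<close>

text \<open>
  The special triple in the form in which it enters the argument: three orthogonal bricks that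
  vanish at \<open>y\<close> but not at all neighbours of \<open>y\<close>. They are indexed by \<open>0\<close>, \<open>1\<close>, \<open>2\<close>.
\<close>

locale brick_triple = marked_quiver Q y \<theta> for Q :: "('v, 'a) pre_digraph" and y \<theta> +
  fixes A :: "nat \<Rightarrow> ('v, 'a, 'k::field) rep"
  assumes A_rep: "r < 3 \<Longrightarrow> is_rep Q (A r)"
    and A_brick: "r < 3 \<Longrightarrow> brick (rV (A r)) (rT (A r))"
    and A_orth: "r < 3 \<Longrightarrow> s < 3 \<Longrightarrow> r \<noteq> s \<Longrightarrow> fhom (rV (A r)) (rT (A r)) (rV (A s)) (rT (A s)) \<phi> \<Longrightarrow> fzero (rV (A r)) \<phi>"
    and A_y: "r < 3 \<Longrightarrow> dimv (A r) y = 0"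
    and A_nb: "r < 3 \<Longrightarrow> 1 \<le> nb (dimv (A r)) y"
begin

lemma neighbour_in_support:
  assumes "r < 3"
  obtains z where "z \<in> verts Q" "0 < dimv (A r) z" "dimv (A r) z \<le> nb (dimv (A r)) y"
proof -
  let ?d = "dimv (A r)"
  let ?O = "{a\<in>arcs Q. tail Q a = y}" and ?I = "{a\<in>arcs Q. head Q a = y}"
  have "(\<Sum>a\<in>?O. ?d (head Q a)) \<noteq> 0 \<or> (\<Sum>a\<in>?I. ?d (tail Q a)) \<noteq> 0"
    using A_nb[OF assms] unfolding nb_def by linarith
  then show ?thesis
  proof
    assume "(\<Sum>a\<in>?O. ?d (head Q a)) \<noteq> 0"
    then obtain a where a: "a \<in> ?O" "?d (head Q a) \<noteq> 0" by (meson sum.neutral)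
    have "?d (head Q a) \<le> (\<Sum>a\<in>?O. ?d (head Q a))" by (rule member_le_sum[OF a(1)]) auto
    then show ?thesis using that[of "head Q a"] a unfolding nb_def by auto
  next
    assume "(\<Sum>a\<in>?I. ?d (tail Q a)) \<noteq> 0"
    then obtain a where a: "a \<in> ?I" "?d (tail Q a) \<noteq> 0" by (meson sum.neutral)
    have "?d (tail Q a) \<le> (\<Sum>a\<in>?I. ?d (tail Q a))" by (rule member_le_sum[OF a(1)]) auto
    then show ?thesis using that[of "tail Q a"] a unfolding nb_def by auto
  qed
qed

text \<open>
  In a brick an endomorphism that kills a nonzero vector is zero; the vector is the first basis
  vector at \<open>z\<close>.
\<close>

lemma A_eval_inj:
  assumes "r < 3" "z \<in> verts Q" "0 < dimv (A r) z" "fhom (rV (A r)) (rT (A r)) (rV (A r)) (rT (A r)) \<phi>"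
    "\<phi> z (unitf 0) = 0"
  shows "fzero (rV (A r)) \<phi>"
proof -
  have "\<not> finj (rV (A r)) \<phi>"
    using assms(2,3,5) unitf_cs[of 0 "dimv (A r) z"] unitf_nz[of 0] unfolding finj_def by blast
  then show ?thesis using A_brick[OF assms(1)] assms(4) unfolding brick_def by blast
qed

abbreviation eA :: "nat \<Rightarrow> nat \<Rightarrow> int" where
  "eA r s \<equiv> euler (dimv (A r)) (dimv (A s))"

text \<open>
  Endomorphisms embed in the space at a neighbour of \<open>y\<close>, which is one of the summands of \<open>nb\<close>.
\<close>

lemma eA_diag_le: assumes "r < 3" shows "eA r r \<le> int (nb (dimv (A r)) y)"
proof -
  obtain z where z: "z \<in> verts Q" "0 < dimv (A r) z" "dimv (A r) z \<le> nb (dimv (A r)) y"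
    using neighbour_in_support[OF assms] .
  note f = frep_rep[OF A_rep[OF assms]]
  have "euler (fdimv (rV (A r))) (fdimv (rV (A r))) \<le> int (fs.dim (rV (A r) z))"
    by (rule euler_le_eval(1)[OF f f z(1) unitf_cs[OF z(2)] A_eval_inj[OF assms z(1,2)]])
  then show ?thesis using z(3) by (simp add: dim_cs)
qed

lemma eA_le_0:
  assumes "r < 3" "s < 3" "r \<noteq> s" shows "eA r s \<le> 0"
  using euler_le_0(1)[OF frep_rep[OF A_rep[OF assms(1)]] frep_rep[OF A_rep[OF assms(2)]] A_orth[OF assms]]
  by (simp add: dim_cs)

definition sA :: "'v \<Rightarrow> nat" where
  "sA x = (\<Sum>r<3. dimv (A r) x)"

lemma sum3: "(\<Sum>r<3. h r) = h 0 + h 1 + h (2::nat)"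
  by (simp add: numeral_3_eq_3 numeral_2_eq_2)

text \<open>
  The squeeze. In \<open>1 \<le> q(s + 2 e\<^sub>y) = q(s) + 4 - 2 \<Sum> n\<^sub>i\<close> the right hand side is a sum of Euler forms,
  of which the off-diagonal ones are at most \<open>0\<close> and the diagonal ones at most \<open>n\<^sub>i\<close>. As \<open>n\<^sub>i \<ge> 1\<close>,
  there is no room for a strict inequality anywhere.
\<close>

lemma
  shows eA_diag: "r < 3 \<Longrightarrow> eA r r = 1" and eA_off: "r < 3 \<Longrightarrow> s < 3 \<Longrightarrow> r \<noteq> s \<Longrightarrow> eA r s = 0"
    and nb_A: "r < 3 \<Longrightarrow> nb (dimv (A r)) y = 1"
    and \<theta>_eq: "x \<in> verts Q \<Longrightarrow> \<theta> x = sA x + (if x = y then 2 else 0)"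
proof -
  let ?t = "\<lambda>r. int (nb (dimv (A r)) y)"
  have sA_eq: "sA = (\<lambda>x. dimv (A 0) x + dimv (A 1) x + dimv (A 2) x)"
    by (simp add: sA_def sum3 fun_eq_iff)
  have sy: "sA y = 0" using A_y by (simp add: sA_def)
  have nbs: "int (nb sA y) = ?t 0 + ?t 1 + ?t 2"
    by (simp add: sA_eq nb_def sum.distrib)
  have tits: "tits (\<lambda>x. int (sA x)) = eA 0 0 + eA 0 1 + eA 0 2 + eA 1 0 + eA 1 1 + eA 1 2 + eA 2 0 + eA 2 1 + eA 2 2"
    unfolding euler_tits[symmetric] sA_eq by (simp add: euler_add)
  let ?m = "\<lambda>x. sA x + (if x = y then 2 else 0)"
  have q: "tits (\<lambda>x. int (?m x)) = tits (\<lambda>x. int (sA x)) + 4 - 2 * int (nb sA y)"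
    by (rule tits_add_2y[of sA, OF sy])
  have pos: "tits (\<lambda>x. int (?m x)) \<ge> 1"
    by (rule tits_pos[OF y]) simp
  note d = eA_diag_le[of 0] eA_diag_le[of 1] eA_diag_le[of 2]
  note o = eA_le_0[of 0 1] eA_le_0[of 0 2] eA_le_0[of 1 0] eA_le_0[of 1 2] eA_le_0[of 2 0] eA_le_0[of 2 1]
  note n = A_nb[of 0] A_nb[of 1] A_nb[of 2]
  have dd': "eA 0 0 \<le> ?t 0" "eA 1 1 \<le> ?t 1" "eA 2 2 \<le> ?t 2" using d by simp_all
  have nn: "1 \<le> ?t 0" "1 \<le> ?t 1" "1 \<le> ?t 2" using n by simp_all
  have oo: "eA 0 1 \<le> 0" "eA 0 2 \<le> 0" "eA 1 0 \<le> 0" "eA 1 2 \<le> 0" "eA 2 0 \<le> 0" "eA 2 1 \<le> 0"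
    using o by simp_all
  have bound: "1 \<le> eA 0 0 + eA 0 1 + eA 0 2 + eA 1 0 + eA 1 1 + eA 1 2 + eA 2 0 + eA 2 1 + eA 2 2 + 4 - 2 * (?t 0 + ?t 1 + ?t 2)"
    using pos unfolding q tits nbs .
  \<comment> \<open>stated for free integers, to keep the arithmetic apart from the sums\<close>
  have t_arith: "t0 = 1 \<and> t1 = 1 \<and> t2 = 1"
    if "1 \<le> a + b + c + d + e + f + g + h + i + 4 - 2 * (t0 + t1 + t2)" "a \<le> t0" "e \<le> t1" "i \<le> t2"
      "1 \<le> t0" "1 \<le> t1" "1 \<le> t2" "b \<le> 0" "c \<le> 0" "d \<le> 0" "f \<le> 0" "g \<le> 0" "h \<le> 0"
    for a b c d e f g h i t0 t1 t2 :: int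
    using that by simp
  have t: "?t 0 = 1" "?t 1 = 1" "?t 2 = 1"
    using t_arith[OF bound dd' nn oo] by blast+
  have tot: "3 \<le> eA 0 0 + eA 0 1 + eA 0 2 + eA 1 0 + eA 1 1 + eA 1 2 + eA 2 0 + eA 2 1 + eA 2 2"
    using bound unfolding t by simp
  have dle: "eA 0 0 \<le> 1" "eA 1 1 \<le> 1" "eA 2 2 \<le> 1" using dd' unfolding t .
  have squeeze: "a = 1 \<and> b = 0 \<and> c = 0 \<and> d = 0 \<and> e = 1 \<and> f = 0 \<and> g = 0 \<and> h = 0 \<and> i = 1"
    if "3 \<le> a + b + c + d + e + f + g + h + i" "a \<le> 1" "e \<le> 1" "i \<le> 1"
      "b \<le> 0" "c \<le> 0" "d \<le> 0" "f \<le> 0" "g \<le> 0" "h \<le> 0" for a b c d e f g h i :: int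
    using that by simp
  note e12 = squeeze[OF tot dle oo]
  then have e1: "eA 0 0 = 1" "eA 1 1 = 1" "eA 2 2 = 1" by blast+
  from e12 have e2: "eA 0 1 = 0" "eA 0 2 = 0" "eA 1 0 = 0" "eA 1 2 = 0" "eA 2 0 = 0" "eA 2 1 = 0" by blast+
  have c3: "r = 0 \<or> r = 1 \<or> r = 2" if "r < 3" for r :: nat using that by presburger
  show "eA r r = 1" if "r < 3" using c3[OF that] e1 by (elim disjE) simp_all
  show "eA r s = 0" if "r < 3" "s < 3" "r \<noteq> s"
    using c3[OF that(1)] c3[OF that(2)] that(3) e2 by (elim disjE) simp_all
  show "nb (dimv (A r)) y = 1" if "r < 3" using c3[OF that] t by (elim disjE) simp_all
  have "tits (\<lambda>x. int (?m x)) = 1" unfolding q tits nbs t e1 e2 by simp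
  then show "x \<in> verts Q \<Longrightarrow> \<theta> x = sA x + (if x = y then 2 else 0)"
    using root_with_2y_is_\<theta>[of ?m x] sy by simp
qed

text \<open>
  Now that the Euler forms attain their bounds, \<open>dim Hom - dim Ext\<close> leaves no room for extensions.
\<close>

lemma A_ext_vanishes:
  assumes "r < 3" "s < 3"
  shows "ext_vanishes (rV (A r)) (rT (A r)) (rV (A s)) (rT (A s))"
proof (cases "r = s")
  case True
  obtain z where z: "z \<in> verts Q" "0 < dimv (A r) z" "dimv (A r) z \<le> nb (dimv (A r)) y"
    using neighbour_in_support[OF assms(1)] .
  note f = frep_rep[OF A_rep[OF assms(1)]]
  have "euler (fdimv (rV (A r))) (fdimv (rV (A r))) \<ge> int (fs.dim (rV (A r) z))"
    using eA_diag[OF assms(1)] z(3) nb_A[OF assms(1)] by (simp add: dim_cs)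
  then show ?thesis
    using euler_le_eval(2)[OF f f z(1) unitf_cs[OF z(2)] A_eval_inj[OF assms(1) z(1,2)]] True by simp
next
  case False
  have "euler (fdimv (rV (A r))) (fdimv (rV (A s))) \<ge> 0"
    using eA_off[OF assms False] by (simp add: dim_cs)
  then show ?thesis
    using euler_le_0(2)[OF frep_rep[OF A_rep[OF assms(1)]] frep_rep[OF A_rep[OF assms(2)]] A_orth[OF assms False]]
    by blast
qed

lemma A_end_scalar:
  assumes r: "r < 3" and phi: "fhom (rV (A r)) (rT (A r)) (rV (A r)) (rT (A r)) \<phi>"
  obtains c where "\<And>x v. x \<in> verts Q \<Longrightarrow> v \<in> rV (A r) x \<Longrightarrow> \<phi> x v = fscale c v"
proof -
  obtain z where z: "z \<in> verts Q" "0 < dimv (A r) z" "dimv (A r) z \<le> nb (dimv (A r)) y"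
    using neighbour_in_support[OF r] .
  note f = frep_rep[OF A_rep[OF r]]
  have "\<not> fzero (rV (A r)) (\<lambda>x v. v)"
    using z(1) unitf_cs[OF z(2)] unitf_nz[of 0] unfolding fzero_def by blast
  moreover have "fs.dim (rV (A r) z) \<le> 1" using z(3) nb_A[OF r] by (simp add: dim_cs)
  ultimately have "\<exists>c. \<forall>x\<in>verts Q. \<forall>v\<in>rV (A r) x. \<phi> x v = fscale c v"
    using euler_le_eval(3)[OF f f z(1) unitf_cs[OF z(2)] A_eval_inj[OF r z(1,2)] _ fhom_id _ phi] by blast
  then show ?thesis using that by blast
qed

definition outward :: "nat \<Rightarrow> bool" where
  "outward r \<longleftrightarrow> (\<exists>a\<in>arcs Q. tail Q a = y \<and> 0 < dimv (A r) (head Q a))"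

definition inward :: "nat \<Rightarrow> bool" where
  "inward r \<longleftrightarrow> (\<exists>a\<in>arcs Q. head Q a = y \<and> 0 < dimv (A r) (tail Q a))"

lemma sum_eq_1_unique:
  fixes h :: "'x \<Rightarrow> nat"
  assumes "finite X" "(\<Sum>x\<in>X. h x) = 1"
  obtains x where "x \<in> X" "h x = 1" "\<And>x'. x' \<in> X \<Longrightarrow> x' \<noteq> x \<Longrightarrow> h x' = 0"
proof -
  obtain x where x: "x \<in> X" "h x \<noteq> 0" using assms(2) by (metis sum.neutral zero_neq_one)
  have "h x + (\<Sum>x\<in>X - {x}. h x) = 1" using assms x by (simp add: sum.remove[symmetric])
  then have "h x = 1" "(\<Sum>x\<in>X - {x}. h x) = 0" using x(2) by auto
  then show ?thesis using that[of x] x(1) assms(1) by simp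
qed

text \<open>
  As \<open>nb = 1\<close>, exactly one arrow joins \<open>y\<close> to the support, and the space at its other end is a line.
\<close>

lemma arrow_cases:
  assumes r: "r < 3"
  obtains (out) a where "a \<in> arcs Q" "tail Q a = y" "dimv (A r) (head Q a) = 1" "outward r" "\<not> inward r"
      "\<And>b. b \<in> arcs Q \<Longrightarrow> tail Q b = y \<Longrightarrow> b \<noteq> a \<Longrightarrow> dimv (A r) (head Q b) = 0"
    | (inn) a where "a \<in> arcs Q" "head Q a = y" "dimv (A r) (tail Q a) = 1" "\<not> outward r" "inward r"
      "\<And>b. b \<in> arcs Q \<Longrightarrow> head Q b = y \<Longrightarrow> b \<noteq> a \<Longrightarrow> dimv (A r) (tail Q b) = 0"
proof -
  let ?d = "dimv (A r)"
  let ?O = "{a\<in>arcs Q. tail Q a = y}" and ?I = "{a\<in>arcs Q. head Q a = y}"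
  have "(\<Sum>a\<in>?O. ?d (head Q a)) + (\<Sum>a\<in>?I. ?d (tail Q a)) = 1"
    using nb_A[OF r] by (simp add: nb_def)
  then consider "(\<Sum>a\<in>?O. ?d (head Q a)) = 1" "(\<Sum>a\<in>?I. ?d (tail Q a)) = 0"
    | "(\<Sum>a\<in>?O. ?d (head Q a)) = 0" "(\<Sum>a\<in>?I. ?d (tail Q a)) = 1" by linarith
  then show ?thesis
  proof cases
    case 1
    obtain a where a: "a \<in> ?O" "?d (head Q a) = 1" "\<And>b. b \<in> ?O \<Longrightarrow> b \<noteq> a \<Longrightarrow> ?d (head Q b) = 0"
      by (rule sum_eq_1_unique[OF _ 1(1)]) auto
    have "\<not> inward r" using 1(2) by (auto simp: inward_def)
    moreover have "outward r" unfolding outward_def using a(1,2) by (intro bexI[of _ a]) simp_all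
    moreover have "a \<in> arcs Q" "tail Q a = y" using a(1) by auto
    ultimately show ?thesis using a(2,3) by (intro out[of a]) simp_all
  next
    case 2
    obtain a where a: "a \<in> ?I" "?d (tail Q a) = 1" "\<And>b. b \<in> ?I \<Longrightarrow> b \<noteq> a \<Longrightarrow> ?d (tail Q b) = 0"
      by (rule sum_eq_1_unique[OF _ 2(2)]) auto
    have "\<not> outward r" using 2(1) by (auto simp: outward_def)
    moreover have "inward r" unfolding inward_def using a(1,2) by (intro bexI[of _ a]) simp_all
    moreover have "a \<in> arcs Q" "head Q a = y" using a(1) by auto
    ultimately show ?thesis using a(2,3) by (intro inn[of a]) simp_all
  qed
qed

lemma inward_iff: "r < 3 \<Longrightarrow> inward r \<longleftrightarrow> \<not> outward r"
  by (erule arrow_cases) auto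

end

section \<open>Filtered objects\<close>

context quiver
begin

lemma kernel_image_vf:
  assumes i: "A \<in> carrier_mat m n" and p: "B \<in> carrier_mat l m"
  shows "inj_on ((*\<^sub>v) A) (carrier_vec n) \<longleftrightarrow> (\<forall>v\<in>cs n. mact A v = 0 \<longrightarrow> v = 0)"
    "(*\<^sub>v) A ` carrier_vec n = {v \<in> carrier_vec m. B *\<^sub>v v = 0\<^sub>v l} \<longleftrightarrow> mact A ` cs n = {v \<in> cs m. mact B v = 0}"
    "(*\<^sub>v) B ` carrier_vec m = carrier_vec l \<longleftrightarrow> mact B ` cs m = cs l"
proof -
  have inj: "inj_on vf (carrier_vec k)" for k using vf_inject by (auto simp: inj_on_def)
  have Av: "A *\<^sub>v v \<in> carrier_vec m" if "v \<in> carrier_vec n" for v using i that by simp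
  have Bv: "B *\<^sub>v v \<in> carrier_vec l" if "v \<in> carrier_vec m" for v using p that by simp
  have imA: "vf ` ((*\<^sub>v) A ` carrier_vec n) = mact A ` cs n"
    unfolding vf_image[symmetric] image_image using vf_mult[OF i] by (intro image_cong refl) auto
  have imB: "vf ` ((*\<^sub>v) B ` carrier_vec m) = mact B ` cs m"
    unfolding vf_image[symmetric] image_image using vf_mult[OF p] by (intro image_cong refl) auto
  have ker: "vf ` {v \<in> carrier_vec m. B *\<^sub>v v = 0\<^sub>v l} = {v \<in> cs m. mact B v = 0}"
  proof -
    have "B *\<^sub>v v = 0\<^sub>v l \<longleftrightarrow> mact B (vf v) = 0" if "v \<in> carrier_vec m" for v
      using vf_inject[OF Bv[OF that] zero_carrier_vec] vf_mult[OF p that] by (simp add: vf_zero)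
    then show ?thesis unfolding vf_image[symmetric] by auto
  qed
  show "inj_on ((*\<^sub>v) A) (carrier_vec n) \<longleftrightarrow> (\<forall>v\<in>cs n. mact A v = 0 \<longrightarrow> v = 0)"
  proof -
    have "inj_on (mact A) (cs n) \<longleftrightarrow> (\<forall>v\<in>cs n. mact A v = 0 \<longrightarrow> v = 0)"
      by (rule fp.linear_inj_on_iff_eq_0[OF mact_linear fds_subspace[OF fds_cs]])
    moreover have "inj_on (mact A) (cs n) \<longleftrightarrow> inj_on ((*\<^sub>v) A) (carrier_vec n)"
    proof -
      have "inj_on (mact A) (vf ` carrier_vec n) \<longleftrightarrow> inj_on (mact A \<circ> vf) (carrier_vec n)"
        using comp_inj_on_iff[OF inj] by blast
      also have "\<dots> \<longleftrightarrow> inj_on (\<lambda>v. vf (A *\<^sub>v v)) (carrier_vec n)"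
        by (rule inj_on_cong) (simp add: vf_mult[OF i])
      also have "\<dots> \<longleftrightarrow> inj_on ((*\<^sub>v) A) (carrier_vec n)"
        using vf_inject[OF Av Av] by (simp add: inj_on_def)
      finally show ?thesis by (simp add: vf_image)
    qed
    ultimately show ?thesis by simp
  qed
  show "(*\<^sub>v) A ` carrier_vec n = {v \<in> carrier_vec m. B *\<^sub>v v = 0\<^sub>v l} \<longleftrightarrow> mact A ` cs n = {v \<in> cs m. mact B v = 0}"
    unfolding imA[symmetric] ker[symmetric]
    by (rule inj_on_image_eq_iff[OF inj, symmetric]) (use Av in auto)
  show "(*\<^sub>v) B ` carrier_vec m = carrier_vec l \<longleftrightarrow> mact B ` cs m = cs l"
    unfolding imB[symmetric] vf_image[of l, symmetric]
    by (rule inj_on_image_eq_iff[OF inj, symmetric]) (use Bv in auto)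
qed

lemma short_exact_iff:
  assumes "is_rep Q X" "is_rep Q Y" "is_rep Q Z"
  shows "short_exact Q X i Y p Z \<longleftrightarrow> is_mor Q X Y i \<and> is_mor Q Y Z p \<and> finj (rV X) (\<lambda>x. mact (i x)) \<and>
    (\<forall>x\<in>verts Q. mact (i x) ` rV X x = {v \<in> rV Y x. mact (p x) v = 0} \<and> mact (p x) ` rV Y x = rV Z x)"
proof -
  let ?P = "\<lambda>x. inj_on ((*\<^sub>v) (i x)) (carrier_vec (dimv X x)) \<and>
        (*\<^sub>v) (i x) ` carrier_vec (dimv X x) = {v \<in> carrier_vec (dimv Y x). p x *\<^sub>v v = 0\<^sub>v (dimv Z x)} \<and>
        (*\<^sub>v) (p x) ` carrier_vec (dimv Y x) = carrier_vec (dimv Z x)"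
  let ?R = "\<lambda>x. (\<forall>v\<in>rV X x. mact (i x) v = 0 \<longrightarrow> v = 0) \<and>
        mact (i x) ` rV X x = {v \<in> rV Y x. mact (p x) v = 0} \<and> mact (p x) ` rV Y x = rV Z x"
  have "?P x \<longleftrightarrow> ?R x" if m: "is_mor Q X Y i \<and> is_mor Q Y Z p" and x: "x \<in> verts Q" for x
  proof -
    have "i x \<in> carrier_mat (dimv Y x) (dimv X x)" "p x \<in> carrier_mat (dimv Z x) (dimv Y x)"
      using m x by (auto simp: is_mor_def)
    from kernel_image_vf[OF this] show ?thesis by argo
  qed
  then have "is_mor Q X Y i \<and> is_mor Q Y Z p \<longrightarrow> (\<forall>x\<in>verts Q. ?P x) = (\<forall>x\<in>verts Q. ?R x)" by (metis (no_types, lifting))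
  moreover have "(\<forall>x\<in>verts Q. ?R x) \<longleftrightarrow> finj (rV X) (\<lambda>x. mact (i x)) \<and>
    (\<forall>x\<in>verts Q. mact (i x) ` rV X x = {v \<in> rV Y x. mact (p x) v = 0} \<and> mact (p x) ` rV Y x = rV Z x)"
    unfolding finj_def ball_conj_distrib ..
  ultimately show ?thesis unfolding short_exact_def by argo
qed

lemma short_exactI:
  assumes X: "is_rep Q X" and Y: "is_rep Q Y" and Z: "is_rep Q Z"
    and i: "fhom (rV X) (rT X) (rV Y) (rT Y) i" and p: "fhom (rV Y) (rT Y) (rV Z) (rT Z) p"
    and inj: "finj (rV X) i" and ker: "\<And>x. x \<in> verts Q \<Longrightarrow> i x ` rV X x = {v \<in> rV Y x. p x v = 0}"
    and surj: "\<And>x. x \<in> verts Q \<Longrightarrow> p x ` rV Y x = rV Z x"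
  shows "short_exact Q X (mor_of X Y i) Y (mor_of Y Z p) Z"
proof -
  note mi = mact_mor_of[OF fhomD(1)[OF i]] and mp = mact_mor_of[OF fhomD(1)[OF p]]
  have "mact (mor_of X Y i x) ` rV X x = i x ` rV X x" "mact (mor_of Y Z p x) ` rV Y x = p x ` rV Y x"
    "{v \<in> rV Y x. mact (mor_of Y Z p x) v = 0} = {v \<in> rV Y x. p x v = 0}" if "x \<in> verts Q" for x
    using mi[OF that] mp[OF that] by (auto intro!: image_cong)
  then show ?thesis
    unfolding short_exact_iff[OF X Y Z]
    using is_mor_of[OF X Y i] is_mor_of[OF Y Z p] inj ker surj mi by (simp add: finj_def)
qed

definition fiso :: "('v \<Rightarrow> ('i \<Rightarrow> 'k::field) set) \<Rightarrow> ('a \<Rightarrow> ('i \<Rightarrow> 'k) \<Rightarrow> 'i \<Rightarrow> 'k) \<Rightarrow>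
    ('v \<Rightarrow> ('j \<Rightarrow> 'k) set) \<Rightarrow> ('a \<Rightarrow> ('j \<Rightarrow> 'k) \<Rightarrow> 'j \<Rightarrow> 'k) \<Rightarrow> bool" where
  "fiso V T W T' \<longleftrightarrow> (\<exists>g h. fhom V T W T' g \<and> fhom W T' V T h \<and>
     (\<forall>x\<in>verts Q. \<forall>v\<in>V x. h x (g x v) = v) \<and> (\<forall>x\<in>verts Q. \<forall>w\<in>W x. g x (h x w) = w))"

lemma matrix_model_iso:
  fixes V :: "'v \<Rightarrow> ('i \<Rightarrow> 'k::field) set"
  assumes V: "frep V T"
  shows "\<exists>X :: ('v, 'a, 'k) rep. is_rep Q X \<and> (\<forall>x\<in>verts Q. dimv X x = fdimv V x) \<and> fiso (rV X) (rT X) V T"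
proof (rule matrix_model[OF V])
  fix X :: "('v, 'a, 'k) rep" and g h
  assume X: "is_rep Q X" "\<And>x. x \<in> verts Q \<Longrightarrow> dimv X x = fdimv V x"
    and gh: "fhom (rV X) (rT X) V T g" "fhom V T (rV X) (rT X) h"
    and inv: "\<And>x v. x \<in> verts Q \<Longrightarrow> v \<in> rV X x \<Longrightarrow> h x (g x v) = v" "\<And>x v. x \<in> verts Q \<Longrightarrow> v \<in> V x \<Longrightarrow> g x (h x v) = v"
  have "fiso (rV X) (rT X) V T" unfolding fiso_def
    by (rule exI[of _ g], rule exI[of _ h], intro conjI ballI gh inv)
  then show ?thesis using X by blast
qed

text \<open>
  Filtered objects are matrix representations, while the filtration below is one of subspaces. So
  membership is asked of all matrix models at once; this also makes the notion invariant under
  isomorphism.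
\<close>

definition filt :: "('v, 'a, 'k::field) rep set \<Rightarrow> ('v \<Rightarrow> ('i \<Rightarrow> 'k) set) \<Rightarrow> ('a \<Rightarrow> ('i \<Rightarrow> 'k) \<Rightarrow> 'i \<Rightarrow> 'k) \<Rightarrow> bool" where
  "filt C V T \<longleftrightarrow> (\<forall>L. is_rep Q L \<longrightarrow> fiso (rV L) (rT L) V T \<longrightarrow> L \<in> filtered_objects Q C)"

lemma filt_zero:
  fixes C :: "('v, 'a, 'k::field) rep set"
  assumes z: "\<And>x v. x \<in> verts Q \<Longrightarrow> v \<in> V x \<Longrightarrow> v = 0"
  shows "filt C V T"
  unfolding filt_def
proof (intro allI impI)
  fix L :: "('v, 'a, 'k) rep"
  assume L: "is_rep Q L" and iso: "fiso (rV L) (rT L) V T"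
  obtain g h where g: "fhom (rV L) (rT L) V T g" and h: "fhom V T (rV L) (rT L) h"
    and hg: "\<And>x v. x \<in> verts Q \<Longrightarrow> v \<in> rV L x \<Longrightarrow> h x (g x v) = v"
    using iso unfolding fiso_def by metis
  have "\<not> nonzero (rV L)"
  proof
    assume "nonzero (rV L)"
    then obtain x v where x: "x \<in> verts Q" and v: "v \<in> rV L x" "v \<noteq> 0" unfolding nonzero_def by blast
    have "g x v = 0" by (rule z[OF x fhomD(3)[OF g x v(1)]])
    then show False using hg[OF x v(1)] v(2) flinear_simps(4)[OF fhomD(2)[OF h x]] by simp
  qed
  then show "L \<in> filtered_objects Q C" using L filtered_zero by (simp add: nonzero_rV)
qed

text \<open>
  The inductive rule for filtered objects, transported to operators on subspaces: \<open>p\<close> is the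
  projection to the top factor \<open>B\<close>, with kernel \<open>K\<close>.
\<close>

lemma filt_step:
  fixes C :: "('v, 'a, 'k::field) rep set" and V :: "'v \<Rightarrow> ('i \<Rightarrow> 'k) set"
  assumes V: "frep V T" and B: "B \<in> C" "is_rep Q B" and p: "fhom V T (rV B) (rT B) p"
    and surj: "\<And>x. x \<in> verts Q \<Longrightarrow> rV B x \<subseteq> p x ` V x"
    and K: "frep K T" "\<And>x v. x \<in> verts Q \<Longrightarrow> v \<in> K x \<longleftrightarrow> v \<in> V x \<and> p x v = 0" "filt C K T"
  shows "filt C V T"
  unfolding filt_def
proof (intro allI impI)
  fix L :: "('v, 'a, 'k) rep"
  assume L: "is_rep Q L" and iso: "fiso (rV L) (rT L) V T"
  obtain g h where g: "fhom (rV L) (rT L) V T g" and h: "fhom V T (rV L) (rT L) h"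
    and hg: "\<And>x v. x \<in> verts Q \<Longrightarrow> v \<in> rV L x \<Longrightarrow> h x (g x v) = v"
    and gh: "\<And>x v. x \<in> verts Q \<Longrightarrow> v \<in> V x \<Longrightarrow> g x (h x v) = v" using iso unfolding fiso_def by metis
  obtain L' :: "('v, 'a, 'k) rep" where L': "is_rep Q L'" and iso': "fiso (rV L') (rT L') K T"
    using matrix_model_iso[OF K(1)] by metis
  obtain g' h' where g': "fhom (rV L') (rT L') K T g'" and h': "fhom K T (rV L') (rT L') h'"
    and hg': "\<And>x v. x \<in> verts Q \<Longrightarrow> v \<in> rV L' x \<Longrightarrow> h' x (g' x v) = v"
    and gh': "\<And>x v. x \<in> verts Q \<Longrightarrow> v \<in> K x \<Longrightarrow> g' x (h' x v) = v"
    using iso' unfolding fiso_def by metis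
  have L'in: "L' \<in> filtered_objects Q C"
    using K(3) L' iso' unfolding filt_def by blast
  have KV: "K x \<subseteq> V x" if "x \<in> verts Q" for x using K(2)[OF that] by blast
  have "fhom (rV L') (rT L') V T g'"
    unfolding fhom_def ffam_def
  proof (intro conjI ballI)
    show "flinear (g' x)" if "x \<in> verts Q" for x by (rule fhomD(2)[OF g' that])
    show "g' x v \<in> V x" if "x \<in> verts Q" "v \<in> rV L' x" for x v
      by (rule subsetD[OF KV[OF that(1)] fhomD(3)[OF g' that]])
    show "g' (head Q a) (rT L' a v) = T a (g' (tail Q a) v)" if "a \<in> arcs Q" "v \<in> rV L' (tail Q a)" for a v
      by (rule fhomD(4)[OF g' that])
  qed
  from fhom_comp[OF this h] have i: "fhom (rV L') (rT L') (rV L) (rT L) (\<lambda>x v. h x (g' x v))" .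
  have q: "fhom (rV L) (rT L) (rV B) (rT B) (\<lambda>x v. p x (g x v))" by (rule fhom_comp[OF g p])
  have "short_exact Q L' (mor_of L' L (\<lambda>x v. h x (g' x v))) L (mor_of L B (\<lambda>x v. p x (g x v))) B"
  proof (rule short_exactI[OF L' L B(2) i q])
    show "finj (rV L') (\<lambda>x v. h x (g' x v))"
      unfolding finj_def
    proof (intro ballI impI)
      fix x v assume x: "x \<in> verts Q" and v: "v \<in> rV L' x" and z: "h x (g' x v) = 0"
      have "g' x v \<in> V x" using fhomD(3)[OF g' x v] KV[OF x] by blast
      then have "g' x v = 0" using gh[OF x, of "g' x v"] z flinear_simps(4)[OF fhomD(2)[OF g x]] by simp
      then show "v = 0" using hg'[OF x v] flinear_simps(4)[OF fhomD(2)[OF h' x]] by simp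
    qed
    fix x assume x: "x \<in> verts Q"
    show "(\<lambda>v. h x (g' x v)) ` rV L' x = {v \<in> rV L x. p x (g x v) = 0}"
    proof (rule equalityI; rule subsetI)
      fix w assume "w \<in> (\<lambda>v. h x (g' x v)) ` rV L' x"
      then obtain v where v: "v \<in> rV L' x" "w = h x (g' x v)" by blast
      have k: "g' x v \<in> K x" by (rule fhomD(3)[OF g' x v(1)])
      then have "g' x v \<in> V x" "p x (g' x v) = 0" using K(2)[OF x] by auto
      then show "w \<in> {v \<in> rV L x. p x (g x v) = 0}"
        using fhomD(3)[OF h x] gh[OF x] by (simp add: v(2))
    next
      fix w assume "w \<in> {v \<in> rV L x. p x (g x v) = 0}"
      then have w: "w \<in> rV L x" "p x (g x w) = 0" by auto
      have k: "g x w \<in> K x" using K(2)[OF x] fhomD(3)[OF g x w(1)] w(2) by blast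
      have "w = h x (g' x (h' x (g x w)))" using gh'[OF x k] hg[OF x w(1)] by simp
      then show "w \<in> (\<lambda>v. h x (g' x v)) ` rV L' x" using fhomD(3)[OF h' x k] by blast
    qed
    show "(\<lambda>v. p x (g x v)) ` rV L x = rV B x"
    proof (rule equalityI; rule subsetI)
      fix w assume "w \<in> (\<lambda>v. p x (g x v)) ` rV L x"
      then show "w \<in> rV B x" using fhomD(3)[OF q x] by blast
    next
      fix w assume "w \<in> rV B x"
      then obtain v where v: "v \<in> V x" "w = p x v" using surj[OF x] by blast
      then have "w = p x (g x (h x v))" using gh[OF x] by simp
      then show "w \<in> (\<lambda>v. p x (g x v)) ` rV L x" using fhomD(3)[OF h x v(1)] by blast
    qed
  qed
  then show "L \<in> filtered_objects Q C" by (rule filtered_step[OF L'in B(1) L])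
qed

end

section \<open>An explicit brick of maximal dimension vector\<close>

lemma fsupp_zero [simp]: "0 \<in> fsupp P" and fsupp_add: "u \<in> fsupp P \<Longrightarrow> v \<in> fsupp P \<Longrightarrow> u + v \<in> fsupp P"
    and fsupp_scale: "u \<in> fsupp P \<Longrightarrow> fscale c u \<in> fsupp P"
    and fsupp_sum: "(\<And>a. a \<in> S \<Longrightarrow> g a \<in> fsupp P) \<Longrightarrow> sum g S \<in> fsupp P"
  by (auto simp: fsupp_def pointwise sum_apply intro: sum.neutral)

lemma fsupp_empty [simp]: "fsupp {} = {0}"
  by (auto simp: fsupp_def fun_eq_iff pointwise)

text \<open>
  Vectors of the glued representation have four blocks: the blocks \<open>0\<close>, \<open>1\<close>, \<open>2\<close> belong to the triple and
  block \<open>3\<close> to the copies of \<open>S(y)\<close>.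
\<close>

definition block :: "nat \<Rightarrow> (nat \<times> nat \<Rightarrow> 'k::field) \<Rightarrow> nat \<Rightarrow> 'k" where
  "block r v = (\<lambda>n. v (r, n))"

definition emb :: "nat \<Rightarrow> (nat \<Rightarrow> 'k::field) \<Rightarrow> nat \<times> nat \<Rightarrow> 'k" where
  "emb r u = (\<lambda>(r', n). if r' = r then u n else 0)"

lemma block_apply: "block r v n = v (r, n)"
  by (simp add: block_def)

lemma block_eqI: "(\<And>r. block r u = block r v) \<Longrightarrow> u = v"
  by (auto simp: block_def fun_eq_iff)

lemma block_linear: "flinear (block r)"
  by (rule flinearI) (auto simp: block_def fun_eq_iff pointwise)

lemma emb_linear: "flinear (emb r)"
  by (rule flinearI) (auto simp: emb_def fun_eq_iff pointwise)

lemma block_emb: "block r (emb s u) = (if r = s then u else 0)"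
  by (auto simp: block_def emb_def fun_eq_iff pointwise)

lemmas block_simps = flinear_simps[OF block_linear]

text \<open>
  The vectors \<open>(1, 0)\<close>, \<open>(0, 1)\<close>, \<open>(1, 1)\<close>, pairwise independent over every field.
\<close>

definition line_vec :: "nat \<Rightarrow> nat \<Rightarrow> 'k::field" where
  "line_vec r n = (if n = 0 then (if r = 1 then 0 else 1) else if n = 1 then (if r = 0 then 0 else 1) else 0)"

text \<open>
  The linear form with kernel spanned by \<open>line_vec r\<close>.
\<close>

definition line_form :: "nat \<Rightarrow> (nat \<Rightarrow> 'k::field) \<Rightarrow> 'k" where
  "line_form r u = u 0 * line_vec r 1 - u 1 * line_vec r 0"

lemma line_vec_cs: "line_vec r \<in> cs 2"
  by (auto simp: line_vec_def cs_iff)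

lemma line_form_add: "line_form r (u + v) = line_form r u + line_form r v" and line_form_scale: "line_form r (fscale c u) = c * line_form r u"
  and line_form_0: "line_form r 0 = 0"
  by (simp_all add: line_form_def pointwise algebra_simps)

lemma less3: "(r::nat) < 3 \<longleftrightarrow> r = 0 \<or> r = 1 \<or> r = 2"
  by presburger

lemma cs2_eqI:
  assumes "u \<in> cs 2" "v \<in> cs 2" "u 0 = v 0" "u 1 = v 1" shows "u = v"
proof
  fix i :: nat
  consider "i = 0" | "i = 1" | "2 \<le> i" by linarith
  then show "u i = v i" using assms by cases (auto simp: cs_iff)
qed

lemma line_form_kernel:
  assumes "r < 3" "u \<in> cs 2" "line_form r u = 0"
  obtains d where "u = fscale d (line_vec r)"
proof -
  have "u = fscale (if r = 1 then u 1 else u 0) (line_vec r)"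
    by (rule cs2_eqI[OF assms(2) fds_closed(5)[OF fds_cs line_vec_cs]])
      (use assms(1,3) in \<open>auto simp: less3 line_form_def line_vec_def pointwise\<close>)
  then show ?thesis using that by blast
qed

lemma line_form_nonzero:
  assumes "r < 3" obtains u where "u \<in> cs 2" "line_form r u \<noteq> (0::'k::field)"
proof -
  have "line_form r (line_vec (if r = 0 then 1 else 0)) \<noteq> (0::'k)"
    using assms by (auto simp: less3 line_form_def line_vec_def)
  then show ?thesis using that line_vec_cs by blast
qed

context brick_triple
begin

text \<open>
  The summands \<open>A r\<close> with \<open>r \<in> J\<close> and \<open>m\<close> copies of \<open>S(y)\<close>; for \<open>J = {0, 1, 2}\<close> and \<open>m = 2\<close> this is the whole
  representation, and the smaller choices are the steps of its filtration.
\<close>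

definition block_dim :: "nat set \<Rightarrow> nat \<Rightarrow> nat \<Rightarrow> 'v \<Rightarrow> nat" where
  "block_dim J m r x = (if r < 3 then (if r \<in> J then dimv (A r) x else 0) else if r = 3 \<and> x = y then m else 0)"

definition MV :: "nat set \<Rightarrow> nat \<Rightarrow> 'v \<Rightarrow> (nat \<times> nat \<Rightarrow> 'k) set" where
  "MV J m x = fsupp (SIGMA r:{..<4}. {..<block_dim J m r x})"

text \<open>
  The arrows act on the triple as before. In addition the unique arrow between \<open>y\<close> and the support of
  \<open>A r\<close> glues: it sends \<open>k\<^sup>2\<close> to the line of \<open>A r\<close> by \<open>line_form r\<close> if it leaves \<open>y\<close>, and the line to
  the span of \<open>line_vec r\<close> if it enters \<open>y\<close>. The operators do not depend on \<open>J\<close> and \<open>m\<close>.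
\<close>

definition MT :: "'a \<Rightarrow> (nat \<times> nat \<Rightarrow> 'k) \<Rightarrow> nat \<times> nat \<Rightarrow> 'k" where
  "MT a v = (\<lambda>(r, n).
     if r < 3 then (rT (A r) a (block r v) + fscale (if tail Q a = y \<and> 0 < dimv (A r) (head Q a)
        then line_form r (block 3 v) else 0) (unitf 0)) n
     else if r = 3 \<and> head Q a = y then (\<Sum>s<3. fscale (block s v 0) (line_vec s)) n else 0)"

lemma MV_iff: "v \<in> MV J m x \<longleftrightarrow> (\<forall>r. block r v \<in> cs (block_dim J m r x))"
proof -
  have "r < 4" if "n < block_dim J m r x" for r n using that by (auto simp: block_dim_def split: if_splits)
  then show ?thesis unfolding MV_def fsupp_def block_def by auto
qed

lemma fds_MV: "fds (MV J m x)"
  unfolding MV_def by (rule fsupp_fds_dim(1)) simp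

lemma dim_MV: "fs.dim (MV {..<3} 2 x) = sA x + (if x = y then 2 else 0)"
proof -
  have "fs.dim (MV {..<3} 2 x) = (\<Sum>r<4. block_dim {..<3} 2 r x)"
    unfolding MV_def by (subst fsupp_fds_dim(2)) (simp_all add: card_SigmaI)
  also have "\<dots> = (\<Sum>r<3. block_dim {..<3} 2 r x) + block_dim {..<3} 2 3 x"
    using sum.lessThan_Suc[of "\<lambda>r. block_dim {..<3} 2 r x" 3] by (simp add: eval_nat_numeral)
  finally show ?thesis by (simp add: block_dim_def sA_def)
qed

lemma block_MT:
  "r < 3 \<Longrightarrow> block r (MT a v) = rT (A r) a (block r v) + fscale (if tail Q a = y \<and> 0 < dimv (A r) (head Q a)
        then line_form r (block 3 v) else 0) (unitf 0)"
  "block 3 (MT a v) = (if head Q a = y then \<Sum>s<3. fscale (block s v 0) (line_vec s) else 0)"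
  "3 < r \<Longrightarrow> block r (MT a v) = 0"
  by (rule ext, subst block_apply, simp add: MT_def pointwise)+

lemma MT_linear: "flinear (MT a)"
proof (rule flinearI; rule block_eqI)
  fix u v and r :: nat
  consider "r < 3" | "r = 3" | "3 < r" by linarith
  then show "block r (MT a (u + v)) = block r (MT a u + MT a v)"
  proof cases
    case 1
    then show ?thesis
      by (simp add: block_MT(1) block_simps flinear_simps[OF mact_linear] line_form_add fs.scale_left_distrib)
  next
    case 2
    then show ?thesis by (simp add: block_MT(2) block_simps pointwise(1) fs.scale_left_distrib sum.distrib)
  qed (simp add: block_MT(3) block_simps)
next
  fix c v and r :: nat
  consider "r < 3" | "r = 3" | "3 < r" by linarith
  then show "block r (MT a (fscale c v)) = block r (fscale c (MT a v))"
  proof cases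
    case 1
    then show ?thesis
      by (simp add: block_MT(1) block_simps flinear_simps[OF mact_linear] line_form_scale fs.scale_right_distrib)
  next
    case 2
    then show ?thesis by (simp add: block_MT(2) block_simps pointwise(5) fs.scale_sum_right)
  qed (simp add: block_MT(3) block_simps)
qed

text \<open>
  The parts that are closed under \<open>MT\<close>: an arrow that leaves \<open>y\<close> needs its target, and an arrow that
  enters \<open>y\<close> needs all of \<open>k\<^sup>2\<close>.
\<close>

definition closed :: "nat set \<Rightarrow> nat \<Rightarrow> bool" where
  "closed J m \<longleftrightarrow> (0 < m \<longrightarrow> (\<forall>r<3. outward r \<longrightarrow> r \<in> J)) \<and> ((\<exists>r\<in>J. r < 3 \<and> inward r) \<longrightarrow> m = 2)"

lemma block_not_inward:
  assumes v: "v \<in> MV J m (tail Q a)" and a: "a \<in> arcs Q" "head Q a = y" and J: "\<not> (\<exists>r\<in>J. r < 3 \<and> inward r)"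
    and s: "s < 3"
  shows "block s v 0 = 0"
proof (rule ccontr)
  assume nz: "block s v 0 \<noteq> 0"
  have "block s v \<in> cs (block_dim J m s (tail Q a))" using v by (simp add: MV_iff)
  then have "0 < block_dim J m s (tail Q a)" using nz by (auto simp: cs_iff)
  then have "s \<in> J" "0 < dimv (A s) (tail Q a)" using s by (auto simp: block_dim_def split: if_splits)
  then have "inward s" unfolding inward_def using a by blast
  then show False using J s \<open>s \<in> J\<close> by blast
qed

lemma MT_in:
  assumes a: "a \<in> arcs Q" and v: "v \<in> MV J m (tail Q a)" and cl: "closed J m"
  shows "MT a v \<in> MV J m (head Q a)"
  unfolding MV_iff
proof
  fix r :: nat
  have cv: "block r v \<in> cs (block_dim J m r (tail Q a))" for r using v by (simp add: MV_iff)
  consider "r < 3" "r \<in> J" | "r < 3" "r \<notin> J" | "r = 3" | "3 < r" by linarith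
  then show "block r (MT a v) \<in> cs (block_dim J m r (head Q a))"
  proof cases
    case 1
    have "rT (A r) a (block r v) \<in> cs (dimv (A r) (head Q a))"
      using A_rep[OF 1(1)] a by (auto simp: is_rep_def intro: mact_cs)
    moreover have "fscale (if tail Q a = y \<and> 0 < dimv (A r) (head Q a) then line_form r (block 3 v) else 0) (unitf 0)
        \<in> cs (dimv (A r) (head Q a))"
      by (simp add: fsupp_scale[OF unitf_cs])
    ultimately show ?thesis using 1 by (simp add: block_MT(1) block_dim_def fsupp_add)
  next
    case 2
    have "block r v = 0" using cv[of r] 2 by (simp only: block_dim_def if_True if_False simp_thms cs_0)
    moreover have "(if tail Q a = y \<and> 0 < dimv (A r) (head Q a) then line_form r (block 3 v) else 0) = 0"
    proof (cases "tail Q a = y \<and> 0 < dimv (A r) (head Q a)")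
      case True
      then have "outward r" unfolding outward_def using a by blast
      then have "m = 0" using cl 2 unfolding closed_def by blast
      then have "block_dim J m 3 (tail Q a) = 0" by (simp add: block_dim_def)
      then have "block 3 v = 0" using cv[of 3] cs_0 by metis
      then show ?thesis by (simp add: line_form_0)
    qed auto
    ultimately have "block r (MT a v) = 0"
      unfolding block_MT(1)[OF 2(1)] by (simp add: flinear_simps(4)[OF mact_linear])
    then show ?thesis by simp
  next
    case 3
    show ?thesis
    proof (cases "head Q a = y")
      case True
      show ?thesis
      proof (cases "\<exists>r\<in>J. r < 3 \<and> inward r")
        case inw: True
        then have "m = 2" using cl unfolding closed_def by blast
        then have "(\<Sum>s<3. fscale (block s v 0) (line_vec s)) \<in> cs m"
          by (auto intro!: fsupp_sum fsupp_scale line_vec_cs)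
        then show ?thesis using 3 True by (simp add: block_MT(2) block_dim_def)
      next
        case False
        have "(\<Sum>s<3. fscale (block s v 0) (line_vec s)) = (0 :: nat \<Rightarrow> 'k)"
          by (rule sum.neutral) (simp add: block_not_inward[OF v a True False])
        then have "block 3 (MT a v) = 0" by (simp add: block_MT(2))
        then show ?thesis using 3 by simp
      qed
    next
      case False
      then have "block 3 (MT a v) = 0" by (simp add: block_MT(2))
      then show ?thesis using 3 by simp
    qed
  next
    case 4
    then show ?thesis by (simp add: block_MT(3))
  qed
qed

lemma frep_MV: "closed J m \<Longrightarrow> frep (MV J m) MT"
  unfolding frep_def using fds_MV MT_linear MT_in by blast

lemma emb_MV:
  assumes "u \<in> cs (block_dim J m r x)" shows "emb r u \<in> MV J m x"
  unfolding MV_iff block_emb using assms by simp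

text \<open>
  The projection to block \<open>r\<close> is a homomorphism if nothing is glued into that block.
\<close>

lemma filt_remove_A:
  fixes C :: "('v, 'a, 'k) rep set"
  assumes r: "r < 3" "r \<in> J" and C: "A r \<in> C" and cl: "closed J m" "closed (J - {r}) m"
    and top: "inward r \<or> m = 0" and K: "filt C (MV (J - {r}) m) MT"
  shows "filt C (MV J m) MT"
proof (rule filt_step[OF frep_MV[OF cl(1)] C A_rep[OF r(1)] _ _ frep_MV[OF cl(2)] _ K, where p = "\<lambda>x. block r"])
  show "fhom (MV J m) MT (rV (A r)) (rT (A r)) (\<lambda>x. block r)"
    unfolding fhom_def ffam_def
  proof (intro conjI ballI)
    show "flinear (block r)" by (rule block_linear)
    show "block r v \<in> rV (A r) x" if "v \<in> MV J m x" for x v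
      using that r unfolding MV_iff by (metis block_dim_def)
    fix a v assume a: "a \<in> arcs Q" and v: "v \<in> MV J m (tail Q a)"
    have "(if tail Q a = y \<and> 0 < dimv (A r) (head Q a) then line_form r (block 3 v) else 0) = 0"
    proof (cases "m = 0")
      case True
      have "block 3 v \<in> cs (block_dim J m 3 (tail Q a))" using v by (simp add: MV_iff)
      moreover have "block_dim J m 3 (tail Q a) = 0" using True by (simp add: block_dim_def)
      ultimately have "block 3 v = 0" using cs_0 by metis
      then show ?thesis by (simp add: line_form_0)
    next
      case False
      then have "\<not> outward r" using top inward_iff[OF r(1)] by blast
      then show ?thesis unfolding outward_def using a by auto
    qed
    then show "block r (MT a v) = rT (A r) a (block r v)" unfolding block_MT(1)[OF r(1)] by simp
  qed
  show "rV (A r) x \<subseteq> block r ` MV J m x" for x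
  proof
    fix u :: "nat \<Rightarrow> 'k" assume "u \<in> rV (A r) x"
    then have "emb r u \<in> MV J m x" using r by (intro emb_MV) (simp add: block_dim_def)
    then show "u \<in> block r ` MV J m x" by (rule image_eqI[rotated]) (simp add: block_emb)
  qed
  show "v \<in> MV (J - {r}) m x \<longleftrightarrow> v \<in> MV J m x \<and> block r v = 0" for x v
  proof
    assume v: "v \<in> MV (J - {r}) m x"
    have "block s v \<in> cs (block_dim J m s x)" for s
    proof -
      have "block s v \<in> cs (block_dim (J - {r}) m s x)" using v by (simp add: MV_iff)
      moreover have "block_dim (J - {r}) m s x \<le> block_dim J m s x" by (simp add: block_dim_def)
      ultimately show ?thesis by (simp add: cs_iff)
    qed
    then have "v \<in> MV J m x" unfolding MV_iff by blast
    moreover have "block r v = 0"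
    proof -
      have "block_dim (J - {r}) m r x = 0" using r by (simp add: block_dim_def)
      moreover have "block r v \<in> cs (block_dim (J - {r}) m r x)" using v by (simp add: MV_iff)
      ultimately show ?thesis using cs_0 by metis
    qed
    ultimately show "v \<in> MV J m x \<and> block r v = 0" by blast
  next
    assume v: "v \<in> MV J m x \<and> block r v = 0"
    show "v \<in> MV (J - {r}) m x"
      unfolding MV_iff
    proof
      fix s
      show "block s v \<in> cs (block_dim (J - {r}) m s x)"
      proof (cases "s = r")
        case True
        then show ?thesis using v by simp
      next
        case False
        then have "block_dim (J - {r}) m s x = block_dim J m s x" by (simp add: block_dim_def)
        then show ?thesis using v by (simp add: MV_iff)
      qed
    qed
  qed
qed

lemma simple_rep_simps: "dimv (simple_rep Q y) x = (if x = y then 1 else 0)"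
  "is_rep Q (simple_rep Q y)" "rT (simple_rep Q y) a v = (0 :: nat \<Rightarrow> 'k)"
  by (simp_all add: simple_rep_def Let_def is_rep_def mact_zero)

text \<open>
  The last coordinate of block \<open>3\<close> is a quotient isomorphic to \<open>S(y)\<close> as long as nothing is glued into
  that block.
\<close>

lemma filt_remove_y:
  fixes C :: "('v, 'a, 'k) rep set"
  assumes C: "simple_rep Q y \<in> C" and cl: "closed J (Suc m)" "closed J m"
    and J: "\<not> (\<exists>r\<in>J. r < 3 \<and> inward r)" and K: "filt C (MV J m) MT"
  shows "filt C (MV J (Suc m)) MT"
proof (rule filt_step[OF frep_MV[OF cl(1)] C simple_rep_simps(2) _ _ frep_MV[OF cl(2)] _ K,
      where p = "\<lambda>x v. fscale (if x = y then block 3 v m else 0) (unitf 0)"])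
  let ?p = "\<lambda>x v. fscale (if x = y then block 3 v m else 0) (unitf 0) :: nat \<Rightarrow> 'k"
  show "fhom (MV J (Suc m)) MT (rV (simple_rep Q y)) (rT (simple_rep Q y)) ?p"
    unfolding fhom_def ffam_def
  proof (intro conjI ballI)
    show "flinear (?p x)" for x
      by (rule flinearI) (simp_all add: block_simps pointwise(1,5) fs.scale_left_distrib)
    show "?p x v \<in> rV (simple_rep Q y) x" for x v
      by (simp add: simple_rep_simps fsupp_scale unitf_cs)
    fix a v assume a: "a \<in> arcs Q" and v: "v \<in> MV J (Suc m) (tail Q a)"
    have "block 3 (MT a v) = 0" if h: "head Q a = y"
      using block_not_inward[OF v a h J] by (simp add: block_MT(2))
    then show "?p (head Q a) (MT a v) = rT (simple_rep Q y) a (?p (tail Q a) v)"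
      by (simp add: simple_rep_simps pointwise(2))
  qed
  show "rV (simple_rep Q y) x \<subseteq> ?p x ` MV J (Suc m) x" for x
  proof
    fix u :: "nat \<Rightarrow> 'k" assume u: "u \<in> rV (simple_rep Q y) x"
    show "u \<in> ?p x ` MV J (Suc m) x"
    proof (cases "x = y")
      case True
      let ?v = "emb 3 (fscale (u 0) (unitf m)) :: nat \<times> nat \<Rightarrow> 'k"
      have "?v \<in> MV J (Suc m) x"
        using True by (intro emb_MV fsupp_scale) (simp add: block_dim_def unitf_cs)
      moreover have "?p x ?v = u"
        using True u by (auto simp: block_emb pointwise unitf_def simple_rep_simps cs_iff fun_eq_iff)
      ultimately show ?thesis by (metis (no_types, lifting) image_eqI)
    next
      case False
      then have "u = ?p x 0" using u by (simp add: simple_rep_simps)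
      moreover have "0 \<in> MV J (Suc m) x" by (simp add: MV_def)
      ultimately show ?thesis by (rule image_eqI[of u "?p x" 0])
    qed
  qed
  show "v \<in> MV J m x \<longleftrightarrow> v \<in> MV J (Suc m) x \<and> ?p x v = 0" for x v
  proof -
    have p0: "?p x v = 0 \<longleftrightarrow> x \<noteq> y \<or> block 3 v m = 0"
      by (simp add: fs.scale_eq_0_iff unitf_nz)
    have d: "block_dim J (Suc m) r x = (if r = 3 \<and> x = y then Suc m else block_dim J m r x)" for r by (simp add: block_dim_def)
    show ?thesis
    proof (cases "x = y")
      case False
      then show ?thesis unfolding MV_iff d p0 by simp
    next
      case True
      have le: "m \<le> i \<longleftrightarrow> i = m \<or> Suc m \<le> i" for i by auto
      have m3: "block 3 v \<in> cs m \<longleftrightarrow> block 3 v \<in> cs (Suc m) \<and> block 3 v m = 0"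
        unfolding cs_iff le by blast
      have "block r v \<in> cs (block_dim J m r x) \<longleftrightarrow> block r v \<in> cs (block_dim J (Suc m) r x) \<and> (r = 3 \<longrightarrow> block 3 v m = 0)" for r :: nat
      proof (cases "r = 3")
        case r: True
        have "block_dim J m r x = m" "block_dim J (Suc m) r x = Suc m" using True r by (simp_all add: block_dim_def)
        then show ?thesis using m3 r by simp
      next
        case False
        then show ?thesis by (simp add: d)
      qed
      then show ?thesis unfolding MV_iff p0 using True by blast
    qed
  qed
qed

text \<open>
  From bottom to top: the members of the triple that receive an arrow from \<open>y\<close>, the two copies of
  \<open>S(y)\<close>, and the members with an arrow to \<open>y\<close>.
\<close>

lemma filt_MV:
  fixes C :: "('v, 'a, 'k) rep set"
  assumes CA: "\<And>r. r < 3 \<Longrightarrow> A r \<in> C" and CS: "simple_rep Q y \<in> C"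
  shows "filt C (MV {..<3} 2) MT"
proof -
  let ?O = "{r. r < 3 \<and> outward r}" and ?I = "{r. r < 3 \<and> inward r}"
  have no_in: "\<not> (\<exists>r\<in>J. r < 3 \<and> inward r)" if "J \<subseteq> ?O" for J
  proof
    assume "\<exists>r\<in>J. r < 3 \<and> inward r"
    then obtain r where "r \<in> J" "r < 3" "inward r" by blast
    moreover have "outward r" using that \<open>r \<in> J\<close> by blast
    ultimately show False by (simp add: inward_iff)
  qed
  have outs: "filt C (MV J 0) MT" if "finite J" "J \<subseteq> ?O" for J
    using that
  proof (induction J rule: finite_induct)
    case empty
    show ?case
      by (rule filt_zero, rule block_eqI) (auto simp: MV_iff block_dim_def cs_iff block_def fun_eq_iff pointwise)
  next
    case (insert r J)
    have cl: "closed (insert r J) 0" "closed (insert r J - {r}) 0"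
      using no_in[OF insert.prems] unfolding closed_def by auto
    have r: "r < 3" using insert.prems by blast
    have "insert r J - {r} = J" using insert.hyps by blast
    then have "filt C (MV (insert r J - {r}) 0) MT" using insert.IH insert.prems by simp
    then show ?case by (rule filt_remove_A[OF r _ CA[OF r] cl, rotated 2]) simp_all
  qed
  have clO: "closed ?O m" for m using no_in[OF order_refl] unfolding closed_def by simp
  have 1: "filt C (MV ?O m) MT" for m
  proof (induction m)
    case 0 show ?case by (rule outs) auto
  next
    case (Suc m) show ?case by (rule filt_remove_y[OF CS clO clO no_in[OF order_refl] Suc])
  qed
  have 2: "filt C (MV (?O \<union> K) 2) MT" if "finite K" "K \<subseteq> ?I" for K
    using that
  proof (induction K rule: finite_induct)
    case empty show ?case using 1 by simp
  next
    case (insert r K)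
    have r: "r < 3" "inward r" using insert.prems by auto
    have nr: "\<not> outward r" using r inward_iff[OF r(1)] by simp
    then have "?O \<union> insert r K - {r} = ?O \<union> K" using insert.hyps by auto
    then have k: "filt C (MV (?O \<union> insert r K - {r}) 2) MT" using insert.IH insert.prems by simp
    have c1: "closed (?O \<union> insert r K) 2" unfolding closed_def by simp
    have c2: "closed (?O \<union> insert r K - {r}) 2" unfolding closed_def using nr by auto
    show ?case by (rule filt_remove_A[OF r(1) _ CA[OF r(1)] c1 c2 _ k]) (simp_all add: r(2))
  qed
  have "r \<in> ?O \<union> ?I \<longleftrightarrow> r \<in> {..<3}" for r using inward_iff[of r] by auto
  then have "?O \<union> ?I = {..<3}" by blast
  then show ?thesis using 2[of ?I] by simp
qed

text \<open>
  By orthogonality and because the \<open>A r\<close> have scalar endomorphisms, an endomorphism acts away from \<open>y\<close>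
  by a scalar \<open>c r\<close> on each block. The gluing arrows make its action \<open>B\<close> on \<open>k\<^sup>2\<close> preserve the three
  lines, with eigenvalue \<open>c r\<close> on a line, or on the quotient by it, according to the direction of the
  arrow. A map that preserves three different lines of \<open>k\<^sup>2\<close> is a scalar.
\<close>

lemma MV_brick: "brick (MV {..<3} 2) MT"
  unfolding brick_def
proof (intro allI impI)
  let ?V = "MV {..<3} 2"
  fix \<phi> assume phi: "fhom ?V MT ?V MT \<phi>"
  have cl: "closed {..<3} 2" by (simp add: closed_def)
  note V = frep_MV[OF cl]
  have block_dim_A: "block_dim {..<3} 2 r x = dimv (A r) x" if "r < 3" for r x using that by (simp add: block_dim_def)
  have block_dim_y: "block_dim {..<3} 2 3 y = 2" by (simp add: block_dim_def)
  have comp_in: "block r v \<in> rV (A r) x" if "v \<in> ?V x" "r < 3" for r v x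
    using that MV_iff block_dim_A by metis
  have emb_in: "emb r u \<in> ?V x" if "u \<in> rV (A r) x" "r < 3" for r u x
    using that by (intro emb_MV) (simp add: block_dim_A)
  have emb3_in: "emb 3 u \<in> ?V y" if "u \<in> cs 2" for u
    using that by (intro emb_MV) (simp add: block_dim_y)
  have comp_y: "block r v = 0" if "v \<in> ?V y" "r < 3" for r v
    using comp_in[OF that] A_y[OF that(2)] cs_0 by metis
  have comp3_0: "block r v = 0" if "v \<in> ?V x" "x \<noteq> y \<or> r \<noteq> 3" "\<not> r < 3" for r v x
  proof -
    have "block r v \<in> cs 0" using that MV_iff block_dim_def by metis
    then show ?thesis using cs_0 by blast
  qed
  \<comment> \<open>away from \<open>y\<close>, the blocks of \<open>\<phi>\<close> are maps between the members of the triple\<close>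
  have block_hom: "fhom (rV (A s)) (rT (A s)) (rV (A r)) (rT (A r)) (\<lambda>x u. block r (\<phi> x (emb s u)))"
    if r: "r < 3" and s: "s < 3" for r s
    unfolding fhom_def ffam_def
  proof (intro conjI ballI)
    show "flinear (\<lambda>u. block r (\<phi> x (emb s u)))" if "x \<in> verts Q" for x
      by (rule flinear_compose[OF flinear_compose[OF emb_linear fhomD(2)[OF phi that]] block_linear])
    show "block r (\<phi> x (emb s u)) \<in> rV (A r) x" if "x \<in> verts Q" "u \<in> rV (A s) x" for x u
      by (rule comp_in[OF fhomD(3)[OF phi that(1) emb_in[OF that(2) s]] r])
    fix a u assume a: "a \<in> arcs Q" and u: "u \<in> rV (A s) (tail Q a)"
    note h = head_in_verts[OF a] and t = tail_in_verts[OF a]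
    have in_h: "rT (A s) a u \<in> rV (A s) (head Q a)" by (rule frepD(3)[OF frep_rep[OF A_rep[OF s]] a u])
    show "block r (\<phi> (head Q a) (emb s (rT (A s) a u))) = rT (A r) a (block r (\<phi> (tail Q a) (emb s u)))"
    proof (cases "tail Q a = y")
      case True
      then have "u = 0" using u A_y[OF s] cs_0 by metis
      then show ?thesis
        by (simp add: flinear_simps(4)[OF mact_linear] flinear_simps(4)[OF emb_linear]
            flinear_simps(4)[OF fhomD(2)[OF phi h]] flinear_simps(4)[OF fhomD(2)[OF phi t]] block_simps)
    next
      case ty: False
      show ?thesis
      proof (cases "head Q a = y")
        case True
        have "block r (\<phi> (head Q a) (emb s (rT (A s) a u))) = 0"
          using comp_y[of _ r] fhomD(3)[OF phi h emb_in[OF in_h s]] True r by simp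
        moreover have "rT (A r) a (block r (\<phi> (tail Q a) (emb s u))) \<in> cs 0"
          using frepD(3)[OF frep_rep[OF A_rep[OF r]] a comp_in[OF fhomD(3)[OF phi t emb_in[OF u s]] r]]
            True A_y[OF r] by metis
        ultimately show ?thesis using cs_0 by metis
      next
        case False
        have "MT a (emb s u) = emb s (rT (A s) a u)"
        proof (rule block_eqI)
          fix q :: nat
          consider "q < 3" | "q = 3" | "3 < q" by linarith
          then show "block q (MT a (emb s u)) = block q (emb s (rT (A s) a u))"
            using False ty s by cases (auto simp: block_MT block_emb flinear_simps(4)[OF mact_linear])
        qed
        then have "\<phi> (head Q a) (emb s (rT (A s) a u)) = MT a (\<phi> (tail Q a) (emb s u))"
          using fhomD(4)[OF phi a emb_in[OF u s]] by simp
        then show ?thesis using ty by (simp add: block_MT(1)[OF r])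
      qed
    qed
  qed
  have "\<forall>r\<in>{..<3}. \<exists>c. \<forall>x\<in>verts Q. \<forall>u\<in>rV (A r) x. block r (\<phi> x (emb r u)) = fscale c u"
  proof
    fix r :: nat assume "r \<in> {..<3}"
    then have r: "r < 3" by simp
    show "\<exists>c. \<forall>x\<in>verts Q. \<forall>u\<in>rV (A r) x. block r (\<phi> x (emb r u)) = fscale c u"
      using A_end_scalar[OF r block_hom[OF r r]] by metis
  qed
  then obtain c where c: "\<And>r x u. r < 3 \<Longrightarrow> x \<in> verts Q \<Longrightarrow> u \<in> rV (A r) x \<Longrightarrow> block r (\<phi> x (emb r u)) = fscale (c r) u"
    by (metis lessThan_iff)
  have off: "block r (\<phi> x (emb s u)) = 0" if "r < 3" "s < 3" "r \<noteq> s" "x \<in> verts Q" "u \<in> rV (A s) x" for r s x u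
    using A_orth[OF that(2,1) _ block_hom[OF that(1,2)]] that(3-5) unfolding fzero_def by metis
  have phi_comp: "block r (\<phi> x v) = fscale (c r) (block r v)" if r: "r < 3" and x: "x \<in> verts Q" "x \<noteq> y" and v: "v \<in> ?V x" for r x v
  proof -
    have dec: "v = (\<Sum>s<3. emb s (block s v))"
    proof (rule block_eqI)
      fix q :: nat
      show "block q v = block q (\<Sum>s<3. emb s (block s v))"
        using comp3_0[OF v, of q] x(2) by (cases "q < 3") (simp_all add: block_simps block_emb)
    qed
    have "block r (\<phi> x v) = (\<Sum>s<3. block r (\<phi> x (emb s (block s v))))"
      by (subst dec) (simp add: block_simps flinear_simps(6)[OF fhomD(2)[OF phi x(1)]])
    also have "\<dots> = (\<Sum>s<3. if r = s then fscale (c r) (block r v) else 0)"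
      using off[OF r _ _ x(1) comp_in[OF v]] c[OF r x(1) comp_in[OF v r]] by (intro sum.cong) auto
    also have "\<dots> = fscale (c r) (block r v)" using r by simp
    finally show ?thesis .
  qed
  define B where "B u = block 3 (\<phi> y (emb 3 u))" for u
  have B_lin: "flinear B" unfolding B_def
    by (rule flinear_compose[OF flinear_compose[OF emb_linear fhomD(2)[OF phi y]] block_linear])
  have B_in: "B u \<in> cs 2" if "u \<in> cs 2" for u
    using fhomD(3)[OF phi y emb3_in[OF that]] block_dim_y unfolding B_def MV_iff by metis
  have arrow_in: "B (line_vec r) = fscale (c r) (line_vec r)" if r: "r < 3" and a: "a \<in> arcs Q" "head Q a = y" "dimv (A r) (tail Q a) = 1" for r a
  proof -
    note t = tail_in_verts[OF a(1)]
    have ty: "tail Q a \<noteq> y" using no_loop_at_y[OF a(1)] a(2) by blast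
    let ?v = "emb r (unitf 0) :: nat \<times> nat \<Rightarrow> 'k"
    have v: "?v \<in> ?V (tail Q a)" by (rule emb_in[OF _ r]) (simp add: a(3) unitf_cs)
    have Mv: "MT a ?v \<in> ?V y" using MT_in[OF a(1) v cl] a(2) by simp
    have c0: "block s ?v 0 = (if s = r then 1 else 0)" for s
      by (simp add: block_emb unitf_def pointwise)
    have "block 3 (MT a ?v) = (\<Sum>s<3. fscale (block s ?v 0) (line_vec s))"
      using a(2) by (simp add: block_MT(2))
    also have "\<dots> = (\<Sum>s<3. if s = r then line_vec r else 0)"
      by (intro sum.cong refl) (simp add: c0)
    finally have "block 3 (MT a ?v) = line_vec r" using r by simp
    moreover have "MT a ?v = emb 3 (block 3 (MT a ?v))"
    proof (rule block_eqI)
      fix q :: nat show "block q (MT a ?v) = block q (emb 3 (block 3 (MT a ?v)))"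
        using comp_y[OF Mv, of q] comp3_0[OF Mv, of q] by (cases "q < 3"; cases "q = 3") (simp_all add: block_emb)
    qed
    ultimately have "B (line_vec r) = block 3 (\<phi> (head Q a) (MT a ?v))" by (simp add: B_def a(2))
    also have "\<dots> = block 3 (MT a (\<phi> (tail Q a) ?v))" using fhomD(4)[OF phi a(1) v] by simp
    also have "\<dots> = (\<Sum>s<3. fscale (block s (\<phi> (tail Q a) ?v) 0) (line_vec s))" using a(2) by (simp add: block_MT(2))
    also have "\<dots> = (\<Sum>s<3. if s = r then fscale (c r) (line_vec r) else 0)"
      by (intro sum.cong refl) (simp add: phi_comp[OF _ t ty v] pointwise(5) c0)
    also have "\<dots> = fscale (c r) (line_vec r)" using r by simp
    finally show ?thesis .
  qed
  have arrow_out: "line_form r (B u) = c r * line_form r u"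
    if r: "r < 3" and a: "a \<in> arcs Q" "tail Q a = y" "dimv (A r) (head Q a) = 1" and u: "u \<in> cs 2" for r a u
  proof -
    note h = head_in_verts[OF a(1)]
    have hy: "head Q a \<noteq> y" using no_loop_at_y[OF a(1)] a(2) by blast
    let ?v = "emb 3 u"
    have v: "?v \<in> ?V (tail Q a)" using emb3_in[OF u] a(2) by simp
    have MT0: "block r (MT a w) 0 = line_form r (block 3 w)" if "w \<in> ?V y" for w
      using comp_y[OF that r] a by (simp add: block_MT(1)[OF r] flinear_simps(4)[OF mact_linear] pointwise unitf_def)
    have pv: "\<phi> y ?v \<in> ?V y" by (rule fhomD(3)[OF phi y emb3_in[OF u]])
    have "block r (\<phi> (head Q a) (MT a ?v)) 0 = c r * block r (MT a ?v) 0"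
      by (simp add: phi_comp[OF r h hy MT_in[OF a(1) v cl]] pointwise(5))
    moreover have "\<phi> (head Q a) (MT a ?v) = MT a (\<phi> y ?v)" using fhomD(4)[OF phi a(1) v] a(2) by simp
    ultimately show ?thesis
      using MT0[OF pv] MT0[OF emb3_in[OF u]] by (simp add: B_def block_emb)
  qed
  have "\<exists>d. B (line_vec r) = fscale d (line_vec r)" if r: "r < 3" for r
    using r
  proof (cases rule: arrow_cases[OF r, case_names out inn])
    case (out a)
    have "line_form r (line_vec r :: nat \<Rightarrow> 'k) = 0" by (simp add: line_form_def)
    then have "line_form r (B (line_vec r)) = 0" using arrow_out[OF r out(1-3) line_vec_cs] by simp
    then show ?thesis using line_form_kernel[OF r B_in[OF line_vec_cs]] by metis
  next
    case (inn a)
    then show ?thesis using arrow_in[OF r inn(1-3)] by blast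
  qed
  then obtain d where d: "\<And>r. r < 3 \<Longrightarrow> B (line_vec r) = fscale (d r) (line_vec r)" by metis
  \<comment> \<open>the third line is the diagonal of the other two, so the eigenvalues agree\<close>
  have w2: "line_vec 2 = line_vec 0 + (line_vec 1 :: nat \<Rightarrow> 'k)"
    by (auto simp: line_vec_def fun_eq_iff pointwise)
  have "fscale (d 2) (line_vec 2) = fscale (d 0) (line_vec 0) + fscale (d 1) (line_vec 1 :: nat \<Rightarrow> 'k)"
    using d[of 0] d[of 1] d[of 2] arg_cong[OF w2, of B] flinear_simps(1)[OF B_lin] by simp
  then have deq: "d 0 = d 2" "d 1 = d 2"
    by (auto simp: line_vec_def fun_eq_iff pointwise dest: spec[of _ 0] spec[of _ 1])
  have B_scalar: "B u = fscale (d 2) u" if u: "u \<in> cs 2" for u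
  proof -
    have u_eq: "u = fscale (u 0) (line_vec 0) + fscale (u 1) (line_vec 1)"
      by (rule cs2_eqI[OF u]) (auto intro!: fsupp_add fsupp_scale line_vec_cs simp: pointwise line_vec_def)
    have "B u = fscale (u 0) (B (line_vec 0)) + fscale (u 1) (B (line_vec 1))"
      by (subst u_eq) (simp add: flinear_simps[OF B_lin])
    also have "\<dots> = fscale (d 2) (fscale (u 0) (line_vec 0) + fscale (u 1) (line_vec 1))"
      using d[of 0] d[of 1] deq by (simp add: fs.scale_right_distrib mult.commute)
    finally show ?thesis using u_eq by simp
  qed
  have c_eq: "c r = d 2" if r: "r < 3" for r
    using r
  proof (cases rule: arrow_cases[OF r, case_names out inn])
    case (out a)
    obtain u where u: "u \<in> cs 2" "line_form r u \<noteq> (0::'k)" using line_form_nonzero[OF r] by blast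
    have "c r * line_form r u = d 2 * line_form r u"
      unfolding arrow_out[OF r out(1-3) u(1), symmetric] B_scalar[OF u(1)] line_form_scale ..
    then show ?thesis using u(2) by simp
  next
    case (inn a)
    have "fscale (c r) (line_vec r) = fscale (d 2) (line_vec r :: nat \<Rightarrow> 'k)"
      unfolding arrow_in[OF r inn(1-3), symmetric] by (rule B_scalar[OF line_vec_cs])
    moreover have "line_vec r \<noteq> (0 :: nat \<Rightarrow> 'k)"
    proof
      assume "line_vec r = (0 :: nat \<Rightarrow> 'k)"
      then have "line_vec r 0 = (0::'k)" "line_vec r 1 = (0::'k)" by (simp_all add: pointwise)
      then show False by (auto simp: line_vec_def split: if_splits)
    qed
    ultimately show ?thesis by simp
  qed
  have scalar: "\<phi> x v = fscale (d 2) v" if x: "x \<in> verts Q" and v: "v \<in> ?V x" for x v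
  proof (rule block_eqI)
    fix r :: nat
    have pv: "\<phi> x v \<in> ?V x" by (rule fhomD(3)[OF phi x v])
    show "block r (\<phi> x v) = block r (fscale (d 2) v)"
    proof (cases "x = y")
      case False
      show ?thesis
      proof (cases "r < 3")
        case True
        then show ?thesis using phi_comp[OF True x False v] c_eq by (simp add: block_simps)
      next
        case r: False
        then show ?thesis using comp3_0[OF pv _ r] comp3_0[OF v _ r] False by (simp add: block_simps)
      qed
    next
      case True
      have v_eq: "v = emb 3 (block 3 v)"
      proof (rule block_eqI)
        fix q :: nat show "block q v = block q (emb 3 (block 3 v))"
          using comp_y[of v q] comp3_0[of v y q] v True by (cases "q < 3"; cases "q = 3") (simp_all add: block_emb)
      qed
      have c3: "block 3 v \<in> cs 2" using v True block_dim_y MV_iff by metis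
      have "block 3 (\<phi> x v) = B (block 3 v)" using v_eq True by (simp add: B_def)
      then have "block 3 (\<phi> x v) = block 3 (fscale (d 2) v)" using B_scalar[OF c3] by (simp add: block_simps)
      then show ?thesis
        using comp_y[of v r] comp_y[of "\<phi> x v" r] comp3_0[of v y r] comp3_0[of "\<phi> x v" y r] v pv True
        by (cases "r < 3"; cases "r = 3") (simp_all add: block_simps)
    qed
  qed
  show "fzero ?V \<phi> \<or> finj ?V \<phi>"
  proof (cases "d 2 = 0")
    case True
    then have "fzero ?V \<phi>" using scalar by (simp add: fzero_def)
    then show ?thesis ..
  next
    case False
    then have "finj ?V \<phi>" using scalar by (simp add: finj_def fs.scale_eq_0_iff)
    then show ?thesis ..
  qed
qed

end

section \<open>Extensions and cocycles\<close>

context quiver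
begin

lemma is_morI:
  assumes X: "is_rep Q X" and Y: "is_rep Q Y"
    and c: "\<And>x. x \<in> verts Q \<Longrightarrow> \<phi> x \<in> carrier_mat (dimv Y x) (dimv X x)"
    and h: "\<And>a v. a \<in> arcs Q \<Longrightarrow> v \<in> rV X (tail Q a) \<Longrightarrow>
      mact (\<phi> (head Q a)) (rT X a v) = rT Y a (mact (\<phi> (tail Q a)) v)"
  shows "is_mor Q X Y \<phi>"
  unfolding is_mor_def
proof (intro conjI ballI c)
  fix a assume a: "a \<in> arcs Q"
  have cX: "lin X a \<in> carrier_mat (dimv X (head Q a)) (dimv X (tail Q a))"
    and cY: "lin Y a \<in> carrier_mat (dimv Y (head Q a)) (dimv Y (tail Q a))"
    using X Y a by (auto simp: is_rep_def)
  note ch = c[OF head_in_verts[OF a]] and ctl = c[OF tail_in_verts[OF a]]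
  show "\<phi> (head Q a) * lin X a = lin Y a * \<phi> (tail Q a)"
    by (rule mact_inject[OF mult_carrier_mat[OF ch cX] mult_carrier_mat[OF cY ctl]])
      (simp add: mact_mult[OF ch cX] mact_mult[OF cY ctl] h[OF a])
qed

abbreviation ma :: "('v, 'k::field) mor \<Rightarrow> 'v \<Rightarrow> (nat \<Rightarrow> 'k) \<Rightarrow> nat \<Rightarrow> 'k" where
  "ma \<phi> \<equiv> \<lambda>x. mact (\<phi> x)"

text \<open>
  A linear section \<open>\<sigma>\<close> of the extension fails to commute with the arrows by a cochain \<open>c\<close> with values in the
  subobject. The relation depends on \<open>X\<close> since extensions do not record their end terms.
\<close>

definition cocycle_of :: "('v, 'a, 'k::field) rep \<Rightarrow> ('v, 'a, 'k) ext \<Rightarrow> ('a \<Rightarrow> (nat \<Rightarrow> 'k) \<Rightarrow> nat \<Rightarrow> 'k) \<Rightarrow> bool" where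
  "cocycle_of X \<xi> c \<longleftrightarrow> (case \<xi> of (E, i, p) \<Rightarrow> \<exists>\<sigma>. ffam (rV X) (rV E) \<sigma> \<and>
     (\<forall>x\<in>verts Q. \<forall>v\<in>rV X x. ma p x (\<sigma> x v) = v) \<and>
     (\<forall>a\<in>arcs Q. \<forall>v\<in>rV X (tail Q a).
        rT E a (\<sigma> (tail Q a) v) - \<sigma> (head Q a) (rT X a v) = ma i (head Q a) (c a v)))"

text \<open>
  Unlike \<open>coboundary\<close>, this does not fix the family whose differential is \<open>c\<close>.
\<close>

definition cob :: "('v, 'a, 'k::field) rep \<Rightarrow> ('v, 'a, 'k) rep \<Rightarrow> ('a \<Rightarrow> (nat \<Rightarrow> 'k) \<Rightarrow> nat \<Rightarrow> 'k) \<Rightarrow> bool" where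
  "cob X Y c \<longleftrightarrow> (\<exists>\<psi>. ffam (rV X) (rV Y) \<psi> \<and> coboundary (rV X) (rT X) (rT Y) \<psi> c)"

lemma extensionsD:
  assumes X: "is_rep Q X" and Y: "is_rep Q Y" and e: "(E, i, p) \<in> extensions Q X Y"
  shows "is_rep Q E" "fhom (rV Y) (rT Y) (rV E) (rT E) (ma i)" "fhom (rV E) (rT E) (rV X) (rT X) (ma p)"
    "finj (rV Y) (ma i)" "x \<in> verts Q \<Longrightarrow> e \<in> rV E x \<Longrightarrow> ma p x e = 0 \<Longrightarrow> \<exists>v\<in>rV Y x. ma i x v = e"
    "x \<in> verts Q \<Longrightarrow> v \<in> rV Y x \<Longrightarrow> ma p x (ma i x v) = 0"
    "x \<in> verts Q \<Longrightarrow> ma p x ` rV E x = rV X x" "is_mor Q Y E i" "is_mor Q E X p"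
proof -
  show E: "is_rep Q E" using e by (simp add: extensions_def)
  have se: "short_exact Q Y i E p X" using e by (simp add: extensions_def)
  note s = se[unfolded short_exact_iff[OF Y E X]]
  show "is_mor Q Y E i" "is_mor Q E X p" using s by blast+
  then show "fhom (rV Y) (rT Y) (rV E) (rT E) (ma i)" "fhom (rV E) (rT E) (rV X) (rT X) (ma p)"
    using fhom_mor[OF Y E] fhom_mor[OF E X] by blast+
  show "finj (rV Y) (ma i)" using s by blast
  have im: "ma i x ` rV Y x = {v \<in> rV E x. ma p x v = 0}" if "x \<in> verts Q" for x using s that by blast
  show "\<exists>v\<in>rV Y x. ma i x v = e" if "x \<in> verts Q" "e \<in> rV E x" "ma p x e = 0"
  proof -
    have "e \<in> ma i x ` rV Y x" unfolding im[OF that(1)] using that(2,3) by simp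
    then show ?thesis by (auto simp: image_iff)
  qed
  show "ma p x (ma i x v) = 0" if "x \<in> verts Q" "v \<in> rV Y x"
  proof -
    have "ma i x v \<in> ma i x ` rV Y x" using that(2) by (rule imageI)
    then show ?thesis unfolding im[OF that(1)] by simp
  qed
  show "ma p x ` rV E x = rV X x" if "x \<in> verts Q" using s that by blast
qed

lemma cocycle_exists:
  assumes X: "is_rep Q X" and Y: "is_rep Q Y" and e: "\<xi> \<in> extensions Q X Y"
  shows "\<exists>c. cochain (rV X) (rV Y) c \<and> cocycle_of X \<xi> c"
proof -
  obtain E i p where xi: "\<xi> = (E, i, p)" by (cases \<xi>)
  note D = extensionsD[OF X Y e[unfolded xi]]
  note fE = frep_rep[OF D(1)] and fY = frep_rep[OF Y]
  obtain s where s: "\<And>x. x \<in> verts Q \<Longrightarrow> flinear (s x)" "\<And>x w. x \<in> verts Q \<Longrightarrow> s x w \<in> rV E x"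
    "\<And>x v. x \<in> verts Q \<Longrightarrow> v \<in> rV E x \<Longrightarrow> ma p x (s x (ma p x v)) = ma p x v"
    using fam_section_exists[OF fE fhomD(1)[OF D(3)]] by metis
  obtain r where r: "\<And>x. x \<in> verts Q \<Longrightarrow> flinear (r x)" "\<And>x w. x \<in> verts Q \<Longrightarrow> r x w \<in> rV Y x"
    "\<And>x v. x \<in> verts Q \<Longrightarrow> v \<in> rV Y x \<Longrightarrow> r x (ma i x v) = v"
    using fam_retraction_exists[OF fY fhomD(1)[OF D(2)] D(4)] by metis
  have ps: "ma p x (s x v) = v" if x: "x \<in> verts Q" and v: "v \<in> rV X x" for x v
  proof -
    obtain e where "e \<in> rV E x" "v = ma p x e" using D(7)[OF x] v by blast
    then show ?thesis using s(3)[OF x] by simp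
  qed
  let ?d = "\<lambda>a v. rT E a (s (tail Q a) v) - s (head Q a) (rT X a v)"
  let ?c = "\<lambda>a v. r (head Q a) (?d a v)"
  have dl: "flinear (?d a)" if "a \<in> arcs Q" for a
    by (rule flinear_ops(4)[OF flinear_compose[OF s(1)[OF tail_in_verts[OF that]] mact_linear]
          flinear_compose[OF mact_linear s(1)[OF head_in_verts[OF that]]]])
  have "cochain (rV X) (rV Y) ?c"
    unfolding cochain_def
  proof (intro ballI conjI)
    fix a assume a: "a \<in> arcs Q"
    show "flinear (?c a)" by (rule flinear_compose[OF dl[OF a] r(1)[OF head_in_verts[OF a]]])
    show "?c a v \<in> rV Y (head Q a)" for v by (rule r(2)[OF head_in_verts[OF a]])
  qed
  moreover have "rT E a (s (tail Q a) v) - s (head Q a) (rT X a v) = ma i (head Q a) (?c a v)"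
    if a: "a \<in> arcs Q" and v: "v \<in> rV X (tail Q a)" for a v
  proof -
    note h = head_in_verts[OF a] and t = tail_in_verts[OF a]
    have Xv: "rT X a v \<in> rV X (head Q a)" by (rule frepD(3)[OF frep_rep[OF X] a v])
    have in_E: "?d a v \<in> rV E (head Q a)"
      by (rule fds_closed(3)[OF fds_cs frepD(3)[OF fE a s(2)[OF t]] s(2)[OF h]])
    have "ma p (head Q a) (?d a v) = 0"
      using fhomD(4)[OF D(3) a s(2)[OF t], of v] ps[OF t v] ps[OF h Xv]
      by (simp add: flinear_simps(2)[OF mact_linear])
    then obtain u where u: "u \<in> rV Y (head Q a)" "ma i (head Q a) u = ?d a v"
      using D(5)[OF h in_E] by blast
    show ?thesis unfolding u(2)[symmetric] by (simp add: r(3)[OF h u(1)])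
  qed
  moreover have "ffam (rV X) (rV E) s" using s(1,2) by (simp add: ffam_def)
  ultimately have "cochain (rV X) (rV Y) ?c \<and> cocycle_of X \<xi> ?c"
    unfolding cocycle_of_def xi prod.case using ps by blast
  then show ?thesis by blast
qed

lemma cocycleE:
  assumes "cocycle_of X (E, i, p) c"
  obtains \<sigma> where "ffam (rV X) (rV E) \<sigma>" "\<And>x v. x \<in> verts Q \<Longrightarrow> v \<in> rV X x \<Longrightarrow> ma p x (\<sigma> x v) = v"
    "\<And>a v. a \<in> arcs Q \<Longrightarrow> v \<in> rV X (tail Q a) \<Longrightarrow> rT E a (\<sigma> (tail Q a) v) = \<sigma> (head Q a) (rT X a v) + ma i (head Q a) (c a v)"
proof -
  obtain \<sigma> where s: "ffam (rV X) (rV E) \<sigma>" "\<forall>x\<in>verts Q. \<forall>v\<in>rV X x. ma p x (\<sigma> x v) = v"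
    "\<forall>a\<in>arcs Q. \<forall>v\<in>rV X (tail Q a). rT E a (\<sigma> (tail Q a) v) - \<sigma> (head Q a) (rT X a v) = ma i (head Q a) (c a v)"
    using assms unfolding cocycle_of_def prod.case by blast
  show ?thesis
    by (rule that[OF s(1)]) (use s(2,3) in \<open>auto simp: algebra_simps\<close>)
qed

text \<open>
  A morphism \<open>\<beta>\<close> of the middle terms over \<open>\<alpha>\<close> and \<open>\<gamma>\<close> carries the section \<open>\<sigma>\<close> of the first extension to
  \<open>\<tau> \<circ> \<gamma> - j \<circ> \<psi>\<close>, where \<open>\<tau>\<close> is the section of the second one, for a unique linear family \<open>\<psi>\<close> from \<open>X\<close> to \<open>Y'\<close>.
  It commutes with the arrows if and only if the differential of \<open>\<psi>\<close> is \<open>\<alpha> c - d \<gamma>\<close>. All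
  comparisons of extensions below are instances.
\<close>

lemma ext_mor_iff:
  assumes X: "is_rep Q X" and Y: "is_rep Q Y" and X': "is_rep Q X'" and Y': "is_rep Q Y'"
    and xi: "\<xi> \<in> extensions Q X Y" and zeta: "\<zeta> \<in> extensions Q X' Y'"
    and al: "is_mor Q Y Y' \<alpha>" and ga: "is_mor Q X X' \<gamma>"
    and c: "cochain (rV X) (rV Y) c" "cocycle_of X \<xi> c" and d: "cochain (rV X') (rV Y') d" "cocycle_of X' \<zeta> d"
  shows "ext_mor Q \<alpha> \<gamma> \<xi> \<zeta> \<longleftrightarrow> cob X Y' (\<lambda>a v. ma \<alpha> (head Q a) (c a v) - d a (ma \<gamma> (tail Q a) v))"
    (is "_ \<longleftrightarrow> cob X Y' ?e")
proof -
  obtain E i p where xi_eq: "\<xi> = (E, i, p)" by (cases \<xi>)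
  obtain F j q where zeta_eq: "\<zeta> = (F, j, q)" by (cases \<zeta>)
  note D = extensionsD[OF X Y xi[unfolded xi_eq]] and D' = extensionsD[OF X' Y' zeta[unfolded zeta_eq]]
  note fE = frep_rep[OF D(1)] and fF = frep_rep[OF D'(1)]
  note A = fhom_mor[OF Y Y' al] and G = fhom_mor[OF X X' ga]
  note lin = flinear_simps[OF mact_linear]
  obtain \<sigma> where s: "ffam (rV X) (rV E) \<sigma>" "\<And>x v. x \<in> verts Q \<Longrightarrow> v \<in> rV X x \<Longrightarrow> ma p x (\<sigma> x v) = v"
    "\<And>a v. a \<in> arcs Q \<Longrightarrow> v \<in> rV X (tail Q a) \<Longrightarrow> rT E a (\<sigma> (tail Q a) v) = \<sigma> (head Q a) (rT X a v) + ma i (head Q a) (c a v)"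
    using cocycleE[OF c(2)[unfolded xi_eq]] by metis
  obtain \<tau> where t: "ffam (rV X') (rV F) \<tau>" "\<And>x v. x \<in> verts Q \<Longrightarrow> v \<in> rV X' x \<Longrightarrow> ma q x (\<tau> x v) = v"
    "\<And>a v. a \<in> arcs Q \<Longrightarrow> v \<in> rV X' (tail Q a) \<Longrightarrow> rT F a (\<tau> (tail Q a) v) = \<tau> (head Q a) (rT X' a v) + ma j (head Q a) (d a v)"
    using cocycleE[OF d(2)[unfolded zeta_eq]] by metis
  have cY: "c a v \<in> rV Y (head Q a)" if "a \<in> arcs Q" "v \<in> rV X (tail Q a)" for a v
    using c(1) that by (simp add: cochain_def)
  have dY: "d a v \<in> rV Y' (head Q a)" if "a \<in> arcs Q" "v \<in> rV X' (tail Q a)" for a v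
    using d(1) that by (simp add: cochain_def)
  have Xin: "rT X a v \<in> rV X (head Q a)" if "a \<in> arcs Q" "v \<in> rV X (tail Q a)" for a v
    by (rule frepD(3)[OF frep_rep[OF X] that])
  show ?thesis
  proof
    assume "ext_mor Q \<alpha> \<gamma> \<xi> \<zeta>"
    then obtain \<beta> where be: "is_mor Q E F \<beta>" "mor_eq Q (mor_comp \<beta> i) (mor_comp j \<alpha>)"
      "mor_eq Q (mor_comp q \<beta>) (mor_comp \<gamma> p)" unfolding xi_eq zeta_eq ext_mor.simps by blast
    note B = fhom_mor[OF D(1) D'(1) be(1)]
    have b1: "ma \<beta> x (ma i x v) = ma j x (ma \<alpha> x v)" if "x \<in> verts Q" for x v
      using be(2) that mor_comp_carrier(2)[OF D(8) be(1) that] mor_comp_carrier(2)[OF al D'(8) that]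
      unfolding mor_eq_def by metis
    have b2: "ma q x (ma \<beta> x v) = ma \<gamma> x (ma p x v)" if "x \<in> verts Q" for x v
      using be(3) that mor_comp_carrier(2)[OF be(1) D'(9) that] mor_comp_carrier(2)[OF D(9) ga that]
      unfolding mor_eq_def by metis
    obtain r where r: "\<And>x. x \<in> verts Q \<Longrightarrow> flinear (r x)" "\<And>x w. x \<in> verts Q \<Longrightarrow> r x w \<in> rV Y' x"
      "\<And>x v. x \<in> verts Q \<Longrightarrow> v \<in> rV Y' x \<Longrightarrow> r x (ma j x v) = v"
      using fam_retraction_exists[OF frep_rep[OF Y'] fhomD(1)[OF D'(2)] D'(4)] by metis
    let ?u = "\<lambda>x v. \<tau> x (ma \<gamma> x v) - ma \<beta> x (\<sigma> x v)"
    let ?\<psi> = "\<lambda>x v. r x (?u x v)"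
    have jp: "ma j x (?\<psi> x v) = ?u x v" if x: "x \<in> verts Q" and v: "v \<in> rV X x" for x v
    proof -
      have "?u x v \<in> rV F x"
        by (rule fds_closed(3)[OF fds_cs ffamD(2)[OF t(1) x fhomD(3)[OF G x v]] fhomD(3)[OF B x ffamD(2)[OF s(1) x v]]])
      moreover have "ma q x (?u x v) = 0"
        by (simp add: lin b2[OF x] s(2)[OF x v] t(2)[OF x fhomD(3)[OF G x v]])
      ultimately obtain w where w: "w \<in> rV Y' x" "ma j x w = ?u x v" using D'(5)[OF x] by blast
      show ?thesis unfolding w(2)[symmetric] by (simp add: r(3)[OF x w(1)])
    qed
    have psi: "ffam (rV X) (rV Y') ?\<psi>"
      unfolding ffam_def
    proof (intro ballI conjI)
      fix x assume x: "x \<in> verts Q"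
      show "flinear (?\<psi> x)"
        by (rule flinear_compose[OF flinear_ops(4)[OF flinear_compose[OF mact_linear ffamD(1)[OF t(1) x]]
              flinear_compose[OF ffamD(1)[OF s(1) x] mact_linear]] r(1)[OF x]])
      show "?\<psi> x v \<in> rV Y' x" for v by (rule r(2)[OF x])
    qed
    have "coboundary (rV X) (rT X) (rT Y') ?\<psi> ?e"
      unfolding coboundary_def
    proof (intro ballI)
      fix a v assume a: "a \<in> arcs Q" and v: "v \<in> rV X (tail Q a)"
      note h = head_in_verts[OF a] and tt = tail_in_verts[OF a]
      let ?l = "?\<psi> (head Q a) (rT X a v) - rT Y' a (?\<psi> (tail Q a) v)"
      have "ma j (head Q a) ?l = ?u (head Q a) (rT X a v) - rT F a (?u (tail Q a) v)"
        using jp[OF h Xin[OF a v]] jp[OF tt v] fhomD(4)[OF D'(2) a ffamD(2)[OF psi tt v]] by (simp add: lin)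
      also have "\<dots> = ma \<beta> (head Q a) (ma i (head Q a) (c a v)) - ma j (head Q a) (d a (ma \<gamma> (tail Q a) v))"
        using fhomD(4)[OF B a ffamD(2)[OF s(1) tt v]] s(3)[OF a v] t(3)[OF a fhomD(3)[OF G tt v]] fhomD(4)[OF G a v]
        by (simp add: lin algebra_simps)
      also have "\<dots> = ma j (head Q a) (?e a v)" by (simp add: b1[OF h] lin)
      finally have "ma j (head Q a) (?l - ?e a v) = 0" by (simp add: lin)
      moreover have "?l - ?e a v \<in> rV Y' (head Q a)"
        by (rule fds_closed(3)[OF fds_cs fds_closed(3)[OF fds_cs ffamD(2)[OF psi h Xin[OF a v]]
              frepD(3)[OF frep_rep[OF Y'] a ffamD(2)[OF psi tt v]]]
              fds_closed(3)[OF fds_cs fhomD(3)[OF A h cY[OF a v]] dY[OF a fhomD(3)[OF G tt v]]]])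
      ultimately have "?l - ?e a v = 0" using D'(4) h unfolding finj_def by blast
      then show "?l = ?e a v" by simp
    qed
    then show "cob X Y' ?e" using psi unfolding cob_def by blast
  next
    assume "cob X Y' ?e"
    then obtain \<psi> where psi: "ffam (rV X) (rV Y') \<psi>" and cb: "coboundary (rV X) (rT X) (rT Y') \<psi> ?e"
      unfolding cob_def by blast
    obtain r where r: "\<And>x. x \<in> verts Q \<Longrightarrow> flinear (r x)" "\<And>x w. x \<in> verts Q \<Longrightarrow> r x w \<in> rV Y x"
      "\<And>x v. x \<in> verts Q \<Longrightarrow> v \<in> rV Y x \<Longrightarrow> r x (ma i x v) = v"
      using fam_retraction_exists[OF frep_rep[OF Y] fhomD(1)[OF D(2)] D(4)] by metis
    let ?\<pi> = "\<lambda>x e. r x (e - \<sigma> x (ma p x e))"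
    have pl: "flinear (?\<pi> x)" if "x \<in> verts Q" for x
      by (rule flinear_compose[OF flinear_ops(4)[OF flinear_ops(1) flinear_compose[OF mact_linear ffamD(1)[OF s(1) that]]] r(1)[OF that]])
    have dec: "ma i x (?\<pi> x e) + \<sigma> x (ma p x e) = e" if x: "x \<in> verts Q" and e: "e \<in> rV E x" for x e
    proof -
      have "e - \<sigma> x (ma p x e) \<in> rV E x"
        by (rule fds_closed(3)[OF fds_cs e ffamD(2)[OF s(1) x fhomD(3)[OF D(3) x e]]])
      moreover have "ma p x (e - \<sigma> x (ma p x e)) = 0" by (simp add: lin s(2)[OF x fhomD(3)[OF D(3) x e]])
      ultimately obtain w where w: "w \<in> rV Y x" "ma i x w = e - \<sigma> x (ma p x e)" using D(5)[OF x] by blast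
      have "?\<pi> x e = w" unfolding w(2)[symmetric] by (rule r(3)[OF x w(1)])
      then show ?thesis using w(2) by simp
    qed
    have pp: "ma p x (ma i x u + \<sigma> x w) = w" "?\<pi> x (ma i x u + \<sigma> x w) = u"
      if x: "x \<in> verts Q" and u: "u \<in> rV Y x" and w: "w \<in> rV X x" for x u w
    proof -
      show p1: "ma p x (ma i x u + \<sigma> x w) = w" by (simp add: lin D(6)[OF x u] s(2)[OF x w])
      show "?\<pi> x (ma i x u + \<sigma> x w) = u" unfolding p1 by (simp add: r(3)[OF x u])
    qed
    \<comment> \<open>\<open>?\<pi>\<close> and \<open>p\<close> split the middle term as a vector space; \<open>\<beta>\<close> is prescribed on both parts\<close>
    let ?b = "\<lambda>x e. ma j x (ma \<alpha> x (?\<pi> x e)) + \<tau> x (ma \<gamma> x (ma p x e)) - ma j x (\<psi> x (ma p x e))"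
    have bE: "fhom (rV E) (rT E) (rV F) (rT F) ?b"
      unfolding fhom_def ffam_def
    proof (intro ballI conjI)
      fix x assume x: "x \<in> verts Q"
      show "flinear (?b x)"
        by (rule flinear_ops(4)[OF flinear_ops(3)[OF flinear_compose[OF flinear_compose[OF pl[OF x] mact_linear] mact_linear]
                flinear_compose[OF flinear_compose[OF mact_linear mact_linear] ffamD(1)[OF t(1) x]]]
              flinear_compose[OF flinear_compose[OF mact_linear ffamD(1)[OF psi x]] mact_linear]])
      fix e assume e: "e \<in> rV E x"
      have pe: "ma p x e \<in> rV X x" by (rule fhomD(3)[OF D(3) x e])
      show "?b x e \<in> rV F x"
        by (rule fds_closed(3)[OF fds_cs fds_closed(2)[OF fds_cs fhomD(3)[OF D'(2) x fhomD(3)[OF A x r(2)[OF x]]]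
              ffamD(2)[OF t(1) x fhomD(3)[OF G x pe]]] fhomD(3)[OF D'(2) x ffamD(2)[OF psi x pe]]])
    next
      fix a e assume a: "a \<in> arcs Q" and e: "e \<in> rV E (tail Q a)"
      note h = head_in_verts[OF a] and tt = tail_in_verts[OF a]
      define x where "x = ma p (tail Q a) e"
      define w where "w = ?\<pi> (tail Q a) e"
      have x: "x \<in> rV X (tail Q a)" unfolding x_def by (rule fhomD(3)[OF D(3) tt e])
      have w: "w \<in> rV Y (tail Q a)" unfolding w_def by (rule r(2)[OF tt])
      have e_eq: "e = ma i (tail Q a) w + \<sigma> (tail Q a) x" using dec[OF tt e] by (simp add: x_def w_def)
      have wY: "rT Y a w + c a x \<in> rV Y (head Q a)"
        by (rule fds_closed(2)[OF fds_cs frepD(3)[OF frep_rep[OF Y] a w] cY[OF a x]])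
      have Ee: "rT E a e = ma i (head Q a) (rT Y a w + c a x) + \<sigma> (head Q a) (rT X a x)"
        unfolding e_eq using fhomD(4)[OF D(2) a w] s(3)[OF a x] by (simp add: lin algebra_simps)
      have p1: "ma p (head Q a) (rT E a e) = rT X a x" "?\<pi> (head Q a) (rT E a e) = rT Y a w + c a x"
        unfolding Ee by (rule pp[OF h wY Xin[OF a x]])+
      have c1: "\<psi> (head Q a) (rT X a x) = rT Y' a (\<psi> (tail Q a) x) + (ma \<alpha> (head Q a) (c a x) - d a (ma \<gamma> (tail Q a) x))"
        using cb a x unfolding coboundary_def by (metis add.commute diff_add_cancel)
      have "?b (head Q a) (rT E a e) = ma j (head Q a) (ma \<alpha> (head Q a) (rT Y a w)) + \<tau> (head Q a) (ma \<gamma> (head Q a) (rT X a x))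
          - ma j (head Q a) (rT Y' a (\<psi> (tail Q a) x)) + ma j (head Q a) (d a (ma \<gamma> (tail Q a) x))"
        unfolding p1(2) unfolding p1(1) unfolding c1 by (simp add: lin algebra_simps)
      also have "\<dots> = rT F a (ma j (tail Q a) (ma \<alpha> (tail Q a) w) + \<tau> (tail Q a) (ma \<gamma> (tail Q a) x) - ma j (tail Q a) (\<psi> (tail Q a) x))"
        using fhomD(4)[OF A a w] fhomD(4)[OF G a x] fhomD(4)[OF D'(2) a fhomD(3)[OF A tt w]]
          fhomD(4)[OF D'(2) a ffamD(2)[OF psi tt x]] t(3)[OF a fhomD(3)[OF G tt x]]
        by (simp add: lin algebra_simps)
      finally show "?b (head Q a) (rT E a e) = rT F a (?b (tail Q a) e)" by (simp add: x_def w_def)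
    qed
    note mb = mact_mor_of[OF fhomD(1)[OF bE]] and bm = is_mor_of[OF D(1) D'(1) bE]
    have "mor_eq Q (mor_comp (mor_of E F ?b) i) (mor_comp j \<alpha>)"
    proof (subst mor_eq_iff[of _ "dimv F" "dimv Y"])
      show "\<forall>x\<in>verts Q. \<forall>v\<in>rV Y x. mact (mor_comp (mor_of E F ?b) i x) v = mact (mor_comp j \<alpha> x) v"
      proof (intro ballI)
        fix x v assume x: "x \<in> verts Q" and v: "v \<in> rV Y x"
        have s0: "\<sigma> x 0 = 0" "\<tau> x 0 = 0" "\<psi> x 0 = 0"
          using flinear_simps(4)[OF ffamD(1)[OF s(1) x]] flinear_simps(4)[OF ffamD(1)[OF t(1) x]]
            flinear_simps(4)[OF ffamD(1)[OF psi x]] by auto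
        have "?b x (ma i x v) = ma j x (ma \<alpha> x v)"
          using pp[OF x v fds_closed(1)[OF fds_cs]] D(6)[OF x v] by (simp add: s0 lin)
        then show "mact (mor_comp (mor_of E F ?b) i x) v = mact (mor_comp j \<alpha> x) v"
          by (simp add: mor_comp_carrier(2)[OF D(8) bm x] mor_comp_carrier(2)[OF al D'(8) x] mb[OF x fhomD(3)[OF D(2) x v]])
      qed
    qed (rule mor_comp_carrier(1)[OF D(8) bm] mor_comp_carrier(1)[OF al D'(8)]; assumption)+
    moreover have "mor_eq Q (mor_comp q (mor_of E F ?b)) (mor_comp \<gamma> p)"
    proof (subst mor_eq_iff[of _ "dimv X'" "dimv E"])
      show "\<forall>x\<in>verts Q. \<forall>v\<in>rV E x. mact (mor_comp q (mor_of E F ?b) x) v = mact (mor_comp \<gamma> p x) v"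
      proof (intro ballI)
        fix x v assume x: "x \<in> verts Q" and v: "v \<in> rV E x"
        have pe: "ma p x v \<in> rV X x" by (rule fhomD(3)[OF D(3) x v])
        have "ma q x (?b x v) = ma \<gamma> x (ma p x v)"
          by (simp add: lin D'(6)[OF x fhomD(3)[OF A x r(2)[OF x]]] D'(6)[OF x ffamD(2)[OF psi x pe]] t(2)[OF x fhomD(3)[OF G x pe]])
        then show "mact (mor_comp q (mor_of E F ?b) x) v = mact (mor_comp \<gamma> p x) v"
          by (simp add: mor_comp_carrier(2)[OF bm D'(9) x] mor_comp_carrier(2)[OF D(9) ga x] mb[OF x v])
      qed
    qed (rule mor_comp_carrier(1)[OF bm D'(9)] mor_comp_carrier(1)[OF D(9) ga]; assumption)+
    ultimately show "ext_mor Q \<alpha> \<gamma> \<xi> \<zeta>"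
      unfolding xi_eq zeta_eq ext_mor.simps using bm by blast
  qed
qed

end

section \<open>Baer sums of extensions in terms of cocycles\<close>

context quiver
begin

lemma cob_cong:
  assumes "cob X Y c" "\<And>a v. a \<in> arcs Q \<Longrightarrow> v \<in> rV X (tail Q a) \<Longrightarrow> c a v = d a v"
  shows "cob X Y d"
proof -
  obtain \<psi> where "ffam (rV X) (rV Y) \<psi>" "coboundary (rV X) (rT X) (rT Y) \<psi> c" using assms(1) unfolding cob_def by blast
  moreover from this(2) have "coboundary (rV X) (rT X) (rT Y) \<psi> d" unfolding coboundary_def using assms(2) by simp
  ultimately show ?thesis unfolding cob_def by blast
qed

lemma cob_minus:
  assumes X: "is_rep Q X" and Y: "is_rep Q Y" and c: "cob X Y c"
  shows "cob X Y (\<lambda>a v. - c a v)"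
proof -
  obtain \<psi> where p: "ffam (rV X) (rV Y) \<psi>" "coboundary (rV X) (rT X) (rT Y) \<psi> c" using c unfolding cob_def by blast
  have "ffam (rV X) (rV Y) (\<lambda>x v. - \<psi> x v)"
    unfolding ffam_def
  proof (intro ballI conjI)
    fix x v assume x: "x \<in> verts Q"
    show "flinear (\<lambda>v. - \<psi> x v)" by (rule flinear_ops(5)[OF ffamD(1)[OF p(1) x]])
    assume "v \<in> rV X x"
    then show "- \<psi> x v \<in> rV Y x" by (rule fds_closed(4)[OF fds_cs ffamD(2)[OF p(1) x]])
  qed
  moreover have "coboundary (rV X) (rT X) (rT Y) (\<lambda>x v. - \<psi> x v) (\<lambda>a v. - c a v)"
    using p(2) unfolding coboundary_def by (simp add: flinear_simps[OF mact_linear] algebra_simps)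
  ultimately show ?thesis unfolding cob_def by blast
qed

lemma is_mor_id: "is_rep Q X \<Longrightarrow> is_mor Q X X (id_mor X)"
  by (rule is_morI) (auto simp: mact_one mact_cs is_rep_def)

lemma is_mor_scalar: "is_rep Q X \<Longrightarrow> is_mor Q X X (scalar_mor r X)"
  by (rule is_morI) (auto simp: scalar_mor_def mact_one mact_smult mact_cs is_rep_def flinear_simps[OF mact_linear])

lemma cocycle_of_cong:
  assumes "cocycle_of X \<xi> c" "\<And>a v. a \<in> arcs Q \<Longrightarrow> v \<in> rV X (tail Q a) \<Longrightarrow> c a v = d a v"
  shows "cocycle_of X \<xi> d"
  using assms unfolding cocycle_of_def by (cases \<xi>) simp

text \<open>
  The cocycles of one extension form a full class modulo coboundaries: its identity relates any two
  of them, and conversely a coboundary changes the section.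
\<close>

lemma cocycle_of_iff:
  assumes X: "is_rep Q X" and Y: "is_rep Q Y" and xi: "\<xi> \<in> extensions Q X Y"
    and c: "cochain (rV X) (rV Y) c" "cocycle_of X \<xi> c" and d: "cochain (rV X) (rV Y) d"
  shows "cocycle_of X \<xi> d \<longleftrightarrow> cob X Y (\<lambda>a v. d a v - c a v)"
proof
  assume dc: "cocycle_of X \<xi> d"
  obtain E i p where xi_eq: "\<xi> = (E, i, p)" by (cases \<xi>)
  note D = extensionsD[OF X Y xi[unfolded xi_eq]]
  have one: "mact (1\<^sub>m n) v = v" if "v \<in> cs n" for v :: "nat \<Rightarrow> 'b" and n by (rule mact_one[OF that])
  have "ext_mor Q (id_mor Y) (id_mor X) \<xi> \<xi>"
    unfolding xi_eq ext_mor.simps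
  proof (intro exI[of _ "id_mor E"] conjI is_mor_id[OF D(1)])
    show "mor_eq Q (mor_comp (id_mor E) i) (mor_comp i (id_mor Y))"
      "mor_eq Q (mor_comp p (id_mor E)) (mor_comp (id_mor X) p)"
      using D(8,9) by (auto simp: mor_eq_def mor_comp_def is_mor_def)
  qed
  then have "cob X Y (\<lambda>a v. ma (id_mor Y) (head Q a) (d a v) - c a (ma (id_mor X) (tail Q a) v))"
    by (simp only: ext_mor_iff[OF X Y X Y xi xi is_mor_id[OF Y] is_mor_id[OF X] d dc c])
  then show "cob X Y (\<lambda>a v. d a v - c a v)"
  proof (rule cob_cong)
    fix a v assume a: "a \<in> arcs Q" and v: "v \<in> rV X (tail Q a)"
    have "d a v \<in> rV Y (head Q a)" using d a v by (simp add: cochain_def)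
    then show "ma (id_mor Y) (head Q a) (d a v) - c a (ma (id_mor X) (tail Q a) v) = d a v - c a v"
      using v by (simp add: mact_one)
  qed
next
  assume "cob X Y (\<lambda>a v. d a v - c a v)"
  then obtain \<psi> where psi: "ffam (rV X) (rV Y) \<psi>" and
    cb: "\<And>a v. a \<in> arcs Q \<Longrightarrow> v \<in> rV X (tail Q a) \<Longrightarrow> \<psi> (head Q a) (rT X a v) - rT Y a (\<psi> (tail Q a) v) = d a v - c a v"
    unfolding cob_def coboundary_def by blast
  obtain E i p where xi_eq: "\<xi> = (E, i, p)" by (cases \<xi>)
  note D = extensionsD[OF X Y xi[unfolded xi_eq]]
  obtain \<sigma> where s: "ffam (rV X) (rV E) \<sigma>" "\<And>x v. x \<in> verts Q \<Longrightarrow> v \<in> rV X x \<Longrightarrow> ma p x (\<sigma> x v) = v"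
    "\<And>a v. a \<in> arcs Q \<Longrightarrow> v \<in> rV X (tail Q a) \<Longrightarrow> rT E a (\<sigma> (tail Q a) v) = \<sigma> (head Q a) (rT X a v) + ma i (head Q a) (c a v)"
    using cocycleE[OF c(2)[unfolded xi_eq]] by metis
  note lin = flinear_simps[OF mact_linear]
  show "cocycle_of X \<xi> d"
    unfolding xi_eq cocycle_of_def prod.case
  proof (intro exI[of _ "\<lambda>x v. \<sigma> x v - ma i x (\<psi> x v)"] conjI ballI)
    show "ffam (rV X) (rV E) (\<lambda>x v. \<sigma> x v - ma i x (\<psi> x v))"
      unfolding ffam_def
    proof (intro ballI conjI)
      fix x v assume x: "x \<in> verts Q"
      show "flinear (\<lambda>v. \<sigma> x v - ma i x (\<psi> x v))"
        by (rule flinear_ops(4)[OF ffamD(1)[OF s(1) x] flinear_compose[OF ffamD(1)[OF psi x] mact_linear]])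
      assume v: "v \<in> rV X x"
      show "\<sigma> x v - ma i x (\<psi> x v) \<in> rV E x"
        by (rule fds_closed(3)[OF fds_cs ffamD(2)[OF s(1) x v] fhomD(3)[OF D(2) x ffamD(2)[OF psi x v]]])
    qed
    show "ma p x (\<sigma> x v - ma i x (\<psi> x v)) = v" if x: "x \<in> verts Q" and v: "v \<in> rV X x" for x v
      by (simp add: lin s(2)[OF x v] D(6)[OF x ffamD(2)[OF psi x v]])
    fix a v assume a: "a \<in> arcs Q" and v: "v \<in> rV X (tail Q a)"
    have d_eq: "d a v = \<psi> (head Q a) (rT X a v) - rT Y a (\<psi> (tail Q a) v) + c a v" using cb[OF a v] by (simp add: algebra_simps)
    show "rT E a (\<sigma> (tail Q a) v - ma i (tail Q a) (\<psi> (tail Q a) v))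
        - (\<sigma> (head Q a) (rT X a v) - ma i (head Q a) (\<psi> (head Q a) (rT X a v))) = ma i (head Q a) (d a v)"
      unfolding d_eq using s(3)[OF a v] fhomD(4)[OF D(2) a ffamD(2)[OF psi tail_in_verts[OF a] v]]
      by (simp add: lin algebra_simps)
  qed
qed

text \<open>
  The vector space \<open>Y \<oplus> X\<close> with the cocycle as off-diagonal block.
\<close>

definition ext_rep :: "('v, 'a, 'k::field) rep \<Rightarrow> ('v, 'a, 'k) rep \<Rightarrow> ('a \<Rightarrow> (nat \<Rightarrow> 'k) \<Rightarrow> nat \<Rightarrow> 'k) \<Rightarrow> ('v, 'a, 'k) rep" where
  "ext_rep X Y c = \<lparr> dimv = (\<lambda>x. dimv Y x + dimv X x),
     lin = (\<lambda>a. lmat (dimv Y (head Q a) + dimv X (head Q a)) (dimv Y (tail Q a) + dimv X (tail Q a))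
       (\<lambda>w. vappend (dimv Y (head Q a)) (rT Y a (vtake (dimv Y (tail Q a)) w) + c a (vdrop (dimv Y (tail Q a)) w))
         (rT X a (vdrop (dimv Y (tail Q a)) w)))) \<rparr>"

lemma extension_exists:
  assumes X: "is_rep Q X" and Y: "is_rep Q Y" and c: "cochain (rV X) (rV Y) c"
  shows "\<exists>\<xi>\<in>extensions Q X Y. cocycle_of X \<xi> c"
proof -
  let ?n = "dimv Y"
  define E where "E = ext_rep X Y c"
  have dE: "dimv E x = ?n x + dimv X x" for x by (simp add: E_def ext_rep_def)
  note lin = flinear_simps[OF mact_linear]
  have rTE: "rT E a w = vappend (?n (head Q a)) (rT Y a (vtake (?n (tail Q a)) w) + c a (vdrop (?n (tail Q a)) w)) (rT X a (vdrop (?n (tail Q a)) w))"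
    if a: "a \<in> arcs Q" and w: "w \<in> rV E (tail Q a)" for a w
    unfolding E_def ext_rep_def rep.simps
  proof (rule mact_lmat)
    have cl: "flinear (c a)" using c a by (simp add: cochain_def)
    show "flinear (\<lambda>w. vappend (?n (head Q a)) (rT Y a (vtake (?n (tail Q a)) w) + c a (vdrop (?n (tail Q a)) w)) (rT X a (vdrop (?n (tail Q a)) w)))"
      by (rule vappend_linear[OF flinear_ops(3)[OF flinear_compose[OF vtake_linear mact_linear] flinear_compose[OF vdrop_linear cl]]
            flinear_compose[OF vdrop_linear mact_linear]])
    show "w \<in> cs (?n (tail Q a) + dimv X (tail Q a))" using w by (simp add: dE)
    fix u :: "nat \<Rightarrow> 'b" assume "u \<in> cs (?n (tail Q a) + dimv X (tail Q a))"
    then show "vappend (?n (head Q a)) (rT Y a (vtake (?n (tail Q a)) u) + c a (vdrop (?n (tail Q a)) u)) (rT X a (vdrop (?n (tail Q a)) u))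
        \<in> cs (?n (head Q a) + dimv X (head Q a))"
      by (intro vappend_cs frepD(3)[OF frep_rep[OF X] a] vdrop_cs)
  qed
  have E: "is_rep Q E" by (simp add: is_rep_def E_def ext_rep_def lmat_carrier)
  let ?i = "\<lambda>x v. vappend (?n x) v 0" and ?p = "\<lambda>x. vdrop (?n x)"
  have c0: "c a 0 = 0" if "a \<in> arcs Q" for a
  proof -
    have "flinear (c a)" using c that by (simp add: cochain_def)
    then show ?thesis by (rule flinear_simps(4))
  qed
  have sh0: "vdrop n u = 0" if "u \<in> cs n" for n and u :: "nat \<Rightarrow> 'b"
    using that by (auto simp: vdrop_def cs_iff fun_eq_iff pointwise)
  have ctE: "vappend (?n x) u v \<in> rV E x" if "v \<in> rV X x" for x u v
    using that by (simp add: dE vappend_cs)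
  have z: "0 \<in> rV X x" for x by (rule fds_closed(1)[OF fds_cs])
  have iin: "vappend (?n x) u 0 \<in> rV E x" for x u by (rule ctE[OF z])
  have iE: "fhom (rV Y) (rT Y) (rV E) (rT E) ?i"
    unfolding fhom_def ffam_def
  proof (intro ballI conjI)
    fix x assume x: "x \<in> verts Q"
    show "flinear (?i x)" by (rule vappend_linear[OF flinear_ops(1,2)])
    show "?i x v \<in> rV E x" for v by (rule iin)
  next
    fix a v assume a: "a \<in> arcs Q" and v: "v \<in> rV Y (tail Q a)"
    show "?i (head Q a) (rT Y a v) = rT E a (?i (tail Q a) v)"
      by (simp add: rTE[OF a iin] vtake_vappend[OF v] vdrop_vappend c0[OF a] lin)
  qed
  have pE: "fhom (rV E) (rT E) (rV X) (rT X) ?p"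
    unfolding fhom_def ffam_def
  proof (intro ballI conjI)
    fix x w assume x: "x \<in> verts Q"
    show "flinear (?p x)" by (rule vdrop_linear)
    assume "w \<in> rV E x"
    then show "?p x w \<in> rV X x" by (simp add: dE vdrop_cs)
  next
    fix a v assume a: "a \<in> arcs Q" and v: "v \<in> rV E (tail Q a)"
    show "?p (head Q a) (rT E a v) = rT X a (?p (tail Q a) v)" by (simp add: rTE[OF a v] vdrop_vappend)
  qed
  have se: "short_exact Q Y (mor_of Y E ?i) E (mor_of E X ?p) X"
  proof (rule short_exactI[OF Y E X iE pE])
    show "finj (rV Y) ?i"
      unfolding finj_def
    proof (intro ballI impI)
      fix x v assume v: "v \<in> rV Y x" and e: "vappend (?n x) v 0 = 0"
      have "v = vtake (?n x) (vappend (?n x) v 0)" by (rule vtake_vappend[OF v, symmetric])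
      then show "v = 0" unfolding e by (simp add: flinear_simps[OF vtake_linear])
    qed
    fix x assume x: "x \<in> verts Q"
    show "?i x ` rV Y x = {v \<in> rV E x. ?p x v = 0}"
    proof (intro equalityI subsetI)
      fix w assume "w \<in> {v \<in> rV E x. ?p x v = 0}"
      then have "w = ?i x (vtake (?n x) w)" using vappend_vtake_vdrop[of "?n x" w] by simp
      then show "w \<in> ?i x ` rV Y x" unfolding image_iff by (rule bexI[OF _ vtake_cs])
    next
      fix w assume "w \<in> ?i x ` rV Y x"
      then obtain v where "w = ?i x v" by blast
      then show "w \<in> {v \<in> rV E x. ?p x v = 0}" by (simp add: vdrop_vappend iin)
    qed
    show "?p x ` rV E x = rV X x"
    proof (intro equalityI subsetI)
      fix v assume v: "v \<in> rV X x"
      have "v = ?p x (vappend (?n x) 0 v)" by (simp add: vdrop_vappend)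
      then show "v \<in> ?p x ` rV E x" unfolding image_iff by (rule bexI[OF _ ctE[OF v]])
    next
      fix v assume "v \<in> ?p x ` rV E x"
      then show "v \<in> rV X x" using fhomD(3)[OF pE x] by blast
    qed
  qed
  then have mem: "(E, mor_of Y E ?i, mor_of E X ?p) \<in> extensions Q X Y" using E by (simp add: extensions_def)
  note mi = mact_mor_of[OF fhomD(1)[OF iE]] and mp = mact_mor_of[OF fhomD(1)[OF pE]]
  have "cocycle_of X (E, mor_of Y E ?i, mor_of E X ?p) c"
    unfolding cocycle_of_def prod.case
  proof (intro exI[of _ "\<lambda>x v. vappend (?n x) 0 v"] conjI ballI)
    show "ffam (rV X) (rV E) (\<lambda>x v. vappend (?n x) 0 v)"
      unfolding ffam_def by (intro ballI conjI vappend_linear[OF flinear_ops(2,1)] ctE)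
    show "ma (mor_of E X ?p) x (vappend (?n x) 0 v) = v" if "x \<in> verts Q" "v \<in> rV X x" for x v
      by (simp add: mp[OF that(1) ctE[OF that(2)]] vdrop_vappend)
    fix a v assume a: "a \<in> arcs Q" and v: "v \<in> rV X (tail Q a)"
    have cv: "c a v \<in> rV Y (head Q a)" using c a v by (simp add: cochain_def)
    have z0: "vtake n (vappend n 0 v) = 0" for n by (rule vtake_vappend) (rule fds_closed(1)[OF fds_cs])
    show "rT E a (vappend (?n (tail Q a)) 0 v) - vappend (?n (head Q a)) 0 (rT X a v) = ma (mor_of Y E ?i) (head Q a) (c a v)"
      by (simp add: rTE[OF a ctE[OF v]] mi[OF head_in_verts[OF a] cv] z0 vdrop_vappend vappend_diff lin)
  qed
  then show ?thesis using mem by blast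
qed

lemma mat_dsum_carrier: "A \<in> carrier_mat m n \<Longrightarrow> B \<in> carrier_mat m' n' \<Longrightarrow> mat_dsum A B \<in> carrier_mat (m + m') (n + n')"
  by (simp add: mat_dsum_def)

lemma sum_delta_mult: "m < n \<Longrightarrow> (\<Sum>j<n. (if m = j then 1 else 0) * v j) = (v m :: 'k::field)" for m n :: nat
  by (simp add: if_distrib[of "\<lambda>c. c * _"] cong: if_cong)

lemma mact_diag:
  assumes v: "v \<in> rV X x" shows "ma (diag_mor X) x v = vappend (dimv X x) v v"
proof
  fix i
  show "ma (diag_mor X) x v i = vappend (dimv X x) v v i"
    using v by (auto simp: mact_def diag_mor_def append_rows_def vappend_def cs_iff sum_delta_mult)
qed

lemma mact_codiag:
  "ma (codiag_mor X) x w = vtake (dimv X x) w + vtake (dimv X x) (vdrop (dimv X x) w)"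
proof
  let ?n = "dimv X x"
  fix i
  show "ma (codiag_mor X) x w i = (vtake ?n w + vtake ?n (vdrop ?n w)) i"
  proof (cases "i < ?n")
    case True
    have ent: "codiag_mor X x $$ (i, j) = (if i = j then 1 else 0) + (if i + ?n = j then 1 else 0)" if "j < ?n + ?n" for j
      using that True by (auto simp: codiag_mor_def diag_mor_def append_rows_def)
    have "ma (codiag_mor X) x w i = (\<Sum>j<?n + ?n. codiag_mor X x $$ (i, j) * w j)"
      using True by (simp add: mact_def codiag_mor_def diag_mor_def append_rows_def)
    also have "\<dots> = (\<Sum>j<?n + ?n. (if i = j then 1 else 0) * w j + (if i + ?n = j then 1 else 0) * w j)"
      by (rule sum.cong[OF refl]) (simp add: ent distrib_right)
    also have "\<dots> = w i + w (i + ?n)"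
      unfolding sum.distrib using True by (simp add: sum_delta_mult)
    finally show ?thesis using True by (simp add: vtake_def vdrop_def pointwise)
  qed (simp add: mact_def codiag_mor_def diag_mor_def append_rows_def vtake_def pointwise)
qed

lemma dimv_dsum: "dimv (rep_dsum X Y) x = dimv X x + dimv Y x"
  by (simp add: rep_dsum_def)

lemma is_mor_diag: assumes X: "is_rep Q X" shows "is_mor Q X (rep_dsum X X) (diag_mor X)"
proof (rule is_morI[OF X is_rep_dsum[OF X X]])
  show "diag_mor X x \<in> carrier_mat (dimv (rep_dsum X X) x) (dimv X x)" for x
    by (simp add: diag_mor_def dimv_dsum)
  fix a v assume a: "a \<in> arcs Q" and v: "v \<in> rV X (tail Q a)"
  show "ma (diag_mor X) (head Q a) (rT X a v) = rT (rep_dsum X X) a (ma (diag_mor X) (tail Q a) v)"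
    by (simp add: mact_diag[OF v] mact_diag[OF frepD(3)[OF frep_rep[OF X] a v]] rT_dsum[OF X X a] vtake_vappend[OF v] vdrop_vappend)
qed

lemma vtake_id: "v \<in> cs n \<Longrightarrow> vtake n v = v"
  by (auto simp: vtake_def cs_iff fun_eq_iff)

lemma is_mor_codiag: assumes X: "is_rep Q X" shows "is_mor Q (rep_dsum X X) X (codiag_mor X)"
proof (rule is_morI[OF is_rep_dsum[OF X X] X])
  show "codiag_mor X x \<in> carrier_mat (dimv X x) (dimv (rep_dsum X X) x)" for x
    by (simp add: codiag_mor_def diag_mor_def dimv_dsum)
  fix a w assume a: "a \<in> arcs Q" and w: "w \<in> rV (rep_dsum X X) (tail Q a)"
  have sw: "vdrop (dimv X (tail Q a)) w \<in> rV X (tail Q a)" using w by (simp add: dimv_dsum vdrop_cs)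
  note T = frepD(3)[OF frep_rep[OF X] a]
  show "ma (codiag_mor X) (head Q a) (rT (rep_dsum X X) a w) = rT X a (ma (codiag_mor X) (tail Q a) w)"
    by (simp add: mact_codiag rT_dsum[OF X X a] vtake_vappend[OF T[OF vtake_cs]] vdrop_vappend vtake_id[OF T[OF sw]] vtake_id[OF sw] flinear_simps[OF mact_linear])
qed

lemma ma_dsum:
  assumes "is_mor Q X E i" "is_mor Q X' E' i'" "x \<in> verts Q"
  shows "ma (mor_dsum i i') x w = vappend (dimv E x) (ma i x (vtake (dimv X x) w)) (ma i' x (vdrop (dimv X x) w))"
  using mact_dsum[of "i x" "dimv E x" "dimv X x" "i' x" "dimv E' x" "dimv X' x" w] assms by (simp add: is_mor_def mor_dsum_def)

lemma is_mor_dsum: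
  assumes r: "is_rep Q X" "is_rep Q E" "is_rep Q X'" "is_rep Q E'" and i: "is_mor Q X E i" "is_mor Q X' E' i'"
  shows "is_mor Q (rep_dsum X X') (rep_dsum E E') (mor_dsum i i')"
proof (rule is_morI[OF is_rep_dsum[OF r(1,3)] is_rep_dsum[OF r(2,4)]])
  show "mor_dsum i i' x \<in> carrier_mat (dimv (rep_dsum E E') x) (dimv (rep_dsum X X') x)" if "x \<in> verts Q" for x
    using i that by (simp add: mor_dsum_def dimv_dsum is_mor_def mat_dsum_carrier)
  fix a w assume a: "a \<in> arcs Q" and w: "w \<in> rV (rep_dsum X X') (tail Q a)"
  note I = fhom_mor[OF r(1,2) i(1)] and I' = fhom_mor[OF r(3,4) i(2)]
  have sw: "vdrop (dimv X (tail Q a)) w \<in> rV X' (tail Q a)" using w by (simp add: dimv_dsum vdrop_cs)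
  note h = head_in_verts[OF a] and t = tail_in_verts[OF a]
  have T: "rT X a (vtake (dimv X (tail Q a)) w) \<in> rV X (head Q a)" by (rule frepD(3)[OF frep_rep[OF r(1)] a vtake_cs])
  have M: "ma i (tail Q a) (vtake (dimv X (tail Q a)) w) \<in> rV E (tail Q a)" by (rule fhomD(3)[OF I t vtake_cs])
  show "ma (mor_dsum i i') (head Q a) (rT (rep_dsum X X') a w) = rT (rep_dsum E E') a (ma (mor_dsum i i') (tail Q a) w)"
    by (simp add: ma_dsum[OF i h] ma_dsum[OF i t] rT_dsum[OF r(1,3) a] rT_dsum[OF r(2,4) a] vdrop_vappend vtake_vappend[OF T] vtake_vappend[OF M]
        fhomD(4)[OF I a vtake_cs] fhomD(4)[OF I' a sw])
qed

lemma ext_dsum_extension: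
  assumes X: "is_rep Q X" and Y: "is_rep Q Y" and xi: "\<xi> \<in> extensions Q X Y" and zeta: "\<zeta> \<in> extensions Q X Y"
    and c: "cochain (rV X) (rV Y) c" "cocycle_of X \<xi> c" and d: "cochain (rV X) (rV Y) d" "cocycle_of X \<zeta> d"
  shows "ext_dsum \<xi> \<zeta> \<in> extensions Q (rep_dsum X X) (rep_dsum Y Y)"
    "cocycle_of (rep_dsum X X) (ext_dsum \<xi> \<zeta>)
       (\<lambda>a w. vappend (dimv Y (head Q a)) (c a (vtake (dimv X (tail Q a)) w)) (d a (vdrop (dimv X (tail Q a)) w)))"
    (is "cocycle_of _ _ ?e")
proof -
  obtain E i p where xi_eq: "\<xi> = (E, i, p)" by (cases \<xi>)
  obtain F j q where zeta_eq: "\<zeta> = (F, j, q)" by (cases \<zeta>)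
  note D = extensionsD[OF X Y xi[unfolded xi_eq]] and D' = extensionsD[OF X Y zeta[unfolded zeta_eq]]
  note XX = is_rep_dsum[OF X X] and YY = is_rep_dsum[OF Y Y] and EF = is_rep_dsum[OF D(1) D'(1)]
  note mi = ma_dsum[OF D(8) D'(8)] and mp = ma_dsum[OF D(9) D'(9)]
  let ?i = "mor_dsum i j" and ?p = "mor_dsum p q"
  have ct0: "vappend n u v = 0 \<Longrightarrow> u \<in> cs n \<Longrightarrow> u = 0 \<and> v = 0" for n and u v :: "nat \<Rightarrow> 'b"
    using vtake_vappend[of u n v] vdrop_vappend[of n u v] flinear_simps(4)[OF vtake_linear] flinear_simps(4)[OF vdrop_linear] by metis
  have sY: "vdrop (dimv Y x) w \<in> rV Y x" if "w \<in> rV (rep_dsum Y Y) x" for x w using that by (simp add: dimv_dsum vdrop_cs)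
  have sX: "vdrop (dimv X x) w \<in> rV X x" if "w \<in> rV (rep_dsum X X) x" for x w using that by (simp add: dimv_dsum vdrop_cs)
  have sE: "vdrop (dimv E x) w \<in> rV F x" if "w \<in> rV (rep_dsum E F) x" for x w using that by (simp add: dimv_dsum vdrop_cs)
  have "short_exact Q (rep_dsum Y Y) ?i (rep_dsum E F) ?p (rep_dsum X X)"
    unfolding short_exact_iff[OF YY EF XX]
  proof (intro conjI ballI is_mor_dsum X Y D(1,8,9) D'(1,8,9))
    show "finj (rV (rep_dsum Y Y)) (ma ?i)"
      unfolding finj_def
    proof (intro ballI impI)
      fix x w assume x: "x \<in> verts Q" and w: "w \<in> rV (rep_dsum Y Y) x" and e: "ma ?i x w = 0"
      have "ma i x (vtake (dimv Y x) w) = 0 \<and> ma j x (vdrop (dimv Y x) w) = 0"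
        by (rule ct0[OF e[unfolded mi[OF x]] fhomD(3)[OF D(2) x vtake_cs]])
      then have "vtake (dimv Y x) w = 0" "vdrop (dimv Y x) w = 0"
        using D(4) D'(4) x vtake_cs sY[OF w] unfolding finj_def by blast+
      then show "w = 0" using vappend_vtake_vdrop[of "dimv Y x" w] vappend_zero by metis
    qed
    fix x assume x: "x \<in> verts Q"
    show "ma ?i x ` rV (rep_dsum Y Y) x = {v \<in> rV (rep_dsum E F) x. ma ?p x v = 0}"
    proof (intro equalityI subsetI)
      fix e assume "e \<in> {v \<in> rV (rep_dsum E F) x. ma ?p x v = 0}"
      then have e: "e \<in> rV (rep_dsum E F) x" and pe: "ma ?p x e = 0" by auto
      have "ma p x (vtake (dimv E x) e) = 0 \<and> ma q x (vdrop (dimv E x) e) = 0"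
        by (rule ct0[OF pe[unfolded mp[OF x]] fhomD(3)[OF D(3) x vtake_cs]])
      then obtain u v where uv: "u \<in> rV Y x" "ma i x u = vtake (dimv E x) e" "v \<in> rV Y x" "ma j x v = vdrop (dimv E x) e"
        using D(5)[OF x vtake_cs] D'(5)[OF x sE[OF e]] by blast
      have "e = ma ?i x (vappend (dimv Y x) u v)" by (simp add: mi[OF x] vtake_vappend[OF uv(1)] vdrop_vappend uv(2,4) vappend_vtake_vdrop)
      then show "e \<in> ma ?i x ` rV (rep_dsum Y Y) x" unfolding image_iff by (rule bexI[where x = "vappend (dimv Y x) u v"]) (simp add: dimv_dsum vappend_cs uv(3))
    next
      fix e assume "e \<in> ma ?i x ` rV (rep_dsum Y Y) x"
      then obtain w where w': "e = ma ?i x w" "w \<in> rV (rep_dsum Y Y) x" by (rule imageE)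
      note w = w'(2,1)
      have "e \<in> rV (rep_dsum E F) x"
        unfolding w(2) mi[OF x] dimv_dsum by (rule vappend_cs[OF fhomD(3)[OF D'(2) x sY[OF w(1)]]])
      moreover have "ma ?p x e = 0"
        by (simp add: w(2) mi[OF x] mp[OF x] vtake_vappend[OF fhomD(3)[OF D(2) x vtake_cs]] vdrop_vappend D(6)[OF x vtake_cs] D'(6)[OF x sY[OF w(1)]] vappend_zero)
      ultimately show "e \<in> {v \<in> rV (rep_dsum E F) x. ma ?p x v = 0}" by simp
    qed
    show "ma ?p x ` rV (rep_dsum E F) x = rV (rep_dsum X X) x"
    proof (intro equalityI subsetI)
      fix w assume w: "w \<in> rV (rep_dsum X X) x"
      have "vtake (dimv X x) w \<in> ma p x ` rV E x" "vdrop (dimv X x) w \<in> ma q x ` rV F x"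
        unfolding D(7)[OF x] D'(7)[OF x] by (rule vtake_cs, rule sX[OF w])
      then obtain e f where ef: "e \<in> rV E x" "vtake (dimv X x) w = ma p x e" "f \<in> rV F x" "vdrop (dimv X x) w = ma q x f" by blast
      have "w = ma ?p x (vappend (dimv E x) e f)" by (simp add: mp[OF x] vtake_vappend[OF ef(1)] vdrop_vappend ef(2,4)[symmetric] vappend_vtake_vdrop)
      then show "w \<in> ma ?p x ` rV (rep_dsum E F) x" unfolding image_iff by (rule bexI[where x = "vappend (dimv E x) e f"]) (simp add: dimv_dsum vappend_cs ef(3))
    next
      fix w assume "w \<in> ma ?p x ` rV (rep_dsum E F) x"
      then obtain e where e': "w = ma ?p x e" "e \<in> rV (rep_dsum E F) x" by (rule imageE)
      note e = e'(2,1)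
      show "w \<in> rV (rep_dsum X X) x"
        unfolding e(2) mp[OF x] dimv_dsum by (rule vappend_cs[OF fhomD(3)[OF D'(3) x sE[OF e(1)]]])
    qed
  qed
  then show "ext_dsum \<xi> \<zeta> \<in> extensions Q (rep_dsum X X) (rep_dsum Y Y)"
    using EF by (simp add: extensions_def xi_eq zeta_eq)
  obtain \<sigma> where s: "ffam (rV X) (rV E) \<sigma>" "\<And>x v. x \<in> verts Q \<Longrightarrow> v \<in> rV X x \<Longrightarrow> ma p x (\<sigma> x v) = v"
    "\<And>a v. a \<in> arcs Q \<Longrightarrow> v \<in> rV X (tail Q a) \<Longrightarrow> rT E a (\<sigma> (tail Q a) v) = \<sigma> (head Q a) (rT X a v) + ma i (head Q a) (c a v)"
    using cocycleE[OF c(2)[unfolded xi_eq]] by metis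
  obtain \<tau> where t: "ffam (rV X) (rV F) \<tau>" "\<And>x v. x \<in> verts Q \<Longrightarrow> v \<in> rV X x \<Longrightarrow> ma q x (\<tau> x v) = v"
    "\<And>a v. a \<in> arcs Q \<Longrightarrow> v \<in> rV X (tail Q a) \<Longrightarrow> rT F a (\<tau> (tail Q a) v) = \<tau> (head Q a) (rT X a v) + ma j (head Q a) (d a v)"
    using cocycleE[OF d(2)[unfolded zeta_eq]] by metis
  let ?s = "\<lambda>x w. vappend (dimv E x) (\<sigma> x (vtake (dimv X x) w)) (\<tau> x (vdrop (dimv X x) w))"
  show "cocycle_of (rep_dsum X X) (ext_dsum \<xi> \<zeta>) ?e"
    unfolding xi_eq zeta_eq ext_dsum.simps cocycle_of_def prod.case
  proof (intro exI[of _ ?s] conjI ballI)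
    show "ffam (rV (rep_dsum X X)) (rV (rep_dsum E F)) ?s"
      unfolding ffam_def
    proof (intro ballI conjI)
      fix x w assume x: "x \<in> verts Q"
      show "flinear (?s x)"
        by (rule vappend_linear[OF flinear_compose[OF vtake_linear ffamD(1)[OF s(1) x]] flinear_compose[OF vdrop_linear ffamD(1)[OF t(1) x]]])
      assume w: "w \<in> rV (rep_dsum X X) x"
      show "?s x w \<in> rV (rep_dsum E F) x" unfolding dimv_dsum by (rule vappend_cs[OF ffamD(2)[OF t(1) x sX[OF w]]])
    qed
    show "ma ?p x (?s x w) = w" if x: "x \<in> verts Q" and w: "w \<in> rV (rep_dsum X X) x" for x w
      by (simp add: mp[OF x] vtake_vappend[OF ffamD(2)[OF s(1) x vtake_cs]] vdrop_vappend s(2)[OF x vtake_cs] t(2)[OF x sX[OF w]] vappend_vtake_vdrop)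
    fix a w assume a: "a \<in> arcs Q" and w: "w \<in> rV (rep_dsum X X) (tail Q a)"
    note h = head_in_verts[OF a] and tt = tail_in_verts[OF a]
    have T: "rT X a (vtake (dimv X (tail Q a)) w) \<in> rV X (head Q a)" by (rule frepD(3)[OF frep_rep[OF X] a vtake_cs])
    have cY: "c a (vtake (dimv X (tail Q a)) w) \<in> rV Y (head Q a)" using c(1) a vtake_cs[of "dimv X (tail Q a)" w] by (simp add: cochain_def)
    show "rT (rep_dsum E F) a (?s (tail Q a) w) - ?s (head Q a) (rT (rep_dsum X X) a w) = ma ?i (head Q a) (?e a w)"
      by (simp add: rT_dsum[OF D(1) D'(1) a] rT_dsum[OF X X a] vtake_vappend[OF ffamD(2)[OF s(1) tt vtake_cs]] vtake_vappend[OF T] vtake_vappend[OF cY]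
          vdrop_vappend s(3)[OF a vtake_cs] t(3)[OF a sX[OF w]] mi[OF h] vappend_diff)
  qed
qed

end

section \<open>The dimension of the space of extensions\<close>

text \<open>
  A record whose operations are induced from a vector space \<open>C\<close> of representatives. The vector space
  axioms then hold without any knowledge of when two representatives are identified, and only the
  dimension depends on that. Additive inverses come from the scalar \<open>- 1\<close>.
\<close>

locale presented_space =
  fixes V :: "('k::field, 'm) module" and C :: "'c::ab_group_add set" and sc :: "'k \<Rightarrow> 'c \<Rightarrow> 'c" and \<Phi> :: "'c \<Rightarrow> 'm"
  assumes C_zero: "0 \<in> C" and C_add: "c \<in> C \<Longrightarrow> d \<in> C \<Longrightarrow> c + d \<in> C" and C_scale: "c \<in> C \<Longrightarrow> sc r c \<in> C"
    and sc_add_left: "sc (r + s) c = sc r c + sc s c" and sc_add: "sc r (c + d) = sc r c + sc r d"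
    and sc_mult: "sc (r * s) c = sc r (sc s c)" and sc_one: "sc 1 c = c"
    and carrier_V: "carrier V = \<Phi> ` C" and zero_V: "zero V = \<Phi> 0"
    and add_V: "c \<in> C \<Longrightarrow> d \<in> C \<Longrightarrow> add V (\<Phi> c) (\<Phi> d) = \<Phi> (c + d)"
    and smult_V: "c \<in> C \<Longrightarrow> smult V r (\<Phi> c) = \<Phi> (sc r c)"
begin

lemma sc_inverse: "sc (- 1) c + c = 0"
proof -
  have "sc 0 c + sc 0 c = sc 0 c" using sc_add_left[of 0 0 c] by simp
  then have z: "sc 0 c = 0" by simp
  show ?thesis using sc_add_left[of "- 1" 1 c] by (simp add: sc_one z)
qed

lemma vectorspace_V: "vectorspace (class_ring :: 'k ring) V"
proof (intro vectorspace.intro moduleI)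
  show f: "field (class_ring :: 'k ring)" by (rule class_field)
  show "cring (class_ring :: 'k ring)" by (rule domain.axioms(1)[OF field.axioms(1)[OF f]])
  show "abelian_group V"
  proof (rule abelian_groupI)
    show "zero V \<in> carrier V" unfolding zero_V carrier_V by (rule imageI[OF C_zero])
    fix u assume "u \<in> carrier V"
    then obtain c where c: "c \<in> C" "u = \<Phi> c" unfolding carrier_V by blast
    show "add V (zero V) u = u" unfolding zero_V c(2) add_V[OF C_zero c(1)] by simp
    show "\<exists>v\<in>carrier V. add V v u = zero V"
    proof (rule bexI[where x = "\<Phi> (sc (- 1) c)"])
      show "add V (\<Phi> (sc (- 1) c)) u = zero V"
        unfolding zero_V c(2) add_V[OF C_scale[OF c(1)] c(1)] sc_inverse ..
      show "\<Phi> (sc (- 1) c) \<in> carrier V" unfolding carrier_V by (rule imageI[OF C_scale[OF c(1)]])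
    qed
    fix v assume "v \<in> carrier V"
    then obtain d where d: "d \<in> C" "v = \<Phi> d" unfolding carrier_V by blast
    show "add V u v \<in> carrier V" unfolding c(2) d(2) add_V[OF c(1) d(1)] carrier_V by (rule imageI[OF C_add[OF c(1) d(1)]])
    show "add V u v = add V v u" unfolding c(2) d(2) add_V[OF c(1) d(1)] add_V[OF d(1) c(1)] by (simp add: add.commute)
    fix w assume "w \<in> carrier V"
    then obtain e where e: "e \<in> C" "w = \<Phi> e" unfolding carrier_V by blast
    show "add V (add V u v) w = add V u (add V v w)"
      unfolding c(2) d(2) e(2) add_V[OF c(1) d(1)] add_V[OF d(1) e(1)] add_V[OF C_add[OF c(1) d(1)] e(1)] add_V[OF c(1) C_add[OF d(1) e(1)]]
      by (simp add: add.assoc)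
  qed
  fix r s u assume "u \<in> carrier V"
  then obtain c where c: "c \<in> C" "u = \<Phi> c" unfolding carrier_V by blast
  note cr = C_scale[OF c(1)]
  show "smult V r u \<in> carrier V" unfolding c(2) smult_V[OF c(1)] carrier_V by (rule imageI[OF cr])
  show "smult V (add class_ring r s) u = add V (smult V r u) (smult V s u)"
    unfolding c(2) smult_V[OF c(1)] add_V[OF cr cr] by (simp add: class_ring_simps sc_add_left)
  show "smult V (mult class_ring r s) u = smult V r (smult V s u)"
    unfolding c(2) smult_V[OF c(1)] smult_V[OF cr] by (simp add: class_ring_simps sc_mult)
  show "smult V (one class_ring) u = u"
    unfolding c(2) smult_V[OF c(1)] by (simp add: class_ring_simps sc_one)
  fix v assume "v \<in> carrier V"
  then obtain d where d: "d \<in> C" "v = \<Phi> d" unfolding carrier_V by blast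
  show "smult V r (add V u v) = add V (smult V r u) (smult V r v)"
    unfolding c(2) d(2) add_V[OF c(1) d(1)] smult_V[OF c(1)] smult_V[OF d(1)] smult_V[OF C_add[OF c(1) d(1)]]
      add_V[OF cr C_scale[OF d(1)]] by (simp add: sc_add)
qed

lemma dim_0:
  assumes "\<And>c. c \<in> C \<Longrightarrow> \<Phi> c = \<Phi> 0" shows "vectorspace.dim class_ring V = 0"
proof -
  interpret V: vectorspace "class_ring :: 'k ring" V by (rule vectorspace_V)
  have "V.span {} = {zero V}" by (auto simp: V.finite_span V.lincomb_def)
  moreover have "carrier V = {zero V}" unfolding carrier_V zero_V using assms C_zero by blast
  ultimately show ?thesis unfolding V.dim_def by (intro Least_eq_0 exI[of _ "{}"]) simp
qed

lemma dim_1: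
  assumes c0: "c0 \<in> C" "\<Phi> c0 \<noteq> \<Phi> 0" and gen: "\<And>c. c \<in> C \<Longrightarrow> \<exists>r. \<Phi> c = \<Phi> (sc r c0)"
  shows "vectorspace.dim class_ring V = 1"
proof -
  interpret V: vectorspace "class_ring :: 'k ring" V by (rule vectorspace_V)
  let ?e = "\<Phi> c0"
  have e: "?e \<in> carrier V" unfolding carrier_V by (rule imageI[OF c0(1)])
  have lc: "V.lincomb a {?e} = smult V (a ?e) ?e" for a
    using e by (simp add: V.lincomb_def V.smult_closed class_ring_simps)
  have sp: "V.span {?e} = carrier V"
  proof (intro equalityI subsetI)
    fix u assume "u \<in> V.span {?e}"
    then obtain a where "u = V.lincomb a {?e}" using V.finite_span[of "{?e}"] e by auto
    then show "u \<in> carrier V" unfolding lc smult_V[OF c0(1)] carrier_V using C_scale[OF c0(1)] by simp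
  next
    fix u assume "u \<in> carrier V"
    then obtain c where c: "c \<in> C" "u = \<Phi> c" unfolding carrier_V by blast
    obtain r where "\<Phi> c = \<Phi> (sc r c0)" using gen[OF c(1)] by blast
    then have "u = V.lincomb (\<lambda>_. r) {?e}" unfolding lc smult_V[OF c0(1)] c(2) .
    then show "u \<in> V.span {?e}" using V.finite_span[of "{?e}"] e by (auto simp: class_ring_simps)
  qed
  \<comment> \<open>the dimension is the least size of a finite generating set, so the empty set must be excluded\<close>
  have no: "V.span {} \<noteq> carrier V"
  proof
    assume "V.span {} = carrier V"
    then have "?e \<in> V.span {}" using e by simp
    then have "?e = zero V" by (simp add: V.finite_span V.lincomb_def)
    then show False using c0(2) by (simp add: zero_V)
  qed
  show ?thesis unfolding V.dim_def
  proof (rule Least_equality)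
    show "\<exists>A. finite A \<and> card A = 1 \<and> A \<subseteq> carrier V \<and> V.span A = carrier V"
      by (rule exI[of _ "{?e}"]) (simp add: e sp)
    fix n assume "\<exists>A. finite A \<and> card A = n \<and> A \<subseteq> carrier V \<and> V.span A = carrier V"
    then obtain A where A: "finite A" "card A = n" "V.span A = carrier V" by blast
    have "A \<noteq> {}" using A(3) no by auto
    then show "1 \<le> n" using A(1,2) card_gt_0_iff[of A] by linarith
  qed
qed

end

context quiver
begin

text \<open>
  For \<open>\<gamma> = id\<close> the general criterion says that the cocycles of a pushout are the images of those of the
  given extension.
\<close>

lemma pushout_cocycle:
  assumes X: "is_rep Q X" and Y: "is_rep Q Y" and Y': "is_rep Q Y'"
    and xi: "\<xi> \<in> extensions Q X Y" and zeta: "\<zeta> \<in> extensions Q X Y'" and al: "is_mor Q Y Y' \<alpha>"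
    and c: "cochain (rV X) (rV Y) c" "cocycle_of X \<xi> c"
  shows "ext_mor Q \<alpha> (id_mor X) \<xi> \<zeta> \<longleftrightarrow> cocycle_of X \<zeta> (\<lambda>a v. ma \<alpha> (head Q a) (c a v))"
proof -
  obtain d where d: "cochain (rV X) (rV Y') d" "cocycle_of X \<zeta> d" using cocycle_exists[OF X Y' zeta] by blast
  have ac: "cochain (rV X) (rV Y') (\<lambda>a v. ma \<alpha> (head Q a) (c a v))"
    unfolding cochain_def
  proof (intro ballI conjI)
    fix a v assume a: "a \<in> arcs Q"
    have cl: "flinear (c a)" using c(1) a by (simp add: cochain_def)
    show "flinear (\<lambda>v. ma \<alpha> (head Q a) (c a v))" by (rule flinear_compose[OF cl mact_linear])
    show "ma \<alpha> (head Q a) (c a v) \<in> rV Y' (head Q a)"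
      using al head_in_verts[OF a] unfolding is_mor_def by (blast intro: mact_cs)
  qed
  show ?thesis
    unfolding ext_mor_iff[OF X Y X Y' xi zeta al is_mor_id[OF X] c d] cocycle_of_iff[OF X Y' zeta d ac]
    by (rule iffI; erule cob_cong) (simp_all add: mact_one)
qed

text \<open>
  Dually, the cocycles of a pullback are the restrictions.
\<close>

lemma pullback_cocycle:
  assumes X: "is_rep Q X" and Y: "is_rep Q Y" and X': "is_rep Q X'"
    and xi: "\<xi> \<in> extensions Q X Y" and zeta: "\<zeta> \<in> extensions Q X' Y" and ga: "is_mor Q X X' \<gamma>"
    and d: "cochain (rV X') (rV Y) d" "cocycle_of X' \<zeta> d"
  shows "ext_mor Q (id_mor Y) \<gamma> \<xi> \<zeta> \<longleftrightarrow> cocycle_of X \<xi> (\<lambda>a v. d a (ma \<gamma> (tail Q a) v))"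
proof -
  obtain c where c: "cochain (rV X) (rV Y) c" "cocycle_of X \<xi> c" using cocycle_exists[OF X Y xi] by blast
  have cY: "c a v \<in> rV Y (head Q a)" if "a \<in> arcs Q" "v \<in> rV X (tail Q a)" for a v using c(1) that by (simp add: cochain_def)
  have dg: "cochain (rV X) (rV Y) (\<lambda>a v. d a (ma \<gamma> (tail Q a) v))"
    unfolding cochain_def
  proof (intro ballI conjI)
    fix a v assume a: "a \<in> arcs Q"
    have dl: "flinear (d a)" using d(1) a by (simp add: cochain_def)
    show "flinear (\<lambda>v. d a (ma \<gamma> (tail Q a) v))" by (rule flinear_compose[OF mact_linear dl])
    have "ma \<gamma> (tail Q a) v \<in> rV X' (tail Q a)"
      using ga tail_in_verts[OF a] unfolding is_mor_def by (blast intro: mact_cs)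
    then show "d a (ma \<gamma> (tail Q a) v) \<in> rV Y (head Q a)" using d(1) a by (simp add: cochain_def)
  qed
  let ?e = "\<lambda>a v. c a v - d a (ma \<gamma> (tail Q a) v)" and ?e' = "\<lambda>a v. d a (ma \<gamma> (tail Q a) v) - c a v"
  have "cob X Y ?e \<longleftrightarrow> cob X Y ?e'"
    using cob_minus[OF X Y, of ?e] cob_minus[OF X Y, of ?e'] by auto
  moreover have "cob X Y (\<lambda>a v. ma (id_mor Y) (head Q a) (c a v) - d a (ma \<gamma> (tail Q a) v)) \<longleftrightarrow> cob X Y ?e"
    by (rule iffI; erule cob_cong) (simp_all add: mact_one[OF cY])
  ultimately show ?thesis
    unfolding ext_mor_iff[OF X Y X' Y xi zeta is_mor_id[OF Y] ga c d] cocycle_of_iff[OF X Y xi c dg] by blast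
qed

lemma cochain_ops:
  "cochain (rV X) (rV Y) 0"
  "cochain (rV X) (rV Y) c \<Longrightarrow> cochain (rV X) (rV Y) d \<Longrightarrow> cochain (rV X) (rV Y) (c + d)"
  "cochain (rV X) (rV Y) c \<Longrightarrow> cochain (rV X) (rV Y) (\<lambda>a v. fscale r (c a v))"
proof -
  have z: "0 = (\<lambda>(a :: 'a) (v :: nat \<Rightarrow> 'b). 0 :: nat \<Rightarrow> 'b)" by (simp add: fun_eq_iff pointwise)
  show "cochain (rV X) (rV Y) 0"
    unfolding z cochain_def by (intro ballI conjI flinear_ops(2) fds_closed(1)[OF fds_cs])
next
  assume c: "cochain (rV X) (rV Y) c" and d: "cochain (rV X) (rV Y) d"
  have s: "c + d = (\<lambda>a v. c a v + d a v)" by (simp add: fun_eq_iff pointwise)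
  show "cochain (rV X) (rV Y) (c + d)"
    using c d unfolding s cochain_def by (simp add: flinear_ops(3) fds_closed(2)[OF fds_cs])
next
  assume c: "cochain (rV X) (rV Y) c"
  then show "cochain (rV X) (rV Y) (\<lambda>a v. fscale r (c a v))"
    unfolding cochain_def by (simp add: flinear_ops(6) fds_closed(5)[OF fds_cs])
qed

definition ext_class :: "('v, 'a, 'k::field) rep \<Rightarrow> ('v, 'a, 'k) rep \<Rightarrow> ('a \<Rightarrow> (nat \<Rightarrow> 'k) \<Rightarrow> nat \<Rightarrow> 'k) \<Rightarrow> ('v, 'a, 'k) ext set" where
  "ext_class X Y c = {\<zeta> \<in> extensions Q X Y. cocycle_of X \<zeta> c}"

lemma ext_class_eq_iff:
  assumes X: "is_rep Q X" and Y: "is_rep Q Y" and c: "cochain (rV X) (rV Y) c" and d: "cochain (rV X) (rV Y) d"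
  shows "ext_class X Y c = ext_class X Y d \<longleftrightarrow> cob X Y (\<lambda>a v. c a v - d a v)"
proof
  assume e: "ext_class X Y c = ext_class X Y d"
  obtain \<xi> where xi: "\<xi> \<in> extensions Q X Y" "cocycle_of X \<xi> d" using extension_exists[OF X Y d] by blast
  then have "\<xi> \<in> ext_class X Y c" unfolding e by (simp add: ext_class_def)
  then show "cob X Y (\<lambda>a v. c a v - d a v)"
    using cocycle_of_iff[OF X Y xi(1) d xi(2) c] by (simp add: ext_class_def)
next
  assume e: "cob X Y (\<lambda>a v. c a v - d a v)"
  have e': "cob X Y (\<lambda>a v. d a v - c a v)" using cob_minus[OF X Y e] by simp
  show "ext_class X Y c = ext_class X Y d"
    unfolding ext_class_def using cocycle_of_iff[OF X Y _ c _ d] cocycle_of_iff[OF X Y _ d _ c] e e' by blast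
qed

lemma ext_equiv_class:
  assumes X: "is_rep Q X" and Y: "is_rep Q Y" and c: "cochain (rV X) (rV Y) c" and xi: "\<xi> \<in> ext_class X Y c"
  shows "ext_equiv Q X Y `` {\<xi>} = ext_class X Y c"
proof -
  have x: "\<xi> \<in> extensions Q X Y" "cocycle_of X \<xi> c" using xi by (auto simp: ext_class_def)
  have "ext_mor Q (id_mor Y) (id_mor X) \<xi> \<zeta> \<longleftrightarrow> cocycle_of X \<zeta> c" if z: "\<zeta> \<in> extensions Q X Y" for \<zeta>
    unfolding pushout_cocycle[OF X Y Y x(1) z is_mor_id[OF Y] c x(2)]
    by (rule iffI; erule cocycle_of_cong) (use c in \<open>simp_all add: cochain_def mact_one\<close>)
  then show ?thesis using x(1) by (auto simp: ext_equiv_def ext_class_def)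
qed

lemma split_extensions_class:
  assumes X: "is_rep Q X" and Y: "is_rep Q Y"
  shows "split_extensions Q X Y = ext_class X Y 0"
proof -
  have "(\<exists>\<sigma>. is_mor Q X E \<sigma> \<and> mor_eq Q (mor_comp p \<sigma>) (id_mor X)) \<longleftrightarrow> cocycle_of X (E, i, p) 0"
    if e: "(E, i, p) \<in> extensions Q X Y" for E i p
  proof -
    note D = extensionsD[OF X Y e]
    note lin = flinear_simps[OF mact_linear]
    show ?thesis
    proof
      assume "\<exists>\<sigma>. is_mor Q X E \<sigma> \<and> mor_eq Q (mor_comp p \<sigma>) (id_mor X)"
      then obtain \<sigma> where s: "is_mor Q X E \<sigma>" "mor_eq Q (mor_comp p \<sigma>) (id_mor X)" by blast
      note S = fhom_mor[OF X D(1) s(1)]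
      show "cocycle_of X (E, i, p) 0"
        unfolding cocycle_of_def prod.case
      proof (intro exI[of _ "ma \<sigma>"] conjI ballI)
        show "ffam (rV X) (rV E) (ma \<sigma>)" by (rule fhomD(1)[OF S])
        show "ma p x (ma \<sigma> x v) = v" if x: "x \<in> verts Q" and v: "v \<in> rV X x" for x v
          using s(2) x mor_comp_carrier(2)[OF s(1) D(9) x] mact_one[OF v] unfolding mor_eq_def by metis
        show "rT E a (ma \<sigma> (tail Q a) v) - ma \<sigma> (head Q a) (rT X a v) = ma i (head Q a) (0 a v)"
          if "a \<in> arcs Q" "v \<in> rV X (tail Q a)" for a v
          using fhomD(4)[OF S that] by (simp add: lin zero_fun_apply)
      qed
    next
      assume "cocycle_of X (E, i, p) 0"
      from cocycleE[OF this] obtain \<sigma> where s: "ffam (rV X) (rV E) \<sigma>" "\<And>x v. x \<in> verts Q \<Longrightarrow> v \<in> rV X x \<Longrightarrow> ma p x (\<sigma> x v) = v"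
        "\<And>a v. a \<in> arcs Q \<Longrightarrow> v \<in> rV X (tail Q a) \<Longrightarrow> rT E a (\<sigma> (tail Q a) v) = \<sigma> (head Q a) (rT X a v) + ma i (head Q a) (0 a v)"
        by metis
      have S: "fhom (rV X) (rT X) (rV E) (rT E) \<sigma>"
        unfolding fhom_def using s(1,3) by (simp add: lin zero_fun_apply)
      have m: "is_mor Q X E (mor_of X E \<sigma>)" by (rule is_mor_of[OF X D(1) S])
      have "mor_eq Q (mor_comp p (mor_of X E \<sigma>)) (id_mor X)"
      proof (subst mor_eq_iff[of _ "dimv X" "dimv X"])
        show "\<forall>x\<in>verts Q. \<forall>v\<in>rV X x. mact (mor_comp p (mor_of X E \<sigma>) x) v = mact (id_mor X x) v"
          by (intro ballI) (simp add: mor_comp_carrier(2)[OF m D(9)] mact_mor_of[OF s(1)] s(2) mact_one)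
      qed (use mor_comp_carrier(1)[OF m D(9)] in auto)
      then show "\<exists>\<sigma>. is_mor Q X E \<sigma> \<and> mor_eq Q (mor_comp p \<sigma>) (id_mor X)" using m by blast
    qed
  qed
  then show ?thesis by (auto simp: split_extensions_def ext_class_def)
qed

text \<open>
  The direct sum of extensions with cocycles \<open>c\<close> and \<open>d\<close> has their direct sum as cocycle. The pullback
  along the diagonal restricts it to \<open>v \<mapsto> (c v, d v)\<close>, and the pushout along the codiagonal adds the two
  entries.
\<close>

lemma baer_sum_class:
  assumes X: "is_rep Q X" and Y: "is_rep Q Y" and c: "cochain (rV X) (rV Y) c" and d: "cochain (rV X) (rV Y) d"
  shows "{\<zeta> \<in> extensions Q X Y. \<exists>\<xi>\<^sub>1 \<in> ext_class X Y c. \<exists>\<xi>\<^sub>2 \<in> ext_class X Y d. baer_sum Q X Y \<xi>\<^sub>1 \<xi>\<^sub>2 \<zeta>}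
    = ext_class X Y (c + d)"
proof -
  note XX = is_rep_dsum[OF X X] and YY = is_rep_dsum[OF Y Y]
  let ?cd = "\<lambda>a v. vappend (dimv Y (head Q a)) (c a v) (d a v)"
  let ?block_dim = "\<lambda>a w. vappend (dimv Y (head Q a)) (c a (vtake (dimv X (tail Q a)) w)) (d a (vdrop (dimv X (tail Q a)) w))"
  have cY: "c a v \<in> rV Y (head Q a)" "d a v \<in> rV Y (head Q a)" if "a \<in> arcs Q" "v \<in> rV X (tail Q a)" for a v
    using c d that by (simp_all add: cochain_def)
  have cd: "cochain (rV X) (rV (rep_dsum Y Y)) ?cd"
    unfolding cochain_def
  proof (intro ballI conjI)
    fix a v assume a: "a \<in> arcs Q"
    show "flinear (?cd a)" by (rule vappend_linear) (use c d a in \<open>simp_all add: cochain_def\<close>)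
    assume "v \<in> rV X (tail Q a)"
    then show "?cd a v \<in> rV (rep_dsum Y Y) (head Q a)" unfolding dimv_dsum by (rule vappend_cs[OF cY(2)[OF a]])
  qed
  have block_dim: "cochain (rV (rep_dsum X X)) (rV (rep_dsum Y Y)) ?block_dim"
    unfolding cochain_def
  proof (intro ballI conjI)
    fix a w assume a: "a \<in> arcs Q"
    have "flinear (c a)" "flinear (d a)" using c d a by (simp_all add: cochain_def)
    from flinear_compose[OF vtake_linear this(1)] flinear_compose[OF vdrop_linear this(2)]
    show "flinear (?block_dim a)" by (rule vappend_linear)
    assume "w \<in> rV (rep_dsum X X) (tail Q a)"
    then have "vdrop (dimv X (tail Q a)) w \<in> rV X (tail Q a)" by (simp add: dimv_dsum vdrop_cs)
    then show "?block_dim a w \<in> rV (rep_dsum Y Y) (head Q a)" unfolding dimv_dsum by (rule vappend_cs[OF cY(2)[OF a]])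
  qed
  have diag: "ext_mor Q (id_mor (rep_dsum Y Y)) (diag_mor X) \<eta> (ext_dsum \<xi>1 \<xi>2) \<longleftrightarrow> cocycle_of X \<eta> ?cd"
    if \<eta>: "\<eta> \<in> extensions Q X (rep_dsum Y Y)" and x1: "\<xi>1 \<in> ext_class X Y c" and x2: "\<xi>2 \<in> ext_class X Y d" for \<eta> \<xi>1 \<xi>2
  proof -
    have s: "ext_dsum \<xi>1 \<xi>2 \<in> extensions Q (rep_dsum X X) (rep_dsum Y Y)" "cocycle_of (rep_dsum X X) (ext_dsum \<xi>1 \<xi>2) ?block_dim"
      using x1 x2 ext_dsum_extension[OF X Y _ _ c _ d] by (simp_all add: ext_class_def)
    show ?thesis
      unfolding pullback_cocycle[OF X YY XX \<eta> s(1) is_mor_diag[OF X] block_dim s(2)]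
      by (rule iffI; erule cocycle_of_cong) (simp_all add: mact_diag vtake_vappend vdrop_vappend)
  qed
  have codiag: "ext_mor Q (codiag_mor Y) (id_mor X) \<eta> \<zeta> \<longleftrightarrow> cocycle_of X \<zeta> (c + d)"
    if \<eta>: "\<eta> \<in> extensions Q X (rep_dsum Y Y)" "cocycle_of X \<eta> ?cd" and \<zeta>: "\<zeta> \<in> extensions Q X Y" for \<eta> \<zeta>
    unfolding pushout_cocycle[OF X YY Y \<eta>(1) \<zeta> is_mor_codiag[OF Y] cd \<eta>(2)]
    by (rule iffI; erule cocycle_of_cong) (simp_all add: mact_codiag vtake_vappend vdrop_vappend vtake_id cY plus_fun_apply)
  show ?thesis
  proof (intro equalityI subsetI)
    fix \<zeta> assume "\<zeta> \<in> {\<zeta> \<in> extensions Q X Y. \<exists>\<xi>\<^sub>1 \<in> ext_class X Y c. \<exists>\<xi>\<^sub>2 \<in> ext_class X Y d. baer_sum Q X Y \<xi>\<^sub>1 \<xi>\<^sub>2 \<zeta>}"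
    then obtain \<xi>1 \<xi>2 \<eta> where z: "\<zeta> \<in> extensions Q X Y" and x: "\<xi>1 \<in> ext_class X Y c" "\<xi>2 \<in> ext_class X Y d"
      and e: "\<eta> \<in> extensions Q X (rep_dsum Y Y)" "ext_mor Q (id_mor (rep_dsum Y Y)) (diag_mor X) \<eta> (ext_dsum \<xi>1 \<xi>2)"
        "ext_mor Q (codiag_mor Y) (id_mor X) \<eta> \<zeta>"
      unfolding baer_sum_def by blast
    have "cocycle_of X \<eta> ?cd" using e(2) unfolding diag[OF e(1) x] .
    then have "cocycle_of X \<zeta> (c + d)" using e(3) codiag[OF e(1) _ z] by simp
    then show "\<zeta> \<in> ext_class X Y (c + d)" using z by (simp add: ext_class_def)
  next
    fix \<zeta> assume "\<zeta> \<in> ext_class X Y (c + d)"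
    then have z: "\<zeta> \<in> extensions Q X Y" "cocycle_of X \<zeta> (c + d)" by (auto simp: ext_class_def)
    obtain \<xi>1 \<xi>2 where x: "\<xi>1 \<in> ext_class X Y c" "\<xi>2 \<in> ext_class X Y d"
      using extension_exists[OF X Y c] extension_exists[OF X Y d] by (auto simp: ext_class_def)
    obtain \<eta> where e: "\<eta> \<in> extensions Q X (rep_dsum Y Y)" "cocycle_of X \<eta> ?cd" using extension_exists[OF X YY cd] by blast
    have "baer_sum Q X Y \<xi>1 \<xi>2 \<zeta>"
      unfolding baer_sum_def using e(1) e(2)[folded diag[OF e(1) x]] z(2)[folded codiag[OF e z(1)]] by blast
    then show "\<zeta> \<in> {\<zeta> \<in> extensions Q X Y. \<exists>\<xi>\<^sub>1 \<in> ext_class X Y c. \<exists>\<xi>\<^sub>2 \<in> ext_class X Y d. baer_sum Q X Y \<xi>\<^sub>1 \<xi>\<^sub>2 \<zeta>}"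
      using z(1) x by blast
  qed
qed

lemma smult_class:
  assumes X: "is_rep Q X" and Y: "is_rep Q Y" and c: "cochain (rV X) (rV Y) c"
  shows "{\<zeta> \<in> extensions Q X Y. \<exists>\<xi> \<in> ext_class X Y c. ext_mor Q (scalar_mor r Y) (id_mor X) \<xi> \<zeta>}
    = ext_class X Y (\<lambda>a v. fscale r (c a v))"
proof -
  have cY: "c a v \<in> rV Y (head Q a)" if "a \<in> arcs Q" "v \<in> rV X (tail Q a)" for a v
    using c that by (simp add: cochain_def)
  have eq: "ext_mor Q (scalar_mor r Y) (id_mor X) \<xi> \<zeta> \<longleftrightarrow> cocycle_of X \<zeta> (\<lambda>a v. fscale r (c a v))"
    if x: "\<xi> \<in> ext_class X Y c" and z: "\<zeta> \<in> extensions Q X Y" for \<xi> \<zeta>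
  proof -
    have xi: "\<xi> \<in> extensions Q X Y" "cocycle_of X \<xi> c" using x by (auto simp: ext_class_def)
    show ?thesis
      unfolding pushout_cocycle[OF X Y Y xi(1) z is_mor_scalar[OF Y] c xi(2)]
      by (rule iffI; erule cocycle_of_cong) (simp_all add: scalar_mor_def mact_smult mact_one cY)
  qed
  obtain \<xi> where "\<xi> \<in> ext_class X Y c" using extension_exists[OF X Y c] by (auto simp: ext_class_def)
  then show ?thesis using eq unfolding ext_class_def[of X Y "\<lambda>a v. fscale r (c a v)"] by blast
qed

text \<open>
  The dictionary of the previous lemmas: an equivalence class of extensions consists of all
  extensions with a given cocycle.
\<close>

lemma presented_Ext1:
  assumes X: "is_rep Q X" and Y: "is_rep Q Y"
  shows "presented_space (Ext1 Q X Y) (Collect (cochain (rV X) (rV Y))) (\<lambda>r c a v. fscale r (c a v)) (ext_class X Y)"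
proof (unfold_locales, goal_cases)
  case 8
  show ?case
  proof (intro equalityI subsetI)
    fix C assume "C \<in> carrier (Ext1 Q X Y)"
    then obtain \<xi> where x: "\<xi> \<in> extensions Q X Y" "C = ext_equiv Q X Y `` {\<xi>}" by (auto simp: Ext1_def quotient_def)
    obtain c where c: "cochain (rV X) (rV Y) c" "cocycle_of X \<xi> c" using cocycle_exists[OF X Y x(1)] by blast
    have "C = ext_class X Y c" unfolding x(2) by (rule ext_equiv_class[OF X Y c(1)]) (simp add: ext_class_def x c)
    then show "C \<in> ext_class X Y ` Collect (cochain (rV X) (rV Y))" using c(1) by blast
  next
    fix C assume "C \<in> ext_class X Y ` Collect (cochain (rV X) (rV Y))"
    then obtain c where c: "cochain (rV X) (rV Y) c" "C = ext_class X Y c" by blast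
    obtain \<xi> where x: "\<xi> \<in> extensions Q X Y" "cocycle_of X \<xi> c" using extension_exists[OF X Y c(1)] by blast
    have "C = ext_equiv Q X Y `` {\<xi>}" unfolding c(2) by (rule ext_equiv_class[OF X Y c(1), symmetric]) (simp add: ext_class_def x)
    then show "C \<in> carrier (Ext1 Q X Y)" using x(1) by (auto simp: Ext1_def quotient_def)
  qed
next
  case 9
  then show ?case by (simp add: Ext1_def split_extensions_class[OF X Y])
next
  case (10 c d)
  then show ?case by (simp add: Ext1_def baer_sum_class[OF X Y])
next
  case (11 c r)
  then show ?case by (simp add: Ext1_def smult_class[OF X Y])
qed (auto simp: cochain_ops fun_eq_iff pointwise algebra_simps)

lemma dim_Ext1_0:
  assumes X: "is_rep Q X" and Y: "is_rep Q Y" and van: "ext_vanishes (rV X) (rT X) (rV Y) (rT Y)"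
  shows "dim_Ext1 Q X Y = 0"
proof -
  interpret presented_space "Ext1 Q X Y" "Collect (cochain (rV X) (rV Y))" "\<lambda>r c a v. fscale r (c a v)" "ext_class X Y"
    by (rule presented_Ext1[OF X Y])
  show ?thesis unfolding dim_Ext1_def
  proof (rule dim_0)
    fix c assume "c \<in> Collect (cochain (rV X) (rV Y))"
    then have c: "cochain (rV X) (rV Y) c" by simp
    then have "cob X Y c" using van unfolding cob_def ext_vanishes_def by blast
    then have "cob X Y (\<lambda>a v. c a v - 0 a v)" by (rule cob_cong) (simp add: zero_fun_apply)
    then show "ext_class X Y c = ext_class X Y 0" by (simp only: ext_class_eq_iff[OF X Y c cochain_ops(1)])
  qed
qed

lemma dim_Ext1_1:
  assumes X: "is_rep Q X" and Y: "is_rep Q Y" and c0: "cochain (rV X) (rV Y) c0" "\<not> cob X Y c0"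
    and gen: "\<And>c. cochain (rV X) (rV Y) c \<Longrightarrow> \<exists>r. cob X Y (\<lambda>a v. c a v - fscale r (c0 a v))"
  shows "dim_Ext1 Q X Y = 1"
proof -
  interpret presented_space "Ext1 Q X Y" "Collect (cochain (rV X) (rV Y))" "\<lambda>r c a v. fscale r (c a v)" "ext_class X Y"
    by (rule presented_Ext1[OF X Y])
  show ?thesis unfolding dim_Ext1_def
  proof (rule dim_1)
    show "c0 \<in> Collect (cochain (rV X) (rV Y))" using c0(1) by simp
    show "ext_class X Y c0 \<noteq> ext_class X Y 0"
    proof
      assume "ext_class X Y c0 = ext_class X Y 0"
      then have "cob X Y (\<lambda>a v. c0 a v - 0 a v)" by (simp only: ext_class_eq_iff[OF X Y c0(1) cochain_ops(1)])
      then have "cob X Y c0" by (rule cob_cong) (simp add: zero_fun_apply)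
      then show False using c0(2) by simp
    qed
    fix c assume "c \<in> Collect (cochain (rV X) (rV Y))"
    then have c: "cochain (rV X) (rV Y) c" by simp
    show "\<exists>r. ext_class X Y c = ext_class X Y (\<lambda>a v. fscale r (c0 a v))"
      using gen[OF c] by (simp only: ext_class_eq_iff[OF X Y c cochain_ops(3)[OF c0(1)]])
  qed
qed

end

section \<open>The extension quiver\<close>

context quiver
begin

lemma dim_Ext1_no_arrow:
  fixes X Y :: "('v, 'a, 'k::field) rep"
  assumes X: "is_rep Q X" and Y: "is_rep Q Y"
    and z: "\<And>a. a \<in> arcs Q \<Longrightarrow> dimv X (tail Q a) = 0 \<or> dimv Y (head Q a) = 0"
  shows "dim_Ext1 Q X Y = 0"
proof (rule dim_Ext1_0[OF X Y], unfold ext_vanishes_def, intro allI impI)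
  fix c assume c: "cochain (rV X) (rV Y) c"
  have "c a v = 0" if a: "a \<in> arcs Q" and v: "v \<in> rV X (tail Q a)" for a v
  proof -
    have "flinear (c a)" "c a v \<in> rV Y (head Q a)" using c a v by (simp_all add: cochain_def)
    then show ?thesis using z[OF a] v by (auto simp: flinear_simps(4))
  qed
  then have "coboundary (rV X) (rT X) (rT Y) (\<lambda>x v. 0) c"
    unfolding coboundary_def by (simp add: flinear_simps[OF mact_linear])
  moreover have "ffam (rV X) (rV Y) (\<lambda>x v. 0)" by (simp add: ffam_def flinear_ops(2))
  ultimately show "\<exists>\<psi>. ffam (rV X) (rV Y) \<psi> \<and> coboundary (rV X) (rT X) (rT Y) \<psi> c" by blast
qed

lemma cob_disjoint_support:
  assumes d: "\<And>x. x \<in> verts Q \<Longrightarrow> dimv X x = 0 \<or> dimv Y x = 0" and X: "is_rep Q X"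
  shows "cob X Y c \<longleftrightarrow> (\<forall>a\<in>arcs Q. \<forall>v\<in>rV X (tail Q a). c a v = 0)"
proof
  assume "cob X Y c"
  then obtain \<psi> where psi: "ffam (rV X) (rV Y) \<psi>" "coboundary (rV X) (rT X) (rT Y) \<psi> c" unfolding cob_def by blast
  have z: "\<psi> x v = 0" if x: "x \<in> verts Q" and v: "v \<in> rV X x" for x v
    using d[OF x] v ffamD[OF psi(1) x] by (auto simp: flinear_simps(4))
  show "\<forall>a\<in>arcs Q. \<forall>v\<in>rV X (tail Q a). c a v = 0"
  proof (intro ballI)
    fix a v assume a: "a \<in> arcs Q" and v: "v \<in> rV X (tail Q a)"
    have "c a v = \<psi> (head Q a) (rT X a v) - rT Y a (\<psi> (tail Q a) v)"
      using psi(2) a v unfolding coboundary_def by simp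
    then show "c a v = 0"
      by (simp add: z[OF tail_in_verts[OF a] v] z[OF head_in_verts[OF a] frepD(3)[OF frep_rep[OF X] a v]] flinear_simps[OF mact_linear])
  qed
next
  assume "\<forall>a\<in>arcs Q. \<forall>v\<in>rV X (tail Q a). c a v = 0"
  then have "coboundary (rV X) (rT X) (rT Y) (\<lambda>x v. 0) c"
    unfolding coboundary_def by (simp add: flinear_simps[OF mact_linear])
  moreover have "ffam (rV X) (rV Y) (\<lambda>x v. 0)" by (simp add: ffam_def flinear_ops(2))
  ultimately show "cob X Y c" unfolding cob_def by blast
qed

lemma cs_1: "v \<in> cs 1 \<longleftrightarrow> v = fscale (v 0) (unitf 0)"
  by (auto simp: cs_iff fun_eq_iff unitf_def pointwise Suc_le_eq)

text \<open>
  With disjoint supports there are no nonzero families and hence no nonzero coboundaries, and a single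
  arrow between two lines carries a one-dimensional space of cochains.
\<close>

lemma dim_Ext1_one_arrow:
  fixes X Y :: "('v, 'a, 'k::field) rep"
  assumes X: "is_rep Q X" and Y: "is_rep Q Y"
    and disj: "\<And>x. x \<in> verts Q \<Longrightarrow> dimv X x = 0 \<or> dimv Y x = 0"
    and a: "a \<in> arcs Q" "dimv X (tail Q a) = 1" "dimv Y (head Q a) = 1"
    and z: "\<And>b. b \<in> arcs Q \<Longrightarrow> b \<noteq> a \<Longrightarrow> dimv X (tail Q b) = 0 \<or> dimv Y (head Q b) = 0"
  shows "dim_Ext1 Q X Y = 1"
proof (rule dim_Ext1_1[OF X Y])
  have cob_iff: "cob X Y c \<longleftrightarrow> (\<forall>a\<in>arcs Q. \<forall>v\<in>rV X (tail Q a). c a v = 0)" for c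
    by (rule cob_disjoint_support[OF _ X]) (rule disj)
  let ?c0 = "\<lambda>b v. if b = a then v else (0 :: nat \<Rightarrow> 'k)"
  show "cochain (rV X) (rV Y) ?c0"
    unfolding cochain_def
  proof (intro ballI conjI)
    fix b v assume b: "b \<in> arcs Q"
    show "flinear (?c0 b)" by (cases "b = a") (simp_all add: flinear_ops(1,2))
    assume "v \<in> rV X (tail Q b)"
    then show "?c0 b v \<in> rV Y (head Q b)" using a(2,3) by (cases "b = a") simp_all
  qed
  show "\<not> cob X Y ?c0"
  proof
    assume "cob X Y ?c0"
    then have "\<forall>b\<in>arcs Q. \<forall>v\<in>rV X (tail Q b). ?c0 b v = 0" by (rule cob_iff[THEN iffD1])
    from bspec[OF bspec[OF this a(1)], of "unitf 0"]
    have "unitf 0 = (0 :: nat \<Rightarrow> 'k)" using unitf_cs[of 0 "dimv X (tail Q a)"] a(2) by simp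
    then show False by (simp add: unitf_nz)
  qed
  fix c assume c: "cochain (rV X) (rV Y) c"
  let ?u = "unitf 0 :: nat \<Rightarrow> 'k"
  have "c b v - fscale (c a ?u 0) (?c0 b v) = 0" if b: "b \<in> arcs Q" and v: "v \<in> rV X (tail Q b)" for b v
  proof (cases "b = a")
    case True
    have cl: "flinear (c a)" using c a(1) by (simp add: cochain_def)
    have "?u \<in> rV X (tail Q a)" unfolding a(2) by (rule unitf_cs) simp
    then have "c a ?u \<in> rV Y (head Q a)" using c a(1) unfolding cochain_def by blast
    then have cu: "c a ?u \<in> cs 1" by (simp only: a(3))
    have "v \<in> cs 1" using v a(2) True by simp
    then have v1: "v = fscale (v 0) ?u" by (simp only: cs_1)
    have cu1: "c a ?u = fscale (c a ?u 0) ?u" using cu by (simp only: cs_1)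
    have "c a v = fscale (v 0) (c a ?u)" by (subst v1) (rule flinear_simps(5)[OF cl])
    also have "\<dots> = fscale (v 0) (fscale (c a ?u 0) ?u)" by (subst cu1) (rule refl)
    also have "\<dots> = fscale (c a ?u 0) (fscale (v 0) ?u)" by (simp add: fun_eq_iff pointwise)
    also have "\<dots> = fscale (c a ?u 0) v" by (simp only: v1[symmetric])
    finally show ?thesis using True by simp
  next
    case False
    have "flinear (c b)" "c b v \<in> rV Y (head Q b)" using c b v by (simp_all add: cochain_def)
    then have "c b v = 0" using z[OF b False] v by (auto simp: flinear_simps(4))
    then show ?thesis using False by simp
  qed
  then show "\<exists>r. cob X Y (\<lambda>b v. c b v - fscale r (?c0 b v))"
    by (intro exI[of _ "c a ?u 0"] cob_iff[THEN iffD2] ballI)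
qed

lemma zero_mor_disjoint_support:
  assumes m: "is_mor Q X Y \<phi>" and d: "\<And>x. x \<in> verts Q \<Longrightarrow> dimv X x = 0 \<or> dimv Y x = 0"
  shows "zero_mor Q \<phi>"
proof -
  have c: "\<phi> x \<in> carrier_mat (dimv Y x) (dimv X x)" if "x \<in> verts Q" for x using m that by (simp add: is_mor_def)
  have "\<phi> x = 0\<^sub>m (dim_row (\<phi> x)) (dim_col (\<phi> x))" if x: "x \<in> verts Q" for x
    by (rule eq_matI) (use c[OF x] d[OF x] in auto)
  then show ?thesis by (simp add: zero_mor_def)
qed

lemma base_field_division_ring:
  assumes X: "is_rep Q X" and e: "end_is_base_field Q X"
  shows "end_division_ring Q X"
  unfolding end_division_ring_def
proof (intro conjI allI impI)
  show "\<not> zero_mor Q (id_mor X)" using e by (simp add: end_is_base_field_def)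
  fix \<phi> assume p: "is_mor Q X X \<phi> \<and> \<not> zero_mor Q \<phi>"
  then obtain c where c: "mor_eq Q \<phi> (scalar_mor c X)" using e by (auto simp: end_is_base_field_def)
  have "c \<noteq> 0"
  proof
    assume "c = 0"
    then have "zero_mor Q \<phi>" using c by (auto simp: zero_mor_def mor_eq_def scalar_mor_def intro!: eq_matI)
    then show False using p by simp
  qed
  then have "mor_eq Q (mor_comp (scalar_mor (inverse c) X) \<phi>) (id_mor X)" "mor_eq Q (mor_comp \<phi> (scalar_mor (inverse c) X)) (id_mor X)"
    using c unfolding mor_eq_def mor_comp_def scalar_mor_def by (auto intro!: eq_matI)
  then show "\<exists>\<psi>. is_mor Q X X \<psi> \<and> mor_eq Q (mor_comp \<psi> \<phi>) (id_mor X) \<and> mor_eq Q (mor_comp \<phi> \<psi>) (id_mor X)"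
    using is_mor_scalar[OF X] by blast
qed

text \<open>
  An endomorphism with an inverse is injective; the zero case is that of the zero matrix.
\<close>

lemma division_ring_brick:
  assumes X: "is_rep Q X" and e: "end_division_ring Q X"
  shows "brick (rV X) (rT X)"
  unfolding brick_def
proof (intro allI impI)
  fix \<phi> assume p: "fhom (rV X) (rT X) (rV X) (rT X) \<phi>"
  let ?m = "mor_of X X \<phi>"
  note mm = is_mor_of[OF X X p] and ap = mact_mor_of[OF fhomD(1)[OF p]]
  show "fzero (rV X) \<phi> \<or> finj (rV X) \<phi>"
  proof (cases "zero_mor Q ?m")
    case True
    then have "fzero (rV X) (ma ?m)" by (simp add: zero_mor_iff[of ?m "dimv X" "dimv X", OF mor_of_carrier])
    then show ?thesis using ap by (simp add: fzero_def)
  next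
    case False
    then obtain \<psi> where s: "is_mor Q X X \<psi>" "mor_eq Q (mor_comp \<psi> ?m) (id_mor X)"
      using e mm unfolding end_division_ring_def by blast
    have "v = 0" if x: "x \<in> verts Q" and v: "v \<in> rV X x" and z: "\<phi> x v = 0" for x v
    proof -
      have "v = mact (id_mor X x) v" by (rule mact_one[OF v, symmetric])
      also have "\<dots> = mact (mor_comp \<psi> ?m x) v" using s(2) x by (simp add: mor_eq_def)
      also have "\<dots> = ma \<psi> x (\<phi> x v)" by (simp add: mor_comp_carrier(2)[OF mm s(1) x] ap[OF x v])
      also have "\<dots> = 0" unfolding z by (rule flinear_simps(4)[OF mact_linear])
      finally show ?thesis .
    qed
    then show ?thesis unfolding finj_def by blast
  qed
qed

lemma id_mor_nonzero:
  assumes X: "is_rep Q X" and nz: "\<not> zero_rep Q X"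
  shows "\<not> zero_mor Q (id_mor X)"
proof
  assume "zero_mor Q (id_mor X)"
  then have "fzero (rV X) (ma (id_mor X))" by (subst (asm) zero_mor_iff[of _ "dimv X" "dimv X"]) simp_all
  then have "\<not> nonzero (rV X)" unfolding nonzero_def fzero_def using mact_one by metis
  then show False using nz by (simp add: nonzero_rV)
qed

end


context brick_triple
begin

abbreviation S :: "('v, 'a, 'k) rep" where
  "S \<equiv> simple_rep Q y"

lemma A_S_disjoint: "r < 3 \<Longrightarrow> dimv (A r) x = 0 \<or> dimv S x = 0" "r < 3 \<Longrightarrow> dimv S x = 0 \<or> dimv (A r) x = 0"
  using A_y by (auto simp: simple_rep_simps)

lemma dim_Ext1_A_A: "r < 3 \<Longrightarrow> s < 3 \<Longrightarrow> dim_Ext1 Q (A r) (A s) = 0"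
  by (rule dim_Ext1_0[OF A_rep A_rep A_ext_vanishes])

lemma dim_Ext1_S_S: "dim_Ext1 Q S S = 0"
  by (rule dim_Ext1_no_arrow[OF simple_rep_simps(2,2)]) (use no_loop_at_y in \<open>auto simp: simple_rep_simps\<close>)

lemma dim_Ext1_S_A: assumes r: "r < 3" shows "dim_Ext1 Q S (A r) = (if outward r then 1 else 0)"
  using r
proof (cases rule: arrow_cases)
  case (out a)
  have "dim_Ext1 Q S (A r) = 1"
    by (rule dim_Ext1_one_arrow[OF simple_rep_simps(2) A_rep[OF r] A_S_disjoint(2)[OF r] out(1)])
      (use out in \<open>auto simp: simple_rep_simps\<close>)
  then show ?thesis using out(4) by simp
next
  case (inn a)
  have "dim_Ext1 Q S (A r) = 0"
    by (rule dim_Ext1_no_arrow[OF simple_rep_simps(2) A_rep[OF r]])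
      (use inn(4) in \<open>auto simp: simple_rep_simps outward_def\<close>)
  then show ?thesis using inn(4) by simp
qed

lemma dim_Ext1_A_S: assumes r: "r < 3" shows "dim_Ext1 Q (A r) S = (if outward r then 0 else 1)"
  using r
proof (cases rule: arrow_cases)
  case (out a)
  have "dim_Ext1 Q (A r) S = 0"
    by (rule dim_Ext1_no_arrow[OF A_rep[OF r] simple_rep_simps(2)])
      (use out(5) in \<open>auto simp: simple_rep_simps inward_def\<close>)
  then show ?thesis using out(4) by simp
next
  case (inn a)
  have "dim_Ext1 Q (A r) S = 1"
    by (rule dim_Ext1_one_arrow[OF A_rep[OF r] simple_rep_simps(2) A_S_disjoint(1)[OF r] inn(1)])
      (use inn in \<open>auto simp: simple_rep_simps\<close>)
  then show ?thesis using inn(4) by simp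
qed

lemma A_nonzero: assumes "r < 3" shows "\<not> zero_rep Q (A r)"
proof -
  obtain z where "z \<in> verts Q" "0 < dimv (A r) z" using neighbour_in_support[OF assms] by metis
  then show ?thesis unfolding zero_rep_def by auto
qed

lemma A_inj: assumes r: "r < 3" "s < 3" and ne: "r \<noteq> s" shows "A r \<noteq> A s"
proof
  assume e: "A r = A s"
  have "fzero (rV (A r)) (\<lambda>x v. v)" by (rule A_orth[OF r ne]) (simp only: e[symmetric] fhom_id)
  then have "\<not> nonzero (rV (A r))" unfolding fzero_def nonzero_def by blast
  then show False using A_nonzero[OF r(1)] by (simp add: nonzero_rV)
qed

lemma A_ne_S: "r < 3 \<Longrightarrow> A r \<noteq> S"
  using A_y[of r] simple_rep_simps(1)[of y] by (metis one_neq_zero)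

lemma A_base_field: assumes r: "r < 3" shows "end_is_base_field Q (A r)"
  unfolding end_is_base_field_def
proof (intro conjI allI impI id_mor_nonzero A_rep A_nonzero r)
  fix \<phi> assume p: "is_mor Q (A r) (A r) \<phi>"
  obtain c where c: "\<And>x v. x \<in> verts Q \<Longrightarrow> v \<in> rV (A r) x \<Longrightarrow> ma \<phi> x v = fscale c v"
    using A_end_scalar[OF r fhom_mor[OF A_rep[OF r] A_rep[OF r] p]] by metis
  have "mor_eq Q \<phi> (scalar_mor c (A r))"
    by (subst mor_eq_iff[of _ "dimv (A r)" "dimv (A r)"])
      (use p c in \<open>simp_all add: is_mor_def scalar_mor_def mact_smult mact_one\<close>)
  then show "\<exists>c. mor_eq Q \<phi> (scalar_mor c (A r))" by blast
qed

lemma S_base_field: "end_is_base_field Q S"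
  unfolding end_is_base_field_def
proof (intro conjI allI impI id_mor_nonzero simple_rep_simps(2))
  show "\<not> zero_rep Q S" using y unfolding zero_rep_def by (auto simp: simple_rep_simps)
  fix \<phi> assume p: "is_mor Q S S \<phi>"
  have "\<phi> x = scalar_mor (\<phi> y $$ (0, 0)) S x" if "x \<in> verts Q" for x
    by (rule eq_matI) (use p that in \<open>auto simp: is_mor_def scalar_mor_def simple_rep_simps split: if_splits\<close>)
  then show "\<exists>c. mor_eq Q \<phi> (scalar_mor c S)" unfolding mor_eq_def by blast
qed

definition C :: "('v, 'a, 'k) rep set" where
  "C = {A 0, A 1, A 2, S}"

lemma C_mem: "r < 3 \<Longrightarrow> A r \<in> C" "S \<in> C"
  by (auto simp: less3 C_def)

lemma C_cases: "X \<in> C \<Longrightarrow> (\<And>r. r < 3 \<Longrightarrow> X = A r \<Longrightarrow> P) \<Longrightarrow> (X = S \<Longrightarrow> P) \<Longrightarrow> P"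
  by (auto simp: less3 C_def)

lemma C_rep: "X \<in> C \<Longrightarrow> is_rep Q X" and C_base_field: "X \<in> C \<Longrightarrow> end_is_base_field Q X"
  by (erule C_cases; simp add: A_rep simple_rep_simps A_base_field S_base_field)+

lemma C_antichain: "antichain Q C"
  unfolding antichain_def
proof (intro conjI ballI impI allI)
  fix X assume X: "X \<in> C"
  show "is_rep Q X" by (rule C_rep[OF X])
  show "end_division_ring Q X" by (rule base_field_division_ring[OF C_rep[OF X] C_base_field[OF X]])
  fix Y \<phi> assume Y: "Y \<in> C" and ne: "X \<noteq> Y" and p: "is_mor Q X Y \<phi>"
  have pc: "\<phi> x \<in> carrier_mat (dimv Y x) (dimv X x)" if "x \<in> verts Q" for x using p that by (simp add: is_mor_def)
  show "zero_mor Q \<phi>"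
  proof (rule C_cases[OF X]; rule C_cases[OF Y])
    fix s r assume r: "r < 3" "X = A r" and s: "s < 3" "Y = A s"
    have "r \<noteq> s" using ne r s by auto
    then have "fzero (rV X) (ma \<phi>)"
      using A_orth[OF r(1) s(1)] fhom_mor[OF C_rep[OF X] C_rep[OF Y] p] unfolding r(2) s(2) by blast
    then show ?thesis by (subst zero_mor_iff[OF pc])
  next
    fix r assume r: "r < 3" "X = A r" and s: "Y = S"
    show ?thesis by (rule zero_mor_disjoint_support[OF p]) (use A_S_disjoint(1)[OF r(1)] r s in simp)
  next
    fix r assume r: "r < 3" "Y = A r" and s: "X = S"
    show ?thesis by (rule zero_mor_disjoint_support[OF p]) (use A_S_disjoint(2)[OF r(1)] r s in simp)
  qed (use ne in simp)
qed

definition G :: "(('v, 'a, 'k) rep, ('v, 'a, 'k) rep \<times> ('v, 'a, 'k) rep \<times> nat) pre_digraph" where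
  "G = ext_quiver Q C"

text \<open>
  Arrows of the extension quiver go from \<open>X\<close> to \<open>Y\<close> when \<open>Ext(X, Y) \<noteq> 0\<close>, which is the direction of the arrow
  of \<open>Q\<close> between \<open>y\<close> and the support of \<open>A r\<close>. The last entry numbers parallel arrows.
\<close>

definition arrow :: "nat \<Rightarrow> ('v, 'a, 'k) rep \<times> ('v, 'a, 'k) rep \<times> nat" where
  "arrow r = (if outward r then (S, A r, 0) else (A r, S, 0))"

lemma ext_quiver_simps: "verts G = C" "tail G = fst" "head G = (\<lambda>(X, Y, l). Y)"
  by (simp_all add: ext_quiver_def G_def)

lemma arrow_ends: "{tail G (arrow r), head G (arrow r)} = {S, A r}"
  by (auto simp: arrow_def ext_quiver_simps)

lemma arcs_G: "arcs G = arrow ` {..<3}"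
proof (intro equalityI subsetI)
  fix e assume "e \<in> arrow ` {..<3}"
  then obtain r where r: "r < 3" "e = arrow r" by blast
  show "e \<in> arcs G"
    using dim_Ext1_S_A[OF r(1)] dim_Ext1_A_S[OF r(1)] r(2) C_mem(1)[OF r(1)] C_mem(2) by (simp add: arrow_def ext_quiver_def G_def)
next
  fix e assume "e \<in> arcs G"
  then obtain X Y l where e: "e = (X, Y, l)" "X \<in> C" "Y \<in> C" "l < dim_Ext1 Q X Y" by (auto simp: ext_quiver_def G_def)
  show "e \<in> arrow ` {..<3}"
  proof (rule C_cases[OF e(2)]; rule C_cases[OF e(3)])
    fix s r assume "r < 3" "X = A r" "s < 3" "Y = A s"
    then show ?thesis using e(4) dim_Ext1_A_A[of r s] by simp
  next
    fix r assume r: "r < 3" "X = A r" and "Y = S"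
    then have "e = arrow r" using e(1,4) dim_Ext1_A_S[OF r(1)] by (simp add: arrow_def split: if_splits)
    then show ?thesis using r(1) by simp
  next
    fix r assume r: "r < 3" "Y = A r" and "X = S"
    then have "e = arrow r" using e(1,4) dim_Ext1_S_A[OF r(1)] by (simp add: arrow_def split: if_splits)
    then show ?thesis using r(1) by simp
  next
    assume "X = S" "Y = S"
    then show ?thesis using e(4) dim_Ext1_S_S by simp
  qed
qed

lemma arcs_between:
  "r < 3 \<Longrightarrow> {e \<in> arcs G. {tail G e, head G e} = {S, A r}} = {arrow r}"
  "r < 3 \<Longrightarrow> {e \<in> arcs G. {tail G e, head G e} = {A r, S}} = {arrow r}"
  "r < 3 \<Longrightarrow> s < 3 \<Longrightarrow> {e \<in> arcs G. {tail G e, head G e} = {A r, A s}} = {}"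
  "{e \<in> arcs G. {tail G e, head G e} = {S, S}} = {}"
proof -
  have B: "{e \<in> arcs G. {tail G e, head G e} = Z} = arrow ` {s. s < 3 \<and> {S, A s} = Z}" for Z
  proof (intro equalityI subsetI)
    fix e assume "e \<in> {e \<in> arcs G. {tail G e, head G e} = Z}"
    then have e: "e \<in> arrow ` {..<3}" "{tail G e, head G e} = Z" unfolding arcs_G by simp_all
    from e(1) obtain s where s: "e = arrow s" "s \<in> {..<3}" by (rule imageE)
    have "{S, A s} = Z" using e(2) unfolding s(1) arrow_ends .
    then show "e \<in> arrow ` {s. s < 3 \<and> {S, A s} = Z}" using s by simp
  next
    fix e assume "e \<in> arrow ` {s. s < 3 \<and> {S, A s} = Z}"
    then obtain s where s: "e = arrow s" "s \<in> {s. s < 3 \<and> {S, A s} = Z}" by (rule imageE)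
    then have "{tail G e, head G e} = Z" using arrow_ends[of s] by simp
    then show "e \<in> {e \<in> arcs G. {tail G e, head G e} = Z}" using s by (simp add: arcs_G)
  qed
  have idx: "{s. s < 3 \<and> {S, A s} = {S, A r}} = {r}" if r: "r < 3" for r
  proof (intro equalityI subsetI)
    fix s assume "s \<in> {s. s < 3 \<and> {S, A s} = {S, A r}}"
    then have s: "s < 3" "{S, A s} = {S, A r}" by simp_all
    then have "A s = A r" by (simp add: doubleton_eq_iff) metis
    then have "s = r" using A_inj[OF s(1) r] by blast
    then show "s \<in> {r}" by simp
  qed (use r in simp)
  show 1: "{e \<in> arcs G. {tail G e, head G e} = {S, A r}} = {arrow r}" if "r < 3" for r
    unfolding B idx[OF that] by simp
  show "{e \<in> arcs G. {tail G e, head G e} = {A r, S}} = {arrow r}" if "r < 3" for r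
    using 1[OF that] by (simp only: insert_commute[of "A r"])
  have "{S, A t} \<noteq> {A r, A s}" if "r < 3" "s < 3" for r s t
  proof
    assume "{S, A t} = {A r, A s}"
    then have "S \<in> {A r, A s}" by blast
    then show False using A_ne_S[OF that(1)] A_ne_S[OF that(2)] by simp
  qed
  then show "{e \<in> arcs G. {tail G e, head G e} = {A r, A s}} = {}" if "r < 3" "s < 3" for r s
    unfolding B using that by simp
  have "{S, A t} \<noteq> {S, S}" if "t < 3" for t
  proof
    assume "{S, A t} = {S, S}"
    then have "A t \<in> {S, S}" by blast
    then show False using A_ne_S[OF that] by simp
  qed
  then show "{e \<in> arcs G. {tail G e, head G e} = {S, S}} = {}"
    unfolding B by simp
qed

text \<open>
  The centre of D4 has the label \<open>3\<close>.
\<close>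

definition lab :: "nat \<Rightarrow> ('v, 'a, 'k) rep" where
  "lab i = (if i = 3 then S else A (if i = 4 then 2 else i - 1))"

lemma D4_labelling: "dynkin_labelling (TypeD 4) G lab"
  unfolding dynkin_labelling_def
proof (intro conjI ballI)
  have v4: "{1..4::nat} = {1, 2, 3, 4}" by auto
  have lv: "lab 1 = A 0" "lab 2 = A 1" "lab 3 = S" "lab 4 = A 2" by (simp_all add: lab_def)
  have ne: "A 0 \<noteq> A 1" "A 0 \<noteq> A 2" "A 1 \<noteq> A 2" "A 0 \<noteq> S" "A 1 \<noteq> S" "A 2 \<noteq> S"
    using A_inj[of 0 1] A_inj[of 0 2] A_inj[of 1 2] A_ne_S[of 0] A_ne_S[of 1] A_ne_S[of 2] by simp_all
  show "wf_digraph G"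
    by unfold_locales (auto simp: ext_quiver_def G_def)
  have im: "lab ` {1, 2, 3, 4} = C" unfolding image_insert image_empty lv C_def by blast
  have "inj_on lab {1, 2, 3, 4}"
    unfolding inj_on_insert using lv ne by (simp add: ne[symmetric])
  then show "bij_betw lab (diagram_verts (TypeD 4)) (verts G)"
    unfolding bij_betw_def diagram_verts.simps v4 im ext_quiver_simps(1) by simp
  fix u v assume "u \<in> diagram_verts (TypeD 4)" "v \<in> diagram_verts (TypeD 4)"
  then have uv: "u \<in> {1, 2, 3, 4}" "v \<in> {1, 2, 3, 4}" unfolding diagram_verts.simps v4 .
  have edge: "{u, v} \<in> diagram_edges (TypeD 4) \<longleftrightarrow> (u = 3) \<noteq> (v = 3)"
  proof -
    have "u = 1 \<or> u = 2 \<or> u = 3 \<or> u = 4" "v = 1 \<or> v = 2 \<or> v = 3 \<or> v = 4" using uv by simp_all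
    then show ?thesis unfolding edges_D by (elim disjE) simp_all
  qed
  let ?ix = "\<lambda>i::nat. if i = 4 then 2 else i - 1"
  have ix: "lab w = A (?ix w) \<and> ?ix w < 3" if "w \<in> {1, 2, 3, 4}" "w \<noteq> 3" for w using that by (auto simp: lab_def)
  show "let B = {a \<in> arcs G. {tail G a, head G a} = {lab u, lab v}}
        in if {u, v} \<in> diagram_edges (TypeD 4) then card B = 1 else B = {}"
    unfolding Let_def edge
  proof (cases "u = 3"; cases "v = 3")
    assume u: "u = 3" and v: "v = 3"
    show "if (u = 3) \<noteq> (v = 3) then card {a \<in> arcs G. {tail G a, head G a} = {lab u, lab v}} = 1
      else {a \<in> arcs G. {tail G a, head G a} = {lab u, lab v}} = {}"
      unfolding u v lv by (simp add: arcs_between(4)[simplified])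
  next
    assume u: "u = 3" and v: "v \<noteq> 3"
    note i = ix[OF uv(2) v]
    show "if (u = 3) \<noteq> (v = 3) then card {a \<in> arcs G. {tail G a, head G a} = {lab u, lab v}} = 1
      else {a \<in> arcs G. {tail G a, head G a} = {lab u, lab v}} = {}"
      unfolding u lv(3) conjunct1[OF i] arcs_between(1)[OF conjunct2[OF i]] using v by simp
  next
    assume u: "u \<noteq> 3" and v: "v = 3"
    note i = ix[OF uv(1) u]
    show "if (u = 3) \<noteq> (v = 3) then card {a \<in> arcs G. {tail G a, head G a} = {lab u, lab v}} = 1
      else {a \<in> arcs G. {tail G a, head G a} = {lab u, lab v}} = {}"
      unfolding v lv(3) conjunct1[OF i] arcs_between(2)[OF conjunct2[OF i]] using u by simp
  next
    assume u: "u \<noteq> 3" and v: "v \<noteq> 3"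
    note i = ix[OF uv(1) u] and j = ix[OF uv(2) v]
    show "if (u = 3) \<noteq> (v = 3) then card {a \<in> arcs G. {tail G a, head G a} = {lab u, lab v}} = 1
      else {a \<in> arcs G. {tail G a, head G a} = {lab u, lab v}} = {}"
      unfolding conjunct1[OF i] conjunct1[OF j] arcs_between(3)[OF conjunct2[OF i] conjunct2[OF j]] using u v by simp
  qed
qed

end

section \<open>The maximal indecomposable representation\<close>

context quiver
begin

text \<open>
  Equality of dimensions makes an injective homomorphism invertible; its linear inverse
  automatically commutes with the arrows.
\<close>

lemma fiso_of_inj:
  assumes V: "frep V T" and W: "frep W T'" and f: "fhom V T W T' f" and inj: "finj V f"
    and dim: "\<And>x. x \<in> verts Q \<Longrightarrow> fdimv W x = fdimv V x"
  shows "fiso V T W T'"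
proof -
  obtain h where h: "\<And>x. x \<in> verts Q \<Longrightarrow> flinear (h x)" "\<And>x w. x \<in> verts Q \<Longrightarrow> h x w \<in> V x"
    "\<And>x v. x \<in> verts Q \<Longrightarrow> v \<in> V x \<Longrightarrow> h x (f x v) = v"
    using fam_retraction_exists[OF V fhomD(1)[OF f] inj] by metis
  have surj: "f x ` V x = W x" if x: "x \<in> verts Q" for x
  proof (rule fds_eqI[OF frepD(1)[OF W x]])
    note Vx = frepD(1)[OF V x] and l = fhomD(2)[OF f x]
    show "fs.subspace (f x ` V x)" by (rule fds_subspace[OF fds_image[OF Vx l]])
    show "f x ` V x \<subseteq> W x" using fhomD(3)[OF f x] by (rule image_subsetI)
    have "fs.dim (f x ` V x) = fs.dim (V x)"
      by (rule dim_image_inj[OF Vx l]) (use inj x in \<open>simp add: finj_def\<close>)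
    then show "fs.dim (W x) \<le> fs.dim (f x ` V x)" using dim[OF x] by simp
  qed
  have fh: "f x (h x w) = w" if x: "x \<in> verts Q" and w: "w \<in> W x" for x w
  proof -
    have "w \<in> f x ` V x" using w by (simp add: surj[OF x])
    then obtain v where "w = f x v" "v \<in> V x" by (rule imageE)
    then show ?thesis using h(3)[OF x] by simp
  qed
  have hh: "fhom W T' V T h"
    unfolding fhom_def ffam_def
  proof (intro conjI ballI h(1,2))
    fix a w assume a: "a \<in> arcs Q" and w: "w \<in> W (tail Q a)"
    note t = tail_in_verts[OF a] and hd = head_in_verts[OF a]
    have "T' a w = f (head Q a) (T a (h (tail Q a) w))"
      using fhomD(4)[OF f a h(2)[OF t]] fh[OF t w] by metis
    then show "h (head Q a) (T' a w) = T a (h (tail Q a) w)"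
      using h(3)[OF hd frepD(3)[OF V a h(2)[OF t]]] by simp
  qed
  show ?thesis unfolding fiso_def
    by (rule exI[of _ f], rule exI[of _ h]) (simp add: f hh h(3) fh)
qed

lemma brick_fiso:
  assumes iso: "fiso V T W T'" and br: "brick W T'"
  shows "brick V T"
  unfolding brick_def
proof (intro allI impI)
  fix \<phi> assume p: "fhom V T V T \<phi>"
  obtain g h where g: "fhom V T W T' g" and h: "fhom W T' V T h"
    and hg: "\<And>x v. x \<in> verts Q \<Longrightarrow> v \<in> V x \<Longrightarrow> h x (g x v) = v"
    using iso unfolding fiso_def by metis
  have g0: "g x 0 = 0" "h x 0 = 0" if "x \<in> verts Q" for x
    using flinear_simps(4)[OF fhomD(2)[OF g that]] flinear_simps(4)[OF fhomD(2)[OF h that]] by simp_all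
  let ?\<psi> = "\<lambda>x w. g x (\<phi> x (h x w))"
  have "fhom W T' W T' ?\<psi>" by (rule fhom_comp[OF fhom_comp[OF h p] g])
  then have "fzero W ?\<psi> \<or> finj W ?\<psi>" using br unfolding brick_def by blast
  then show "fzero V \<phi> \<or> finj V \<phi>"
  proof
    assume z: "fzero W ?\<psi>"
    have "\<phi> x v = 0" if x: "x \<in> verts Q" and v: "v \<in> V x" for x v
    proof -
      have "?\<psi> x (g x v) = 0" using z x fhomD(3)[OF g x v] unfolding fzero_def by blast
      then have "g x (\<phi> x v) = 0" by (simp add: hg[OF x v])
      then show ?thesis using hg[OF x fhomD(3)[OF p x v]] by (simp add: g0[OF x])
    qed
    then show ?thesis by (simp add: fzero_def)
  next
    assume i: "finj W ?\<psi>"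
    have "v = 0" if x: "x \<in> verts Q" and v: "v \<in> V x" and z: "\<phi> x v = 0" for x v
    proof -
      have "?\<psi> x (g x v) = 0" by (simp add: hg[OF x v] z g0[OF x])
      then have "g x v = 0" using i x fhomD(3)[OF g x v] unfolding finj_def by blast
      then show ?thesis using hg[OF x v] by (simp add: g0[OF x])
    qed
    then show ?thesis unfolding finj_def by blast
  qed
qed

end

context brick_triple
begin

abbreviation MM :: "'v \<Rightarrow> (nat \<times> nat \<Rightarrow> 'k) set" where
  "MM \<equiv> MV {..<3} 2"

lemma frep_MM: "frep MM MT"
  by (rule frep_MV) (simp add: closed_def)

lemma dim_MM: "x \<in> verts Q \<Longrightarrow> fdimv MM x = \<theta> x"
  by (simp add: dim_MV \<theta>_eq)

lemma euler_MM: "euler (fdimv MM) (fdimv MM) = 1"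
proof -
  have "euler (fdimv MM) (fdimv MM) = euler \<theta> \<theta>" by (rule euler_cong) (simp_all add: dim_MM)
  then show ?thesis by (simp add: euler_tits tits_\<theta>)
qed

lemma maximal_indecomposable_exists:
  "\<exists>M :: ('v, 'a, 'k) rep. maximal_indecomposable Q M"
proof -
  obtain M :: "('v, 'a, 'k) rep" where M: "is_rep Q M" "\<forall>x\<in>verts Q. dimv M x = fdimv MM x" "fiso (rV M) (rT M) MM MT"
    using matrix_model_iso[OF frep_MM] by metis
  have d: "dimv M x = \<theta> x" if "x \<in> verts Q" for x using M(2) that dim_MM by simp
  have "\<not> zero_rep Q M" unfolding zero_rep_def using d[OF y] y \<theta>y by (metis zero_neq_numeral)
  then have "indecomposable_rep Q M"
    by (rule brick_indecomposable[OF M(1) _ brick_fiso[OF M(3) MV_brick]])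
  then show ?thesis
    unfolding maximal_indecomposable_def using maximal_positive_root_\<theta>[of "dimv M"] d by blast
qed

lemma euler_pos:
  fixes U :: "'v \<Rightarrow> ('i \<Rightarrow> 'k) set"
  assumes U: "frep U T" and nz: "nonzero U"
  shows "euler (fdimv U) (fdimv U) \<ge> 1"
proof -
  obtain x v where x: "x \<in> verts Q" and v: "v \<in> U x" "v \<noteq> 0" using nz unfolding nonzero_def by blast
  have "fs.dim (U x) \<noteq> 0" using fds_dim_0[OF frepD(1)[OF U x]] v by auto
  then show ?thesis unfolding euler_tits by (intro tits_pos[OF x]) simp
qed

text \<open>
  Both \<open>M\<close> and the glued representation have no self-extensions and dimension vector \<open>\<theta>\<close>, so they are
  isomorphic, and the filtration is carried over.
\<close>

lemma maximal_indecomposable_filtered: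
  fixes M :: "('v, 'a, 'k) rep"
  assumes M: "maximal_indecomposable Q M"
  shows "M \<in> filtered_objects Q C"
proof -
  have ind: "indecomposable_rep Q M" and mx: "maximal_positive_root Q (dimv M)"
    using M by (auto simp: maximal_indecomposable_def)
  have R: "is_rep Q M" using ind by (simp add: indecomposable_rep_def)
  note fM = frep_rep[OF R]
  have dims: "fdimv MM x = fdimv (rV M) x" if "x \<in> verts Q" for x
    using maximal_positive_root_eq[OF mx that] dim_MM[OF that] by (simp add: dim_cs)
  have eM: "ext_vanishes (rV M) (rT M) (rV M) (rT M)"
    by (rule findec_rigid[OF euler_pos fM indecomposable_findec[OF ind]])
  have eMM: "ext_vanishes MM MT MM MT"
    by (rule brick_ext_vanishes[OF frep_MM MV_brick]) (simp add: euler_MM)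
  have one: "euler (fdimv (rV M)) (fdimv (rV M)) = 1"
  proof -
    have "euler (fdimv (rV M)) (fdimv (rV M)) = euler (fdimv MM) (fdimv MM)" by (rule euler_cong; simp only: dims)
    then show ?thesis using euler_MM by (rule trans)
  qed
  obtain f where f: "fhom (rV M) (rT M) MM MT f" "finj (rV M) f"
    by (rule rigid_unique[OF fM frep_MM _ eM eMM one]) (simp_all add: dims)
  have "fiso (rV M) (rT M) MM MT" by (rule fiso_of_inj[OF fM frep_MM f dims])
  moreover have "filt C MM MT" by (rule filt_MV) (rule C_mem(1), assumption, rule C_mem(2))
  ultimately show ?thesis using R unfolding filt_def by blast
qed

theorem ext_quiver_type_D4:
  "antichain Q C" "\<forall>X\<in>C. end_is_base_field Q X" "verts G = C" "distinct [A 0, A 1, A 2, S]"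
  "\<forall>X\<in>{A 0, A 1, A 2}. card {e \<in> arcs G. {tail G e, head G e} = {S, X}} = 1"
  "\<forall>e\<in>arcs G. \<exists>X\<in>{A 0, A 1, A 2}. {tail G e, head G e} = {S, X}"
  "\<exists>g. dynkin_labelling (TypeD 4) G g"
  "\<exists>M. maximal_indecomposable Q M \<and> M \<in> filtered_objects Q C"
  "\<forall>M. maximal_indecomposable Q M \<longrightarrow> M \<in> filtered_objects Q C"
proof -
  show "distinct [A 0, A 1, A 2, S]"
    using A_inj[of 0 1] A_inj[of 0 2] A_inj[of 1 2] A_ne_S[of 0] A_ne_S[of 1] A_ne_S[of 2] by simp
  show "\<forall>X\<in>{A 0, A 1, A 2}. card {e \<in> arcs G. {tail G e, head G e} = {S, X}} = 1"
    using arcs_between(1)[of 0] arcs_between(1)[of 1] arcs_between(1)[of 2] by simp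
  show "\<forall>e\<in>arcs G. \<exists>X\<in>{A 0, A 1, A 2}. {tail G e, head G e} = {S, X}"
  proof
    fix e assume "e \<in> arcs G"
    then obtain r where r: "e = arrow r" "r \<in> {..<3}" unfolding arcs_G by (rule imageE)
    have "A r \<in> {A 0, A 1, A 2}" using r(2) by (auto simp: less3)
    then show "\<exists>X\<in>{A 0, A 1, A 2}. {tail G e, head G e} = {S, X}" unfolding r(1) arrow_ends by blast
  qed
  show "\<exists>g. dynkin_labelling (TypeD 4) G g" using D4_labelling by blast
  show "\<exists>M. maximal_indecomposable Q M \<and> M \<in> filtered_objects Q C"
    using maximal_indecomposable_exists maximal_indecomposable_filtered by blast
qed (use C_antichain C_base_field maximal_indecomposable_filtered in \<open>simp_all add: ext_quiver_simps\<close>)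

end

section \<open>The special antichain triple\<close>

text \<open>
  A support inside \<open>\<Delta>'\<close> means dimension \<open>0\<close> at \<open>y\<close>, and a support not inside \<open>\<Delta>''\<close> means a nonzero space at
  some neighbour of \<open>y\<close>.
\<close>

lemma (in marked_quiver) special_triple_brick_triple:
  fixes A1 A2 A3 :: "('v, 'a, 'k::field) rep"
  assumes sp: "special_antichain_triple Q y A1 A2 A3"
  shows "brick_triple Q y \<theta> (\<lambda>r. if r = 0 then A1 else if r = 1 then A2 else A3)" (is "brick_triple Q y \<theta> ?A")
proof -
  have anti: "antichain Q {A1, A2, A3}" and dist: "distinct [A1, A2, A3]"
    and supp: "\<And>X. X \<in> {A1, A2, A3} \<Longrightarrow> rep_support Q X \<subseteq> verts Q - {y}"
      "\<And>X. X \<in> {A1, A2, A3} \<Longrightarrow> \<not> rep_support Q X \<subseteq> verts Q - ({y} \<union> neighbours Q y)"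
    using sp unfolding special_antichain_triple_def by blast+
  have mem: "?A r \<in> {A1, A2, A3}" for r by simp
  have ne: "?A r \<noteq> ?A s" if "r < 3" "s < 3" "r \<noteq> s" for r s :: nat
    using that dist by (auto simp: less3)
  have rep: "is_rep Q X" and div: "end_division_ring Q X" if "X \<in> {A1, A2, A3}" for X
    using anti that unfolding antichain_def by blast+
  have orth: "zero_mor Q \<phi>" if "X \<in> {A1, A2, A3}" "Y \<in> {A1, A2, A3}" "X \<noteq> Y" "is_mor Q X Y \<phi>" for X Y \<phi>
    using anti that unfolding antichain_def by blast
  have y0: "dimv X y = 0" if "X \<in> {A1, A2, A3}" for X
    using supp(1)[OF that] y unfolding rep_support_def by blast
  have nb1: "1 \<le> nb (dimv X) y" if X: "X \<in> {A1, A2, A3}" for X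
  proof -
    obtain x where x: "dimv X x \<noteq> 0" "x = y \<or> x \<in> neighbours Q y"
      using supp(2)[OF X] unfolding rep_support_def by blast
    then have "x \<in> neighbours Q y" using y0[OF X] by auto
    then obtain a where a: "a \<in> arcs Q" "{tail Q a, head Q a} = {x, y}" unfolding neighbours_def by blast
    from a(2) consider "tail Q a = y" "head Q a = x" | "tail Q a = x" "head Q a = y" by (auto simp: doubleton_eq_iff)
    then show ?thesis
    proof cases
      case 1
      then have "dimv X x \<le> (\<Sum>a\<in>{a\<in>arcs Q. tail Q a = y}. dimv X (head Q a))"
        using member_le_sum[of a "{a\<in>arcs Q. tail Q a = y}" "\<lambda>a. dimv X (head Q a)"] a(1) by simp
      then show ?thesis using x(1) unfolding nb_def by linarith
    next
      case 2
      then have "dimv X x \<le> (\<Sum>a\<in>{a\<in>arcs Q. head Q a = y}. dimv X (tail Q a))"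
        using member_le_sum[of a "{a\<in>arcs Q. head Q a = y}" "\<lambda>a. dimv X (tail Q a)"] a(1) by simp
      then show ?thesis using x(1) unfolding nb_def by linarith
    qed
  qed
  show ?thesis
  proof (intro brick_triple.intro brick_triple_axioms.intro marked_quiver_axioms)
    fix r s :: nat and \<phi>
    assume r: "r < 3"
    show "is_rep Q (?A r)" by (rule rep[OF mem])
    show "brick (rV (?A r)) (rT (?A r))" by (rule division_ring_brick[OF rep[OF mem] div[OF mem]])
    show "dimv (?A r) y = 0" by (rule y0[OF mem])
    show "1 \<le> nb (dimv (?A r)) y" by (rule nb1[OF mem])
    assume s: "s < 3" "r \<noteq> s" and p: "fhom (rV (?A r)) (rT (?A r)) (rV (?A s)) (rT (?A s)) \<phi>"
    let ?m = "mor_of (?A r) (?A s) \<phi>"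
    have "zero_mor Q ?m" by (rule orth[OF mem mem ne[OF r s] is_mor_of[OF rep[OF mem] rep[OF mem] p]])
    then have "fzero (rV (?A r)) (ma ?m)" by (simp only: zero_mor_iff[of ?m "dimv (?A s)" "dimv (?A r)", OF mor_of_carrier])
    then show "fzero (rV (?A r)) \<phi>" unfolding fzero_def by (simp only: mact_mor_of[OF fhomD(1)[OF p]] cong: ball_cong) simp
  qed
qed

theorem theorem3p6:
  fixes Q :: "('v, 'a) pre_digraph"
    and A1 A2 A3 :: "('v, 'a, 'k::field) rep"
    and f :: "nat \<Rightarrow> 'v" and T :: dynkin
  assumes "(\<exists>n \<ge> 4. T = TypeD n) \<or> (\<exists>m \<in> {6, 7, 8}. T = TypeE m)"
    and "dynkin_labelling T Q f"
    and "y = f (exceptional_vertex T)"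
    and "special_antichain_triple Q y A1 A2 A3"
    and "S = simple_rep Q y"
    and "C = {A1, A2, A3, S}"
    and "G = ext_quiver Q C"
  shows "antichain Q C \<and> (\<forall>X \<in> C. end_is_base_field Q X)
    \<and> verts G = C \<and> distinct [A1, A2, A3, S]
    \<and> (\<forall>X \<in> {A1, A2, A3}. card {e \<in> arcs G. {tail G e, head G e} = {S, X}} = 1)
    \<and> (\<forall>e \<in> arcs G. \<exists>X \<in> {A1, A2, A3}. {tail G e, head G e} = {S, X})
    \<and> (\<exists>g. dynkin_labelling (TypeD 4) G g)
    \<and> (\<exists>M. maximal_indecomposable Q M \<and> M \<in> filtered_objects Q C)
    \<and> (\<forall>M. maximal_indecomposable Q M \<longrightarrow> M \<in> filtered_objects Q C)"
proof -
  have "is_DE T" using assms(1) by (simp add: is_DE_def)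
  then interpret mq: marked_quiver Q y "\<lambda>x. diagram_root T (inv_into (diagram_verts T) f x)"
    unfolding assms(3) using assms(2) by (rule dynkin_marked_quiver)
  interpret bt: brick_triple Q y "\<lambda>x. diagram_root T (inv_into (diagram_verts T) f x)"
      "\<lambda>r. if r = 0 then A1 else if r = 1 then A2 else A3"
    by (rule mq.special_triple_brick_triple[OF assms(4)])
  have C: "bt.C = C" by (simp add: bt.C_def assms(5,6))
  have G: "bt.G = G" by (simp add: bt.G_def C assms(7))
  show ?thesis
    using bt.ext_quiver_type_D4[unfolded C G] by (simp only: assms(5)) simp
qed

end
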